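(* Let $R$ be a Gorenstein local ring, let $I$ be an ideal of $R$ of codimension at least two, and let $S=R[It]$ be its Rees algebra, assumed Cohen-Macaulay. If the canonical module of $S$ has the expected form, then $S$ is Gorenstein in codimension less than $\operatorname{codim}(I)$; in particular $\operatorname{bideg}(S)=0$ and $\operatorname{cdeg}(S)=0$.
   Context: The codimension of an ideal is its height. The canonical module of $S$ has the expected form if $\omega_S\simeq\omega_R(1,t)^m$ for some integer $m\ge -1$, where (up to shift of grading) for $m\ge0$, $\omega_R(1,t)^m=\omega_R\oplus\omega_Rt\oplus\cdots\oplus\omega_Rt^m\oplus I\omega_Rt^{m+1}\oplus I^2\omega_Rt^{m+2}\oplus\cdots$, and for $m=-1$ it is $\bigoplus_{j\ge0}I^{j+1}\omega_Rt^j$; here $\omega_R\simeq R$, so that for $m\geq 0$ this is the $S$-submodule of $R[t]$ generated by $1,t,\dots,t^m$. "$S$ is Gorenstein in codimension less than $n$" means that $S_P$ is Gorenstein for every prime ideal $P$ of $S$ of height less than $n$. For a Cohen-Macaulay ring $S$ with a canonical ideal $\mathcal C$ (an ideal isomorphic to a canonical module), $\operatorname{bideg}(S)=\sum_{\operatorname{ht}P=1}[\lambda(S_P/\mathcal C_P)-\lambda(S_P/\mathcal C^{**}_P)]\deg(S/P)$ and $\operatorname{cdeg}(S)=\sum_{\operatorname{ht}P=1}[\mathrm e_0(\mathcal C_P)-\lambda(S_P/\mathcal C_P)]\deg(S/P)$, where $\lambda$ is length, $\mathcal C^{**}$ is the bidual with respect to $\operatorname{Hom}_S(-,S)$ viewed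 as an ideal of $S$, $\mathrm e_0(\mathcal C_P)$ is the multiplicity of $S_P$ with respect to $\mathcal C_P$ (read as $0$ if $\mathcal C_P=S_P$), and $\deg$ is multiplicity with respect to the maximal ideal. For the Rees algebra these degrees are understood after localizing at its graded maximal ideal $(\mathfrak m,It)$, $\mathfrak m$ being the maximal ideal of $R$. *)

theory Defs
  imports Complex_Main "HOL-Library.Extended_Nat"
    "HOL-Algebra.UnivPoly" "HOL-Algebra.Ideal_Product" "HOL-Algebra.Ring_Divisibility"
begin

section \<open>Modules\<close>

definition self_module :: "('a, 'r) ring_scheme \<Rightarrow> ('a, 'a) module"
  where "self_module R =
    \<lparr>carrier = carrier R, monoid.mult = monoid.mult R, one = one R,
     ring.zero = ring.zero R, add = add R, smult = monoid.mult R\<rparr>"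

text \<open>Homomorphisms are extensional, so that equality in \<open>Hom\<close> is equality of functions.\<close>

definition module_hom ::
    "('a, 'r) ring_scheme \<Rightarrow> ('a, 'b, 'm) module_scheme \<Rightarrow> ('a, 'c, 'n) module_scheme \<Rightarrow> ('b \<Rightarrow> 'c) set"
  where "module_hom R M N =
    {h \<in> carrier M \<rightarrow>\<^sub>E carrier N.
       (\<forall>x\<in>carrier M. \<forall>y\<in>carrier M. h (x \<oplus>\<^bsub>M\<^esub> y) = h x \<oplus>\<^bsub>N\<^esub> h y) \<and>
       (\<forall>a\<in>carrier R. \<forall>x\<in>carrier M. h (a \<odot>\<^bsub>M\<^esub> x) = a \<odot>\<^bsub>N\<^esub> h x)}"

definition module_iso ::
    "('a, 'r) ring_scheme \<Rightarrow> ('a, 'b, 'm) module_scheme \<Rightarrow> ('a, 'c, 'n) module_scheme \<Rightarrow> bool"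
  where "module_iso R M N \<longleftrightarrow> (\<exists>h\<in>module_hom R M N. bij_betw h (carrier M) (carrier N))"

text \<open>The ring fields \<open>mult\<close> and \<open>one\<close> of a module record carry no information.\<close>

definition hom_module ::
    "('a, 'r) ring_scheme \<Rightarrow> ('a, 'b, 'm) module_scheme \<Rightarrow> ('a, 'c, 'n) module_scheme
      \<Rightarrow> ('a, 'b \<Rightarrow> 'c) module"
  where "hom_module R M N =
    \<lparr>carrier = module_hom R M N, monoid.mult = undefined, one = undefined,
     ring.zero = (\<lambda>x\<in>carrier M. \<zero>\<^bsub>N\<^esub>),
     add = (\<lambda>f g. \<lambda>x\<in>carrier M. f x \<oplus>\<^bsub>N\<^esub> g x),
     smult = (\<lambda>a f. \<lambda>x\<in>carrier M. a \<odot>\<^bsub>N\<^esub> f x)\<rparr>"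

definition quot_module :: "('a, 'b, 'm) module_scheme \<Rightarrow> 'b set \<Rightarrow> ('a, 'b set) module"
  where "quot_module M N =
    \<lparr>carrier = a_rcosets\<^bsub>M\<^esub> N, monoid.mult = undefined, one = undefined, ring.zero = N, add = set_add M,
     smult = (\<lambda>a X. \<Union>x\<in>X. N +>\<^bsub>M\<^esub> (a \<odot>\<^bsub>M\<^esub> x))\<rparr>"

definition span_module ::
    "('a, 'r) ring_scheme \<Rightarrow> ('a, 'b, 'm) module_scheme \<Rightarrow> 'b set \<Rightarrow> 'b set"
  where "span_module R M A = \<Inter>{N. submodule N R M \<and> A \<subseteq> N}"

definition fin_gen :: "('a, 'r) ring_scheme \<Rightarrow> ('a, 'b, 'm) module_scheme \<Rightarrow> bool"
  where "fin_gen R M \<longleftrightarrow>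
    (\<exists>A. finite A \<and> A \<subseteq> carrier M \<and> span_module R M A = carrier M)"

definition ideal_smult ::
    "('a, 'r) ring_scheme \<Rightarrow> 'a set \<Rightarrow> ('a, 'b, 'm) module_scheme \<Rightarrow> 'b set"
  where "ideal_smult R J M = span_module R M {a \<odot>\<^bsub>M\<^esub> x | a x. a \<in> J \<and> x \<in> carrier M}"

definition annihilator :: "('a, 'r) ring_scheme \<Rightarrow> ('a, 'b, 'm) module_scheme \<Rightarrow> 'a set"
  where "annihilator R M = {a \<in> carrier R. \<forall>x\<in>carrier M. a \<odot>\<^bsub>M\<^esub> x = \<zero>\<^bsub>M\<^esub>}"

definition module_length :: "('a, 'r) ring_scheme \<Rightarrow> ('a, 'b, 'm) module_scheme \<Rightarrow> enat"
  where "module_length R M =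
    Sup {enat n | n. \<exists>c. (\<forall>i\<le>n. submodule (c i) R M) \<and> (\<forall>i<n. c i \<subset> c (Suc i))}"

definition quot_length :: "('a, 'r) ring_scheme \<Rightarrow> 'a set \<Rightarrow> enat"
  where "quot_length R J = module_length R (quot_module (self_module R) J)"


section \<open>Localization\<close>

text \<open>The fraction \<open>m / s\<close>, as an equivalence class of pairs. Operations on classes are
  unions over representatives, as for the cosets of a quotient ring.\<close>

definition fraction ::
    "'a set \<Rightarrow> ('a, 'b, 'm) module_scheme \<Rightarrow> 'b \<Rightarrow> 'a \<Rightarrow> ('b \<times> 'a) set"
  where "fraction T M m s =
    {(n, t). n \<in> carrier M \<and> t \<in> T \<and> (\<exists>u\<in>T. u \<odot>\<^bsub>M\<^esub> (t \<odot>\<^bsub>M\<^esub> m) = u \<odot>\<^bsub>M\<^esub> (s \<odot>\<^bsub>M\<^esub> n))}"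

definition loc_ring :: "('a, 'r) ring_scheme \<Rightarrow> 'a set \<Rightarrow> (('a \<times> 'a) set) ring"
  where "loc_ring R T =
    \<lparr>carrier = {fraction T (self_module R) a s | a s. a \<in> carrier R \<and> s \<in> T},
     monoid.mult = (\<lambda>X Y. \<Union>(a, s)\<in>X. \<Union>(b, t)\<in>Y. fraction T (self_module R) (a \<otimes>\<^bsub>R\<^esub> b) (s \<otimes>\<^bsub>R\<^esub> t)),
     one = fraction T (self_module R) \<one>\<^bsub>R\<^esub> \<one>\<^bsub>R\<^esub>,
     ring.zero = fraction T (self_module R) \<zero>\<^bsub>R\<^esub> \<one>\<^bsub>R\<^esub>,
     add = (\<lambda>X Y. \<Union>(a, s)\<in>X. \<Union>(b, t)\<in>Y.
       fraction T (self_module R) (t \<otimes>\<^bsub>R\<^esub> a \<oplus>\<^bsub>R\<^esub> s \<otimes>\<^bsub>R\<^esub> b) (s \<otimes>\<^bsub>R\<^esub> t))\<rparr>"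

definition loc_module ::
    "('a, 'r) ring_scheme \<Rightarrow> 'a set \<Rightarrow> ('a, 'b, 'm) module_scheme
      \<Rightarrow> (('a \<times> 'a) set, ('b \<times> 'a) set) module"
  where "loc_module R T M =
    \<lparr>carrier = {fraction T M m s | m s. m \<in> carrier M \<and> s \<in> T},
     monoid.mult = undefined, one = undefined,
     ring.zero = fraction T M \<zero>\<^bsub>M\<^esub> \<one>\<^bsub>R\<^esub>,
     add = (\<lambda>X Y. \<Union>(m, s)\<in>X. \<Union>(n, t)\<in>Y.
       fraction T M (t \<odot>\<^bsub>M\<^esub> m \<oplus>\<^bsub>M\<^esub> s \<odot>\<^bsub>M\<^esub> n) (s \<otimes>\<^bsub>R\<^esub> t)),
     smult = (\<lambda>X Y. \<Union>(a, s)\<in>X. \<Union>(n, t)\<in>Y. fraction T M (a \<odot>\<^bsub>M\<^esub> n) (s \<otimes>\<^bsub>R\<^esub> t))\<rparr>"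

definition loc_at :: "('a, 'r) ring_scheme \<Rightarrow> 'a set \<Rightarrow> (('a \<times> 'a) set) ring"
  where "loc_at R P = loc_ring R (carrier R - P)"

definition loc_module_at ::
    "('a, 'r) ring_scheme \<Rightarrow> 'a set \<Rightarrow> ('a, 'b, 'm) module_scheme
      \<Rightarrow> (('a \<times> 'a) set, ('b \<times> 'a) set) module"
  where "loc_module_at R P M = loc_module R (carrier R - P) M"

definition loc_ideal_at :: "('a, 'r) ring_scheme \<Rightarrow> 'a set \<Rightarrow> 'a set \<Rightarrow> ('a \<times> 'a) set set"
  where "loc_ideal_at R P J =
    {fraction (carrier R - P) (self_module R) a s | a s. a \<in> J \<and> s \<in> carrier R - P}"


section \<open>Height, dimension, depth\<close>

definition height :: "('a, 'r) ring_scheme \<Rightarrow> 'a set \<Rightarrow> enat"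
  where "height R P =
    Sup {enat n | n. \<exists>c. (\<forall>i\<le>n. primeideal (c i) R) \<and> (\<forall>i<n. c i \<subset> c (Suc i)) \<and> c n = P}"

text \<open>The unit ideal has height \<open>\<infinity>\<close>.\<close>

definition ideal_height :: "('a, 'r) ring_scheme \<Rightarrow> 'a set \<Rightarrow> enat"
  where "ideal_height R I = (INF P\<in>{P. primeideal P R \<and> I \<subseteq> P}. height R P)"

definition krull_dim :: "('a, 'r) ring_scheme \<Rightarrow> enat"
  where "krull_dim R = (SUP P\<in>{P. primeideal P R}. height R P)"

definition module_dim :: "('a, 'r) ring_scheme \<Rightarrow> ('a, 'b, 'm) module_scheme \<Rightarrow> enat"
  where "module_dim R M = krull_dim (R Quot annihilator R M)"

definition noetherian_local_ring :: "('a, 'r) ring_scheme \<Rightarrow> bool"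
  where "noetherian_local_ring R \<longleftrightarrow>
    cring R \<and> noetherian_ring R \<and> (\<exists>!\<mm>. maximalideal \<mm> R)"

definition max_ideal :: "('a, 'r) ring_scheme \<Rightarrow> 'a set"
  where "max_ideal R = (THE \<mm>. maximalideal \<mm> R)"

definition regular_sequence ::
    "('a, 'r) ring_scheme \<Rightarrow> ('a, 'b, 'm) module_scheme \<Rightarrow> 'a list \<Rightarrow> bool"
  where "regular_sequence R M xs \<longleftrightarrow>
    set xs \<subseteq> carrier R \<and>
    (\<forall>i<length xs. \<forall>m\<in>carrier M.
       xs ! i \<odot>\<^bsub>M\<^esub> m \<in> ideal_smult R (Idl\<^bsub>R\<^esub> (set (take i xs))) M \<longrightarrow>
       m \<in> ideal_smult R (Idl\<^bsub>R\<^esub> (set (take i xs))) M) \<and>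
    ideal_smult R (Idl\<^bsub>R\<^esub> (set xs)) M \<noteq> carrier M"

text \<open>Depth over a local ring.\<close>

definition depth :: "('a, 'r) ring_scheme \<Rightarrow> ('a, 'b, 'm) module_scheme \<Rightarrow> enat"
  where "depth R M =
    Sup {enat (length xs) | xs. regular_sequence R M xs \<and> set xs \<subseteq> max_ideal R}"

definition cohen_macaulay_local_ring :: "('a, 'r) ring_scheme \<Rightarrow> bool"
  where "cohen_macaulay_local_ring R \<longleftrightarrow>
    noetherian_local_ring R \<and> depth R (self_module R) = krull_dim R"

definition cohen_macaulay_ring :: "('a, 'r) ring_scheme \<Rightarrow> bool"
  where "cohen_macaulay_ring R \<longleftrightarrow>
    cring R \<and> noetherian_ring R \<and>
    (\<forall>\<mm>. maximalideal \<mm> R \<longrightarrow> cohen_macaulay_local_ring (loc_at R \<mm>))"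

definition maximal_cohen_macaulay_module ::
    "('a, 'r) ring_scheme \<Rightarrow> ('a, 'b, 'm) module_scheme \<Rightarrow> bool"
  where "maximal_cohen_macaulay_module R M \<longleftrightarrow>
    module R M \<and> fin_gen R M \<and> carrier M \<noteq> {\<zero>\<^bsub>M\<^esub>} \<and>
    depth R M = module_dim R M \<and> module_dim R M = krull_dim R"


section \<open>Injective dimension and Ext\<close>

text \<open>The test modules live on the type of the ring. By Baer's criterion this is no restriction:
  the ring and its ideals are among them.\<close>

definition injective_module :: "('a, 'r) ring_scheme \<Rightarrow> ('a, 'e, 'm) module_scheme \<Rightarrow> bool"
  where "injective_module R E \<longleftrightarrow>
    module R E \<and>
    (\<forall>(A :: ('a, 'a) module) (B :: ('a, 'a) module). \<forall>f\<in>module_hom R A B. \<forall>g\<in>module_hom R A E.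
       module R A \<and> module R B \<and> inj_on f (carrier A) \<longrightarrow>
       (\<exists>h\<in>module_hom R B E. \<forall>x\<in>carrier A. h (f x) = g x))"

definition injective_resolution ::
    "('a, 'r) ring_scheme \<Rightarrow> ('a, 'b, 'm) module_scheme
      \<Rightarrow> ('b \<Rightarrow> 'e) \<Rightarrow> (nat \<Rightarrow> ('a, 'e) module) \<Rightarrow> (nat \<Rightarrow> 'e \<Rightarrow> 'e) \<Rightarrow> bool"
  where "injective_resolution R M \<epsilon> E d \<longleftrightarrow>
    (\<forall>i. injective_module R (E i)) \<and>
    \<epsilon> \<in> module_hom R M (E 0) \<and> inj_on \<epsilon> (carrier M) \<and>
    (\<forall>i. d i \<in> module_hom R (E i) (E (Suc i))) \<and>
    \<epsilon> ` carrier M = a_kernel (E 0) (E 1) (d 0) \<and>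
    (\<forall>i. d i ` carrier (E i) = a_kernel (E (Suc i)) (E (Suc (Suc i))) (d (Suc i)))"

text \<open>Resolutions are taken on the type \<open>(nat + 'a + 'b) set\<close>, whose cardinality \<open>\<kappa>\<close> is \<open>2\<close> to an
  infinite power that is at least \<open>|R|\<close> and \<open>|M|\<close>. Embedding \<open>M\<close> into
  \<open>Hom\<^sub>\<int>(R, D)\<close> with \<open>D\<close> the divisible hull of \<open>M\<close>, and using \<open>\<kappa>\<^bsup>|R|\<^esup> = \<kappa>\<close>, every module has
  a minimal injective resolution on this type, so the infimum is the usual injective dimension
  (of a nonzero module).\<close>

definition inj_dim :: "('a, 'r) ring_scheme \<Rightarrow> ('a, 'b, 'm) module_scheme \<Rightarrow> enat"
  where "inj_dim R M =
    Inf {enat n | n. \<exists>\<epsilon> (E :: nat \<Rightarrow> ('a, (nat + 'a + 'b) set) module) d.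
      injective_resolution R M \<epsilon> E d \<and> (\<forall>i>n. carrier (E i) = {\<zero>\<^bsub>E i\<^esub>})}"

definition free_module :: "('a, 'r) ring_scheme \<Rightarrow> nat \<Rightarrow> ('a, nat \<Rightarrow> 'a) module"
  where "free_module R n =
    \<lparr>carrier = {..<n} \<rightarrow>\<^sub>E carrier R, monoid.mult = undefined, one = undefined,
     ring.zero = (\<lambda>i\<in>{..<n}. \<zero>\<^bsub>R\<^esub>),
     add = (\<lambda>v w. \<lambda>i\<in>{..<n}. v i \<oplus>\<^bsub>R\<^esub> w i),
     smult = (\<lambda>a v. \<lambda>i\<in>{..<n}. a \<otimes>\<^bsub>R\<^esub> v i)\<rparr>"

definition free_resolution ::
    "('a, 'r) ring_scheme \<Rightarrow> ('a, 'b, 'm) module_scheme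
      \<Rightarrow> (nat \<Rightarrow> nat) \<Rightarrow> ((nat \<Rightarrow> 'a) \<Rightarrow> 'b) \<Rightarrow> (nat \<Rightarrow> (nat \<Rightarrow> 'a) \<Rightarrow> (nat \<Rightarrow> 'a)) \<Rightarrow> bool"
  where "free_resolution R N r \<epsilon> d \<longleftrightarrow>
    (let F = (\<lambda>i. free_module R (r i)) in
      \<epsilon> \<in> module_hom R (F 0) N \<and> \<epsilon> ` carrier (F 0) = carrier N \<and>
      (\<forall>i. d i \<in> module_hom R (F (Suc i)) (F i)) \<and>
      d 0 ` carrier (F 1) = a_kernel (F 0) N \<epsilon> \<and>
      (\<forall>i. d (Suc i) ` carrier (F (Suc (Suc i))) = a_kernel (F (Suc i)) (F i) (d i)))"

definition cocycles ::
    "('a, 'r) ring_scheme \<Rightarrow> (nat \<Rightarrow> nat) \<Rightarrow> (nat \<Rightarrow> (nat \<Rightarrow> 'a) \<Rightarrow> (nat \<Rightarrow> 'a))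
      \<Rightarrow> ('a, 'b, 'm) module_scheme \<Rightarrow> nat \<Rightarrow> ((nat \<Rightarrow> 'a) \<Rightarrow> 'b) set"
  where "cocycles R r d M i =
    {f \<in> module_hom R (free_module R (r i)) M.
       \<forall>x\<in>carrier (free_module R (r (Suc i))). f (d i x) = \<zero>\<^bsub>M\<^esub>}"

fun coboundaries ::
    "('a, 'r) ring_scheme \<Rightarrow> (nat \<Rightarrow> nat) \<Rightarrow> (nat \<Rightarrow> (nat \<Rightarrow> 'a) \<Rightarrow> (nat \<Rightarrow> 'a))
      \<Rightarrow> ('a, 'b, 'm) module_scheme \<Rightarrow> nat \<Rightarrow> ((nat \<Rightarrow> 'a) \<Rightarrow> 'b) set"
  where
    "coboundaries R r d M 0 = {\<zero>\<^bsub>hom_module R (free_module R (r 0)) M\<^esub>}"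
  | "coboundaries R r d M (Suc i) =
      (\<lambda>g. \<lambda>x\<in>carrier (free_module R (r (Suc i))). g (d i x)) ` module_hom R (free_module R (r i)) M"

text \<open>\<open>Ext\<^sup>i\<^sub>R(N, M)\<close> for a finitely generated module \<open>N\<close> over a Noetherian ring, from a chosen
  resolution of \<open>N\<close> by finitely generated free modules.\<close>

definition ext_module ::
    "('a, 'r) ring_scheme \<Rightarrow> nat \<Rightarrow> ('a, 'c, 'n) module_scheme \<Rightarrow> ('a, 'b, 'm) module_scheme
      \<Rightarrow> ('a, ((nat \<Rightarrow> 'a) \<Rightarrow> 'b) set) module"
  where "ext_module R i N M =
    (let (r, d) = (SOME (r, d). \<exists>\<epsilon>. free_resolution R N r \<epsilon> d)
     in quot_module
          ((hom_module R (free_module R (r i)) M)\<lparr>carrier := cocycles R r d M i\<rparr>)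
          (coboundaries R r d M i))"

definition residue_module :: "('a, 'r) ring_scheme \<Rightarrow> ('a, 'a set) module"
  where "residue_module R = quot_module (self_module R) (max_ideal R)"

text \<open>The type \<open>dim\<^sub>k Ext\<^sup>t\<^sub>R(k, M)\<close>, \<open>t = depth M\<close>: the maximal ideal kills this module, so its
  dimension over \<open>k\<close> is its length over \<open>R\<close>.\<close>

definition cm_type :: "('a, 'r) ring_scheme \<Rightarrow> ('a, 'b, 'm) module_scheme \<Rightarrow> enat"
  where "cm_type R M =
    module_length R (ext_module R (the_enat (depth R M)) (residue_module R) M)"


section \<open>Gorenstein rings and canonical modules\<close>

definition gorenstein_local_ring :: "('a, 'r) ring_scheme \<Rightarrow> bool"
  where "gorenstein_local_ring R \<longleftrightarrow>
    noetherian_local_ring R \<and> inj_dim R (self_module R) < \<infinity>"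

definition canonical_module_local ::
    "('a, 'r) ring_scheme \<Rightarrow> ('a, 'b, 'm) module_scheme \<Rightarrow> bool"
  where "canonical_module_local R C \<longleftrightarrow>
    cohen_macaulay_local_ring R \<and> maximal_cohen_macaulay_module R C \<and>
    cm_type R C = 1 \<and> inj_dim R C < \<infinity>"

definition canonical_module :: "('a, 'r) ring_scheme \<Rightarrow> ('a, 'b, 'm) module_scheme \<Rightarrow> bool"
  where "canonical_module R C \<longleftrightarrow>
    module R C \<and> fin_gen R C \<and>
    (\<forall>\<mm>. maximalideal \<mm> R \<longrightarrow> canonical_module_local (loc_at R \<mm>) (loc_module_at R \<mm> C))"

definition ideal_module :: "('a, 'r) ring_scheme \<Rightarrow> 'a set \<Rightarrow> ('a, 'a) module"
  where "ideal_module R J = (self_module R)\<lparr>carrier := J\<rparr>"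

text \<open>Canonical ideals of a Cohen-Macaulay local ring.\<close>

definition canonical_ideal :: "('a, 'r) ring_scheme \<Rightarrow> 'a set \<Rightarrow> bool"
  where "canonical_ideal R J \<longleftrightarrow> ideal J R \<and> canonical_module_local R (ideal_module R J)"


section \<open>Multiplicity, bicanonical degree and canonical degree\<close>

text \<open>The multiplicity \<open>e\<^sub>0(J)\<close> of a Noetherian local ring with respect to an ideal \<open>J\<close> primary to
  the maximal ideal; for the unit ideal the formula gives \<open>0\<close>.\<close>

definition multiplicity_wrt :: "('a, 'r) ring_scheme \<Rightarrow> 'a set \<Rightarrow> real"
  where "multiplicity_wrt R J =
    (let d = the_enat (krull_dim R)
     in lim (\<lambda>n. fact d * real (the_enat (quot_length R (J [^]\<^bsub>ideals_set R\<^esub> n))) / real n ^ d))"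

definition local_degree :: "('a, 'r) ring_scheme \<Rightarrow> real"
  where "local_degree R = multiplicity_wrt R (max_ideal R)"

text \<open>\<open>J\<^sup>*\<^sup>*\<close> as an ideal of \<open>R\<close>: the inclusion \<open>\<iota> : J \<rightarrow> R\<close> induces \<open>J\<^sup>*\<^sup>* \<rightarrow> R\<^sup>*\<^sup>* = R\<close>, which is
  \<open>\<phi> \<mapsto> \<phi>(\<iota>)\<close>; it is injective if \<open>J\<close> contains a nonzerodivisor.\<close>

definition bidual_ideal :: "('a, 'r) ring_scheme \<Rightarrow> 'a set \<Rightarrow> 'a set"
  where "bidual_ideal R J =
    (\<lambda>\<phi>. \<phi> (\<lambda>x\<in>J. x)) `
      module_hom R (hom_module R (ideal_module R J) (self_module R)) (self_module R)"

definition bideg_term :: "('a, 'r) ring_scheme \<Rightarrow> 'a set \<Rightarrow> 'a set \<Rightarrow> real"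
  where "bideg_term R C P =
    (real (the_enat (quot_length (loc_at R P) (loc_ideal_at R P C)))
      - real (the_enat (quot_length (loc_at R P) (loc_ideal_at R P (bidual_ideal R C)))))
    * local_degree (R Quot P)"

definition cdeg_term :: "('a, 'r) ring_scheme \<Rightarrow> 'a set \<Rightarrow> 'a set \<Rightarrow> real"
  where "cdeg_term R C P =
    (multiplicity_wrt (loc_at R P) (loc_ideal_at R P C)
      - real (the_enat (quot_length (loc_at R P) (loc_ideal_at R P C))))
    * local_degree (R Quot P)"

text \<open>The sums over all primes of height one, with finitely many nonzero terms: \<open>C\<^sub>P = R\<^sub>P\<close> unless
  \<open>P\<close> is a minimal prime of the canonical ideal \<open>C\<close>. The index sets drop the zero terms because
  \<open>sum\<close> is meaningful over finite sets only.\<close>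

definition bideg :: "('a, 'r) ring_scheme \<Rightarrow> 'a set \<Rightarrow> real"
  where "bideg R C =
    (\<Sum>P | primeideal P R \<and> height R P = 1 \<and> bideg_term R C P \<noteq> 0. bideg_term R C P)"

definition cdeg :: "('a, 'r) ring_scheme \<Rightarrow> 'a set \<Rightarrow> real"
  where "cdeg R C =
    (\<Sum>P | primeideal P R \<and> height R P = 1 \<and> cdeg_term R C P \<noteq> 0. cdeg_term R C P)"


section \<open>Rees algebras\<close>

definition rees_algebra :: "('a, 'r) ring_scheme \<Rightarrow> 'a set \<Rightarrow> ('a, nat \<Rightarrow> 'a) up_ring"
  where "rees_algebra R I =
    (UP R)\<lparr>carrier := {p \<in> carrier (UP R). \<forall>j. coeff (UP R) p j \<in> I [^]\<^bsub>ideals_set R\<^esub> j}\<rparr>"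

definition rees_max_ideal :: "('a, 'r) ring_scheme \<Rightarrow> 'a set \<Rightarrow> (nat \<Rightarrow> 'a) set"
  where "rees_max_ideal R I =
    Idl\<^bsub>rees_algebra R I\<^esub> ({monom (UP R) a 0 | a. a \<in> max_ideal R} \<union> {monom (UP R) a 1 | a. a \<in> I})"

text \<open>\<open>\<omega>\<^sub>R(1,t)\<^sup>m\<close> for \<open>\<omega>\<^sub>R = R\<close>: the coefficient of \<open>t\<^sup>j\<close> ranges over \<open>I\<^bsup>j-m\<^esup>\<close>, where \<open>I\<^bsup>j-m\<^esup> = R\<close>
  for \<open>j \<le> m\<close>; for \<open>m = -1\<close> it ranges over \<open>I\<^bsup>j+1\<^esup>\<close>.\<close>

definition expected_module :: "('a, 'r) ring_scheme \<Rightarrow> 'a set \<Rightarrow> int \<Rightarrow> (nat \<Rightarrow> 'a, nat \<Rightarrow> 'a) module"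
  where "expected_module R I m =
    \<lparr>carrier = {p \<in> carrier (UP R). \<forall>j. coeff (UP R) p j \<in> I [^]\<^bsub>ideals_set R\<^esub> nat (int j - m)},
     monoid.mult = undefined, one = undefined,
     ring.zero = ring.zero (UP R), add = add (UP R), smult = monoid.mult (UP R)\<rparr>"

definition expected_form ::
    "('a, 'r) ring_scheme \<Rightarrow> 'a set \<Rightarrow> (nat \<Rightarrow> 'a, 'w, 'm) module_scheme \<Rightarrow> bool"
  where "expected_form R I \<omega> \<longleftrightarrow>
    (\<exists>m\<ge>-1. module_iso (rees_algebra R I) \<omega> (expected_module R I m))"

end

theory Submission
  imports Defs
begin

text \<open>
  Write \<open>K\<close> for the expected form of the canonical module of \<open>S = R[It]\<close>. Cohen-Macaulayness of \<open>S\<close> at its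
  graded maximal ideal gives a nonzerodivisor \<open>a \<in> I\<close>, and \<open>a\<^sup>m K\<close> is an ideal \<open>J\<close> of \<open>S\<close> isomorphic to
  the canonical module. If a prime \<open>P\<close> of \<open>S\<close> misses some \<open>b\<close> or some \<open>bt\<close> with \<open>b \<in> I\<close>, then \<open>J\<close> is
  generated at \<open>P\<close> by one nonzerodivisor, so \<open>S\<^sub>P\<close> has finite injective dimension over itself; otherwise
  \<open>P\<close> contains \<open>pR[t] \<inter> S\<close> with \<open>p = P \<inter> R \<supseteq> I\<close>, and its height is at least that of \<open>I\<close>.

  Any canonical ideal \<open>C\<close> of the localization is then principal, generated by a nonzerodivisor, at every
  prime of height one: over a one-dimensional Gorenstein ring a faithful ideal of finite injective
  dimension is principal. Hence \<open>C\<close> and its bidual agree there, and \<open>e\<^sub>0\<close> of \<open>C\<close> is the length of the quotient.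

  All homological facts are used in elementwise form: injective coresolutions are manipulated through
  Baer's criterion and the divisibility of their elements by regular sequences.
\<close>

text \<open>Two obstacles shape the development. Injective dimension refers to resolutions on one
  fixed type determined by ring and module, while a localized resolution lives on another. Over a
  Noetherian ring the torsion of an injective module with respect to a multiplicative set is
  injective and splits off, so localizing amounts to passing to a complement inside the same type; a
  Loewenheim-Skolem closure then moves a coresolution from any type to the prescribed one. Secondly,
  an arbitrary canonical ideal \<open>C\<close> is known only globally, and it might vanish at a
  prime of height one. It does not, because finite injective dimension and maximal depth make it
  faithful. Codimension at least two enters twice: it keeps \<open>I\<close> out of the associated
  primes of \<open>R\<close>, and it exceeds the height of every prime over which
  \<open>bideg\<close> and \<open>cdeg\<close> sum. As the canonical module of \<open>S\<close> is
  described at maximal ideals, a prime \<open>P\<close> is reached in two localizations, at a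
  maximal ideal above \<open>P\<close> and then at the extension of \<open>P\<close>.\<close>

abbreviation (input) car where "car \<equiv> carrier"
abbreviation (input) mult_in ("(_ *[_] _)" [70, 0, 71] 70) where "x *[G] y \<equiv> x \<otimes>\<^bsub>G\<^esub> y"
abbreviation (input) add_in ("(_ +[_] _)" [65, 0, 66] 65) where "x +[G] y \<equiv> x \<oplus>\<^bsub>G\<^esub> y"
abbreviation (input) diff_in ("(_ -[_] _)" [65, 0, 66] 65) where "x -[G] y \<equiv> x \<ominus>\<^bsub>G\<^esub> y"
abbreviation (input) smult_in ("(_ *>[_] _)" [70, 0, 71] 70) where "a *>[M] x \<equiv> a \<odot>\<^bsub>M\<^esub> x"
abbreviation (input) neg_in ("(-[_] _)" [0, 81] 80) where "-[G] x \<equiv> \<ominus>\<^bsub>G\<^esub> x"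
abbreviation (input) zero_in ("0[_]") where "0[G] \<equiv> \<zero>\<^bsub>G\<^esub>"
abbreviation (input) one_in ("1[_]") where "1[G] \<equiv> \<one>\<^bsub>G\<^esub>"

notation (input) iff (infixr "<->" 25) and monoid.mult (infixl "**\<index>" 70) and add (infixl "+.\<index>" 65)

section \<open>Ideals of Noetherian rings\<close>

lemma (in ring) idealD:
  assumes "ideal J R"
  shows "J <= car R" "\<zero> : J" "!!x. x : J ==> x : car R"
    "!!x y. [|x : J; y : J|] ==> x +. y : J" "!!x. x : J ==> \<ominus> x : J"
    "!!x y. [|x : J; y : J|] ==> x \<ominus> y : J"
    "!!a x. [|a : car R; x : J|] ==> a ** x : J" "!!a x. [|a : car R; x : J|] ==> x ** a : J"
proof -
  interpret J: ideal J R by fact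
  show "J <= car R" "\<zero> : J" "!!x. x : J ==> x : car R" using J.a_subset by auto
  show "!!x y. [|x : J; y : J|] ==> x +. y : J" "!!x. x : J ==> \<ominus> x : J"
    "!!a x. [|a : car R; x : J|] ==> a ** x : J" "!!a x. [|a : car R; x : J|] ==> x ** a : J" by (auto intro: J.I_l_closed J.I_r_closed)
  thus "!!x y. [|x : J; y : J|] ==> x \<ominus> y : J" by (simp add: minus_eq)
qed

lemma (in cring) ideal_criterion:
  assumes "J <= car R" "\<zero> : J" "!!x y. [|x : J; y : J|] ==> x +. y : J"
    "!!a x. [|a : car R; x : J|] ==> a ** x : J"
  shows "ideal J R"
proof (rule idealI[OF ring_axioms])
  have "\<ominus> x : J" if "x : J" for x
  proof -
    have "\<ominus> x = (\<ominus> \<one>) ** x" using that assms(1) by (auto simp: l_minus)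
    thus ?thesis using assms(4) that by simp
  qed
  thus "subgroup J (add_monoid R)" using assms by (intro subgroup.intro) (auto simp: a_inv_def)
  show "!!a x. [|a : J; x : car R|] ==> x ** a : J" using assms by auto
  show "!!a x. [|a : J; x : car R|] ==> a ** x : J" using assms m_comm by (metis subsetD)
qed

lemma (in ring) primeD:
  assumes "primeideal P R"
  shows "ideal P R" "\<one> ~: P" "!!a b. [|a : car R; b : car R; a ** b : P|] ==> a : P \<or> b : P"
    "P ~= car R"
proof -
  interpret P: primeideal P R by fact
  show "ideal P R" ..
  show "!!a b. [|a : car R; b : car R; a ** b : P|] ==> a : P \<or> b : P" by (rule P.I_prime)
  show "P ~= car R" using P.I_notcarr by auto
  thus "\<one> ~: P" using P.one_imp_carrier by auto
qed

lemma (in cring) primeideal_criterion: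
  assumes "ideal P R" "\<one> ~: P" "!!a b. [|a : car R; b : car R; a ** b : P|] ==> a : P \<or> b : P"
  shows "primeideal P R"
  using assms by (intro primeidealI) (auto intro: is_cring)

text \<open>Submodules of an ideal are ideals, so a module \<open>M / N\<close> is represented by a
  pair of ideals without forming the quotient: \<open>adjoin\<close> is \<open>N + x M\<close>, the
  submodule to divide by next, \<open>colon R N m\<close> is the annihilator of the class of
  \<open>m\<close>, and \<open>nonzerodiv\<close> says that \<open>x\<close> is regular on
  \<open>M / N\<close>. With \<open>M = carrier R\<close> the first is the ideal generated by
  \<open>N\<close> and \<open>x\<close>.\<close>

definition adjoin :: "('a, 'r) ring_scheme => 'a set => 'a => 'a set => 'a set"
  where "adjoin R N x M = {n +[R] x *[R] m | n m. n : N & m : M}"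

definition colon :: "('a, 'r) ring_scheme => 'a set => 'a => 'a set"
  where "colon R N m = {r : car R. r *[R] m : N}"

definition nonzerodiv :: "('a, 'r) ring_scheme => 'a set => 'a set => 'a => bool"
  where "nonzerodiv R N M x <-> (ALL m:M. x *[R] m : N --> m : N)"

context cring
begin

lemma adjoinI: "n : N ==> m : M ==> n +. x ** m : adjoin R N x M"
  by (auto simp: adjoin_def)

lemma adjoinE:
  assumes "y : adjoin R N x M"
  obtains n m where "n : N" "m : M" "y = n +. x ** m" using assms by (auto simp: adjoin_def)

lemma adjoin_ideal:
  assumes N: "ideal N R" and M: "ideal M R" and x: "x : car R"
  shows "ideal (adjoin R N x M) R"
proof (rule ideal_criterion)
  note n = idealD[OF N] and m = idealD[OF M]
  show "adjoin R N x M <= car R" using n(3) m(3) x by (auto simp: adjoin_def)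
  show "\<zero> : adjoin R N x M" using adjoinI[OF n(2) m(2), of x] x by simp
  show "u +. v : adjoin R N x M" if uv: "u : adjoin R N x M" "v : adjoin R N x M" for u v
  proof -
    obtain a b c d where *: "a : N" "b : M" "u = a +. x ** b" "c : N" "d : M" "v = c +. x ** d" using uv by (metis adjoinE)
    have "u +. v = (a +. c) +. x ** (b +. d)" using * n(3) m(3) x by (simp, algebra)
    thus ?thesis using * n m adjoinI by auto
  qed
  show "a ** u : adjoin R N x M" if au: "a : car R" "u : adjoin R N x M" for a u
  proof -
    obtain c b where *: "c : N" "b : M" "u = c +. x ** b" using au by (metis adjoinE)
    have "a ** u = (a ** c) +. x ** (a ** b)" using * n(3) m(3) x au by (simp, algebra)
    thus ?thesis using * n m adjoinI au by auto
  qed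
qed

lemma adjoin_superset:
  assumes N: "ideal N R" and M: "ideal M R" and x: "x : car R"
  shows "N <= adjoin R N x M"
proof
  fix n assume n: "n : N"
  have "n +. x ** \<zero> : adjoin R N x M" using n idealD(2)[OF M] by (rule adjoinI)
  thus "n : adjoin R N x M" using n idealD(3)[OF N] x by simp
qed

lemma adjoin_mult:
  assumes N: "ideal N R" and M: "ideal M R" and x: "x : car R" and "m : M"
  shows "x ** m : adjoin R N x M"
  using adjoinI[OF idealD(2)[OF N] \<open>m : M\<close>, of x] assms idealD(3)[OF M] by simp

lemma adjoin_self:
  assumes N: "ideal N R" and x: "x : car R"
  shows "x : adjoin R N x (car R)"
  using adjoin_mult[OF N oneideal x one_closed] x by simp

lemma adjoin_minimal:
  assumes L: "ideal L R" and "N <= L" "!!m. m : M ==> x ** m : L"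
  shows "adjoin R N x M <= L"
  using assms idealD(4)[OF L] by (auto simp: adjoin_def)

lemma adjoin_commute:
  assumes N: "ideal N R" and M: "ideal M R" and x: "x : car R" and y: "y : car R"
  shows "adjoin R (adjoin R N x M) y M = adjoin R (adjoin R N y M) x M"
proof -
  have sub: "adjoin R (adjoin R N u M) v M <= adjoin R (adjoin R N v M) u M"
    if u: "u : car R" and v: "v : car R" for u v
  proof -
    have Nv: "ideal (adjoin R N v M) R" by (rule adjoin_ideal[OF N M v])
    have L: "ideal (adjoin R (adjoin R N v M) u M) R" by (rule adjoin_ideal[OF Nv M u])
    show ?thesis by (intro adjoin_minimal[OF L])
        (use adjoin_superset[OF Nv M u] adjoin_superset[OF N M v] adjoin_mult[OF Nv M u]
          adjoin_mult[OF N M v] in auto)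
  qed
  show ?thesis using sub[OF x y] sub[OF y x] by auto
qed

lemma colon_ideal:
  assumes N: "ideal N R" and m: "m : car R"
  shows "ideal (colon R N m) R"
  using idealD[OF N] m by (intro ideal_criterion) (auto simp: colon_def l_distr m_assoc)

lemma subset_colon:
  assumes N: "ideal N R" and m: "m : car R"
  shows "N <= colon R N m"
  using idealD[OF N] m by (auto simp: colon_def)

lemma colon_mult_subset:
  assumes N: "ideal N R" and m: "m : car R" "r : car R"
  shows "colon R N m <= colon R N (r ** m)"
proof
  fix a assume a: "a : colon R N m"
  hence "a ** (r ** m) = r ** (a ** m)" using m by (auto simp: colon_def m_lcomm)
  thus "a : colon R N (r ** m)" using a idealD(7)[OF N] m by (auto simp: colon_def)
qed

text \<open>\<open>k\<close> is a lower bound for the depth of \<open>M / N\<close> over a ring in which the elements of \<open>nn\<close> are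
  the admissible members of regular sequences.\<close>

fun depth_ge :: "'a set => 'a set => nat => 'a set => bool" where
  "depth_ge nn M 0 N <-> ~ M <= N"
| "depth_ge nn M (Suc k) N <->
    (EX x:nn. nonzerodiv R N M x & depth_ge nn M k (adjoin R N x M))"

end

section \<open>Nakayama's lemma, associated primes and prime avoidance\<close>

locale noetherian_cring = cring + noetherian_ring

context noetherian_cring
begin

text \<open>In a Noetherian ring the union of a nonempty chain of ideals belongs to the chain, which
  is what Zorn's lemma asks for. Noetherian induction is applied in this form throughout: a maximal
  member of a family is shown to be as large as desired, or a maximal counterexample is
  refuted.\<close>

lemma ideal_family_maximal:
  assumes "\<S> ~= {}" "!!J. J : \<S> ==> ideal J R"
  shows "EX M:\<S>. ALL J:\<S>. M <= J --> J = M"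
proof (rule subset_Zorn_nonempty[OF assms(1)])
  fix C assume C: "C ~= {}" "subset.chain \<S> C"
  hence "subset.chain {I. ideal I R} C" using assms(2) by (auto simp: subset_chain_def)
  thus "\<Union>C : \<S>" using ideal_chain_is_trivial[OF C(1)] C(2) by (auto simp: subset_chain_def)
qed

text \<open>Nakayama: for \<open>L\<close> maximal with \<open>N <= L < M\<close> and \<open>m : M - L\<close> the hypothesis
  gives \<open>(1 - x a) m : L\<close>.\<close>

lemma nakayama:
  assumes N: "ideal N R" and M: "ideal M R" and x: "x : car R"
    and unit: "!!a. a : car R ==> \<one> \<ominus> x ** a : Units R"
    and sub: "M <= adjoin R N x M" and NM: "N <= M"
  shows "M = N"
proof (rule ccontr)
  assume "M ~= N"
  let ?S = "{L. ideal L R & N <= L & L < M}"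
  have "N : ?S" using N NM \<open>M ~= N\<close> by auto
  hence "?S ~= {}" by blast
  hence "EX L:?S. ALL J:?S. L <= J --> J = L" by (rule ideal_family_maximal) auto
  then obtain L where L: "L : ?S" and max: "!!J. [|J : ?S; L <= J|] ==> J = L" by auto
  hence Li: "ideal L R" by auto
  obtain m where m: "m : M" "m ~: L" using L by auto
  note cl = idealD[OF Li] and clM = idealD[OF M]
  have mc: "m : car R" using m clM by auto
  let ?L' = "adjoin R L m (car R)"
  have L': "ideal ?L' R" "L <= ?L'" "m : ?L'" using adjoin_ideal[OF Li oneideal mc] adjoin_superset[OF Li oneideal mc] adjoin_self[OF Li mc] .
  moreover have "?L' <= M" by (rule adjoin_minimal[OF M]) (use L m clM in auto)
  ultimately have "?L' = M" using max[of ?L'] L m by blast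
  obtain n k where n: "n : N" "k : M" "m = n +. x ** k" using sub m adjoinE by (metis subsetD)
  obtain l a where l: "l : L" "a : car R" "k = l +. m ** a" using n(2) \<open>?L' = M\<close> adjoinE by metis
  have nc: "n : car R" "n : L" using n L cl by auto
  have lc: "l : car R" using l cl by auto
  have xa: "\<one> \<ominus> x ** a : Units R" using unit l by auto
  have "m \<ominus> x ** a ** m = n +. x ** l"
  proof -
    have "n +. x ** (l +. m ** a) \<ominus> x ** a ** m = n +. x ** l" using nc(1) lc mc x l(2) by algebra
    thus ?thesis using n(3) l(3) by metis
  qed
  moreover have "(\<one> \<ominus> x ** a) ** m = m \<ominus> x ** a ** m" using mc x l(2) by algebra
  ultimately have "(\<one> \<ominus> x ** a) ** m = n +. x ** l" by simp
  hence *: "(\<one> \<ominus> x ** a) ** m : L" using nc l cl x by auto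
  have "m = inv (\<one> \<ominus> x ** a) ** ((\<one> \<ominus> x ** a) ** m)" using xa mc Units_closed by (simp add: m_assoc[symmetric] Units_l_inv)
  hence "m : L" using * xa cl(7) by (metis Units_inv_closed)
  thus False using m by simp
qed

text \<open>If \<open>b m\<close> is nonzero in \<open>M / N\<close>, its annihilator contains that
  of \<open>m\<close> and equals it by maximality; so \<open>a b m = 0\<close> forces
  \<open>a m = 0\<close>. Only annihilators above that of \<open>u\<close> compete, which places the
  prime over a prescribed annihilator.\<close>

lemma colon_maximal_prime:
  assumes N: "ideal N R" and M: "ideal M R" and u: "u : M" "u ~: N"
  obtains m where "m : M" "m ~: N" "primeideal (colon R N m) R" "colon R N u <= colon R N m"
    "!!m'. [|m' : M; m' ~: N; colon R N m <= colon R N m'|] ==> colon R N m' = colon R N m"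
proof -
  note cN = idealD[OF N] and cM = idealD[OF M]
  let ?S = "{colon R N m | m. m : M & m ~: N & colon R N u <= colon R N m}"
  have "?S ~= {}" using u by auto
  moreover have "ideal J R" if "J : ?S" for J using that colon_ideal[OF N] cM by auto
  ultimately have "EX Q:?S. ALL J:?S. Q <= J --> J = Q" by (rule ideal_family_maximal)
  then obtain Q where Q: "Q : ?S" and max: "!!J. [|J : ?S; Q <= J|] ==> J = Q" by auto
  then obtain m where m: "Q = colon R N m" "m : M" "m ~: N" "colon R N u <= colon R N m" by blast
  have mc: "m : car R" using m cM by auto
  have max': "colon R N m' = colon R N m" if "m' : M" "m' ~: N" "colon R N m <= colon R N m'" for m'
  proof -
    have "colon R N m' : ?S" using that m by blast
    thus ?thesis using max that m by blast
  qed
  have "primeideal (colon R N m) R"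
  proof (rule primeideal_criterion[OF colon_ideal[OF N mc]])
    show "\<one> ~: colon R N m" using m mc by (auto simp: colon_def)
    fix a b assume ab: "a : car R" "b : car R" "a ** b : colon R N m"
    show "a : colon R N m \<or> b : colon R N m"
    proof (rule disjCI)
      assume "b ~: colon R N m"
      hence bm: "b ** m : M" "b ** m ~: N" using ab m cM by (auto simp: colon_def)
      have "colon R N (b ** m) = colon R N m" using max'[OF bm colon_mult_subset[OF N mc ab(2)]] .
      moreover have "a : colon R N (b ** m)" using ab mc by (simp add: colon_def m_assoc)
      ultimately show "a : colon R N m" by simp
    qed
  qed
  thus ?thesis using that m max' by blast
qed

text \<open>The generators have to be found inside \<open>S\<close> itself: below, \<open>S\<close>
  consists of elements with maximal prime annihilators, a property that an arbitrary generator of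
  \<open>Idl S\<close> may lack.\<close>

lemma ideal_generated_by_finite_subset:
  assumes S: "S <= car R"
  obtains F where "finite F" "F <= S" "Idl F = Idl S"
proof -
  let ?S = "{Idl F | F. finite F & F <= S}"
  have "Idl {} : ?S" by (rule CollectI) (intro exI[of _ "{}"], simp)
  hence "?S ~= {}" by blast
  moreover have "ideal J R" if "J : ?S" for J using that genideal_ideal S by blast
  ultimately have "EX Q:?S. ALL J:?S. Q <= J --> J = Q" by (rule ideal_family_maximal)
  then obtain Q where Q: "Q : ?S" and max: "!!J. [|J : ?S; Q <= J|] ==> J = Q" by auto
  then obtain F where F: "Q = Idl F" "finite F" "F <= S" by blast
  have "S <= Idl F"
  proof
    fix s assume s: "s : S"
    have 1: "Idl (insert s F) : ?S" using s F by blast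
    have 2: "Q <= Idl (insert s F)" unfolding F(1) by (rule subset_Idl_subset) (use F s S in auto)
    have "Idl (insert s F) = Q" using max[OF 1 2] .
    moreover have "insert s F <= Idl (insert s F)" by (rule genideal_self) (use F s S in auto)
    ultimately show "s : Idl F" using F by blast
  qed
  hence "Idl S <= Idl F" by (intro genideal_minimal genideal_ideal) (use F S in auto)
  moreover have "Idl F <= Idl S" by (rule subset_Idl_subset) (use F S in auto)
  ultimately show ?thesis using that F by blast
qed

text \<open>Otherwise each ideal of the family has an element outside \<open>P\<close>, and the
  product of these lies in the intersection but not in \<open>P\<close>. The factor
  \<open>carrier R\<close> takes care of the empty family, whose intersection is the whole
  type.\<close>

lemma prime_contains_finite_Inter:
  assumes P: "primeideal P R" and "finite \<J>" and "!!J. J : \<J> ==> ideal J R"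
    and "car R Int \<Inter>\<J> <= P"
  shows "EX J:\<J>. J <= P"
proof (rule ccontr)
  assume neg: "~ (EX J:\<J>. J <= P)"
  have "EX x:car R Int \<Inter>\<J>. x ~: P" using assms(2,3) neg
  proof (induction \<J> rule: finite_induct)
    case empty
    thus ?case using primeD(2)[OF P] by auto
  next
    case (insert J \<J>)
    then obtain x where x: "x : car R" "x : \<Inter>\<J>" "x ~: P" by auto
    obtain y where y: "y : J" "y ~: P" using insert.prems(2) by auto
    have J: "ideal J R" and JJ: "!!K. K : \<J> ==> ideal K R" using insert.prems by auto
    have yc: "y : car R" using y idealD(3)[OF J] by auto
    have "x ** y : J" using idealD(7)[OF J] x y by auto
    moreover have "x ** y : K" if "K : \<J>" for K using idealD(8)[OF JJ[OF that]] x yc that by auto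
    moreover have "x ** y ~: P" using primeD(3)[OF P x(1) yc] x y by auto
    ultimately show ?case using x yc by (intro bexI[of _ "x ** y"]) auto
  qed
  thus False using assms(4) by auto
qed

text \<open>The maximal annihilators of elements of \<open>M / N\<close> are finite in number: finitely many such
  elements generate all of them, and then every maximal annihilator contains one of finitely many.\<close>

lemma finite_maximal_colons:
  assumes N: "ideal N R" and M: "ideal M R"
  obtains \<P> where "finite \<P>"
    "!!P. P : \<P> ==> primeideal P R & (EX m:M. m ~: N & P = colon R N m)"
    "!!u. [|u : M; u ~: N|] ==> EX P:\<P>. colon R N u <= P"
proof -
  note cN = idealD[OF N] and cM = idealD[OF M]
  define S where "S = {m : M. m ~: N & primeideal (colon R N m) R &
    (ALL m':M. m' ~: N & colon R N m <= colon R N m' --> colon R N m' = colon R N m)}"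
  have Sc: "S <= car R" using cM by (auto simp: S_def)
  obtain F where F: "finite F" "F <= S" "Idl F = Idl S" using ideal_generated_by_finite_subset[OF Sc] .
  show ?thesis
  proof
    show "finite (colon R N ` F)" using F by simp
    show "primeideal P R & (EX m:M. m ~: N & P = colon R N m)" if "P : colon R N ` F" for P using that F by (auto simp: S_def)
    fix u assume u: "u : M" "u ~: N"
    obtain m where m: "m : M" "m ~: N" "primeideal (colon R N m) R" "colon R N u <= colon R N m"
      "!!m'. [|m' : M; m' ~: N; colon R N m <= colon R N m'|] ==> colon R N m' = colon R N m" using colon_maximal_prime[OF N M u] by blast
    hence "m : S" by (auto simp: S_def)
    \<comment> \<open>The elements that the common annihilator of \<open>F\<close> kills modulo
      \<open>N\<close>. They form an ideal containing \<open>F\<close>, hence everything that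
      \<open>F\<close> generates, in particular \<open>m\<close>.\<close>
    let ?A = "{y : car R. ALL a:car R Int \<Inter>(colon R N ` F). a ** y : N}"
    have "ideal ?A R" by (rule ideal_criterion) (use cN in "auto simp: r_distr m_lcomm")
    moreover have "F <= ?A" using F Sc by (auto simp: colon_def)
    ultimately have "Idl F <= ?A" by (rule genideal_minimal)
    hence "m : ?A" using F(3) genideal_self[OF Sc] \<open>m : S\<close> by auto
    hence "car R Int \<Inter>(colon R N ` F) <= colon R N m" by (auto simp: colon_def)
    moreover have colF: "ideal J R" if "J : colon R N ` F" for J using that F(2) Sc colon_ideal[OF N] by blast
    ultimately obtain f where f: "f : F" "colon R N f <= colon R N m" using prime_contains_finite_Inter[OF m(3), of "colon R N ` F"] F(1) colF by auto
    hence "colon R N m = colon R N f" using F m by (auto simp: S_def)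
    thus "EX P:colon R N ` F. colon R N u <= P" using f m by auto
  qed
qed

text \<open>Prime avoidance for a coset \<open>x + K\<close> (Kaplansky, Theorem 124).\<close>

lemma coset_prime_avoidance:
  assumes K: "ideal K R" and x: "x : car R"
    and fin: "finite \<P>" and prime: "!!P. P : \<P> ==> primeideal P R"
    and no: "!!P. P : \<P> ==> ~ (x : P & K <= P)"
  obtains k where "k : K" "!!P. P : \<P> ==> x +. k ~: P"
proof -
  note cK = idealD[OF K]
  have "EX k:K. ALL P:\<P>. x +. k ~: P" using fin prime no
  proof (induction "card \<P>" arbitrary: \<P> rule: less_induct)
    case less
    show ?case
    \<comment> \<open>A prime inside another one may be dropped, since avoiding the larger one
      suffices. In the remaining case no other member lies in \<open>P\<close>, which is needed to
      choose \<open>j\<close> below.\<close>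
    proof (cases "EX P:\<P>. EX Q:\<P>. P ~= Q & P <= Q")
      case True
      then obtain P Q where PQ: "P : \<P>" "Q : \<P>" "P ~= Q" "P <= Q" by blast
      have "card (\<P> - {P}) < card \<P>" using PQ less.prems(1) by (meson card_Diff1_less)
      then obtain k where "k : K" "ALL P':\<P> - {P}. x +. k ~: P'" using less by blast
      thus ?thesis using PQ by (intro bexI[of _ k]) blast+
    next
      case False
      show ?thesis
      proof (cases "\<P> = {}")
        case True thus ?thesis using cK by auto
      next
        case ne: False
        then obtain P where P: "P : \<P>" by auto
        hence "card (\<P> - {P}) < card \<P>" using less.prems(1) by (meson card_Diff1_less)
        then obtain k where k: "k : K" "ALL P':\<P> - {P}. x +. k ~: P'" using less by blast
        show ?thesis
        proof (cases "x +. k : P")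
          case False thus ?thesis using k by (intro bexI[of _ k]) auto
        next
          case xk: True
          note Pp = less.prems(2)[OF P]
          note cP = idealD[OF primeD(1)[OF Pp]]
          have kc: "k : car R" using k cK by auto
          have "~ K <= P"
          proof
            assume KP: "K <= P"
            hence "(x +. k) \<ominus> k : P" using xk k cP by auto
            moreover have "(x +. k) \<ominus> k = x" using x kc by algebra
            ultimately show False using less.prems(3)[OF P] KP by auto
          qed
          moreover have "ideal J R" if "J : insert K (\<P> - {P})" for J using that K less.prems(2) primeD(1) by auto
          moreover have "~ Q <= P" if "Q : \<P> - {P}" for Q using False that P by blast
          ultimately have "~ car R Int \<Inter>(insert K (\<P> - {P})) <= P" using prime_contains_finite_Inter[OF Pp, of "insert K (\<P> - {P})"] less.prems(1)
            by (metis finite_insert finite_Diff insertE)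
          \<comment> \<open>The correction \<open>j\<close> lies in \<open>K\<close> and in all
            other primes but not in \<open>P\<close>: adding it moves \<open>x + k\<close> out of
            \<open>P\<close> and changes nothing modulo the others.\<close>
          then obtain j where j: "j : car R" "j : K" "ALL Q:\<P> - {P}. j : Q" "j ~: P" by auto
          have "x +. (k +. j) ~: Q" if Q: "Q : \<P>" for Q
          proof
            assume in_Q: "x +. (k +. j) : Q"
            note cQ = idealD[OF primeD(1)[OF less.prems(2)[OF Q]]]
            show False
            proof (cases "Q = P")
              case True
              have "(x +. (k +. j)) \<ominus> (x +. k) : P" using in_Q xk True cP by auto
              moreover have "(x +. (k +. j)) \<ominus> (x +. k) = j" using x kc j(1) by algebra
              ultimately show False using j by simp
            next
              case False
              hence "(x +. (k +. j)) \<ominus> j : Q" using in_Q j Q cQ by auto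
              moreover have "(x +. (k +. j)) \<ominus> j = x +. k" using x kc j(1) by algebra
              ultimately show False using k Q False by auto
            qed
          qed
          thus ?thesis using k j cK by (intro bexI[of _ "k +. j"]) auto
        qed
      qed
    qed
  qed
  thus ?thesis using that by blast
qed

text \<open>If no nonzero element of any of the finitely many modules \<open>M / N\<close> is killed by \<open>x\<close> and \<open>K\<close>,
  some element of \<open>x + K\<close> is a nonzerodivisor on all of them.\<close>

lemma coset_nonzerodivisor:
  assumes K: "ideal K R" and x: "x : car R" and fin: "finite \<A>"
    and id: "!!N M. (N, M) : \<A> ==> ideal N R & ideal M R"
    and no: "!!N M m. [|(N, M) : \<A>; m : M; x ** m : N; !!k. k : K ==> k ** m : N|] ==> m : N"
  obtains k where "k : K" "!!N M. (N, M) : \<A> ==> nonzerodiv R N M (x +. k)"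
proof -
  note cK = idealD[OF K]
  have "\<exists>\<P>. finite \<P> & (ALL P:\<P>. primeideal P R & (EX m:snd p. m ~: fst p & P = colon R (fst p) m)) &
      (ALL u:snd p. u ~: fst p --> (EX P:\<P>. colon R (fst p) u <= P))" if "p : \<A>" for p
  proof -
    have "ideal (fst p) R" "ideal (snd p) R" using id[of "fst p" "snd p"] that by auto
    thus ?thesis by (metis finite_maximal_colons)
  qed
  then obtain Q where Q: "!!p. p : \<A> ==> finite (Q p) &
      (ALL P:Q p. primeideal P R & (EX m:snd p. m ~: fst p & P = colon R (fst p) m)) &
      (ALL u:snd p. u ~: fst p --> (EX P:Q p. colon R (fst p) u <= P))" by metis
  have "~ (x : P & K <= P)" if P: "P : \<Union>(Q ` \<A>)" for P
  proof
    assume xK: "x : P & K <= P"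
    obtain N M m where *: "(N, M) : \<A>" "m : M" "m ~: N" "P = colon R N m" using P Q by fastforce
    thus False using no[OF *(1,2)] xK by (auto simp: colon_def)
  qed
  moreover have "finite (\<Union>(Q ` \<A>))" using fin Q by auto
  moreover have "primeideal P R" if "P : \<Union>(Q ` \<A>)" for P using that Q by auto
  ultimately obtain k where k: "k : K" "!!P. P : \<Union>(Q ` \<A>) ==> x +. k ~: P" using coset_prime_avoidance[OF K x] by metis
  have "nonzerodiv R N M (x +. k)" if NM: "(N, M) : \<A>" for N M unfolding nonzerodiv_def
  proof (intro ballI impI, rule ccontr)
    fix m assume m: "m : M" "(x +. k) ** m : N" "m ~: N"
    then obtain P where P: "P : Q (N, M)" "colon R N m <= P" using Q[OF NM] by auto
    moreover have "x +. k : colon R N m" using m x k cK by (auto simp: colon_def)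
    ultimately show False using k NM by auto
  qed
  thus ?thesis using that k by blast
qed

text \<open>An ideal maximal among those that miss \<open>T\<close> is prime: for \<open>a\<close>
  and \<open>b\<close> outside it, the ideals enlarged by \<open>a\<close> and by \<open>b\<close>
  both meet \<open>T\<close>, and the product of the two elements found would be a member of
  \<open>T\<close> in the ideal if \<open>a b\<close> were in it.\<close>

lemma prime_disjoint_from_multiplicative_set:
  assumes J: "ideal J R" and T: "T <= car R" "\<one> : T" "!!s t. [|s : T; t : T|] ==> s ** t : T"
    and disj: "J Int T = {}"
  obtains P where "primeideal P R" "J <= P" "P Int T = {}"
proof -
  let ?S = "{L. ideal L R & J <= L & L Int T = {}}"
  have "J : ?S" using J disj by auto
  hence "?S ~= {}" by blast
  hence "EX P:?S. ALL L:?S. P <= L --> L = P" by (rule ideal_family_maximal) auto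
  then obtain P where P: "P : ?S" and max: "!!L. [|L : ?S; P <= L|] ==> L = P" by auto
  hence Pi: "ideal P R" by auto
  note cP = idealD[OF Pi]
  have "primeideal P R"
  proof (rule primeideal_criterion[OF Pi])
    show "\<one> ~: P" using P T by auto
    fix a b assume ab: "a : car R" "b : car R" "a ** b : P"
    show "a : P \<or> b : P"
    proof (rule ccontr)
      assume neg: "~ (a : P \<or> b : P)"
      have meets: "EX t:T. EX r:car R. EX p:P. t = p +. c ** r" if c: "c : car R" "c ~: P" for c
      proof -
        let ?L = "adjoin R P c (car R)"
        have "ideal ?L R" "P <= ?L" "c : ?L" using adjoin_ideal[OF Pi oneideal c(1)] adjoin_superset[OF Pi oneideal c(1)] adjoin_self[OF Pi c(1)] .
        hence "?L Int T ~= {}" using max[of ?L] P c by auto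
        thus ?thesis by (auto simp: adjoin_def) 
      qed
      obtain s r p where s: "s : T" "r : car R" "p : P" "s = p +. a ** r" using meets ab neg by blast
      obtain t r' p' where t: "t : T" "r' : car R" "p' : P" "t = p' +. b ** r'" using meets ab neg by blast
      have pc: "p : car R" "p' : car R" using s t cP by auto
      have "s ** t = p ** t +. (a ** r) ** p' +. (r ** r') ** (a ** b)" unfolding s(4) t(4) using pc s(2) t(2) ab(1,2) by algebra
      also have "... : P" using s t ab cP T pc by auto
      finally show False using T(3)[OF s(1) t(1)] P by auto
    qed
  qed
  thus ?thesis using that P by blast
qed

text \<open>A nonzerodivisor modulo \<open>J\<close> lies in no minimal prime of \<open>J\<close>.
  To find the prime inside \<open>q\<close>, the multiplicative set consists of the products
  \<open>x^n s\<close> with \<open>s\<close> outside \<open>q\<close>; it misses \<open>J\<close>,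
  because \<open>x^n s\<close> in \<open>J\<close> puts \<open>s\<close> into \<open>J\<close> and
  so into \<open>q\<close>.\<close>

lemma nonzerodivisor_prime_below:
  assumes J: "ideal J R" and x: "x : car R" "nonzerodiv R J (car R) x"
    and q: "primeideal q R" "J <= q"
  obtains q' where "primeideal q' R" "J <= q'" "q' <= q" "x ~: q'"
proof -
  let ?T = "{x [^] (n::nat) ** s | n s. s : car R - q}"
  note cq = primeD[OF q(1)]
  have pow: "m : J" if "x [^] (n::nat) ** m : J" "m : car R" for n m using that
  proof (induction n)
    case 0 thus ?case by simp
  next
    case (Suc n)
    have "x ** (x [^] n ** m) = x [^] Suc n ** m" using x(1) Suc.prems(2) by (simp add: m_ac)
    moreover have "x [^] n ** m : car R" using x(1) Suc.prems(2) by simp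
    ultimately have "x [^] n ** m : J" using x(2) Suc.prems(1) by (metis nonzerodiv_def)
    thus ?case using Suc.IH Suc.prems(2) by auto
  qed
  have memT: "x [^] (n::nat) ** s : ?T" if "s : car R" "s ~: q" for n s using that by blast
  have T4: "J Int ?T = {}" using pow q by auto
  have T2: "\<one> : ?T" using memT[of \<one> 0] cq(2) by simp
  have T3: "s ** t : ?T" if st: "s : ?T" "t : ?T" for s t
  proof -
    obtain n a m b where *: "s = x [^] (n::nat) ** a" "a : car R - q" "t = x [^] (m::nat) ** b" "b : car R - q" using st by blast
    have "s ** t = x [^] (n + m) ** (a ** b)" using * x(1) by (simp add: nat_pow_mult[symmetric] m_ac)
    moreover have "a ** b : car R" "a ** b ~: q" using * cq(3) by auto
    ultimately show ?thesis using memT by simp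
  qed
  have T1: "?T <= car R" using x by auto
  obtain q' where q': "primeideal q' R" "J <= q'" "q' Int ?T = {}" by (rule prime_disjoint_from_multiplicative_set[OF J T1 T2 T3 T4])
  have "s : q" if s: "s : q'" for s
  proof (rule ccontr)
    assume "s ~: q"
    moreover have sc: "s : car R" using s idealD(3)[OF primeD(1)[OF q'(1)]] by auto
    ultimately have "s : ?T" using memT[of s 0] by simp
    thus False using q' s by blast
  qed
  moreover have "x : ?T" using memT[of \<one> 1] cq(2) x(1) by simp
  ultimately show ?thesis using that[OF q'(1,2)] q'(3) by blast
qed

lemma maximal_ideal_above:
  assumes J: "ideal J R" "J ~= car R"
  obtains \<mm> where "maximalideal \<mm> R" "J <= \<mm>"
proof -
  let ?S = "{L. ideal L R & J <= L & L ~= car R}"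
  have "J : ?S" using J by auto
  hence "?S ~= {}" by blast
  hence "EX P:?S. ALL L:?S. P <= L --> L = P" by (rule ideal_family_maximal) auto
  then obtain P where P: "P : ?S" and max: "!!L. [|L : ?S; P <= L|] ==> L = P" by auto
  have "maximalideal P R" by (rule maximalidealI) (use P max in blast)+
  thus ?thesis using that P by blast
qed

end

section \<open>Depth, and heights of primes, in a Noetherian local ring\<close>

locale local_noetherian = noetherian_cring +
  fixes nn :: "'a set"
  assumes n_ideal: "ideal nn R" and n_proper: "\<one> ~: nn"
    and n_units: "!!x. [|x : car R; x ~: nn|] ==> x : Units R"
begin

lemmas n_closed = idealD[OF n_ideal]

lemma n_prime: "primeideal nn R"
proof (rule primeideal_criterion[OF n_ideal n_proper])
  fix a b assume ab: "a : car R" "b : car R" "a ** b : nn"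
  show "a : nn \<or> b : nn"
  proof (rule disjCI)
    assume "b ~: nn"
    hence b: "b : Units R" using n_units ab by auto
    hence "a = inv b ** (a ** b)" using ab by (simp add: m_ac)
    thus "a : nn" using n_closed(7)[of "inv b" "a ** b"] ab b by simp
  qed
qed

lemma proper_ideal_subset_n:
  assumes "ideal J R" "\<one> ~: J" shows "J <= nn"
proof
  fix x assume x: "x : J"
  note cJ = idealD[OF assms(1)]
  show "x : nn"
  proof (rule ccontr)
    assume "x ~: nn"
    hence u: "x : Units R" using n_units x cJ by auto
    hence "inv x ** x : J" using cJ(7) x by blast
    thus False using u assms(2) by simp
  qed
qed

lemma one_minus_unit:
  assumes "x : nn" "a : car R" shows "\<one> \<ominus> x ** a : Units R"
proof (rule n_units)
  have xc: "x : car R" using assms n_closed by auto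
  thus "\<one> \<ominus> x ** a : car R" using assms by auto
  show "\<one> \<ominus> x ** a ~: nn"
  proof
    assume "\<one> \<ominus> x ** a : nn"
    hence "(\<one> \<ominus> x ** a) +. x ** a : nn" using assms n_closed by auto
    moreover have "(\<one> \<ominus> x ** a) +. x ** a = \<one>" using xc assms(2) by algebra
    ultimately show False using n_proper by simp
  qed
qed

lemmas nakayama_local = nakayama[OF _ _ n_closed(3) one_minus_unit]

end

lemma (in noetherian_cring) colon_prime:
  assumes N: "ideal N R" and M: "ideal M R" and u: "u : M" "u ~: N"
  shows "EX m:M. m ~: N & primeideal (colon R N m) R & colon R N u <= colon R N m"
  by (rule colon_maximal_prime[OF N M u]) blast

lemma depth_ge_not_subset:
  assumes "cring R" "ideal N R" "ideal M R" "nn <= car R" "cring.depth_ge R nn M k N"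
  shows "~ M <= N"
proof -
  interpret cring R by fact
  show ?thesis using assms(2,5)
  proof (induction k arbitrary: N)
    case (Suc k)
    then obtain x where x: "x : nn" "depth_ge nn M k (adjoin R N x M)" by auto
    hence xc: "x : car R" using assms(4) by auto
    thus ?case using Suc.IH[OF adjoin_ideal[OF Suc.prems(1) assms(3) xc] x(2)]
        adjoin_superset[OF Suc.prems(1) assms(3) xc] by auto
  qed auto
qed

context local_noetherian
begin

lemma depth_ge_Suc_imp:
  assumes "ideal M R" "ideal N R" "depth_ge nn M (Suc k) N" shows "depth_ge nn M k N"
  using assms(2,3)
proof (induction k arbitrary: N)
  case 0
  thus ?case using depth_ge_not_subset[OF is_cring 0(1) assms(1) n_closed(1) 0(2)] by simp
next
  case (Suc k)
  then obtain x where x: "x : nn" "nonzerodiv R N M x" "depth_ge nn M (Suc k) (adjoin R N x M)" by auto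
  hence "depth_ge nn M k (adjoin R N x M)" using Suc.IH adjoin_ideal[OF Suc.prems(1) assms(1)] n_closed by blast
  thus ?case using x by auto
qed

lemma depth_ge_mono:
  assumes "ideal M R" "ideal N R" "k <= l" "depth_ge nn M l N" shows "depth_ge nn M k N"
  using assms(3,4) by (induction rule: dec_induct) (use depth_ge_Suc_imp[OF assms(1,2)] in blast)+

text \<open>The coset of zero modulo \<open>nn\<close>: the only obstruction to a regular element in
  it is a nonzero class killed by all of \<open>nn\<close>, that is, a socle element.\<close>

lemma common_nonzerodivisor:
  assumes "finite \<A>" "!!N M. (N, M) : \<A> ==> ideal N R & ideal M R"
    and no: "!!N M m. [|(N, M) : \<A>; m : M; !!k. k : nn ==> k ** m : N|] ==> m : N"
  obtains x where "x : nn" "!!N M. (N, M) : \<A> ==> nonzerodiv R N M x"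
proof -
  obtain k where k: "k : nn" "!!N M. (N, M) : \<A> ==> nonzerodiv R N M (\<zero> +. k)"
    by (rule coset_nonzerodivisor[OF n_ideal zero_closed assms(1,2)]) (use no in blast)+
  thus ?thesis using that n_closed(3) by simp
qed

text \<open>Both socles are Ext^1 of the residue field into \<open>M / N\<close>, hence isomorphic.
  On elements: \<open>y\<close> sends \<open>u\<close> into \<open>N + x M\<close>, so
  \<open>y u = n + x v\<close>, and \<open>v\<close> is the element that corresponds to
  \<open>u\<close>.\<close>

lemma socle_exchange:
  assumes N: "ideal N R" and M: "ideal M R" and x: "x : nn" "nonzerodiv R N M x"
    and y: "y : nn" "nonzerodiv R N M y"
    and u: "u : M" "u ~: adjoin R N x M" "!!k. k : nn ==> k ** u : adjoin R N x M"
  shows "EX v:M. v ~: adjoin R N y M & (ALL k:nn. k ** v : adjoin R N y M)"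
proof -
  note cN = idealD[OF N] and cM = idealD[OF M]
  have c: "x : car R" "y : car R" "u : car R" using x y u n_closed(3) cM(3) by auto
  obtain n v where v: "n : N" "v : M" "y ** u = n +. x ** v" using u(3)[OF y(1)] by (metis adjoinE)
  have cv: "n : car R" "v : car R" using v cN(3) cM(3) by auto
  have xv: "x ** v = y ** u \<ominus> n" unfolding v(3) using cv c by algebra
  have "v ~: adjoin R N y M"
  proof
    assume "v : adjoin R N y M"
    then obtain n' w where w: "n' : N" "w : M" "v = n' +. y ** w" by (metis adjoinE)
    have cw: "n' : car R" "w : car R" using w cN(3) cM(3) by auto
    have "y ** (u \<ominus> x ** w) = y ** u \<ominus> x ** (y ** w)" using c cw by algebra
    also have "... = n +. x ** n'" unfolding v(3) w(3) using c cw cv(1) by algebra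
    also have "... : N" using cN(4,7) v(1) w(1) c by simp
    finally have "u \<ominus> x ** w : N" using y(2) u(1) w(2) cM(6,7) c by (simp add: nonzerodiv_def)
    hence "(u \<ominus> x ** w) +. x ** w : adjoin R N x M" using w adjoinI by blast
    moreover have "(u \<ominus> x ** w) +. x ** w = u" using c cw by algebra
    ultimately show False using u by simp
  qed
  moreover have "k ** v : adjoin R N y M" if k: "k : nn" for k
  proof -
    have kc: "k : car R" using k n_closed(3) by auto
    obtain n1 m1 where m: "n1 : N" "m1 : M" "k ** u = n1 +. x ** m1" using u(3)[OF k] by (metis adjoinE)
    have cm: "n1 : car R" "m1 : car R" using m cN(3) cM(3) by auto
    have "x ** (k ** v \<ominus> y ** m1) = k ** (x ** v) \<ominus> y ** (x ** m1)" using c cv cm kc by algebra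
    also have "... = y ** (k ** u) \<ominus> k ** n \<ominus> y ** (x ** m1)" unfolding xv using c cv cm kc by algebra
    also have "... = y ** n1 \<ominus> k ** n" unfolding m(3) using c cv(1) cm kc by algebra
    also have "... : N" using cN(6,7) v(1) m(1) c kc by simp
    finally have "k ** v \<ominus> y ** m1 : N" using x(2) v(2) m(2) cM(6,7) c kc by (simp add: nonzerodiv_def)
    hence "(k ** v \<ominus> y ** m1) +. y ** m1 : adjoin R N y M" using m adjoinI by blast
    moreover have "(k ** v \<ominus> y ** m1) +. y ** m1 = k ** v" using c cv cm kc by algebra
    ultimately show ?thesis by simp
  qed
  ultimately show ?thesis using v by auto
qed

text \<open>If \<open>y u = z v\<close> modulo \<open>N\<close>, then \<open>z v\<close> vanishes
  modulo \<open>y\<close>, so \<open>v = y w\<close> modulo \<open>N\<close>, and \<open>y\<close>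
  cancels from \<open>y u = y z w\<close>.\<close>

lemma nonzerodivisor_swap:
  assumes N: "ideal N R" and M: "ideal M R" and y: "y : car R" "nonzerodiv R N M y"
    and z: "z : car R" "nonzerodiv R (adjoin R N y M) M z"
  shows "nonzerodiv R (adjoin R N z M) M y"
  unfolding nonzerodiv_def
proof (intro ballI impI)
  note cN = idealD[OF N] and cM = idealD[OF M]
  fix u assume u: "u : M" "y ** u : adjoin R N z M"
  then obtain n v where v: "n : N" "v : M" "y ** u = n +. z ** v" by (metis adjoinE)
  have c: "u : car R" "n : car R" "v : car R" using u v cN(3) cM(3) by auto
  have "z ** v = \<ominus> n +. y ** u" unfolding v(3) using c z by algebra
  also have "... : adjoin R N y M" by (rule adjoinI) (use v(1) u(1) cN in auto)
  finally have "v : adjoin R N y M" using z(2) v(2) by (auto simp: nonzerodiv_def)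
  then obtain n' w where w: "n' : N" "w : M" "v = n' +. y ** w" by (metis adjoinE)
  have cw: "n' : car R" "w : car R" using w cN(3) cM(3) by auto
  have "y ** (u \<ominus> z ** w) = y ** u \<ominus> z ** (y ** w)" using c(1) cw y(1) z(1) by algebra
  also have "... = n +. z ** n'" unfolding v(3) w(3) using c(2) cw y(1) z(1) by algebra
  also have "... : N" using cN(4,7) v(1) w(1) z(1) by simp
  finally have "u \<ominus> z ** w : N" using y(2) u(1) w(2) cM(6,7) z(1) by (simp add: nonzerodiv_def)
  hence "(u \<ominus> z ** w) +. z ** w : adjoin R N z M" using w adjoinI by blast
  moreover have "(u \<ominus> z ** w) +. z ** w = u" using c cw z by algebra
  ultimately show "u : adjoin R N z M" by simp
qed

text \<open>The depth of \<open>M / (N + x M)\<close> does not depend on the choice of the nonzerodivisor \<open>x\<close>: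
  two choices \<open>x\<close> and \<open>y\<close> are compared through a third one that is regular modulo both.\<close>

lemma depth_ge_adjoin:
  assumes M: "ideal M R" and N: "ideal N R" and NM: "N <= M"
    and x: "x : nn" "nonzerodiv R N M x" and d: "depth_ge nn M (Suc k) N"
  shows "depth_ge nn M k (adjoin R N x M)"
  using N NM x d
proof (induction k arbitrary: N x)
  case 0
  have "M ~= N" using depth_ge_not_subset[OF is_cring 0(1) M n_closed(1) 0(5)] by auto
  thus ?case using nakayama_local[OF 0(1) M 0(3) 0(3) _ _ 0(2)] by auto
next
  case (Suc k)
  note N = Suc.prems(1) and NM = Suc.prems(2) and x = Suc.prems(3,4)
  obtain y where y: "y : nn" "nonzerodiv R N M y" "depth_ge nn M (Suc k) (adjoin R N y M)" using Suc.prems(5) by auto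
  have xc: "x : car R" and yc: "y : car R" using x y n_closed(3) by auto
  have id: "ideal (adjoin R N z M) R" if "z : car R" for z using adjoin_ideal[OF N M that] .
  have sub: "adjoin R N z M <= M" if "z : car R" for z using adjoin_minimal[OF M NM] that idealD(7)[OF M] by auto
  obtain z' where z': "z' : nn" "nonzerodiv R (adjoin R N y M) M z'" using y(3) by auto
  have soc_y: "v : adjoin R N y M" if "v : M" "ALL k:nn. k ** v : adjoin R N y M" for v using z' that by (auto simp: nonzerodiv_def)
  have soc_x: "v : adjoin R N x M" if "v : M" "ALL k:nn. k ** v : adjoin R N x M" for v
    using socle_exchange[OF N M x y(1,2), of v] that soc_y by blast
  have soc: "v : N" if "v : M" "ALL k:nn. k ** v : N" for v using y that by (auto simp: nonzerodiv_def)
  \<comment> \<open>Such a \<open>z\<close> exists because none of the three modules has a socle: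
    \<open>M / (N + y M)\<close> has positive depth, and \<open>M / (N + x M)\<close> inherits this
    by \<open>socle_exchange\<close>.\<close>
  obtain z where z: "z : nn" "!!L K. (L, K) : {(N, M), (adjoin R N y M, M), (adjoin R N x M, M)} ==> nonzerodiv R L K z"
    by (rule common_nonzerodivisor[of "{(N, M), (adjoin R N y M, M), (adjoin R N x M, M)}"])
      (use N M id[OF xc] id[OF yc] soc soc_x soc_y in blast)+
  have zc: "z : car R" using z n_closed(3) by auto
  have zr: "nonzerodiv R N M z" "nonzerodiv R (adjoin R N y M) M z"
    "nonzerodiv R (adjoin R N x M) M z" using z(2) by auto
  \<comment> \<open>The sequence \<open>y, z\<close> is swapped to \<open>z, y\<close>, which shows
    that \<open>M / (N + z M)\<close> has depth at least \<open>Suc k\<close>. The induction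
    hypothesis, applied there to \<open>x\<close>, gives the claim for \<open>z, x\<close>, and a
    last exchange for \<open>x, z\<close>.\<close>
  have "depth_ge nn M k (adjoin R (adjoin R N y M) z M)" by (rule Suc.IH[OF id[OF yc] sub[OF yc] z(1) zr(2) y(3)])
  hence "depth_ge nn M k (adjoin R (adjoin R N z M) y M)" using adjoin_commute[OF N M yc zc] by simp
  hence dz: "depth_ge nn M (Suc k) (adjoin R N z M)" using y(1) nonzerodivisor_swap[OF N M yc y(2) zc zr(2)] by auto
  have "depth_ge nn M k (adjoin R (adjoin R N z M) x M)"
    by (rule Suc.IH[OF id[OF zc] sub[OF zc] x(1) nonzerodivisor_swap[OF N M xc x(2) zc zr(3)] dz])
  thus ?case using adjoin_commute[OF N M xc zc] z(1) zr(3) by auto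
qed

text \<open>A regular element can be found in the form \<open>g + h\<close>, where \<open>g\<close>
  is one of the generators and \<open>h\<close> lies in the ideal generated by \<open>aa\<close> and
  the remaining ones. It can replace \<open>g\<close> as a generator, so each step of a regular
  sequence consumes one generator of \<open>nn\<close> modulo \<open>aa\<close>.\<close>

lemma depth_ge_le_card_generators:
  assumes "finite G" "G <= car R" "ideal aa R" "nn = Idl (aa Un G)" "depth_ge nn (car R) k aa"
  shows "k <= card G"
  using assms
proof (induction G arbitrary: aa k rule: finite_induct)
  case empty
  show ?case
  proof (cases k)
    case (Suc k')
    then obtain x where x: "x : nn" "nonzerodiv R aa (car R) x" using empty.prems(4) by auto
    have "nn <= aa" using empty.prems(2,3) genideal_minimal[of aa aa] by simp
    hence "\<one> : aa" using x n_closed(3)[OF x(1)] by (auto simp: nonzerodiv_def)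
    hence "car R <= aa" using ideal.one_imp_carrier empty.prems(2) by blast
    thus ?thesis using depth_ge_not_subset[OF is_cring empty.prems(2) oneideal n_closed(1) empty.prems(4)] by simp
  qed simp
next
  case (insert g G)
  note aa = insert.prems(2)
  have gc: "g : car R" and Gc: "G <= car R" and ac: "aa <= car R" using insert.prems(1) idealD(1)[OF aa] by auto
  show ?case
  proof (cases k)
    case (Suc k')
    then obtain x where x: "x : nn" "nonzerodiv R aa (car R) x" using insert.prems(4) by auto
    let ?K = "Idl (aa Un G)"
    have K: "ideal ?K R" using genideal_ideal ac Gc by auto
    have subK: "aa Un G <= ?K" by (rule genideal_self) (use ac Gc in auto)
    \<comment> \<open>What \<open>g\<close> and \<open>?K\<close> kill is killed by all of
      \<open>nn\<close>, in particular by the regular element \<open>x\<close>.\<close>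
    have no: "m : aa" if m: "m : car R" "g ** m : aa" "!!k. k : ?K ==> k ** m : aa" for m
    proof -
      have "ideal (colon R aa m) R" by (rule colon_ideal[OF aa m(1)])
      moreover have "aa Un insert g G <= colon R aa m" using m subK gc Gc ac by (auto simp: colon_def)
      ultimately have "nn <= colon R aa m" unfolding insert.prems(3) by (rule genideal_minimal)
      thus ?thesis using x m(1) by (auto simp: colon_def nonzerodiv_def)
    qed
    obtain h where h: "h : ?K" "!!N M. (N, M) : {(aa, car R)} ==> nonzerodiv R N M (g +. h)"
      by (rule coset_nonzerodivisor[OF K gc, of "{(aa, car R)}"]) (use no aa oneideal in auto)
    let ?y = "g +. h"
    have hc: "h : car R" using h idealD(3)[OF K] by auto
    hence yc: "?y : car R" using gc by auto
    have n_sup: "aa Un insert g G <= nn" unfolding insert.prems(3) by (rule genideal_self) (use ac gc Gc in auto)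
    hence "?K <= nn" using genideal_minimal[OF n_ideal] by auto
    hence yn: "?y : nn" using h n_sup n_closed(4) by auto
    let ?b = "adjoin R aa ?y (car R)"
    have b: "ideal ?b R" "aa <= ?b" "?y : ?b" using adjoin_ideal[OF aa oneideal yc] adjoin_superset[OF aa oneideal yc] adjoin_self[OF aa yc] .
    have bn: "?b <= nn" by (rule adjoin_minimal[OF n_ideal]) (use n_sup yn n_closed(8) in auto)
    have bG: "?b Un G <= car R" using b(1) idealD(1) Gc by auto
    have L: "ideal (Idl (?b Un G)) R" using genideal_ideal[OF bG] .
    have subL: "?b Un G <= Idl (?b Un G)" using genideal_self[OF bG] .
    have "?K <= Idl (?b Un G)" by (rule subset_Idl_subset[OF bG]) (use b in auto)
    hence hL: "h : Idl (?b Un G)" using h(1) by blast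
    have yL: "?y : Idl (?b Un G)" using b(3) subL by blast
    have "?y \<ominus> h : Idl (?b Un G)" by (rule idealD(6)[OF L yL hL])
    moreover have "?y \<ominus> h = g" using gc hc by algebra
    ultimately have "aa Un insert g G <= Idl (?b Un G)" using b subL by auto
    hence "nn <= Idl (?b Un G)" unfolding insert.prems(3) by (rule genideal_minimal[OF L])
    moreover have "Idl (?b Un G) <= nn" by (rule genideal_minimal[OF n_ideal]) (use bn n_sup in auto)
    ultimately have nL: "nn = Idl (?b Un G)" by auto
    have "depth_ge nn (car R) k' ?b" by (rule depth_ge_adjoin[OF oneideal aa ac yn]) (use h insert.prems(4) Suc in auto)
    hence "k' <= card G" using insert.IH[OF Gc b(1) nL] by simp
    thus ?thesis using Suc insert.hyps by simp
  qed simp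
qed

lemma depth_ge_bounded: "EX s. ALL k. depth_ge nn (car R) k {\<zero>} --> k <= s"
proof -
  obtain G where G: "G <= car R" "finite G" "nn = Idl G" using finetely_gen[OF n_ideal] by auto
  have "nn <= Idl ({\<zero>} Un G)" unfolding G(3) by (rule subset_Idl_subset) (use G in auto)
  moreover have "Idl ({\<zero>} Un G) <= nn" by (rule genideal_minimal[OF n_ideal]) (use G genideal_self[OF G(1)] n_closed(2) in auto)
  ultimately have "nn = Idl ({\<zero>} Un G)" by auto
  thus ?thesis using depth_ge_le_card_generators[OF G(2,1) zeroideal] by blast
qed

end

section \<open>Chains of primes, regular sequences and unmixedness\<close>

definition prime_chain :: "('a, 'r) ring_scheme => nat => (nat => 'a set) => bool"
  where "prime_chain R n c <-> (ALL i<=n. primeideal (c i) R) & (ALL i<n. c i < c (Suc i))"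

lemma height_eq: "height R P = Sup {enat n | n. EX c. prime_chain R n c & c n = P}"
  by (simp add: height_def prime_chain_def conj_assoc)

lemma prime_chain_le_height: "prime_chain R n c ==> enat n <= height R (c n)"
  unfolding height_eq by (rule Sup_upper) blast

lemma prime_chain_le_krull_dim: "prime_chain R n c ==> enat n <= krull_dim R"
  unfolding krull_dim_def by (rule SUP_upper2[where i="c n"]) (auto simp: prime_chain_def intro: prime_chain_le_height)

lemma height_le_krull_dim: "primeideal P R ==> height R P <= krull_dim R"
  unfolding krull_dim_def by (auto intro: SUP_upper)

lemma height_leI: "(!!n c. [|prime_chain R n c; c n = P|] ==> enat n <= e) ==> height R P <= e"
  unfolding height_eq by (auto intro!: Sup_least)

text \<open>A supremum that is at least \<open>n\<close> need not be attained when it is infinite,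
  but it strictly exceeds \<open>n - 1\<close>, and that produces a chain; hence the chain may be
  longer than \<open>n\<close>, and \<open>n = 0\<close> is served by the one-term chain.\<close>

lemma enat_le_height:
  assumes "primeideal P R" "enat n <= height R P"
  obtains m c where "n <= m" "prime_chain R m c" "c m = P"
proof (cases n)
  case 0
  thus ?thesis using that[of 0 "%_. P"] assms(1) by (auto simp: prime_chain_def)
next
  case (Suc n')
  hence "enat n' < height R P" using assms(2) by (metis Suc_ile_eq)
  then obtain m c where "enat n' < enat m" "prime_chain R m c" "c m = P" unfolding height_eq less_Sup_iff by blast
  thus ?thesis using that[of m c] Suc by auto
qed

lemma prime_chain_snoc:
  assumes "prime_chain R n c" "primeideal P R" "c n < P"
  shows "prime_chain R (Suc n) (c(Suc n := P))"
  using assms by (auto simp: prime_chain_def le_Suc_eq less_Suc_eq)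

lemma prime_chain_Cons:
  assumes "prime_chain R n c" "primeideal P R" "P < c 0"
  shows "prime_chain R (Suc n) (%i. case i of 0 => P | Suc j => c j)"
  using assms by (auto simp: prime_chain_def split: nat.split)

lemma height_strict_mono:
  assumes "primeideal P R" "primeideal Q R" "P < Q" "enat n <= height R P"
  shows "enat (Suc n) <= height R Q"
proof -
  obtain m c where m: "n <= m" "prime_chain R m c" "c m = P" using enat_le_height[OF assms(1,4)] .
  hence "prime_chain R (Suc m) (c(Suc m := Q))" using prime_chain_snoc assms(2,3) by blast
  hence "enat (Suc m) <= height R Q" using prime_chain_le_height by fastforce
  thus ?thesis using m(1) by (meson enat_ord_simps(1) order_trans Suc_le_mono)
qed

fun adjoin_seq :: "('a, 'r) ring_scheme => 'a set => (nat => 'a) => 'a set => nat => 'a set" where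
  "adjoin_seq R N x M 0 = N"
| "adjoin_seq R N x M (Suc j) = adjoin R (adjoin_seq R N x M j) (x j) M"

text \<open>\<open>depth_ge\<close> takes a regular sequence apart at its front, while
  \<open>adjoin_seq\<close> grows at its end.\<close>

lemma adjoin_seq_shift:
  "adjoin_seq R N x M (Suc j) = adjoin_seq R (adjoin R N (x 0) M) (%i. x (Suc i)) M j" by (induction j) auto

lemma (in cring) adjoin_seq_ideal:
  assumes "ideal N R" "ideal M R" "!!i. i < j ==> x i : car R"
  shows "ideal (adjoin_seq R N x M j) R"
  using assms(3) by (induction j) (auto intro: assms adjoin_ideal)

context local_noetherian
begin

text \<open>Each regular element permits a descent: a prime over the longer ideal contains a prime
  over the shorter one that omits the last element, so the height grows by one at each step.\<close>

lemma adjoin_seq_prime_height: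
  assumes "!!j. j < k ==> x j : car R"
    "!!j. j < k ==> nonzerodiv R (adjoin_seq R {\<zero>} x (car R) j) (car R) (x j)"
    "primeideal q R" "adjoin_seq R {\<zero>} x (car R) k <= q"
  shows "enat k <= height R q"
  using assms
proof (induction k arbitrary: q)
  case 0
  thus ?case by (simp add: zero_enat_def[symmetric])
next
  case (Suc k)
  let ?a = "adjoin_seq R {\<zero>} x (car R) k"
  have a: "ideal ?a R" by (rule adjoin_seq_ideal[OF zeroideal oneideal]) (use Suc.prems in auto)
  have xk: "x k : car R" "nonzerodiv R ?a (car R) (x k)" using Suc.prems by auto
  have "?a <= q" and "x k : q" using Suc.prems(4) adjoin_superset[OF a oneideal xk(1)] adjoin_self[OF a xk(1)] by auto
  obtain q' where q': "primeideal q' R" "?a <= q'" "q' <= q" "x k ~: q'" by (rule nonzerodivisor_prime_below[OF a xk Suc.prems(3) \<open>?a <= q\<close>])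
  have "enat k <= height R q'" by (rule Suc.IH[OF _ _ q'(1,2)]) (use Suc.prems in auto)
  moreover have "q' < q" using q' \<open>x k : q\<close> by auto
  ultimately show ?case using height_strict_mono[OF q'(1) Suc.prems(3)] by simp
qed

text \<open>Depth is at most the dimension of \<open>R / p\<close> for each associated prime
  \<open>p\<close>. Let \<open>x\<close> be the first regular element and \<open>N\<close> the part
  killed by \<open>p\<close>. By Nakayama \<open>N\<close> is not contained in
  \<open>aa + x R\<close>, so a class survives there whose annihilator contains \<open>p\<close> and
  \<open>x\<close>. An associated prime above that annihilator contains \<open>p\<close> strictly,
  and the induction continues with it.\<close>

lemma associated_prime_chain:
  assumes "depth_ge nn (car R) k aa" "ideal aa R" "u : car R" "primeideal (colon R aa u) R"
  shows "EX c. prime_chain R k c & c 0 = colon R aa u"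
  using assms
proof (induction k arbitrary: aa u)
  case 0
  thus ?case by (intro exI[of _ "%_. colon R aa u"]) (auto simp: prime_chain_def)
next
  case (Suc k)
  note aa = Suc.prems(2) and uc = Suc.prems(3) and p = Suc.prems(4)
  let ?p = "colon R aa u"
  note ca = idealD[OF aa]
  obtain x where x: "x : nn" "nonzerodiv R aa (car R) x"
    "depth_ge nn (car R) k (adjoin R aa x (car R))" using Suc.prems(1) by auto
  have xc: "x : car R" using x n_closed(3) by auto
  let ?b = "adjoin R aa x (car R)"
  have b: "ideal ?b R" "aa <= ?b" using adjoin_ideal[OF aa oneideal xc] adjoin_superset[OF aa oneideal xc] .
  have u: "u ~: aa" using primeD(2)[OF p] uc by (auto simp: colon_def)
  define N where "N = {v : car R. ALL a:?p. a ** v : aa}"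
  have pc: "a : car R" if "a : ?p" for a using that by (auto simp: colon_def)
  have N: "ideal N R" unfolding N_def by (rule ideal_criterion) (use ca pc in "auto simp: r_distr m_lcomm")
  have aN: "aa <= N" using ca pc by (auto simp: N_def)
  have uN: "u : N" using uc by (auto simp: N_def colon_def)
  have "~ N <= ?b"
  proof
    assume Nb: "N <= ?b"
    \<comment> \<open>If \<open>n + x m\<close> is killed by \<open>p\<close> modulo
      \<open>aa\<close>, so is \<open>m\<close>, because \<open>x\<close> can be cancelled.\<close>
    have "N <= adjoin R aa x N"
    proof
      fix v assume v: "v : N"
      then obtain n m where nm: "n : aa" "m : car R" "v = n +. x ** m" using Nb by (metis adjoinE subsetD)
      have "a ** m : aa" if a: "a : ?p" for a
      proof -
        have nc: "n : car R" "a : car R" using nm ca(3) pc a by auto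
        have "x ** (a ** m) = a ** (n +. x ** m) \<ominus> a ** n" using nc nm(2) xc by algebra
        also have "... : aa" using v a nm(1) ca(6,7) nc unfolding N_def nm(3) by simp
        finally show ?thesis using x(2) nc nm by (auto simp: nonzerodiv_def)
      qed
      hence "m : N" using nm by (auto simp: N_def)
      thus "v : adjoin R aa x N" using nm adjoinI by blast
    qed
    hence "N = aa" using nakayama_local[OF aa N x(1) x(1) _ _ aN] by auto
    thus False using u uN by auto
  qed
  then obtain v where v: "v : N" "v ~: ?b" by auto
  have vc: "v : car R" using v idealD(3)[OF N] by auto
  obtain w where w: "w : car R" "w ~: ?b" "primeideal (colon R ?b w) R" "colon R ?b v <= colon R ?b w"
    using colon_prime[OF b(1) oneideal vc v(2)] by auto
  obtain c where c: "prime_chain R k c" "c 0 = colon R ?b w" using Suc.IH[OF x(3) b(1) w(1,3)] by auto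
  have "?p <= colon R ?b w" 
  proof
    fix a assume a: "a : ?p"
    hence "a ** v : ?b" using v(1) b(2) by (auto simp: N_def)
    hence "a : colon R ?b v" using pc[OF a] by (simp add: colon_def)
    thus "a : colon R ?b w" using w(4) by blast
  qed
  moreover have "x : colon R ?b v" using adjoin_mult[OF aa oneideal xc vc] xc by (auto simp: colon_def)
  moreover have "x ~: ?p" using x(2) u uc by (auto simp: colon_def nonzerodiv_def)
  ultimately have "?p < c 0" using w(4) c(2) by auto
  thus ?case using prime_chain_Cons[OF c(1) p] by (intro exI[of _ "%i. case i of 0 => ?p | Suc j => c j"]) auto
qed

text \<open>Unmixedness: otherwise \<open>q\<close> could be put in front of a chain of length
  \<open>d\<close> that starts at the associated prime.\<close>

lemma associated_prime_minimal:
  assumes d: "depth_ge nn (car R) d {\<zero>}" "krull_dim R = enat d"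
    and u: "u : car R" "primeideal (colon R {\<zero>} u) R"
    and q: "primeideal q R"
  shows "~ q < colon R {\<zero>} u"
proof
  assume *: "q < colon R {\<zero>} u"
  obtain c where "prime_chain R d c" "c 0 = colon R {\<zero>} u" using associated_prime_chain[OF d(1) zeroideal u] by auto
  hence "enat (Suc d) <= krull_dim R" using prime_chain_le_krull_dim[OF prime_chain_Cons[OF _ q]] * by auto
  thus False using d by simp
qed

text \<open>This expresses that \<open>R\<close> modulo the sequence is Artinian: a prime over it
  has height at least \<open>d\<close>, so a strictly larger prime would exceed the
  dimension.\<close>

lemma prime_over_maximal_regular_sequence:
  assumes "krull_dim R = enat d" "!!j. j < d ==> x j : car R"
    "!!j. j < d ==> nonzerodiv R (adjoin_seq R {\<zero>} x (car R) j) (car R) (x j)"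
    "primeideal q R" "adjoin_seq R {\<zero>} x (car R) d <= q"
  shows "q = nn"
proof (rule ccontr)
  assume "q ~= nn"
  have "enat d <= height R q" using adjoin_seq_prime_height assms by blast
  moreover have "q < nn" using proper_ideal_subset_n primeD[OF assms(4)] \<open>q ~= nn\<close> by blast
  ultimately have "enat (Suc d) <= height R nn" using height_strict_mono[OF assms(4) n_prime] by auto
  hence "enat (Suc d) <= krull_dim R" using height_le_krull_dim[OF n_prime] order_trans by blast
  thus False using assms(1) by simp
qed

text \<open>To be applied to \<open>R\<close> and a canonical ideal. At each step neither quotient
  has a socle, so one nonzerodivisor serves both, and by \<open>depth_ge_adjoin\<close> the choice
  costs at most one in either depth.\<close>

lemma common_regular_sequence:
  assumes "ideal M R" "ideal M' R" "ideal N R" "ideal N' R" "N <= M" "N' <= M'"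
    "depth_ge nn M k N" "depth_ge nn M' k N'"
  shows "EX x. ALL j<k. x j : nn & nonzerodiv R (adjoin_seq R N x M j) M (x j)
    & nonzerodiv R (adjoin_seq R N' x M' j) M' (x j)" using assms(3-8)
proof (induction k arbitrary: N N')
  case (Suc k)
  have *: "m : L" if "depth_ge nn K (Suc k) L" "m : K" "!!k. k : nn ==> k ** m : L" for L K m using that by (auto simp: nonzerodiv_def)
  obtain z where z: "z : nn" "!!L K. (L, K) : {(N, M), (N', M')} ==> nonzerodiv R L K z" by (rule common_nonzerodivisor[of "{(N, M), (N', M')}"])
      (use assms(1,2) Suc.prems * in blast)+
  have zc: "z : car R" using z n_closed(3) by auto
  have sub: "adjoin R N z M <= M" "adjoin R N' z M' <= M'" using adjoin_minimal Suc.prems(3,4) assms(1,2) idealD(7) zc by metis+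
  obtain x where x: "ALL j<k. x j : nn & nonzerodiv R (adjoin_seq R (adjoin R N z M) x M j) M (x j)
    & nonzerodiv R (adjoin_seq R (adjoin R N' z M') x M' j) M' (x j)"
    using Suc.IH[OF adjoin_ideal[OF Suc.prems(1) assms(1) zc] adjoin_ideal[OF Suc.prems(2) assms(2) zc] sub]
      depth_ge_adjoin[OF assms(1) Suc.prems(1,3) z(1) _ Suc.prems(5)]
      depth_ge_adjoin[OF assms(2) Suc.prems(2,4) z(1) _ Suc.prems(6)] z(2) by blast
  let ?y = "%i. case i of 0 => z | Suc j => x j"
  have "?y j : nn & nonzerodiv R (adjoin_seq R N ?y M j) M (?y j)
    & nonzerodiv R (adjoin_seq R N' ?y M' j) M' (?y j)" if "j < Suc k" for j
  proof (cases j)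
    case 0
    thus ?thesis using z by simp
  next
    case (Suc i)
    thus ?thesis using x that by (simp only: adjoin_seq_shift) simp
  qed
  thus ?case by blast
qed simp

end

section \<open>Ext in terms of elements\<close>

text \<open>An injective coresolution \<open>C \<rightarrow> E\<^sub>0 \<rightarrow> E\<^sub>1 \<rightarrow> ...\<close> of an ideal \<open>C\<close> of a Noetherian local ring.
  Of injectivity only the consequence is recorded that \<open>v = a w\<close> with \<open>J w = 0\<close> is
  solvable if \<open>(J : a) v = 0\<close>. Since \<open>Hom(R/J, E\<^sub>i) = {x : E\<^sub>i. J x = 0}\<close>, the cohomology of
  \<open>cycles J\<close> modulo \<open>bounds J\<close> is \<open>Ext\<^sup>i(R/J, C)\<close>.\<close>

locale local_coresolution = local_noetherian +
  fixes C :: "'a set" and eps :: "'a => 'e" and E :: "nat => ('a, 'e) module" and d :: "nat => 'e => 'e"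
    and n :: nat
  assumes C_ideal: "ideal C R"
    and E_module: "!!i. module R (E i)"
    and d_closed [simp]: "!!i x. x : car (E i) ==> d i x : car (E (Suc i))"
    and d_add: "!!i x y. [|x : car (E i); y : car (E i)|] ==> d i (x +[E i] y) = d i x +[E (Suc i)] d i y"
    and d_smult: "!!i a x. [|a : car R; x : car (E i)|] ==> d i (a *>[E i] x) = a *>[E (Suc i)] d i x"
    and eps_closed: "!!c. c : C ==> eps c : car (E 0)"
    and eps_add: "!!c c'. [|c : C; c' : C|] ==> eps (c +. c') = eps c +[E 0] eps c'"
    and eps_smult: "!!a c. [|a : car R; c : C|] ==> eps (a ** c) = a *>[E 0] eps c"
    and eps_inj: "!!c. [|c : C; eps c = 0[E 0]|] ==> c = \<zero>"
    and exact_0: "!!x. x : car (E 0) ==> d 0 x = 0[E 1] <-> (EX c:C. x = eps c)"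
    and exact: "!!i x. x : car (E (Suc i)) ==>
      d (Suc i) x = 0[E (Suc (Suc i))] <-> (EX y:car (E i). x = d i y)"
    and divisible: "!!i J a v. [|ideal J R; a : car R; v : car (E i);
        !!r. [|r : car R; r ** a : J|] ==> r *>[E i] v = 0[E i]|] ==>
      EX w:car (E i). (ALL j:J. j *>[E i] w = 0[E i]) & a *>[E i] w = v"
    and E_vanish: "!!i. n < i ==> car (E i) = {0[E i]}"
begin

sublocale E: module R "E i" for i by (rule E_module)

lemmas C_closed = idealD[OF C_ideal]

definition killed :: "'a set => nat => 'e set"
  where "killed J i = {x : car (E i). ALL j:J. j *>[E i] x = 0[E i]}"

definition cycles :: "'a set => nat => 'e set"
  where "cycles J i = {x : killed J i. d i x = 0[E (Suc i)]}"

fun bounds :: "'a set => nat => 'e set" where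
  "bounds J 0 = {0[E 0]}"
| "bounds J (Suc i) = d i ` killed J i"

text \<open>Vanishing of Ext^i(R/J, C); the opposite inclusion is
  \<open>bounds_subset_cycles\<close>.\<close>

definition ext_zero :: "nat => 'a set => bool"
  where "ext_zero i J <-> cycles J i <= bounds J i"

definition eqv :: "'a set => nat => 'e => 'e => bool"
  where "eqv J i x y <-> x : car (E i) & y : car (E i) & x -[E i] y : bounds J i"

lemma E_minus_eq_zero: "[|x : car (E i); y : car (E i)|] ==> x -[E i] y = 0[E i] <-> x = y"
  by (metis E.minus_eq E.M.minus_equality E.M.minus_minus E.M.r_neg E.M.a_inv_closed E.M.a_comm)

lemma E_smult_left_commute: "[|a : car R; b : car R; x : car (E i)|] ==>
    a *>[E i] (b *>[E i] x) = b *>[E i] (a *>[E i] x)" by (simp add: E.smult_assoc1[symmetric] m_comm)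

lemma E_minus_zero: "x : car (E i) ==> x -[E i] 0[E i] = x"
  by (simp add: E.minus_eq)

lemma d_zero: "d i 0[E i] = 0[E (Suc i)]"
  using d_smult[of \<zero> "0[E i]" i] by simp

lemma E_smult_minus: "[|a : car R; x : car (E i); y : car (E i)|] ==>
    a *>[E i] (x -[E i] y) = a *>[E i] x -[E i] a *>[E i] y" by (simp add: E.minus_eq E.smult_r_distr E.smult_r_minus)

lemma d_uminus: "x : car (E i) ==> d i (-[E i] x) = -[E (Suc i)] d i x"
  using d_smult[of "\<ominus> \<one>" x i] by (simp add: E.smult_l_minus)

lemma d_minus: "[|x : car (E i); y : car (E i)|] ==>
    d i (x -[E i] y) = d i x -[E (Suc i)] d i y" by (simp add: E.minus_eq d_add d_uminus)

lemma killed_submodule: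
  assumes "J <= car R"
  shows "submodule (killed J i) R (E i)"
proof (rule E.submoduleI)
  show "a *>[E i] x : killed J i" if "a : car R" "x : killed J i" for a x
  proof -
    have "j *>[E i] (a *>[E i] x) = a *>[E i] (j *>[E i] x)" if "j : J" for j using that assms \<open>a : car R\<close> \<open>x : killed J i\<close>
      by (intro E_smult_left_commute) (auto simp: killed_def)
    thus ?thesis using that by (auto simp: killed_def)
  qed
qed (use assms in "auto simp: killed_def E.smult_r_distr E.smult_r_minus subset_iff")

lemma cycles_submodule:
  assumes "J <= car R"
  shows "submodule (cycles J i) R (E i)"
proof -
  note k = E.submoduleE[OF killed_submodule[OF assms, of i]]
  have c: "x : car (E i)" if "x : killed J i" for x using that k(1) by auto
  have z: "0[E i] : killed J i" using assms by (auto simp: killed_def)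
  show ?thesis by (rule E.submoduleI) (use k(3-5) c z in "auto simp: cycles_def d_zero d_add d_uminus d_smult")
qed

lemma bounds_submodule:
  assumes "J <= car R"
  shows "submodule (bounds J i) R (E i)"
proof (cases i)
  case 0
  thus ?thesis by (auto intro!: E.submoduleI)
next
  case (Suc k)
  note s = E.submoduleE[OF killed_submodule[OF assms, of k]]
  have c: "x : car (E k)" if "x : killed J k" for x using that s(1) by auto
  show ?thesis unfolding Suc
  proof (rule E.submoduleI)
    show "bounds J (Suc k) <= car (E (Suc k))" using c by auto
    have "0[E k] : killed J k" using assms by (auto simp: killed_def)
    thus "0[E (Suc k)] : bounds J (Suc k)" using d_zero[of k] by (metis bounds.simps(2) image_eqI)
    show "-[E (Suc k)] a : bounds J (Suc k)" if "a : bounds J (Suc k)" for a using that s(3) c by (auto simp: d_uminus[symmetric])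
    show "a +[E (Suc k)] b : bounds J (Suc k)" if "a : bounds J (Suc k)" "b : bounds J (Suc k)" for a b
      using that s(5) c by (auto simp: d_add[symmetric])
    show "a *>[E (Suc k)] x : bounds J (Suc k)" if "a : car R" "x : bounds J (Suc k)" for a x using that s(4) c by (auto simp: d_smult[symmetric])
  qed
qed

lemma submodule_minus:
  assumes "submodule S R (E i)" "x : S" "y : S" shows "x -[E i] y : S"
  using E.submoduleE[OF assms(1)] assms(2,3) by (simp add: E.minus_eq)

lemma killedD: "x : killed J i ==> x : car (E i)" "[|x : killed J i; j : J|] ==> j *>[E i] x = 0[E i]"
  by (auto simp: killed_def)

lemma killed_antimono: "J <= K ==> killed K i <= killed J i"
  by (auto simp: killed_def)

lemma cycles_antimono: "J <= K ==> cycles K i <= cycles J i"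
  using killed_antimono[of J K i] by (auto simp: cycles_def)

lemma bounds_antimono: "J <= K ==> bounds K i <= bounds J i"
  using killed_antimono[of J K "i - 1"] by (cases i) (auto simp: image_mono)

lemma d_d: "x : car (E i) ==> d (Suc i) (d i x) = 0[E (Suc (Suc i))]"
  using exact d_closed by blast

lemma bounds_subset_cycles:
  assumes "J <= car R" shows "bounds J i <= cycles J i"
proof (cases i)
  case 0
  thus ?thesis using assms d_zero[of 0] by (auto simp: cycles_def killed_def)
next
  case (Suc k)
  show ?thesis
  proof
    fix x assume "x : bounds J i"
    then obtain y where y: "y : killed J k" "x = d k y" using Suc by auto
    have "j *>[E (Suc k)] x = 0[E (Suc k)]" if "j : J" for j using d_smult[of j y k] killedD[OF y(1)] that assms y d_zero by auto
    thus "x : cycles J i" using killedD(1)[OF y(1)] y Suc d_d by (auto simp: cycles_def killed_def)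
  qed
qed

lemma cycles_closed: "x : cycles J i ==> x : car (E i)"
  by (auto simp: cycles_def killed_def)

lemma bounds_closed: "x : bounds J i ==> x : car (E i)"
  by (cases i) (auto simp: killed_def)

lemma killed_adjoin:
  assumes "x : killed J i" "J <= car R" "a : car R" "a *>[E i] x = 0[E i]"
  shows "x : killed (adjoin R J a (car R)) i"
proof -
  have "(j +. a ** m) *>[E i] x = 0[E i]" if "j : J" "m : car R" for j m
  proof -
    have "(a ** m) *>[E i] x = m *>[E i] (a *>[E i] x)" using that assms(3) killedD(1)[OF assms(1)] by (simp add: E.smult_assoc1 E_smult_left_commute)
    thus ?thesis using that assms killedD[OF assms(1)] by (auto simp: E.smult_l_distr subset_iff)
  qed
  thus ?thesis using killedD(1)[OF assms(1)] by (auto simp: killed_def adjoin_def)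
qed

section \<open>The cohomology sequence of 0 -> R/(J : a) -> R/J -> R/(J + a R) -> 0\<close>

lemma killed_colon_mult:
  assumes "x : killed J i" "a : car R"
  shows "a *>[E i] x : killed (colon R J a) i"
  using assms by (auto simp: killed_def colon_def E.smult_assoc1[symmetric])

lemma cycles_colon_mult:
  assumes "x : cycles J i" "a : car R"
  shows "a *>[E i] x : cycles (colon R J a) i"
  using assms killed_colon_mult[of x J i a] by (auto simp: cycles_def d_smult killed_def)

lemma bounds_colon_mult:
  assumes "x : bounds J i" "a : car R"
  shows "a *>[E i] x : bounds (colon R J a) i"
proof (cases i)
  case (Suc k)
  then obtain y where y: "y : killed J k" "x = d k y" using assms by auto
  hence "a *>[E i] x = d k (a *>[E k] y)" using Suc assms killedD by (simp add: d_smult)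
  thus ?thesis using killed_colon_mult[OF y(1) assms(2)] Suc by auto
qed (use assms in auto)

text \<open>Surjectivity of Hom(R/J, E) -> Hom(R/(J : a), E), the one place where
  \<open>divisible\<close> is applied.\<close>

lemma killed_divide:
  assumes "ideal J R" "a : car R" "v : killed (colon R J a) i"
  obtains w where "w : killed J i" "a *>[E i] w = v"
proof -
  have "EX w:car (E i). (ALL j:J. j *>[E i] w = 0[E i]) & a *>[E i] w = v"
    by (rule divisible[OF assms(1,2)]) (use assms(3) in "auto simp: killed_def colon_def")
  thus ?thesis using that by (auto simp: killed_def)
qed

lemma bounds_divide:
  assumes "ideal J R" "a : car R" "v : bounds (colon R J a) i"
  obtains b where "b : bounds J i" "a *>[E i] b = v"
proof (cases i)
  case 0
  thus ?thesis using that[of "0[E 0]"] assms by auto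
next
  case (Suc k)
  then obtain y where y: "y : killed (colon R J a) k" "v = d k y" using assms by auto
  obtain w where w: "w : killed J k" "a *>[E k] w = y" using killed_divide[OF assms(1,2) y(1)] .
  hence "a *>[E i] d k w = v" using y Suc assms killedD d_smult by metis
  thus ?thesis using that[of "d k w"] w Suc by auto
qed

text \<open>Exactness at Ext^i(R/J): a class that dies in Ext^i(R/(J : a)) comes from Ext^i(R/(J + a
  R)). The representative is corrected by a coboundary so that \<open>a\<close> kills it.\<close>

lemma cycles_lift:
  assumes J: "ideal J R" and a: "a : car R" and z: "z : cycles J i" "a *>[E i] z : bounds (colon R J a) i"
  obtains z' where "z' : cycles (adjoin R J a (car R)) i" "eqv J i z z'"
proof -
  note Jc = idealD(1)[OF J]
  obtain b where b: "b : bounds J i" "a *>[E i] b = a *>[E i] z" using bounds_divide[OF J a z(2)] .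
  have c: "z : car (E i)" "b : car (E i)" using cycles_closed[OF z(1)] bounds_closed[OF b(1)] .
  let ?z = "z -[E i] b"
  have zc: "?z : cycles J i" using submodule_minus[OF cycles_submodule[OF Jc] z(1)] b bounds_subset_cycles[OF Jc] by auto
  moreover have "a *>[E i] ?z = 0[E i]" using b c a E_minus_eq_zero by (simp add: E_smult_minus)
  ultimately have "?z : cycles (adjoin R J a (car R)) i" using killed_adjoin[OF _ Jc a] by (auto simp: cycles_def)
  moreover have "z -[E i] ?z = b"
    using c by (metis E.M.a_comm E.M.a_inv_closed E.M.add.inv_solve_left E.M.minus_closed E.M.minus_equality E.M.minus_minus E.minus_eq E.M.add.inv_mult_group E.M.add.m_assoc E.M.r_neg1)
  ultimately show ?thesis using that[of ?z] b c by (auto simp: eqv_def)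
qed

text \<open>Injectivity of Ext^i(R/(J + a R)) -> Ext^i(R/J) when Ext^(i-1)(R/(J : a)) vanishes. The
  condition is written with \<open>i = Suc k\<close> because there is nothing to require for
  \<open>i = 0\<close>.\<close>

lemma bounds_adjoin:
  assumes J: "ideal J R" and a: "a : car R"
    and V: "!!k. i = Suc k ==> ext_zero k (colon R J a)"
    and e: "e : bounds J i" "a *>[E i] e = 0[E i]"
  shows "e : bounds (adjoin R J a (car R)) i"
proof (cases i)
  case 0
  thus ?thesis using e by auto
next
  case (Suc k)
  note Jc = idealD(1)[OF J]
  obtain v where v: "v : killed J k" "e = d k v" using e Suc by auto
  have vc: "v : car (E k)" using killedD v by auto
  have "d k (a *>[E k] v) = 0[E (Suc k)]" using v e Suc a vc by (simp add: d_smult)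
  hence "a *>[E k] v : cycles (colon R J a) k" using killed_colon_mult[OF v(1) a] by (auto simp: cycles_def)
  hence "a *>[E k] v : bounds (colon R J a) k" using V[OF Suc] by (auto simp: ext_zero_def)
  then obtain b where b: "b : bounds J k" "a *>[E k] b = a *>[E k] v" using bounds_divide[OF J a] by blast
  have bc: "b : cycles J k" using b bounds_subset_cycles[OF Jc] by auto
  hence bc': "b : car (E k)" "b : killed J k" "d k b = 0[E (Suc k)]" using cycles_closed by (auto simp: cycles_def)
  have "v -[E k] b : killed J k" using submodule_minus[OF killed_submodule[OF Jc] v(1) bc'(2)] .
  moreover have "a *>[E k] (v -[E k] b) = 0[E k]" using b vc bc' a E_minus_eq_zero by (simp add: E_smult_minus)
  ultimately have "v -[E k] b : killed (adjoin R J a (car R)) k" using killed_adjoin Jc a by blast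
  moreover have "d k (v -[E k] b) = e" using v vc bc' by (simp add: d_minus E_minus_zero)
  ultimately show ?thesis using Suc by (metis bounds.simps(2) image_eqI)
qed

lemma colon_nonzerodivisor:
  assumes "ideal J R" "x : car R" "nonzerodiv R J (car R) x"
  shows "colon R J x = J"
  using assms subset_colon[OF assms(1,2)] by (auto simp: colon_def nonzerodiv_def m_comm)

text \<open>Here \<open>(J : x) = J\<close>, so all terms of the sequence next to the new one refer
  to \<open>J\<close> itself.\<close>

lemma ext_zero_adjoin:
  assumes J: "ideal J R" and x: "x : car R" "nonzerodiv R J (car R) x"
    and V: "!!k. i = Suc k ==> ext_zero k J" "ext_zero i J"
  shows "ext_zero i (adjoin R J x (car R))"
  unfolding ext_zero_def
proof
  fix e assume e: "e : cycles (adjoin R J x (car R)) i"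
  have "e : bounds J i" using e V(2) cycles_antimono[OF adjoin_superset[OF J oneideal x(1)]] by (auto simp: ext_zero_def)
  moreover have "x *>[E i] e = 0[E i]" using e adjoin_self[OF J x(1)] by (auto simp: cycles_def killed_def)
  ultimately show "e : bounds (adjoin R J x (car R)) i" using bounds_adjoin[OF J x(1)] V(1) colon_nonzerodivisor[OF J x] by auto
qed

text \<open>Surjectivity of Ext^i(R/J) -> Ext^i(R/(J : sig)), on the level of cycles. A quotient
  \<open>u0\<close> of \<open>e\<close> by \<open>sig\<close> need not be a cycle, but
  \<open>d u0\<close> is a cycle over \<open>J + sig R\<close>, where Ext^(i+1) vanishes; the
  resulting \<open>w\<close> corrects \<open>u0\<close>.\<close>

lemma cycles_divide:
  assumes J: "ideal J R" and s: "sig : car R" and V: "ext_zero (Suc i) (adjoin R J sig (car R))"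
    and e: "e : cycles (colon R J sig) i"
  obtains u where "u : cycles J i" "sig *>[E i] u = e"
proof -
  note Jc = idealD(1)[OF J]
  let ?K = "adjoin R J sig (car R)"
  obtain u0 where u0: "u0 : killed J i" "sig *>[E i] u0 = e" using killed_divide[OF J s] e by (auto simp: cycles_def)
  have uc: "u0 : car (E i)" using killedD u0 by auto
  have "d i u0 : cycles J (Suc i)" using bounds_subset_cycles[OF Jc, of "Suc i"] u0 by auto
  moreover have "sig *>[E (Suc i)] d i u0 = 0[E (Suc i)]" using d_smult[OF s uc] u0(2) e by (auto simp: cycles_def)
  ultimately have "d i u0 : cycles ?K (Suc i)" using killed_adjoin[OF _ Jc s] by (auto simp: cycles_def)
  then obtain w where w: "w : killed ?K i" "d i u0 = d i w" using V by (auto simp: ext_zero_def)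
  have wJ: "w : killed J i" using w killed_antimono[OF adjoin_superset[OF J oneideal s]] by auto
  have wc: "w : car (E i)" using killedD w by auto
  have "sig *>[E i] w = 0[E i]" using killedD(2)[OF w(1)] adjoin_self[OF J s] by auto
  hence "sig *>[E i] (u0 -[E i] w) = e" using u0 uc wc s by (auto simp: E_smult_minus E_minus_zero)
  moreover have "u0 -[E i] w : cycles J i" using submodule_minus[OF killed_submodule[OF Jc] u0(1) wJ] uc wc w(2) E_minus_eq_zero
    by (auto simp: cycles_def d_minus)
  ultimately show ?thesis using that by blast
qed

lemma ext_zero_free: "ext_zero (Suc i) {\<zero>}"
  unfolding ext_zero_def
proof
  fix e assume "e : cycles {\<zero>} (Suc i)"
  then obtain y where "y : car (E i)" "e = d i y" using exact by (auto simp: cycles_def killed_def)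
  thus "e : bounds {\<zero>} (Suc i)" by (auto simp: killed_def)
qed

lemma eqv_refl: "J <= car R ==> x : car (E i) ==> eqv J i x x"
  using subgroup.one_closed[OF submodule.axioms(1)[OF bounds_submodule], of J i]
    E_minus_eq_zero[of x i x] by (simp add: eqv_def)

lemma eqv_sym: assumes "J <= car R" "eqv J i x y" shows "eqv J i y x"
proof -
  have "y -[E i] x = -[E i] (x -[E i] y)" using assms(2) by (simp add: eqv_def E.minus_eq E.M.minus_add E.M.a_comm)
  thus ?thesis using E.submoduleE(3)[OF bounds_submodule[OF assms(1)]] assms(2) by (auto simp: eqv_def)
qed

lemma E_minus_minus: "[|x : car (E i); y : car (E i); z : car (E i)|] ==>
    (x -[E i] y) +[E i] (y -[E i] z) = x -[E i] z" by (simp add: E.minus_eq E.M.a_assoc E.M.r_neg1)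

lemma eqv_trans: assumes "J <= car R" "eqv J i x y" "eqv J i y z" shows "eqv J i x z"
  using E.submoduleE(5)[OF bounds_submodule[OF assms(1)], of "x -[E i] y" i "y -[E i] z"] assms(2,3) by (simp add: eqv_def E_minus_minus)

lemma eqv_add: assumes "J <= car R" "eqv J i x y" "eqv J i x' y'"
  shows "eqv J i (x +[E i] x') (y +[E i] y')"
proof -
  have "(x +[E i] x') -[E i] (y +[E i] y') = (x -[E i] y) +[E i] (x' -[E i] y')"
    using assms(2,3) by (simp add: eqv_def E.minus_eq E.M.minus_add E.M.a_ac)
  thus ?thesis using E.submoduleE(5)[OF bounds_submodule[OF assms(1)]] assms(2,3) by (auto simp: eqv_def)
qed

lemma eqv_smult: assumes "J <= car R" "eqv J i x y" "a : car R"
  shows "eqv J i (a *>[E i] x) (a *>[E i] y)"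
  using E.submoduleE(4)[OF bounds_submodule[OF assms(1)], of a] assms(2,3) by (auto simp: eqv_def E_smult_minus[symmetric])

lemma eqv_zero: "x : bounds J i <-> eqv J i x 0[E i]"
  using bounds_closed[of x J i] by (auto simp: eqv_def E_minus_zero)

lemma eqv_antimono: "J <= K ==> eqv K i x y ==> eqv J i x y"
  using bounds_antimono[of J K i] by (auto simp: eqv_def)

lemma eqv_bounds: "[|J <= car R; eqv J i x y; y : bounds J i|] ==> x : bounds J i"
  using eqv_trans eqv_zero by blast

section \<open>Ext of the quotient by a regular sequence\<close>

context
  fixes x :: "nat => 'a" and delta :: nat
  assumes x_n: "!!j. j < delta ==> x j : nn"
    and x_regular: "!!j. j < delta ==> nonzerodiv R (adjoin_seq R {\<zero>} x (car R) j) (car R) (x j)"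
begin

abbreviation aa :: "nat => 'a set" where "aa == adjoin_seq R {\<zero>} x (car R)"

abbreviation xC :: "nat => 'a set" where "xC == adjoin_seq R {\<zero>} x C"

lemma x_carrier: "j < delta ==> x j : car R"
  using x_n n_closed(3) by blast

lemma a_ideal: "j <= delta ==> ideal (aa j) R"
  using adjoin_seq_ideal[OF zeroideal oneideal] x_carrier by auto

lemma a_carrier: "j <= delta ==> aa j <= car R"
  using a_ideal idealD(1) by blast

lemma xC_subset: "j <= delta ==> xC j <= C"
proof (induction j)
  case (Suc j)
  thus ?case using adjoin_minimal[OF C_ideal, of "xC j" C "x j"] x_carrier[of j] C_closed(7) by auto
qed (use C_closed in auto)

text \<open>\<open>R / aa j\<close> has projective dimension at most \<open>j\<close>, each regular
  element costing one degree.\<close>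

lemma ext_zero_above: "[|j <= delta; j < i|] ==> ext_zero i (aa j)"
proof (induction j arbitrary: i)
  case 0
  thus ?case using ext_zero_free[of "i - 1"] by simp
next
  case (Suc j)
  have "ext_zero i (adjoin R (aa j) (x j) (car R))" by (rule ext_zero_adjoin[OF a_ideal x_carrier x_regular]) (use Suc in auto)
  thus ?case by simp
qed

text \<open>The connecting map sends the class of \<open>x j w\<close> to that of
  \<open>d w\<close>; this is its independence of the choice of \<open>w\<close>.\<close>

lemma connecting_eqv:
  assumes j: "j < delta" and w: "w : killed (aa j) j" "w' : killed (aa j) j"
    and eq: "eqv (aa j) j (x j *>[E j] w) (x j *>[E j] w')"
  shows "eqv (aa (Suc j)) (Suc j) (d j w) (d j w')"
proof -
  have J: "ideal (aa j) R" and xj: "x j : car R" and reg: "nonzerodiv R (aa j) (car R) (x j)" using j a_ideal x_carrier x_regular by auto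
  note Jc = idealD(1)[OF J]
  have c: "w : car (E j)" "w' : car (E j)" using w killedD by auto
  have "x j *>[E j] (w -[E j] w') : bounds (colon R (aa j) (x j)) j"
    using eq c xj by (simp add: eqv_def E_smult_minus colon_nonzerodivisor[OF J xj reg])
  then obtain b where b: "b : bounds (aa j) j" "x j *>[E j] b = x j *>[E j] (w -[E j] w')" using bounds_divide[OF J xj] by blast
  have bc: "b : killed (aa j) j" "b : car (E j)" "d j b = 0[E (Suc j)]"
    using bounds_subset_cycles[OF Jc] b(1) bounds_closed by (auto simp: cycles_def)
  let ?u = "(w -[E j] w') -[E j] b"
  have "?u : killed (aa j) j" using submodule_minus[OF killed_submodule[OF Jc]] w bc(1) by blast
  moreover have "x j *>[E j] ?u = 0[E j]" using b(2) c bc xj by (simp add: E_smult_minus E_minus_eq_zero)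
  ultimately have "?u : killed (aa (Suc j)) j" using killed_adjoin[OF _ Jc xj] by simp
  moreover have "d j ?u = d j w -[E (Suc j)] d j w'" using c bc by (simp add: d_minus E_minus_zero)
  ultimately have "d j w -[E (Suc j)] d j w' : bounds (aa (Suc j)) (Suc j)" by (metis bounds.simps(2) image_eqI)
  thus ?thesis using c by (simp add: eqv_def)
qed

text \<open>\<open>phi\<close> will result from arbitrary choices of preimages, so it is linear only
  up to coboundaries. The last two clauses say that it is onto modulo coboundaries and that its
  kernel is \<open>(x 0, ..., x (j - 1)) C\<close>.\<close>

definition ext_iso :: "nat => ('a => 'e) => bool"
  where "ext_iso j phi <->
    (ALL c:C. phi c : cycles (aa j) j) &
    (ALL c:C. ALL c':C. eqv (aa j) j (phi (c +. c')) (phi c +[E j] phi c')) &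
    (ALL a:car R. ALL c:C. eqv (aa j) j (phi (a ** c)) (a *>[E j] phi c)) &
    (ALL z:cycles (aa j) j. EX c:C. eqv (aa j) j z (phi c)) &
    (ALL c:C. phi c : bounds (aa j) j <-> c : xC j)"

text \<open>\<open>C / (x\<^sub>0, ..., x\<^sub>j\<^sub>-\<^sub>1) C\<close> is isomorphic to \<open>Ext\<^sup>j(R / (x\<^sub>0, ..., x\<^sub>j\<^sub>-\<^sub>1), C)\<close>. The isomorphism for \<open>j + 1\<close>
  maps \<open>c\<close> to \<open>d w\<close>, where \<open>x\<^sub>j w\<close> is the image of \<open>c\<close> under the isomorphism for \<open>j\<close>.\<close>

lemma ext_iso_exists: "j <= delta ==> \<exists>phi. ext_iso j phi"
proof (induction j)
  case 0
  have zc: "{\<zero>} <= car R" by auto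
  have cyc: "eps c : cycles {\<zero>} 0" if "c : C" for c using that eps_closed exact_0 by (auto simp: cycles_def killed_def)
  have "eps (\<zero> ** \<zero>) = \<zero> *>[E 0] eps \<zero>" by (rule eps_smult) (use C_closed(2) in auto)
  hence "eps \<zero> = 0[E 0]" using eps_closed[OF C_closed(2)] by simp
  hence eps0: "eps c = 0[E 0] <-> c = \<zero>" if "c : C" for c using that eps_inj by blast
  have surj: "EX c:C. eqv {\<zero>} 0 z (eps c)" if z: "z : cycles {\<zero>} 0" for z
  proof -
    have "z : car (E 0)" "d 0 z = 0[E 1]" using z by (auto simp: cycles_def killed_def)
    then obtain c where "c : C" "z = eps c" using exact_0 by blast
    thus ?thesis using eqv_refl[OF zc eps_closed] by blast
  qed
  have add: "eqv {\<zero>} 0 (eps (c +. c')) (eps c +[E 0] eps c')" if "c : C" "c' : C" for c c'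
    using eqv_refl[OF zc eps_closed[OF C_closed(4)[OF that]]] eps_add[OF that] by simp
  have smult: "eqv {\<zero>} 0 (eps (a ** c)) (a *>[E 0] eps c)" if "a : car R" "c : C" for a c
    using eqv_refl[OF zc eps_closed[OF C_closed(7)[OF that]]] eps_smult[OF that] by simp
  have "ext_iso 0 eps" unfolding ext_iso_def adjoin_seq.simps using cyc eps0 surj add smult by simp
  thus ?case by blast
next
  case (Suc j)
  then obtain phi where "ext_iso j phi" by auto
  hence phi1: "!!c. c : C ==> phi c : cycles (aa j) j"
    and phi2: "!!c c'. [|c : C; c' : C|] ==> eqv (aa j) j (phi (c +. c')) (phi c +[E j] phi c')"
    and phi3: "!!a c. [|a : car R; c : C|] ==> eqv (aa j) j (phi (a ** c)) (a *>[E j] phi c)"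
    and phi4: "!!z. z : cycles (aa j) j ==> EX c:C. eqv (aa j) j z (phi c)"
    and phi5: "!!c. c : C ==> phi c : bounds (aa j) j <-> c : xC j"
    by (auto simp: ext_iso_def)
  have j: "j < delta" using Suc by auto
  have J: "ideal (aa j) R" and xj: "x j : car R" and reg: "nonzerodiv R (aa j) (car R) (x j)" using j a_ideal x_carrier x_regular by auto
  note Jc = idealD(1)[OF J]
  have J'c: "aa (Suc j) <= car R" using a_carrier[of "Suc j"] j by simp
  note cj = colon_nonzerodivisor[OF J xj reg]
  have "EX w. w : killed (aa j) j & x j *>[E j] w = phi c" if "c : C" for c
    using killed_divide[OF J xj, of "phi c" j] phi1[OF that] cj by (auto simp: cycles_def)
  then obtain W where W: "!!c. c : C ==> W c : killed (aa j) j" "!!c. c : C ==> x j *>[E j] W c = phi c" by metis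
  have Wc: "W c : car (E j)" if "c : C" for c using W(1)[OF that] killedD by auto
  note km = E.submoduleE[OF killed_submodule[OF Jc, of j]]
  have phic: "phi c : car (E j)" "phi c : killed (aa j) j" "d j (phi c) = 0[E (Suc j)]" if "c : C" for c
    using phi1[OF that] by (auto simp: cycles_def killed_def)
  note lift = connecting_eqv[OF j]
  let ?phi = "%c. d j (W c)"
  have 1: "?phi c : cycles (aa (Suc j)) (Suc j)" if c: "c : C" for c
  proof -
    have "?phi c : cycles (aa j) (Suc j)" using bounds_subset_cycles[OF Jc, of "Suc j"] W(1)[OF c] by auto
    moreover have "x j *>[E (Suc j)] ?phi c = 0[E (Suc j)]" using d_smult[OF xj Wc[OF c]] W(2)[OF c] phic[OF c] by simp
    ultimately show ?thesis using killed_adjoin[OF _ Jc xj] by (auto simp: cycles_def)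
  qed
  have 2: "eqv (aa (Suc j)) (Suc j) (?phi (c +. c')) (?phi c +[E (Suc j)] ?phi c')" if c: "c : C" "c' : C" for c c'
  proof -
    have cc: "c +. c' : C" using c C_closed(4) by auto
    have "eqv (aa j) j (x j *>[E j] W (c +. c')) (x j *>[E j] (W c +[E j] W c'))"
      using phi2[OF c] W(2)[OF c(1)] W(2)[OF c(2)] W(2)[OF cc] Wc c xj by (simp add: E.smult_r_distr)
    thus ?thesis using lift[of "W (c +. c')" "W c +[E j] W c'"] W(1) c cc km(5) Wc by (simp add: d_add)
  qed
  have 3: "eqv (aa (Suc j)) (Suc j) (?phi (a ** c)) (a *>[E (Suc j)] ?phi c)" if c: "a : car R" "c : C" for a c
  proof -
    have cc: "a ** c : C" using c C_closed(7) by auto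
    have "eqv (aa j) j (x j *>[E j] W (a ** c)) (x j *>[E j] (a *>[E j] W c))"
      using phi3[OF c] W(2)[OF c(2)] W(2)[OF cc] E_smult_left_commute[OF xj c(1) Wc[OF c(2)]] by simp
    thus ?thesis using lift[of "W (a ** c)" "a *>[E j] W c"] W(1) c cc km(4) Wc by (simp add: d_smult)
  qed
  \<comment> \<open>A cycle over the longer ideal is a boundary \<open>d w\<close> over the shorter
    one, whose Ext vanishes in degree \<open>Suc j\<close>. As \<open>x j\<close> kills it,
    \<open>x j w\<close> is a cycle and is reached by the map for \<open>j\<close>.\<close>
  have 4: "EX c:C. eqv (aa (Suc j)) (Suc j) z (?phi c)" if z: "z : cycles (aa (Suc j)) (Suc j)" for z
  proof -
    have "z : cycles (aa j) (Suc j)" using z cycles_antimono[OF adjoin_superset[OF J oneideal xj]] by auto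
    hence "z : bounds (aa j) (Suc j)" using ext_zero_above[of j "Suc j"] j by (auto simp: ext_zero_def)
    then obtain w where w: "w : killed (aa j) j" "z = d j w" by auto
    have wc: "w : car (E j)" using killedD w by auto
    have "x j *>[E (Suc j)] z = 0[E (Suc j)]" using z adjoin_self[OF J xj] by (auto simp: cycles_def killed_def)
    hence "x j *>[E j] w : cycles (aa j) j" using w km(4)[OF xj w(1)] wc xj by (auto simp: cycles_def d_smult)
    then obtain c where c: "c : C" "eqv (aa j) j (x j *>[E j] w) (phi c)" using phi4 by blast
    hence "eqv (aa (Suc j)) (Suc j) z (?phi c)" using lift[OF w(1) W(1)[OF c(1)]] W(2)[OF c(1)] w(2) by simp
    thus ?thesis using c by auto
  qed
  have 5: "?phi c : bounds (aa (Suc j)) (Suc j) <-> c : xC (Suc j)" if c: "c : C" for c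
  proof
    assume "?phi c : bounds (aa (Suc j)) (Suc j)"
    then obtain u where u: "u : killed (aa (Suc j)) j" "?phi c = d j u" by auto
    have uk: "u : killed (aa j) j" using u(1) killed_antimono[OF adjoin_superset[OF J oneideal xj]] by auto
    have uc: "u : car (E j)" using killedD u by auto
    have xu: "x j *>[E j] u = 0[E j]" using killedD(2)[OF u(1)] adjoin_self[OF J xj] by simp
    \<comment> \<open>\<open>u\<close> has the same differential as \<open>W c\<close> and is killed
      by \<open>x j\<close>. So \<open>W c - u\<close> is a cycle over \<open>aa j\<close>,
      represented by some \<open>c'\<close>, and multiplying by \<open>x j\<close> shows that
      \<open>c\<close> and \<open>x j c'\<close> have the same image under
      \<open>phi\<close>.\<close>
    have "W c -[E j] u : cycles (aa j) j" using submodule_minus[OF killed_submodule[OF Jc] W(1)[OF c] uk] u(2) Wc[OF c] uc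
      by (simp add: cycles_def d_minus E_minus_eq_zero)
    then obtain c' where c': "c' : C" "eqv (aa j) j (W c -[E j] u) (phi c')" using phi4 by blast
    have xc': "x j ** c' : C" using c' xj C_closed(7) by auto
    have "x j *>[E j] (W c -[E j] u) = phi c" using W(2)[OF c] Wc[OF c] uc xj xu phic[OF c] by (simp add: E_smult_minus E_minus_zero)
    hence e1: "eqv (aa j) j (phi c) (phi (x j ** c'))" using eqv_smult[OF Jc c'(2) xj] eqv_trans[OF Jc _ eqv_sym[OF Jc phi3[OF xj c'(1)]]] by simp
    let ?c = "c \<ominus> x j ** c'"
    have cc: "?c : C" using c xc' C_closed(6) by auto
    have "?c +. x j ** c' = c" using C_closed(3)[OF c] C_closed(3)[OF c'(1)] xj by algebra
    hence e2: "eqv (aa j) j (phi c) (phi ?c +[E j] phi (x j ** c'))" using phi2[OF cc xc'] by simp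
    have "eqv (aa j) j (phi ?c +[E j] phi (x j ** c')) (phi (x j ** c'))" using eqv_trans[OF Jc eqv_sym[OF Jc e2] e1] .
    moreover have "(phi ?c +[E j] phi (x j ** c')) -[E j] phi (x j ** c') = phi ?c"
      using phic(1)[OF cc] phic(1)[OF xc'] by (simp add: E.minus_eq E.M.a_assoc E.M.r_neg)
    ultimately have "phi ?c : bounds (aa j) j" by (simp add: eqv_def)
    hence "?c : xC j" using phi5[OF cc] by simp
    hence "?c +. x j ** c' : adjoin R (xC j) (x j) C" using c'(1) by (rule adjoinI)
    thus "c : xC (Suc j)" using \<open>?c +. x j ** c' = c\<close> by simp
  next
    assume "c : xC (Suc j)"
    then obtain m c' where m: "m : xC j" "c' : C" "c = m +. x j ** c'" by (auto elim: adjoinE)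
    have mC: "m : C" using m(1) xC_subset[of j] j by auto
    have xc': "x j ** c' : C" using m(2) xj C_closed(7) by auto
    have "eqv (aa j) j (phi m) 0[E j]" using phi5[OF mC] m(1) eqv_zero by auto
    hence "eqv (aa j) j (phi m +[E j] phi (x j ** c')) (0[E j] +[E j] x j *>[E j] phi c')" by (rule eqv_add[OF Jc _ phi3[OF xj m(2)]])
    hence "eqv (aa j) j (phi c) (0[E j] +[E j] x j *>[E j] phi c')" using eqv_trans[OF Jc phi2[OF mC xc']] m(3) by simp
    hence "eqv (aa j) j (x j *>[E j] W c) (x j *>[E j] phi c')" using W(2)[OF c] phic[OF m(2)] xj by simp
    hence "eqv (aa (Suc j)) (Suc j) (?phi c) (d j (phi c'))" using lift[OF W(1)[OF c] phic(2)[OF m(2)]] by simp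
    thus "?phi c : bounds (aa (Suc j)) (Suc j)" unfolding eqv_zero using phic[OF m(2)] by simp
  qed
  have "ext_iso (Suc j) ?phi" unfolding ext_iso_def using 1 2 3 4 5 by blast
  thus ?case by blast
qed

lemma a_subset_n: "j <= delta ==> aa j <= nn"
proof (induction j)
  case (Suc j)
  thus ?case using adjoin_minimal[OF n_ideal, of "aa j" "car R" "x j"] x_n[of j] n_closed(8) by auto
qed (use n_closed in auto)

section \<open>Ideals over a maximal regular sequence: Ext is concentrated in one degree\<close>

context
  assumes maximal: "!!q. [|primeideal q R; aa delta <= q|] ==> q = nn"
begin

text \<open>An associated prime of \<open>R / J\<close> contains \<open>aa delta\<close> and is
  therefore \<open>nn\<close>; looking for one inside the principal ideal of \<open>b\<close> yields
  a multiple of \<open>b\<close> that is a nonzero socle element.\<close>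

lemma socle_element:
  assumes J: "ideal J R" "aa delta <= J" and b: "b : car R" "b ~: J"
  obtains r where "r : car R" "r ** b ~: J" "colon R J (r ** b) = nn"
proof -
  have M: "ideal (PIdl b) R" and bM: "b : PIdl b" using cgenideal_ideal[OF b(1)] cgenideal_self[OF b(1)] .
  obtain m where m: "m : PIdl b" "m ~: J" "primeideal (colon R J m) R" using colon_prime[OF J(1) M bM b(2)] by blast
  have mc: "m : car R" using m(1) idealD(3)[OF M] by auto
  have "colon R J m = nn" using maximal[OF m(3)] J(2) subset_colon[OF J(1) mc] by auto
  thus ?thesis using that m(1,2) by (auto simp: cgenideal_def)
qed

text \<open>Descending induction on \<open>i\<close>, from where the coresolution stops. For the
  residue field: a socle element \<open>sig\<close> embeds it into \<open>R / aa delta\<close>, and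
  Ext^i of the latter is zero and maps onto Ext^i of the former because Ext^(i+1) already vanishes.
  In general: a maximal counterexample \<open>K\<close> has a socle element \<open>a\<close>, and
  Ext^i(R/K) sits between Ext^i(R/(K + a R)) and Ext^i of the residue field.\<close>

lemma ext_zero_top:
  assumes "delta < i" "ideal J R" "aa delta <= J"
  shows "ext_zero i J"
  using assms
proof (induction "Suc n - i" arbitrary: i J rule: less_induct)
  case less
  note aI = a_ideal[OF order_refl]
  note ac = idealD(1)[OF aI]
  show ?case
  proof (cases "n < i")
    case True
    have "x = 0[E i]" if "x : cycles J i" for x using that E_vanish[OF True] cycles_closed by blast
    moreover have "0[E i] : bounds J i" using subgroup.one_closed[OF submodule.axioms(1)[OF bounds_submodule[OF idealD(1)[OF less.prems(2)]]]] by simp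
    ultimately show ?thesis by (auto simp: ext_zero_def)
  next
    case False
    have next_zero: "ext_zero (Suc i) K" if "ideal K R" "aa delta <= K" for K using less.hyps[of "Suc i" K] False that less.prems(1) by auto
    have "\<one> ~: aa delta" using a_subset_n n_proper by auto
    then obtain sig where sig: "sig : car R" "colon R (aa delta) sig = nn"
      using socle_element[OF aI order_refl one_closed] by (metis m_closed one_closed)
    have zero_n: "ext_zero i nn" unfolding ext_zero_def
    proof
      fix e assume e: "e : cycles nn i"
      have "ext_zero (Suc i) (adjoin R (aa delta) sig (car R))"
        using next_zero adjoin_ideal[OF aI oneideal sig(1)] adjoin_superset[OF aI oneideal sig(1)] by auto
      then obtain u where u: "u : cycles (aa delta) i" "sig *>[E i] u = e" using cycles_divide[OF aI sig(1)] e sig(2) by metis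
      hence "u : bounds (aa delta) i" using ext_zero_above[OF order_refl less.prems(1)] by (auto simp: ext_zero_def)
      thus "e : bounds nn i" using bounds_colon_mult[OF _ sig(1)] sig(2) u(2) by metis
    qed
    show ?thesis
    proof (rule ccontr)
      assume neg: "~ ext_zero i J"
      let ?S = "{K. ideal K R & aa delta <= K & ~ ext_zero i K}"
      have "?S ~= {}" using neg less.prems by blast
      hence "EX K:?S. ALL L:?S. K <= L --> L = K" by (rule ideal_family_maximal) auto
      then obtain K where K: "ideal K R" "aa delta <= K" "~ ext_zero i K"
        and max: "!!L. [|ideal L R; aa delta <= L; K <= L; ~ ext_zero i L|] ==> L = K" by auto
      note Kc = idealD(1)[OF K(1)]
      have zb: "0[E i] : bounds K i" using subgroup.one_closed[OF submodule.axioms(1)[OF bounds_submodule[OF Kc]]] by simp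
      have "\<one> ~: K"
      proof
        assume "\<one> : K"
        hence "z = 0[E i]" if "z : cycles K i" for z using that by (auto simp: cycles_def killed_def)
        thus False using K(3) zb by (auto simp: ext_zero_def)
      qed
      then obtain a where a: "a : car R" "a ~: K" "colon R K a = nn" using socle_element[OF K(1,2) one_closed] by (metis m_closed one_closed)
      let ?L = "adjoin R K a (car R)"
      have L: "ideal ?L R" "K <= ?L" "a : ?L"
        using adjoin_ideal[OF K(1) oneideal a(1)] adjoin_superset[OF K(1) oneideal a(1)] adjoin_self[OF K(1) a(1)] .
      hence zL: "ext_zero i ?L" using max[of ?L] a(2) K(2) by auto
      have "ext_zero i K" unfolding ext_zero_def
      proof
        fix z assume z: "z : cycles K i"
        have "a *>[E i] z : bounds (colon R K a) i" using cycles_colon_mult[OF z a(1)] a(3) zero_n by (auto simp: ext_zero_def)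
        then obtain z' where z': "z' : cycles ?L i" "eqv K i z z'" using cycles_lift[OF K(1) a(1) z] by blast
        hence "z' : bounds K i" using zL bounds_antimono[OF L(2)] by (auto simp: ext_zero_def)
        thus "z : bounds K i" using eqv_bounds[OF Kc z'(2)] by simp
      qed
      thus False using K(3) by simp
    qed
  qed
qed

text \<open>Ext^i(R/J) injects into Ext^i(R/aa delta) when Ext^(i-1) vanishes on the quotients by
  all ideals over \<open>aa delta\<close>: the ideal over which \<open>z\<close> is a boundary can
  be enlarged by any element of \<open>J\<close>.\<close>

lemma bounds_of_cycles:
  assumes J: "ideal J R" "aa delta <= J" and z: "z : cycles J i" "z : bounds (aa delta) i"
    and V: "!!k K. [|i = Suc k; ideal K R; aa delta <= K|] ==> ext_zero k K"
  shows "z : bounds J i"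
proof -
  let ?S = "{L. ideal L R & aa delta <= L & L <= J & z : bounds L i}"
  have "?S ~= {}" using a_ideal[OF order_refl] J(2) z(2) by blast
  hence "EX L:?S. ALL K:?S. L <= K --> K = L" by (rule ideal_family_maximal) auto
  then obtain L where L: "ideal L R" "aa delta <= L" "L <= J" "z : bounds L i"
    and max: "!!K. [|ideal K R; aa delta <= K; K <= J; z : bounds K i; L <= K|] ==> K = L" by auto
  have "J <= L"
  proof
    fix a assume a: "a : J"
    hence ac: "a : car R" using idealD(3)[OF J(1)] by auto
    let ?K = "adjoin R L a (car R)"
    have K: "ideal ?K R" "L <= ?K" "a : ?K" using adjoin_ideal[OF L(1) oneideal ac] adjoin_superset[OF L(1) oneideal ac] adjoin_self[OF L(1) ac] .
    have "z : bounds ?K i"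
    proof (rule bounds_adjoin[OF L(1) ac _ L(4)])
      show "ext_zero k (colon R L a)" if "i = Suc k" for k using V[OF that colon_ideal[OF L(1) ac]] L(2) subset_colon[OF L(1) ac] by auto
      show "a *>[E i] z = 0[E i]" using z(1) a by (auto simp: cycles_def killed_def)
    qed
    moreover have "?K <= J" by (rule adjoin_minimal[OF J(1) L(3)]) (use a idealD(8)[OF J(1)] in auto)
    ultimately show "a : L" using max[of ?K] K L(2) by auto
  qed
  thus ?thesis using L(3,4) by (simp add: subset_antisym)
qed

context
  assumes C_regular: "!!j. j < delta ==> nonzerodiv R (xC j) C (x j)"
begin

text \<open>Ext^j(R/aa j, C) is \<open>C / xC j\<close>, on which \<open>x j\<close> is regular;
  hence a class of degree \<open>j\<close> killed by \<open>x j\<close> is zero. In lower degrees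
  Ext has vanished before.\<close>

lemma ext_zero_below: "[|j <= delta; i < j|] ==> ext_zero i (aa j)"
proof (induction j arbitrary: i)
  case (Suc j)
  hence j: "j < delta" by auto
  have J: "ideal (aa j) R" and xj: "x j : car R" and reg: "nonzerodiv R (aa j) (car R) (x j)" using j a_ideal x_carrier x_regular by auto
  note Jc = idealD(1)[OF J]
  note cj = colon_nonzerodivisor[OF J xj reg]
  show ?case unfolding ext_zero_def
  proof
    fix e assume e: "e : cycles (aa (Suc j)) i"
    have eJ: "e : cycles (aa j) i" using e cycles_antimono[OF adjoin_superset[OF J oneideal xj]] by auto
    have xe: "x j *>[E i] e = 0[E i]" using e adjoin_self[OF J xj] by (auto simp: cycles_def killed_def)
    have eb: "e : bounds (aa j) i"
    proof (cases "i < j")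
      case True
      thus ?thesis using Suc.IH[of i] j eJ by (auto simp: ext_zero_def)
    next
      case False
      hence ij: "i = j" using Suc.prems by simp
      obtain phi where "ext_iso j phi" using ext_iso_exists[of j] j by auto
      then obtain c where c: "c : C" "eqv (aa j) j e (phi c)"
        and phi3: "eqv (aa j) j (phi (x j ** c)) (x j *>[E j] phi c)"
        and phi5: "phi c : bounds (aa j) j <-> c : xC j" "phi (x j ** c) : bounds (aa j) j <-> x j ** c : xC j"
        using eJ xj C_closed(7) unfolding ext_iso_def ij by metis
      have "eqv (aa j) j (phi (x j ** c)) 0[E j]" using eqv_trans[OF Jc phi3 eqv_sym[OF Jc eqv_smult[OF Jc c(2) xj]]] xe ij by simp
      hence "x j ** c : xC j" using phi5(2) eqv_zero by simp
      hence "c : xC j" using C_regular[OF j] c(1) by (auto simp: nonzerodiv_def)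
      hence "phi c : bounds (aa j) j" using phi5(1) by simp
      thus ?thesis using eqv_bounds[OF Jc c(2)] ij by simp
    qed
    have "e : bounds (adjoin R (aa j) (x j) (car R)) i" by (rule bounds_adjoin[OF J xj _ eb xe]) (use Suc.IH j Suc.prems cj in auto)
    thus "e : bounds (aa (Suc j)) i" by simp
  qed
qed simp

text \<open>Together with \<open>ext_zero_top\<close> this leaves only degree \<open>delta\<close>,
  where Ext is then exact on the quotients by ideals over \<open>aa delta\<close>. That exactness is
  the injectivity of \<open>C / xC delta\<close> over \<open>R / aa delta\<close>.\<close>

lemma ext_zero_bottom:
  assumes "i < delta" "ideal J R" "aa delta <= J"
  shows "ext_zero i J"
  using assms
proof (induction i arbitrary: J rule: less_induct)
  case (less i)
  show ?case unfolding ext_zero_def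
  proof
    fix z assume z: "z : cycles J i"
    hence "z : bounds (aa delta) i" using cycles_antimono[OF less.prems(3)] ext_zero_below[OF order_refl less.prems(1)] by (auto simp: ext_zero_def)
    thus "z : bounds J i" by (rule bounds_of_cycles[OF less.prems(2,3) z]) (use less in auto)
  qed
qed

text \<open>\<open>C / xC\<close> is an injective module over \<open>R / aa\<close>; only the extension of maps from the socle of
  \<open>R / aa\<close> is stated.\<close>

theorem socle_divisible:
  assumes m: "m : C" "!!k. k : nn ==> k ** m : xC delta" and sig: "sig : car R" "colon R (aa delta) sig = nn"
  obtains u where "u : C" "sig ** u \<ominus> m : xC delta"
proof -
  have J: "ideal (aa delta) R" and Jc: "aa delta <= car R" using a_ideal a_carrier by auto
  obtain phi where "ext_iso delta phi" using ext_iso_exists by auto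
  hence phi1: "!!c. c : C ==> phi c : cycles (aa delta) delta"
    and phi2: "!!c c'. [|c : C; c' : C|] ==> eqv (aa delta) delta (phi (c +. c')) (phi c +[E delta] phi c')"
    and phi3: "!!a c. [|a : car R; c : C|] ==> eqv (aa delta) delta (phi (a ** c)) (a *>[E delta] phi c)"
    and phi4: "!!z. z : cycles (aa delta) delta ==> EX c:C. eqv (aa delta) delta z (phi c)"
    and phi5: "!!c. c : C ==> phi c : bounds (aa delta) delta <-> c : xC delta"
    by (auto simp: ext_iso_def)
  \<comment> \<open>The class of \<open>m\<close> is killed by \<open>nn\<close>. The ideal over
    which it has a representing cycle is raised from \<open>aa delta\<close> to \<open>nn\<close>:
    multiplying the cycle by \<open>a\<close> gives a boundary over \<open>aa delta\<close>, hence
    over the colon ideal because lower Ext vanishes, and \<open>cycles_lift\<close> then adjoins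
    \<open>a\<close>.\<close>
  have "EX z:cycles nn delta. eqv (aa delta) delta (phi m) z"
  proof -
    let ?S = "{L. ideal L R & aa delta <= L & L <= nn & (EX z:cycles L delta. eqv (aa delta) delta (phi m) z)}"
    have "aa delta : ?S" using J a_subset_n[OF order_refl] phi1[OF m(1)] eqv_refl[OF Jc cycles_closed[OF phi1[OF m(1)]]] by blast
    hence "?S ~= {}" by blast
    hence "EX L:?S. ALL K:?S. L <= K --> K = L" by (rule ideal_family_maximal) auto
    then obtain L z where L: "ideal L R" "aa delta <= L" "L <= nn" and z: "z : cycles L delta" "eqv (aa delta) delta (phi m) z"
      and max: "ALL K:?S. L <= K --> K = L"
      by auto
    have "nn <= L"
    proof
      fix a assume a: "a : nn"
      hence ac: "a : car R" using n_closed(3) by auto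
      let ?K = "adjoin R L a (car R)"
      have K: "ideal ?K R" "L <= ?K" "a : ?K" using adjoin_ideal[OF L(1) oneideal ac] adjoin_superset[OF L(1) oneideal ac] adjoin_self[OF L(1) ac] .
      have am: "a ** m : C" using m ac C_closed(7) by auto
      have "eqv (aa delta) delta (phi (a ** m)) 0[E delta]" using phi5[OF am] m(2)[OF a] eqv_zero by simp
      hence "eqv (aa delta) delta (a *>[E delta] phi m) 0[E delta]" using eqv_trans[OF Jc eqv_sym[OF Jc phi3[OF ac m(1)]]] by simp
      hence "eqv (aa delta) delta (a *>[E delta] z) 0[E delta]" using eqv_trans[OF Jc eqv_smult[OF Jc eqv_sym[OF Jc z(2)] ac]] by simp
      hence az: "a *>[E delta] z : bounds (aa delta) delta" using eqv_zero by simp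
      have "a *>[E delta] z : bounds (colon R L a) delta" by (rule bounds_of_cycles[OF colon_ideal[OF L(1) ac] _ cycles_colon_mult[OF z(1) ac] az])
          (use ext_zero_bottom L(2) subset_colon[OF L(1) ac] in auto)
      then obtain z' where z': "z' : cycles ?K delta" "eqv L delta z z'" using cycles_lift[OF L(1) ac z(1)] by blast
      have "eqv (aa delta) delta (phi m) z'" using eqv_trans[OF Jc z(2) eqv_antimono[OF L(2) z'(2)]] .
      moreover have "?K <= nn" by (rule adjoin_minimal[OF n_ideal L(3)]) (use a n_closed(8) in auto)
      ultimately have "?K = L" using max K(1,2) L(2) z'(1) by blast
      thus "a : L" using K(3) by simp
    qed
    thus ?thesis using L(3) z by (metis subset_antisym)
  qed
  then obtain z where z: "z : cycles nn delta" "eqv (aa delta) delta (phi m) z" by blast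
  \<comment> \<open>The socle element \<open>sig\<close> embeds the residue field into
    \<open>R / aa delta\<close>; vanishing of the next Ext extends the cycle \<open>z\<close> along
    this embedding.\<close>
  have "ext_zero (Suc delta) (adjoin R (aa delta) sig (car R))"
    by (rule ext_zero_top) (use adjoin_ideal[OF J oneideal sig(1)] adjoin_superset[OF J oneideal sig(1)] in auto)
  then obtain v where v: "v : cycles (aa delta) delta" "sig *>[E delta] v = z" using cycles_divide[OF J sig(1)] z(1) sig(2) by metis
  obtain u where u: "u : C" "eqv (aa delta) delta v (phi u)" using phi4[OF v(1)] by auto
  have su: "sig ** u : C" using u sig C_closed(7) by auto
  have "eqv (aa delta) delta (sig *>[E delta] phi u) z" using eqv_smult[OF Jc eqv_sym[OF Jc u(2)] sig(1)] v(2) by simp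
  hence e1: "eqv (aa delta) delta (phi (sig ** u)) (phi m)" using eqv_trans[OF Jc eqv_trans[OF Jc phi3[OF sig(1) u(1)]] eqv_sym[OF Jc z(2)]] by simp
  let ?c = "sig ** u \<ominus> m"
  have cc: "?c : C" using su m(1) C_closed(6) by auto
  have "?c +. m = sig ** u" using C_closed(3)[OF u(1)] C_closed(3)[OF m(1)] sig(1) by algebra
  hence "eqv (aa delta) delta (phi ?c +[E delta] phi m) (phi (sig ** u))" using eqv_sym[OF Jc phi2[OF cc m(1)]] by simp
  hence "eqv (aa delta) delta (phi ?c +[E delta] phi m) (phi m)" using eqv_trans[OF Jc _ e1] by simp
  moreover have "phi ?c : car (E delta)" "phi m : car (E delta)" using phi1 cc m(1) cycles_closed by auto
  ultimately have "phi ?c : bounds (aa delta) delta" by (simp add: eqv_def E.minus_eq E.M.a_assoc E.M.r_neg)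
  thus ?thesis using that u(1) phi5[OF cc] by simp
qed

end

end

end

end

section \<open>Injective modules and Baer's criterion\<close>

lemma (in cring) self_module_module: "module R (self_module R)"
proof (rule moduleI[OF is_cring])
  show "abelian_group (self_module R)"
  proof (rule abelian_groupI)
    show "EX y:car (self_module R). y +[self_module R] x = 0[self_module R]" if "x : car (self_module R)" for x
      using that by (intro bexI[of _ "\<ominus> x"]) (auto simp: self_module_def l_neg)
  qed (auto simp: self_module_def a_ac)
qed (auto simp: self_module_def l_distr r_distr m_assoc)

lemma (in module) submodule_criterion:
  assumes "H <= car M" "0[M] : H" "!!x y. [|x : H; y : H|] ==> x +[M] y : H"
    "!!a x. [|a : car R; x : H|] ==> a *>[M] x : H"
  shows "submodule H R M"
proof (rule submoduleI[OF assms(1,2) _ assms(3,4)])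
  fix x assume x: "x : H"
  hence "(\<ominus> \<one>) *>[M] x = -[M] x" using assms(1) by (auto simp: smult_l_minus)
  thus "-[M] x : H" using assms(4)[OF _ x, of "\<ominus> \<one>"] by simp
qed

lemma (in cring) ideal_module_module:
  assumes "ideal J R" shows "module R (ideal_module R J)"
proof -
  have "submodule J R (self_module R)" by (rule module.submodule_criterion[OF self_module_module])
      (use idealD[OF assms] in "auto simp: self_module_def")
  thus ?thesis unfolding ideal_module_def by (rule submodule.submodule_is_module[OF _ self_module_module])
qed

lemma module_homD:
  assumes "h : module_hom R M N"
  shows "x : car M ==> h x : car N"
    "[|x : car M; y : car M|] ==> h (x +[M] y) = h x +[N] h y"
    "[|a : car R; x : car M|] ==> h (a *>[M] x) = a *>[N] h x" using assms by (auto simp: module_hom_def)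

lemma restrict_module_hom:
  assumes "!!x. x : car M ==> h x : car N"
    "!!x y. [|x : car M; y : car M|] ==> h (x +[M] y) = h x +[N] h y"
    "!!a x. [|a : car R; x : car M|] ==> h (a *>[M] x) = a *>[N] h x"
    and "!!x y. [|x : car M; y : car M|] ==> x +[M] y : car M"
    "!!a x. [|a : car R; x : car M|] ==> a *>[M] x : car M"
  shows "(\<lambda>x\<in>car M. h x) : module_hom R M N"
  using assms by (auto simp: module_hom_def)

text \<open>The form in which injectivity is verified and applied: over a Noetherian ring it comes
  down to finitely many equations \<open>r e = y\<close>. \<open>g\<close> is linear on
  \<open>J\<close> only and arbitrary elsewhere, so no restricted function has to be formed.\<close>

definition baer :: "('a, 'r) ring_scheme => ('a, 'e, 'm) module_scheme => bool"
  where "baer R E <-> module R E &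
    (ALL J g. ideal J R & (ALL j:J. g j : car E) &
      (ALL i:J. ALL j:J. g (i +[R] j) = g i +[E] g j) &
      (ALL a:car R. ALL j:J. g (a *[R] j) = a *>[E] g j) -->
      (EX e:car E. ALL j:J. g j = j *>[E] e))"

lemma baer_module: "baer R E ==> module R E"
  by (simp add: baer_def)

lemma baerD:
  assumes "baer R E" "ideal J R" "!!j. j : J ==> g j : car E"
    "!!i j. [|i : J; j : J|] ==> g (i +[R] j) = g i +[E] g j"
    "!!a j. [|a : car R; j : J|] ==> g (a *[R] j) = a *>[E] g j"
  shows "EX e:car E. ALL j:J. g j = j *>[E] e"
  using assms(1)[unfolded baer_def, THEN conjunct2, rule_format, of J g] assms(2-) by blast

lemma baerI:
  assumes "module R E"
    "!!J g. [|ideal J R; !!j. j : J ==> g j : car E;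
      !!i j. [|i : J; j : J|] ==> g (i +[R] j) = g i +[E] g j;
      !!a j. [|a : car R; j : J|] ==> g (a *[R] j) = a *>[E] g j|] ==>
      EX e:car E. ALL j:J. g j = j *>[E] e"
  shows "baer R E"
  unfolding baer_def using assms by auto

lemma injective_imp_baer:
  fixes R :: "('a, 'r) ring_scheme" and E :: "('a, 'e, 'm) module_scheme"
  assumes "injective_module R E" shows "baer R E"
proof (rule baerI)
  show M: "module R E" using assms by (auto simp: injective_module_def)
  interpret module R E by fact
  fix J g assume J: "ideal J R" and g: "!!j. j : J ==> g j : car E"
      "!!i j. [|i : J; j : J|] ==> g (i +[R] j) = g i +[E] g j"
      "!!a j. [|a : car R; j : J|] ==> g (a *[R] j) = a *>[E] g j"
  note cJ = R.idealD[OF J]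
  let ?A = "ideal_module R J" and ?B = "self_module R"
  have sel: "car ?A = J" "add ?A = add R" "smult ?A = monoid.mult R"
    "car ?B = car R" "add ?B = add R" "smult ?B = monoid.mult R" by (auto simp: ideal_module_def self_module_def)
  have f: "(\<lambda>x\<in>J. x) : module_hom R ?A ?B" using cJ by (auto simp: module_hom_def sel)
  have g': "(\<lambda>x\<in>J. g x) : module_hom R ?A E" using cJ g by (auto simp: module_hom_def sel)
  have "inj_on (\<lambda>x\<in>J. x) (car ?A)" by (auto simp: sel inj_on_def)
  then obtain h where h: "h : module_hom R ?B E" "ALL x:car ?A. h ((\<lambda>x\<in>J. x) x) = (\<lambda>x\<in>J. g x) x"
    using assms R.ideal_module_module[OF J] R.self_module_module f g' unfolding injective_module_def by blast
  have h1: "h 1[R] : car E" using module_homD(1)[OF h(1)] by (simp add: sel)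
  have "g j = j *>[E] h 1[R]" if j: "j : J" for j using module_homD(3)[OF h(1), of j "1[R]"] h(2) j cJ(3)[OF j] by (simp add: sel)
  thus "EX e:car E. ALL j:J. g j = j *>[E] e" using h1 by blast
qed

text \<open>Baer's criterion implies injectivity: a maximal partial extension, as a linear relation, is total.\<close>

lemma baer_extension:
  fixes A :: "('a, 'x, 'p) module_scheme" and B :: "('a, 'y, 'q) module_scheme"
  assumes E: "baer R E" and A: "module R A" and B: "module R B"
    and f: "f : module_hom R A B" "inj_on f (car A)" and g: "g : module_hom R A E"
  shows "EX h:module_hom R B E. ALL x:car A. h (f x) = g x"
proof -
  interpret E: module R E using E by (rule baer_module)
  interpret A: module R A by fact
  interpret B: module R B by fact
  \<comment> \<open>Partial homomorphisms are taken as graphs. The last clause is single-valuedness,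
    which for a linear relation need only be asked at zero.\<close>
  define lin where "lin G <-> G <= car B \<times> car E &
    (ALL x y x' y'. (x, y) : G & (x', y') : G --> (x +[B] x', y +[E] y') : G) &
    (ALL a:car R. ALL x y. (x, y) : G --> (a *>[B] x, a *>[E] y) : G) &
    (ALL y. (0[B], y) : G --> y = 0[E])" for G
  let ?G0 = "(%x. (f x, g x)) ` car A"
  let ?S = "{G. lin G & ?G0 <= G}"
  note fD = module_homD[OF f(1)] and gD = module_homD[OF g]
  have f0: "f 0[A] = 0[B]" "g 0[A] = 0[E]" using fD(3)[of "0[R]" "0[A]"] gD(3)[of "0[R]" "0[A]"] fD(1)[of "0[A]"] gD(1)[of "0[A]"] by auto
  have "lin ?G0" unfolding lin_def
  proof (intro conjI allI impI ballI)
    show "?G0 <= car B \<times> car E" using fD gD by auto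
    show "(x +[B] x', y +[E] y') : ?G0" if xy: "(x, y) : ?G0 & (x', y') : ?G0" for x y x' y'
    proof -
      obtain u v where "u : car A" "v : car A" "x = f u" "y = g u" "x' = f v" "y' = g v" using xy by blast
      thus ?thesis by (intro image_eqI[of _ _ "u +[A] v"]) (auto simp: fD gD)
    qed
    show "(a *>[B] x, a *>[E] y) : ?G0" if xy: "a : car R" "(x, y) : ?G0" for a x y
    proof -
      obtain u where "u : car A" "x = f u" "y = g u" using xy by blast
      thus ?thesis using xy by (intro image_eqI[of _ _ "a *>[A] u"]) (auto simp: fD gD)
    qed
    show "y = 0[E]" if y0: "(0[B], y) : ?G0" for y
    proof -
      obtain u where u: "u : car A" "0[B] = f u" "y = g u" using y0 by blast
      hence "f u = f 0[A]" using f0 by simp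
      hence "u = 0[A]" using inj_onD[OF f(2)] u(1) by simp
      thus ?thesis using u f0 by simp
    qed
  qed
  hence "?S ~= {}" by blast
  hence "EX M:?S. ALL X:?S. M <= X --> X = M"
  proof (rule subset_Zorn_nonempty)
    fix \<C> assume ne: "\<C> ~= {}" and ch: "subset.chain ?S \<C>"
    have L: "lin G" "?G0 <= G" if "G : \<C>" for G using ch that by (auto simp: subset_chain_def)
    have common: "EX G:\<C>. p : G & q : G" if pq: "p : \<Union>\<C>" "q : \<Union>\<C>" for p q
    proof -
      obtain G H where "G : \<C>" "H : \<C>" "p : G" "q : H" using pq by blast
      moreover from this have "G <= H \<or> H <= G" using ch by (auto simp: subset_chain_def)
      ultimately show ?thesis by blast
    qed
    have "lin (\<Union>\<C>)" unfolding lin_def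
    proof (intro conjI allI impI ballI)
      show "\<Union>\<C> <= car B \<times> car E" using L(1) unfolding lin_def by blast
      show "(x +[B] x', y +[E] y') : \<Union>\<C>" if xy: "(x, y) : \<Union>\<C> & (x', y') : \<Union>\<C>" for x y x' y'
      proof -
        obtain G where "G : \<C>" "(x, y) : G" "(x', y') : G" using common xy by meson
        thus ?thesis using L(1)[of G] unfolding lin_def by blast
      qed
      show "(a *>[B] x, a *>[E] y) : \<Union>\<C>" if "a : car R" "(x, y) : \<Union>\<C>" for a x y using that L(1) unfolding lin_def by blast
      show "y = 0[E]" if "(0[B], y) : \<Union>\<C>" for y using that L(1) unfolding lin_def by blast
    qed
    thus "\<Union>\<C> : ?S" using L(2) ne by blast
  qed
  then obtain G where G: "lin G" "?G0 <= G" and max: "!!X. [|lin X; ?G0 <= X; G <= X|] ==> X = G" by auto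
  have Gc: "x : car B" "y : car E" if "(x, y) : G" for x y using that G(1) by (auto simp: lin_def)
  have Ga: "(x +[B] x', y +[E] y') : G" if "(x, y) : G" "(x', y') : G" for x y x' y' using that G(1) by (auto simp: lin_def)
  have Gs: "(a *>[B] x, a *>[E] y) : G" if "a : car R" "(x, y) : G" for a x y using that G(1) by (auto simp: lin_def)
  have Gz: "y = 0[E]" if "(0[B], y) : G" for y using that G(1) by (auto simp: lin_def)
  have G0: "(0[B], 0[E]) : G" using G(2) f0 A.M.zero_closed by force
  have Gm: "(-[B] x, -[E] y) : G" if "(x, y) : G" for x y
    using Gs[of "-[R] 1[R]", OF _ that] Gc[OF that] by (simp add: E.smult_l_minus B.smult_l_minus)
  have Gf: "y = y'" if "(x, y) : G" "(x, y') : G" for x y y'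
  proof -
    have "(0[B], y +[E] -[E] y') : G" using Ga[OF that(1) Gm[OF that(2)]] Gc[OF that(1)] by (simp add: B.M.r_neg)
    hence "y +[E] -[E] y' = 0[E]" by (rule Gz)
    thus ?thesis using Gc(2)[OF that(1)] Gc(2)[OF that(2)] by (metis E.M.minus_equality E.M.minus_minus E.M.a_comm E.M.a_inv_closed)
  qed
  have total: "EX y. (b, y) : G" if b: "b : car B" for b
  proof (rule ccontr)
    assume nb: "\<nexists>y. (b, y) : G"
    \<comment> \<open>The scalars that bring \<open>b\<close> into the domain form an ideal, on
      which the partial map induces a linear \<open>k\<close>. The element \<open>e\<close> that
      represents \<open>k\<close> is a consistent value at \<open>b\<close>.\<close>
    define J where "J = {r : car R. EX y. (r *>[B] b, y) : G}"
    define k where "k r = (THE y. (r *>[B] b, y) : G)" for r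
    have k: "(r *>[B] b, k r) : G" if "r : J" for r unfolding k_def by (rule theI') (use that Gf J_def in blast)
    have kI: "k r = y" if "(r *>[B] b, y) : G" for r y unfolding k_def by (rule the_equality) (use that Gf in auto)
    have Jc: "r : car R" if "r : J" for r using that by (auto simp: J_def)
    have sumk: "((r +[R] s) *>[B] b, k r +[E] k s) : G" if "r : J" "s : J" for r s
      using Ga[OF k[OF that(1)] k[OF that(2)]] Jc that b by (simp add: B.smult_l_distr)
    have prodk: "((a *[R] r) *>[B] b, a *>[E] k r) : G" if "a : car R" "r : J" for a r
      using Gs[OF that(1) k[OF that(2)]] Jc that b by (simp add: B.smult_assoc1)
    have J: "ideal J R"
    proof (rule E.R.ideal_criterion)
      show "0[R] : J" using G0 b by (auto simp: J_def)
      show "J <= car R" using Jc by blast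
      show "r +[R] s : J" if "r : J" "s : J" for r s using sumk[OF that] Jc[OF that(1)] Jc[OF that(2)] unfolding J_def by blast
      show "a *[R] r : J" if "a : car R" "r : J" for a r using prodk[OF that] that(1) Jc[OF that(2)] unfolding J_def by blast
    qed
    have "EX e:car E. ALL r:J. k r = r *>[E] e"
    proof (rule baerD[OF E J, of k])
      show "!!j. j : J ==> k j : car E" by (rule Gc(2)[OF k])
      show "!!i j. [|i : J; j : J|] ==> k (i +[R] j) = k i +[E] k j" by (rule kI[OF sumk])
      show "!!a j. [|a : car R; j : J|] ==> k (a *[R] j) = a *>[E] k j" by (rule kI[OF prodk])
    qed
    then obtain e where e: "e : car E" "!!r. r : J ==> k r = r *>[E] e" by blast
    define H where "H = {(x +[B] r *>[B] b, y +[E] r *>[E] e) | x y r. (x, y) : G & r : car R}"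
    have HI: "(x +[B] r *>[B] b, y +[E] r *>[E] e) : H" if "(x, y) : G" "r : car R" for x y r using that by (auto simp: H_def)
    have HE: "EX x y r. (x, y) : G & r : car R & p = x +[B] r *>[B] b & q = y +[E] r *>[E] e"
      if "(p, q) : H" for p q using that by (auto simp: H_def)
    have "lin H" unfolding lin_def
    proof (intro conjI allI impI ballI)
      show "H <= car B \<times> car E" using Gc b e by (auto simp: H_def)
    next
      fix p q p' q' assume pq: "(p, q) : H & (p', q') : H"
      then obtain x y r x' y' r' where *: "(x, y) : G" "r : car R" "p = x +[B] r *>[B] b" "q = y +[E] r *>[E] e"
        "(x', y') : G" "r' : car R" "p' = x' +[B] r' *>[B] b" "q' = y' +[E] r' *>[E] e" using HE by metis
      have "((x +[B] x') +[B] (r +[R] r') *>[B] b, (y +[E] y') +[E] (r +[R] r') *>[E] e) : H" using HI[OF Ga[OF *(1,5)]] *(2,6) by simp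
      moreover have "(x +[B] x') +[B] (r +[R] r') *>[B] b = p +[B] p'"
        using Gc[OF *(1)] Gc[OF *(5)] *(2,6) b by (simp add: *(3,7) B.smult_l_distr B.M.a_ac)
      moreover have "(y +[E] y') +[E] (r +[R] r') *>[E] e = q +[E] q'"
        using Gc[OF *(1)] Gc[OF *(5)] *(2,6) e by (simp add: *(4,8) E.smult_l_distr E.M.a_ac)
      ultimately show "(p +[B] p', q +[E] q') : H" by simp
    next
      fix a p q assume a: "a : car R" and pq: "(p, q) : H"
      then obtain x y r where *: "(x, y) : G" "r : car R" "p = x +[B] r *>[B] b" "q = y +[E] r *>[E] e" using HE by metis
      have "(a *>[B] x +[B] (a *[R] r) *>[B] b, a *>[E] y +[E] (a *[R] r) *>[E] e) : H" using HI[OF Gs[OF a *(1)]] *(2) a by simp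
      thus "(a *>[B] p, a *>[E] q) : H" using Gc[OF *(1)] *(2) a b e(1)
        by (simp add: *(3,4) E.smult_r_distr B.smult_r_distr E.smult_assoc1 B.smult_assoc1)
    next
      fix q assume "(0[B], q) : H"
      then obtain x y r where *: "(x, y) : G" "r : car R" "0[B] = x +[B] r *>[B] b" "q = y +[E] r *>[E] e" using HE by metis
      have "r *>[B] b = -[B] x" using *(2,3) Gc(1)[OF *(1)] b by (metis B.M.a_comm B.M.minus_equality B.smult_closed)
      hence "(r *>[B] b, -[E] y) : G" using Gm[OF *(1)] by simp
      hence "r : J" "k r = -[E] y" using *(2) kI by (auto simp: J_def)
      hence "r *>[E] e = -[E] y" using e(2) by simp
      thus "q = 0[E]" using *(4) Gc(2)[OF *(1)] by (simp add: E.M.r_neg)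
    qed
    moreover have "G <= H"
    proof
      fix p assume "p : G"
      then obtain x y where xy: "p = (x, y)" "(x, y) : G" by (metis surj_pair)
      thus "p : H" using HI[OF xy(2) E.R.zero_closed] Gc[OF xy(2)] b e(1) by simp
    qed
    moreover have "(b, e) : H" using HI[OF G0 E.R.one_closed] b e(1) by simp
    ultimately show False using max[of H] G(2) nb by blast
  qed
  let ?h = "%x. THE y. (x, y) : G"
  have h: "(x, ?h x) : G" if "x : car B" for x by (rule theI') (use total[OF that] Gf in blast)
  have hI: "?h x = y" if "(x, y) : G" for x y by (rule the_equality) (use that Gf in auto)
  have "(\<lambda>x\<in>car B. ?h x) : module_hom R B E"
  proof (rule restrict_module_hom)
    show "?h x : car E" if "x : car B" for x by (rule Gc(2)[OF h[OF that]])
    show "?h (x +[B] y) = ?h x +[E] ?h y" if "x : car B" "y : car B" for x y by (rule hI[OF Ga[OF h[OF that(1)] h[OF that(2)]]])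
    show "?h (a *>[B] x) = a *>[E] ?h x" if "a : car R" "x : car B" for a x by (rule hI[OF Gs[OF that(1) h[OF that(2)]]])
  qed auto
  moreover have "?h (f x) = g x" if "x : car A" for x using hI G(2) that by blast
  ultimately show ?thesis using fD(1) by (intro bexI[of _ "\<lambda>x\<in>car B. ?h x"]) auto
qed

lemma baer_imp_injective: "baer R E ==> injective_module R E"
  unfolding injective_module_def by (intro conjI allI ballI impI, erule baer_module, elim conjE, rule baer_extension)

text \<open>Baer's condition for the map \<open>j + t r |-> r v\<close> on \<open>J + t R\<close>,
  which \<open>kill\<close> makes well defined: it vanishes on \<open>J\<close> and takes the value
  \<open>v\<close> at \<open>t\<close>.\<close>

lemma baer_divisible:
  assumes E: "baer R E" and J: "ideal J R" and t: "t : car R" and v: "v : car E"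
    and kill: "!!r. [|r : car R; r *[R] t : J|] ==> r *>[E] v = 0[E]"
  shows "EX w:car E. (ALL j:J. j *>[E] w = 0[E]) & t *>[E] w = v"
proof -
  interpret module R E using E by (rule baer_module)
  note cJ = R.idealD[OF J]
  let ?K = "adjoin R J t (car R)"
  have K: "ideal ?K R" by (rule R.adjoin_ideal[OF J R.oneideal t])
  have "EX r:car R. EX j:J. y = j +[R] t *[R] r" if "y : ?K" for y using that by (auto simp: adjoin_def)
  then obtain rho where rho: "!!y. y : ?K ==> rho y : car R & (EX j:J. y = j +[R] t *[R] rho y)" by metis
  have eq: "rho y *>[E] v = r *>[E] v" if y: "y = j +[R] t *[R] r" "j : J" "r : car R" for y j r
  proof -
    have yK: "y : ?K" using y by (auto simp: adjoin_def)
    obtain j' where j': "j' : J" "y = j' +[R] t *[R] rho y" "rho y : car R" using rho[OF yK] by auto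
    have c: "j : car R" "j' : car R" using y j' cJ by auto
    have "(rho y -[R] r) *[R] t = (j' +[R] t *[R] rho y) -[R] (j +[R] t *[R] r) +[R] (j -[R] j')" using c y(3) j'(3) t by algebra
    also have "... = y -[R] y +[R] (j -[R] j')" using j'(2) y(1) by simp
    also have "... = j -[R] j'" using c R.idealD(3)[OF K yK] by algebra
    finally have "(rho y -[R] r) *[R] t : J" using cJ(6)[OF y(2) j'(1)] by simp
    hence "(rho y -[R] r) *>[E] v = 0[E]" using kill j'(3) y(3) by simp
    hence "rho y *>[E] v +[E] -[E] (r *>[E] v) = 0[E]" using j'(3) y(3) v by (simp add: R.minus_eq smult_l_distr smult_l_minus)
    thus ?thesis using j'(3) y(3) v by (metis M.a_comm M.a_inv_closed M.minus_equality M.minus_minus smult_closed)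
  qed
  have "EX e:car E. ALL y:?K. rho y *>[E] v = y *>[E] e"
  proof (rule baerD[OF E K, of "%y. rho y *>[E] v"])
    show "rho y *>[E] v : car E" if "y : ?K" for y using rho[OF that] v by auto
    show "rho (y +[R] z) *>[E] v = rho y *>[E] v +[E] rho z *>[E] v" if yz: "y : ?K" "z : ?K" for y z
    proof -
      obtain j k where j: "j : J" "y = j +[R] t *[R] rho y" "rho y : car R" "k : J" "z = k +[R] t *[R] rho z" "rho z : car R" using rho yz by metis
      have c: "j : car R" "k : car R" using j cJ by auto
      have "(j +[R] t *[R] rho y) +[R] (k +[R] t *[R] rho z) = (j +[R] k) +[R] t *[R] (rho y +[R] rho z)" using c j(3,6) t by algebra
      hence "y +[R] z = (j +[R] k) +[R] t *[R] (rho y +[R] rho z)" using j(2,5) by simp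
      from eq[OF this cJ(4)[OF j(1,4)]] show ?thesis using j(3,6) v by (simp add: smult_l_distr)
    qed
    show "rho (a *[R] y) *>[E] v = a *>[E] (rho y *>[E] v)" if ay: "a : car R" "y : ?K" for a y
    proof -
      obtain j where j: "j : J" "y = j +[R] t *[R] rho y" "rho y : car R" using rho ay by metis
      have c: "j : car R" using j cJ by auto
      have "a *[R] (j +[R] t *[R] rho y) = (a *[R] j) +[R] t *[R] (a *[R] rho y)" using c j(3) t ay(1) by algebra
      hence "a *[R] y = (a *[R] j) +[R] t *[R] (a *[R] rho y)" using j(2) by simp
      from eq[OF this cJ(7)[OF ay(1) j(1)]] show ?thesis using j(3) v ay by (simp add: smult_assoc1)
    qed
  qed
  then obtain e where e: "e : car E" "!!y. y : ?K ==> rho y *>[E] v = y *>[E] e" by blast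
  have "j *>[E] e = 0[E]" if j: "j : J" for j
  proof -
    have "j : ?K" using R.adjoin_superset[OF J R.oneideal t] j by auto
    moreover have "j = j +[R] t *[R] 0[R]" using cJ(3)[OF j] t by simp
    ultimately show ?thesis using e(2)[of j] eq[of j j "0[R]"] j v by simp
  qed
  moreover have "t *>[E] e = v"
  proof -
    have "t = 0[R] +[R] t *[R] 1[R]" using t by simp
    thus ?thesis using e(2)[OF R.adjoin_self[OF J t]] eq[of t "0[R]" "1[R]"] cJ(2) v by simp
  qed
  ultimately show ?thesis using e(1) by blast
qed

section \<open>Localization\<close>

text \<open>\<open>B\<close> is the localization of \<open>A\<close> at \<open>T\<close>, up to isomorphism, with canonical map \<open>phi\<close>.\<close>

locale ring_localization =
  fixes A :: "('a, 'r) ring_scheme" and T :: "'a set" and B :: "('b, 's) ring_scheme" and phi :: "'a => 'b"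
  assumes A_cring: "cring A" and B_cring: "cring B" and phi_hom: "phi : ring_hom A B"
    and T_subset: "T <= car A" and T_one: "1[A] : T" and T_mult: "!!s t. [|s : T; t : T|] ==> s *[A] t : T"
    and phi_unit: "!!s. s : T ==> phi s : Units B"
    and phi_surj: "!!b. b : car B ==> EX a:car A. EX s:T. phi s *[B] b = phi a"
    and phi_ker: "!!a. [|a : car A; phi a = 0[B]|] ==> EX s:T. s *[A] a = 0[A]"
begin

sublocale A: cring A by (rule A_cring)
sublocale B: cring B by (rule B_cring)

lemma T_carrier: "s : T ==> s : car A"
  using T_subset by auto

lemma phi_in: "a : car A ==> phi a : car B"
  by (rule ring_hom_closed[OF phi_hom])

lemma phi_mult: "[|a : car A; a' : car A|] ==> phi (a *[A] a') = phi a *[B] phi a'"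
  by (rule ring_hom_mult[OF phi_hom])

lemma phi_add: "[|a : car A; a' : car A|] ==> phi (a +[A] a') = phi a +[B] phi a'"
  by (rule ring_hom_add[OF phi_hom])

lemma phi_one: "phi 1[A] = 1[B]"
  by (rule ring_hom_one[OF phi_hom])

lemma phi_zero: "phi 0[A] = 0[B]"
proof -
  have "phi 0[A] +[B] phi 0[A] = phi 0[A]" using phi_add[of "0[A]" "0[A]"] by simp
  thus ?thesis using phi_in[of "0[A]"] by (simp add: B.add.r_cancel_one')
qed

lemma phi_minus: "[|a : car A; a' : car A|] ==> phi (a -[A] a') = phi a -[B] phi a'"
proof -
  assume a: "a : car A" "a' : car A"
  have "phi (-[A] a') +[B] phi a' = 0[B]" using a phi_add[of "-[A] a'" a'] phi_zero by (simp add: A.l_neg)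
  hence "phi (-[A] a') = -[B] phi a'" using a phi_in by (simp add: B.minus_equality)
  thus ?thesis using a by (simp add: A.minus_eq B.minus_eq phi_add)
qed

lemma phi_eq: 
  assumes "a : car A" "a' : car A" "phi a = phi a'"
  obtains t where "t : T" "t *[A] a = t *[A] a'"
proof -
  have "phi (a -[A] a') = 0[B]" using assms phi_minus phi_in by (simp add: B.r_right_minus_eq)
  then obtain t where t: "t : T" "t *[A] (a -[A] a') = 0[A]" using phi_ker assms by (metis A.minus_closed)
  have tc: "t : car A" using t T_carrier by auto
  have "t *[A] a -[A] t *[A] a' = 0[A]" using t(2) tc assms(1,2) by (simp add: A.minus_eq A.r_distr A.r_minus)
  hence "t *[A] a = t *[A] a'" using tc assms by (simp add: A.r_right_minus_eq)
  thus ?thesis using that t by blast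
qed

lemma phi_cancel:
  assumes "s : T" "b : car B" "b' : car B" "phi s *[B] b = phi s *[B] b'"
  shows "b = b'"
  using assms phi_unit B.Units_l_cancel by blast

definition divisible_by_T :: "('a, 'e, 'm) module_scheme => bool"
  where "divisible_by_T F <-> module A F &
    (ALL s:T. ALL x:car F. s *>[F] x = 0[F] --> x = 0[F]) &
    (ALL s:T. ALL x:car F. EX y:car F. s *>[F] y = x)"

text \<open>If \<open>T\<close> acts bijectively, the action of \<open>A\<close> extends uniquely to \<open>B\<close>.\<close>

definition act :: "('a, 'e, 'm) module_scheme => 'b => 'e => 'e"
  where "act F b x = (THE y. y : car F &
    (EX a:car A. EX s:T. phi s *[B] b = phi a & s *>[F] y = a *>[F] x))"

definition extend_scalars :: "('a, 'e, 'm) module_scheme => ('b, 'e) module"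
  where "extend_scalars F =
    (|carrier = car F, monoid.mult = undefined, one = undefined,
     ring.zero = 0[F], add = (\<oplus>\<^bsub>F\<^esub>), smult = act F|)"

lemma extend_scalars_simps [simp]:
  "car (extend_scalars F) = car F" "0[extend_scalars F] = 0[F]"
  "x +[extend_scalars F] y = x +[F] y" "b *>[extend_scalars F] x = act F b x" by (auto simp: extend_scalars_def)

context
  fixes F :: "('a, 'e, 'm) module_scheme"
  assumes F: "divisible_by_T F"
begin

interpretation F: module A F using F by (simp add: divisible_by_T_def)

lemma T_cancel:
  assumes "s : T" "x : car F" "y : car F" "s *>[F] x = s *>[F] y"
  shows "x = y"
proof -
  have sc: "s : car A" using assms T_carrier by auto
  have "s *>[F] (x +[F] -[F] y) = 0[F]" using assms sc by (simp add: F.smult_r_distr F.smult_r_minus F.M.r_neg)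
  hence "x +[F] -[F] y = 0[F]" using F assms unfolding divisible_by_T_def by simp
  thus ?thesis using assms by (metis F.M.a_comm F.M.a_inv_closed F.M.minus_equality F.M.minus_minus)
qed

lemma T_divide: "[|s : T; x : car F|] ==> EX y:car F. s *>[F] y = x"
  using F unfolding divisible_by_T_def by simp

lemma smult_left_commute: "[|a : car A; b : car A; x : car F|] ==>
    a *>[F] (b *>[F] x) = b *>[F] (a *>[F] x)" by (simp add: F.smult_assoc1[symmetric] A.m_comm)

lemma act_unique:
  assumes "x : car F" "b : car B" "a : car A" "s : T" "phi s *[B] b = phi a" "y : car F" "s *>[F] y = a *>[F] x"
    and "a' : car A" "s' : T" "phi s' *[B] b = phi a'" "y' : car F" "s' *>[F] y' = a' *>[F] x"
  shows "y = y'"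
proof -
  have c: "s : car A" "s' : car A" using assms T_carrier by auto
  have "phi (s' *[A] a) = phi s' *[B] (phi s *[B] b)" using assms c by (simp add: phi_mult)
  also have "... = phi s *[B] (phi s' *[B] b)" using assms(2) c phi_in by (simp add: B.m_lcomm)
  also have "... = phi (s *[A] a')" using assms c by (simp add: phi_mult)
  finally obtain t where t: "t : T" "t *[A] (s' *[A] a) = t *[A] (s *[A] a')" using phi_eq[of "s' *[A] a" "s *[A] a'"] assms c by (metis A.m_closed)
  have tc: "t : car A" using t T_carrier by auto
  have "(t *[A] (s *[A] s')) *>[F] y = t *>[F] (s' *>[F] (s *>[F] y))" using assms(6) c tc by (simp add: F.smult_assoc1 smult_left_commute)
  also have "... = (t *[A] (s' *[A] a)) *>[F] x" using assms(1,3,7) c tc by (simp add: F.smult_assoc1)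
  also have "... = t *>[F] (s *>[F] (a' *>[F] x))" unfolding t(2) using assms(1,8) c tc by (simp add: F.smult_assoc1)
  also have "... = (t *[A] (s *[A] s')) *>[F] y'" using assms(11,12) c tc by (simp add: F.smult_assoc1)
  finally show ?thesis using T_cancel[of "t *[A] (s *[A] s')" y y'] T_mult t(1) assms(4,9,6,11) by simp
qed

lemma act_eqI:
  assumes "x : car F" "b : car B" "a : car A" "s : T" "phi s *[B] b = phi a" "y : car F" "s *>[F] y = a *>[F] x"
  shows "act F b x = y"
  unfolding act_def
proof (rule the_equality)
  show "y : car F & (EX a:car A. EX s:T. phi s *[B] b = phi a & s *>[F] y = a *>[F] x)" using assms(3-7) by blast
  fix y' assume "y' : car F & (EX a:car A. EX s:T. phi s *[B] b = phi a & s *>[F] y' = a *>[F] x)"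
  then obtain a' s' where "y' : car F" "a' : car A" "s' : T" "phi s' *[B] b = phi a'" "s' *>[F] y' = a' *>[F] x" by auto
  thus "y' = y" using act_unique[OF assms(1,2) _ _ _ _ _ assms(3-7)] by simp
qed

lemma act_spec:
  assumes "x : car F" "b : car B" "a : car A" "s : T" "phi s *[B] b = phi a"
  shows "s *>[F] act F b x = a *>[F] x"
proof -
  obtain y where y: "y : car F" "s *>[F] y = a *>[F] x" using T_divide[OF assms(4) F.smult_closed[OF assms(3,1)]] by auto
  thus ?thesis using act_eqI[OF assms y] by simp
qed

lemma act_closed:
  assumes "x : car F" "b : car B" shows "act F b x : car F"
proof -
  obtain a s where as: "a : car A" "s : T" "phi s *[B] b = phi a" using phi_surj assms(2) by blast
  obtain y where y: "y : car F" "s *>[F] y = a *>[F] x" using T_divide[OF as(2) F.smult_closed[OF as(1) assms(1)]] by auto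
  thus ?thesis using act_eqI[OF assms as y] by simp
qed

lemma act_phi: "[|x : car F; a : car A|] ==> act F (phi a) x = a *>[F] x"
  by (rule act_eqI[where s="1[A]" and a=a]) (auto simp: T_one phi_in phi_one)

lemma extend_scalars_module: "module B (extend_scalars F)"
proof (rule moduleI[OF B_cring])
  show "abelian_group (extend_scalars F)"
  proof (rule abelian_groupI)
    show "EX y:car (extend_scalars F). y +[extend_scalars F] x = 0[extend_scalars F]"
      if "x : car (extend_scalars F)" for x using that by (intro bexI[of _ "-[F] x"]) (auto simp: F.M.l_neg)
  qed (auto simp: F.M.a_ac)
  show "b *>[extend_scalars F] x : car (extend_scalars F)" if "b : car B" "x : car (extend_scalars F)" for b x using act_closed that by simp
  show "1[B] *>[extend_scalars F] x = x" if "x : car (extend_scalars F)" for x using act_phi[of x "1[A]"] that phi_one by simp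
  fix b b' assume b: "b : car B" "b' : car B"
  obtain a s a' s' where as: "a : car A" "s : T" "phi s *[B] b = phi a" "a' : car A" "s' : T" "phi s' *[B] b' = phi a'" using phi_surj b by metis
  have c: "s : car A" "s' : car A" using as T_carrier by auto
  fix x assume "x : car (extend_scalars F)"
  hence x: "x : car F" by simp
  let ?y = "act F b x" and ?y' = "act F b' x"
  have y: "?y : car F" "?y' : car F" "s *>[F] ?y = a *>[F] x" "s' *>[F] ?y' = a' *>[F] x"
    using act_closed[OF x b(1)] act_closed[OF x b(2)] act_spec[OF x b(1) as(1-3)] act_spec[OF x b(2) as(4-6)] .
  have "act F (b +[B] b') x = ?y +[F] ?y'"
  proof (rule act_eqI[where s="s *[A] s'" and a="s' *[A] a +[A] s *[A] a'"])
    have "phi s *[B] phi s' *[B] (b +[B] b') = phi s' *[B] (phi s *[B] b) +[B] phi s *[B] (phi s' *[B] b')"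
      using b phi_in[OF c(1)] phi_in[OF c(2)] by algebra
    thus "phi (s *[A] s') *[B] (b +[B] b') = phi (s' *[A] a +[A] s *[A] a')" using as c by (simp add: phi_mult phi_add)
    have "(s *[A] s') *>[F] (?y +[F] ?y') = s' *>[F] (s *>[F] ?y) +[F] s *>[F] (s' *>[F] ?y')"
      using y(1,2) c by (simp add: F.smult_r_distr F.smult_assoc1 smult_left_commute)
    thus "(s *[A] s') *>[F] (?y +[F] ?y') = (s' *[A] a +[A] s *[A] a') *>[F] x" using y c as(1,4) x by (simp add: F.smult_l_distr F.smult_assoc1)
  qed (use b c as(1,2,4,5) T_mult x y(1,2) in auto)
  thus "(b +[B] b') *>[extend_scalars F] x = b *>[extend_scalars F] x +[extend_scalars F] b' *>[extend_scalars F] x" by simp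
  have "act F (b *[B] b') x = act F b ?y'"
  proof (rule act_eqI[where s="s *[A] s'" and a="a *[A] a'"])
    have "phi s *[B] phi s' *[B] (b *[B] b') = (phi s *[B] b) *[B] (phi s' *[B] b')" using b phi_in[OF c(1)] phi_in[OF c(2)] by algebra
    thus "phi (s *[A] s') *[B] (b *[B] b') = phi (a *[A] a')" using as c by (simp add: phi_mult)
    have "(s *[A] s') *>[F] act F b ?y' = s' *>[F] (s *>[F] act F b ?y')"
      using act_closed[OF y(2) b(1)] c by (simp add: F.smult_assoc1 smult_left_commute)
    also have "... = a *>[F] (s' *>[F] ?y')" using act_spec[OF y(2) b(1) as(1-3)] smult_left_commute[OF c(2) as(1) y(2)] by simp
    finally show "(s *[A] s') *>[F] act F b ?y' = (a *[A] a') *>[F] x" using y(4) as(1,4) x by (simp add: F.smult_assoc1)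
  qed (use b c as(1,2,4,5) T_mult x act_closed[OF y(2) b(1)] in auto)
  thus "(b *[B] b') *>[extend_scalars F] x = b *>[extend_scalars F] (b' *>[extend_scalars F] x)" by simp
  fix z assume "z : car (extend_scalars F)"
  hence z: "z : car F" by simp
  have "act F b (x +[F] z) = act F b x +[F] act F b z" by (rule act_eqI[OF _ b(1) as(1-3)])
      (use x z c as(1) act_closed[OF _ b(1)] act_spec[OF _ b(1) as(1-3)] in "auto simp: F.smult_r_distr")
  thus "b *>[extend_scalars F] (x +[extend_scalars F] z) =
      b *>[extend_scalars F] x +[extend_scalars F] b *>[extend_scalars F] z" by simp
qed

text \<open>The map \<open>g\<close> is pulled back to the preimage of \<open>J\<close> in
  \<open>A\<close>. The element found there represents \<open>g\<close> on all of \<open>J\<close>,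
  since every element of \<open>J\<close> becomes some \<open>phi a\<close> after multiplication by
  some \<open>phi s\<close>, and \<open>s\<close> can be cancelled in \<open>F\<close>.\<close>

lemma extend_scalars_baer:
  assumes "baer A F" shows "baer B (extend_scalars F)"
proof (rule baerI[OF extend_scalars_module])
  fix J g assume J: "ideal J B" and g: "!!j. j : J ==> g j : car (extend_scalars F)"
      "!!i j. [|i : J; j : J|] ==> g (i +[B] j) = g i +[extend_scalars F] g j"
      "!!a j. [|a : car B; j : J|] ==> g (a *[B] j) = a *>[extend_scalars F] g j"
  note cJ = B.idealD[OF J]
  let ?I = "{a : car A. phi a : J}"
  have I: "ideal ?I A" by (rule A.ideal_criterion) (use cJ phi_in in "auto simp: phi_zero phi_add phi_mult")
  have "EX e:car F. ALL a:?I. g (phi a) = a *>[F] e"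
  proof (rule baerD[OF assms I, of "%a. g (phi a)"])
    show "g (phi (a *[A] j)) = a *>[F] g (phi j)" if aj: "a : car A" "j : ?I" for a j
    proof -
      have j: "j : car A" "phi j : J" using aj by auto
      have "g (phi (a *[A] j)) = act F (phi a) (g (phi j))" using g(3)[OF phi_in[OF aj(1)] j(2)] phi_mult[OF aj(1) j(1)] by simp
      also have "... = a *>[F] g (phi j)" by (rule act_phi) (use g(1)[OF j(2)] aj in auto)
      finally show ?thesis .
    qed
    show "g (phi (i +[A] j)) = g (phi i) +[F] g (phi j)" if ij: "i : ?I" "j : ?I" for i j
    proof -
      have "i : car A" "phi i : J" "j : car A" "phi j : J" using ij by auto
      thus ?thesis using g(2)[of "phi i" "phi j"] phi_add[of i j] by simp
    qed
    show "g (phi j) : car F" if "j : ?I" for j using g(1)[of "phi j"] that by simp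
  qed
  then obtain e where e: "e : car F" "!!a. [|a : car A; phi a : J|] ==> g (phi a) = a *>[F] e" by blast
  have "g b = act F b e" if b: "b : J" for b
  proof -
    have bc: "b : car B" using cJ b by auto
    obtain a s where as: "a : car A" "s : T" "phi s *[B] b = phi a" using phi_surj bc by blast
    have sc: "s : car A" using as T_carrier by auto
    have "phi a : J" using as(3) cJ(7)[OF phi_in[OF sc] b] by simp
    hence "a *>[F] e = g (phi s *[B] b)" using e(2)[OF as(1)] as(3) by simp
    also have "... = s *>[F] g b" using g(3)[OF phi_in[OF sc] b] g(1)[OF b] act_phi sc by simp
    finally show ?thesis using act_eqI[OF e(1) bc as, of "g b"] g(1)[OF b] by simp
  qed
  thus "EX e:car (extend_scalars F). ALL j:J. g j = j *>[extend_scalars F] e" using e(1) by auto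
qed

end

text \<open>A map that respects scalars from \<open>A\<close> also respects fractions, because
  denominators can be cancelled in \<open>G\<close>.\<close>

lemma act_linear:
  assumes F: "divisible_by_T F" "divisible_by_T G" and h: "!!x. x : car F ==> h x : car G"
    "!!a x. [|a : car A; x : car F|] ==> h (a *>[F] x) = a *>[G] h x"
    and "b : car B" "x : car F"
  shows "h (act F b x) = act G b (h x)"
proof -
  obtain a s where as: "a : car A" "s : T" "phi s *[B] b = phi a" using phi_surj assms(5) by blast
  have "s *>[G] h (act F b x) = a *>[G] h x" using h(2)[OF T_carrier[OF as(2)] act_closed[OF F(1) assms(6,5)]] h(2)[OF as(1) assms(6)]
      act_spec[OF F(1) assms(6,5) as] by simp
  thus ?thesis using act_eqI[OF F(2) h(1)[OF assms(6)] assms(5) as h(1)[OF act_closed[OF F(1) assms(6,5)]]] by simp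
qed

text \<open>Over a Noetherian ring the \<open>T\<close>-torsion of an injective module is injective, hence a direct
  summand, and the complement is the localization.\<close>

lemma finite_torsion:
  assumes "module A E" "finite X" "X <= car E" "!!x. x : X ==> EX s:T. s *>[E] x = 0[E]"
  shows "EX s:T. ALL x:X. s *>[E] x = 0[E]"
  using assms(2-4)
proof (induction X rule: finite_induct)
  case empty
  thus ?case using T_one by auto
next
  case (insert x X)
  interpret E: module A E by fact
  obtain s t where st: "s : T" "ALL x:X. s *>[E] x = 0[E]" "t : T" "t *>[E] x = 0[E]" using insert by (metis insert_iff insert_subset)
  have c: "s : car A" "t : car A" using st T_carrier by auto
  have "(s *[A] t) *>[E] y = 0[E]" if y: "y : insert x X" for y
  proof -
    have yc: "y : car E" using y insert.prems by auto
    show ?thesis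
    proof (cases "y = x")
      case True thus ?thesis using st c yc by (simp add: E.smult_assoc1)
    next
      case False
      hence "s *>[E] y = 0[E]" using y st by auto
      thus ?thesis using c yc by (simp add: A.m_comm[of s t] E.smult_assoc1)
    qed
  qed
  thus ?case using T_mult st by blast
qed

definition torsion :: "('a, 'e, 'm) module_scheme => 'e set"
  where "torsion E = {x : car E. EX s:T. s *>[E] x = 0[E]}"

lemma torsion_submodule:
  assumes "module A E" shows "submodule (torsion E) A E"
proof -
  interpret E: module A E by fact
  show ?thesis
  proof (rule E.submodule_criterion)
    show "torsion E <= car E" by (auto simp: torsion_def)
    show "0[E] : torsion E" using T_one E.smult_r_null[OF A.one_closed] by (auto simp: torsion_def intro!: bexI[of _ "1[A]"])
    show "x +[E] y : torsion E" if xy: "x : torsion E" "y : torsion E" for x y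
    proof -
      obtain s where "s : T" "ALL z:{x, y}. s *>[E] z = 0[E]" using finite_torsion[OF assms, of "{x, y}"] xy by (auto simp: torsion_def)
      thus ?thesis using xy T_carrier by (auto simp: torsion_def E.smult_r_distr intro!: bexI[of _ s])
    qed
    show "a *>[E] x : torsion E" if ax: "a : car A" "x : torsion E" for a x
    proof -
      obtain s where s: "s : T" "s *>[E] x = 0[E]" "x : car E" using ax by (auto simp: torsion_def)
      have "s *>[E] (a *>[E] x) = a *>[E] (s *>[E] x)" using s(1,3) ax(1) T_carrier by (simp add: E.smult_assoc1[symmetric] A.m_comm)
      thus ?thesis using s ax by (auto simp: torsion_def)
    qed
  qed
qed

lemma T_pow: "s : T ==> s [^]\<^bsub>A\<^esub> (k::nat) : T"
  by (induction k) (auto simp: T_one T_mult)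

context
  fixes E :: "('a, 'e, 'm) module_scheme"
  assumes noeth: "noetherian_ring A" and E: "baer A E"
begin

interpretation NA: noetherian_cring A using noeth A_cring by (simp add: noetherian_cring_def)

interpretation E: module A E using E by (rule baer_module)

text \<open>The exponent where the ascending chain of ideals \<open>(J : s^k)\<close> stops; it
  absorbs the failure of \<open>s\<close> to be a nonzerodivisor whenever an equation is divided by
  \<open>s\<close> below.\<close>

lemma colon_powers_stable:
  assumes "ideal J A" "s : car A"
  obtains k where "colon A J (s [^]\<^bsub>A\<^esub> Suc k) <= colon A J (s [^]\<^bsub>A\<^esub> (k::nat))"
proof -
  let ?S = "range (%k::nat. colon A J (s [^]\<^bsub>A\<^esub> k))"
  have "?S ~= {}" by auto
  hence "EX M:?S. ALL K:?S. M <= K --> K = M" by (rule NA.ideal_family_maximal) (use assms A.colon_ideal in auto)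
  then obtain M where M: "M : ?S" and max: "ALL K:?S. M <= K --> K = M" by (rule bexE)
  then obtain k :: nat where k: "M = colon A J (s [^]\<^bsub>A\<^esub> k)" by (rule_tac rangeE)
  have "colon A J (s [^]\<^bsub>A\<^esub> k) <= colon A J (s *[A] s [^]\<^bsub>A\<^esub> k)" by (rule A.colon_mult_subset) (use assms in auto)
  moreover have "s *[A] s [^]\<^bsub>A\<^esub> k = s [^]\<^bsub>A\<^esub> Suc k" using assms by (simp add: A.m_comm)
  ultimately have "M <= colon A J (s [^]\<^bsub>A\<^esub> Suc k)" using k by simp
  hence "colon A J (s [^]\<^bsub>A\<^esub> Suc k) = M" using bspec[OF max rangeI, of "Suc k"] by simp
  thus ?thesis using that[of k] k by simp
qed

text \<open>Let \<open>e\<close> represent \<open>g\<close> in \<open>E\<close>. As \<open>J\<close>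
  is finitely generated, one \<open>s\<close> in \<open>T\<close> annihilates \<open>J e\<close>.
  The aim is an element \<open>w\<close> killed by \<open>J\<close> that agrees with
  \<open>e\<close> after multiplication by a power of \<open>s\<close>: then \<open>e - w\<close> is
  torsion and still represents \<open>g\<close>.\<close>

lemma torsion_baer: "baer A (E(|carrier := torsion E|))"
proof (rule baerI)
  show "module A (E(|carrier := torsion E|))" by (rule submodule.submodule_is_module[OF torsion_submodule[OF E.module_axioms] E.module_axioms])
  fix J g assume J: "ideal J A" and g: "!!j. j : J ==> g j : car (E(|carrier := torsion E|))"
      "!!i j. [|i : J; j : J|] ==> g (i +[A] j) = g i +[E(|carrier := torsion E|)] g j"
      "!!a j. [|a : car A; j : J|] ==> g (a *[A] j) = a *>[E(|carrier := torsion E|)] g j"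
  note cJ = A.idealD[OF J]
  have "EX e:car E. ALL j:J. g j = j *>[E] e" by (rule baerD[OF E J]) (use g in "auto simp: torsion_def")
  then obtain e where e: "e : car E" "!!j. j : J ==> g j = j *>[E] e" by blast
  obtain X where X: "X <= car A" "finite X" "J = Idl\<^bsub>A\<^esub> X" using NA.finetely_gen[OF J] by auto
  have XJ: "X <= J" unfolding X(3) by (rule A.genideal_self[OF X(1)])
  have "EX s:T. ALL x:g ` X. s *>[E] x = 0[E]" by (rule finite_torsion[OF E.module_axioms]) (use X XJ g(1) in "auto simp: torsion_def")
  then obtain s where s: "s : T" "!!x. x : X ==> s *>[E] (x *>[E] e) = 0[E]" using e(2) XJ by (metis image_eqI subsetD)
  have sc: "s : car A" using s T_carrier by auto
  have "ideal {j : car A. j *>[E] (s *>[E] e) = 0[E]} A" by (rule A.ideal_criterion) (use sc e in "auto simp: E.smult_l_distr E.smult_assoc1")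
  moreover have "X <= {j : car A. j *>[E] (s *>[E] e) = 0[E]}"
  proof
    fix x assume x: "x : X"
    hence "x : car A" using X by auto
    hence "x *>[E] (s *>[E] e) = s *>[E] (x *>[E] e)" using sc e by (simp add: E.smult_assoc1[symmetric] A.m_comm)
    thus "x : {j : car A. j *>[E] (s *>[E] e) = 0[E]}" using s(2)[OF x] \<open>x : car A\<close> by simp
  qed
  ultimately have kill: "j *>[E] (s *>[E] e) = 0[E]" if "j : J" for j using A.genideal_minimal that unfolding X(3) by blast
  obtain k where k: "colon A J (s [^]\<^bsub>A\<^esub> Suc k) <= colon A J (s [^]\<^bsub>A\<^esub> k)" using colon_powers_stable[OF J sc] .
  let ?t = "s [^]\<^bsub>A\<^esub> Suc k"
  have tc: "?t : car A" "s [^]\<^bsub>A\<^esub> k : car A" and tT: "?t : T" using sc T_pow[OF s(1), of "Suc k"] by auto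
  \<comment> \<open>Solvable because \<open>r s^(k+1)\<close> in \<open>J\<close> already implies
    \<open>r s^k\<close> in \<open>J\<close>, and \<open>J\<close> kills \<open>s e\<close>.\<close>
  have "EX w:car E. (ALL j:J. j *>[E] w = 0[E]) & ?t *>[E] w = ?t *>[E] e"
  proof (rule baer_divisible[OF E J tc(1)])
    fix r assume r: "r : car A" "r *[A] ?t : J"
    hence "r *[A] s [^]\<^bsub>A\<^esub> k : J" using k by (auto simp: colon_def)
    hence "(r *[A] s [^]\<^bsub>A\<^esub> k) *>[E] (s *>[E] e) = 0[E]" by (rule kill)
    thus "r *>[E] (?t *>[E] e) = 0[E]" using r(1) sc tc e by (simp add: E.smult_assoc1)
  qed (use tc e in auto)
  then obtain w where w: "w : car E" "!!j. j : J ==> j *>[E] w = 0[E]" "?t *>[E] w = ?t *>[E] e" by blast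
  let ?e = "e +[E] -[E] w"
  have "?t *>[E] ?e = 0[E]" using w e tc(1) E.smult_r_distr[of ?t e "-[E] w"] E.smult_r_minus[of ?t w] by (simp add: E.M.r_neg del: A.nat_pow_Suc)
  hence "?e : torsion E" using tT w e by (auto simp: torsion_def)
  moreover have "g j = j *>[E] ?e" if j: "j : J" for j
    using e(2)[OF j] w(2)[OF j] w(1) e(1) cJ(3)[OF j] by (simp add: E.smult_r_distr E.smult_r_minus)
  ultimately show "EX e:car (E(|carrier := torsion E|)). ALL j:J. g j = j *>[E(|carrier := torsion E|)] e" by auto
qed

text \<open>Since the torsion submodule is injective, its identity extends to a projection of
  \<open>E\<close> onto it. \<open>rho\<close> is the complementary projection, so its kernel is the
  torsion.\<close>

lemma torsion_complement:
  obtains F rho where "submodule F A E" "!!x. x : car E ==> rho x : F"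
    "!!x y. [|x : car E; y : car E|] ==> rho (x +[E] y) = rho x +[E] rho y"
    "!!a x. [|a : car A; x : car E|] ==> rho (a *>[E] x) = a *>[E] rho x"
    "!!x. x : F ==> rho x = x" "!!x. x : car E ==> rho x = 0[E] <-> x : torsion E"
proof -
  let ?G = "E(|carrier := torsion E|)"
  have G: "module A ?G" using torsion_baer by (rule baer_module)
  note ts = E.submoduleE[OF torsion_submodule[OF E.module_axioms]]
  have "EX h:module_hom A E ?G. ALL x:car ?G. h ((\<lambda>x\<in>torsion E. x) x) = (\<lambda>x\<in>torsion E. x) x"
  proof (rule baer_extension[OF torsion_baer G E.module_axioms])
    show "(\<lambda>x\<in>torsion E. x) : module_hom A ?G E" using ts by (auto simp: module_hom_def)
    show "(\<lambda>x\<in>torsion E. x) : module_hom A ?G ?G" using ts by (auto simp: module_hom_def)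
    show "inj_on (\<lambda>x\<in>torsion E. x) (car ?G)" by (auto simp: inj_on_def)
  qed
  then obtain prj where prj: "prj : module_hom A E ?G" "!!x. x : torsion E ==> prj x = x" by auto
  have prjc: "prj x : torsion E" "prj x : car E" if "x : car E" for x using module_homD(1)[OF prj(1) that] ts(1) by auto
  have prja: "prj (x +[E] y) = prj x +[E] prj y" if "x : car E" "y : car E" for x y using module_homD(2)[OF prj(1) that] by simp
  have prjs: "prj (a *>[E] x) = a *>[E] prj x" if "a : car A" "x : car E" for a x using module_homD(3)[OF prj(1) that] by simp
  have prjm: "prj (-[E] x) = -[E] prj x" if "x : car E" for x using prjs[of "-[A] 1[A]" x] that prjc[OF that] by (simp add: E.smult_l_minus)
  have prj0: "prj 0[E] = 0[E]" using prjs[of "0[A]" "0[E]"] prjc(2)[of "0[E]"] by simp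
  let ?F = "{x : car E. prj x = 0[E]}" and ?rho = "%x. x +[E] -[E] prj x"
  show ?thesis
  proof
    show "submodule ?F A E" by (rule E.submodule_criterion) (auto simp: prj0 prja prjs)
    show "?rho x : ?F" if "x : car E" for x using that prjc[OF that] prj(2)[OF prjc(1)[OF that]] by (simp add: prja prjm E.M.r_neg)
    show "?rho (x +[E] y) = ?rho x +[E] ?rho y" if "x : car E" "y : car E" for x y using that prjc by (simp add: prja E.M.minus_add E.M.a_ac)
    show "?rho (a *>[E] x) = a *>[E] ?rho x" if "a : car A" "x : car E" for a x using that prjc by (simp add: prjs E.smult_r_distr E.smult_r_minus)
    show "?rho x = x" if "x : ?F" for x using that by simp
    show "?rho x = 0[E] <-> x : torsion E" if x: "x : car E" for x
    proof
      assume "?rho x = 0[E]"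
      hence "x = prj x" using x prjc[OF x] by (metis E.M.a_comm E.M.a_inv_closed E.M.minus_equality E.M.minus_minus)
      thus "x : torsion E" using prjc(1)[OF x] by simp
    next
      assume "x : torsion E"
      thus "?rho x = 0[E]" using prj(2) x by (simp add: E.M.r_neg)
    qed
  qed
qed

text \<open>With \<open>k\<close> such that \<open>(0 : s^(k+1)) = (0 : s^k)\<close>, the equation
  \<open>s^(k+1) w = s^k x\<close> is solvable; thus \<open>s w = x\<close> holds up to an element
  killed by \<open>s^k\<close>.\<close>

lemma torsion_divide:
  assumes "s : T" "x : car E"
  obtains y where "y : car E" "s *>[E] y +[E] -[E] x : torsion E"
proof -
  have sc: "s : car A" using assms T_carrier by auto
  obtain k where k: "colon A {0[A]} (s [^]\<^bsub>A\<^esub> Suc k) <= colon A {0[A]} (s [^]\<^bsub>A\<^esub> k)" using colon_powers_stable[OF A.zeroideal sc] .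
  let ?p = "s [^]\<^bsub>A\<^esub> k"
  have pc: "?p : car A" "s [^]\<^bsub>A\<^esub> Suc k : car A" and pT: "?p : T" using sc T_pow[OF assms(1)] by auto
  have "EX w:car E. (ALL j:{0[A]}. j *>[E] w = 0[E]) & s [^]\<^bsub>A\<^esub> Suc k *>[E] w = ?p *>[E] x"
  proof (rule baer_divisible[OF E A.zeroideal pc(2)])
    fix r assume r: "r : car A" "r *[A] s [^]\<^bsub>A\<^esub> Suc k : {0[A]}"
    hence "r *[A] ?p = 0[A]" using k by (auto simp: colon_def)
    thus "r *>[E] (?p *>[E] x) = 0[E]" using r(1) pc assms by (simp add: E.smult_assoc1[symmetric])
  qed (use pc assms in auto)
  then obtain w where w: "w : car E" "s [^]\<^bsub>A\<^esub> Suc k *>[E] w = ?p *>[E] x" by blast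
  have "?p *>[E] (s *>[E] w +[E] -[E] x) = 0[E]" using w pc sc assms by (simp add: E.smult_r_distr E.smult_r_minus E.smult_assoc1 E.M.r_neg)
  thus ?thesis using that[OF w(1)] pT w sc assms by (auto simp: torsion_def)
qed

end

end

section \<open>Finite injective dimension under localization\<close>

text \<open>A finite injective coresolution whose terms live on an arbitrary type \<open>'e\<close>,
  in contrast to \<open>inj_dim\<close>.\<close>

locale coresolution =
  fixes R :: "('a, 'r) ring_scheme" and M :: "('a, 'b, 'm) module_scheme" and n :: nat
    and eps :: "'b => 'e" and E :: "nat => ('a, 'e) module" and d :: "nat => 'e => 'e"
  assumes E_baer: "!!i. baer R (E i)"
    and d_closed: "!!i x. x : car (E i) ==> d i x : car (E (Suc i))"
    and d_add: "!!i x y. [|x : car (E i); y : car (E i)|] ==> d i (x +[E i] y) = d i x +[E (Suc i)] d i y"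
    and d_smult: "!!i a x. [|a : car R; x : car (E i)|] ==> d i (a *>[E i] x) = a *>[E (Suc i)] d i x"
    and eps_closed: "!!c. c : car M ==> eps c : car (E 0)"
    and eps_add: "!!c c'. [|c : car M; c' : car M|] ==> eps (c +[M] c') = eps c +[E 0] eps c'"
    and eps_smult: "!!a c. [|a : car R; c : car M|] ==> eps (a *>[M] c) = a *>[E 0] eps c"
    and eps_inj: "!!c. [|c : car M; eps c = 0[E 0]|] ==> c = 0[M]"
    and exact_0: "!!x. x : car (E 0) ==> d 0 x = 0[E 1] <-> (EX c:car M. x = eps c)"
    and exact: "!!i x. x : car (E (Suc i)) ==>
      d (Suc i) x = 0[E (Suc (Suc i))] <-> (EX y:car (E i). x = d i y)"
    and E_vanish: "!!i. n < i ==> car (E i) = {0[E i]}"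
begin

sublocale E: module R "E i" for i by (rule baer_module[OF E_baer])

lemma d_zero: "d i 0[E i] = 0[E (Suc i)]"
  using d_smult[of "0[R]" "0[E i]" i] d_closed[of "0[E i]" i] by simp

lemma d_d: "x : car (E i) ==> d (Suc i) (d i x) = 0[E (Suc (Suc i))]"
  using exact d_closed by blast

lemma d_eps: "c : car M ==> d 0 (eps c) = 0[E 1]"
  using exact_0 eps_closed by blast

end

lemma a_kernel_eq: "a_kernel G H h = {x : car G. h x = 0[H]}"
  by (simp add: a_kernel_def kernel_def)

lemma inj_dim_finite_imp_coresolution:
  fixes R :: "('a, 'r) ring_scheme" and M :: "('a, 'b, 'm) module_scheme"
  assumes "inj_dim R M < \<infinity>" "module R M"
  shows "EX n eps (E :: nat => ('a, (nat + 'a + 'b) set) module) d. coresolution R M n eps E d"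
proof -
  interpret M: module R M by fact
  let ?S = "{enat n | n. \<exists>eps (E :: nat => ('a, (nat + 'a + 'b) set) module) d.
      injective_resolution R M eps E d & (ALL i>n. car (E i) = {0[E i]})}"
  have "?S ~= {}"
  proof
    assume "?S = {}"
    hence "inj_dim R M = Inf {}" unfolding inj_dim_def by (rule arg_cong)
    hence "inj_dim R M = \<infinity>" by (simp add: top_enat_def)
    thus False using assms by simp
  qed
  then obtain n eps d and E :: "nat => ('a, (nat + 'a + 'b) set) module"
    where r: "injective_resolution R M eps E d" and v: "ALL i>n. car (E i) = {0[E i]}" by blast
  have i: "injective_module R (E i)" for i using r by (simp add: injective_resolution_def)
  have eps: "eps : module_hom R M (E 0)" "inj_on eps (car M)" using r by (auto simp: injective_resolution_def)
  have d: "d i : module_hom R (E i) (E (Suc i))" for i using r by (auto simp: injective_resolution_def)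
  have k0: "eps ` car M = a_kernel (E 0) (E 1) (d 0)" using r by (auto simp: injective_resolution_def)
  have k: "d i ` car (E i) = a_kernel (E (Suc i)) (E (Suc (Suc i))) (d (Suc i))" for i using r by (auto simp: injective_resolution_def)
  interpret E0: module R "E 0" using baer_module[OF injective_imp_baer[OF i]] .
  have "eps 0[M] = 0[E 0]" using module_homD(3)[OF eps(1), of "0[R]" "0[M]"] module_homD(1)[OF eps(1), of "0[M]"] by simp
  hence inj: "c = 0[M]" if "c : car M" "eps c = 0[E 0]" for c using inj_onD[OF eps(2), of c "0[M]"] that by simp
  have "coresolution R M n eps E d"
  proof
    show "d 0 x = 0[E 1] <-> (EX c:car M. x = eps c)" if "x : car (E 0)" for x using k0 that unfolding a_kernel_eq by blast
    show "d (Suc i) x = 0[E (Suc (Suc i))] <-> (EX y:car (E i). x = d i y)" if "x : car (E (Suc i))" for i x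
      using k[of i] that unfolding a_kernel_eq by blast
  qed (use injective_imp_baer[OF i] module_homD[OF eps(1)] module_homD[OF d] inj v in auto)
  thus ?thesis by blast
qed

lemma coresolution_imp_inj_dim_finite:
  fixes R :: "('a, 'r) ring_scheme" and M :: "('a, 'b, 'm) module_scheme"
    and E :: "nat => ('a, (nat + 'a + 'b) set) module"
  assumes "coresolution R M n eps E d" "module R M"
  shows "inj_dim R M < \<infinity>"
proof -
  interpret coresolution R M n eps E d by fact
  interpret M: module R M by fact
  let ?e = "\<lambda>x\<in>car M. eps x" and ?d = "%i. \<lambda>x\<in>car (E i). d i x"
  have "injective_resolution R M ?e E ?d" unfolding injective_resolution_def
  proof (intro conjI allI)
    show "injective_module R (E i)" for i by (rule baer_imp_injective[OF E_baer])
    show "?e : module_hom R M (E 0)" by (rule restrict_module_hom) (auto simp: eps_closed eps_add eps_smult)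
    show "?d i : module_hom R (E i) (E (Suc i))" for i by (rule restrict_module_hom) (auto simp: d_closed d_add d_smult)
    show "inj_on ?e (car M)"
    proof (rule inj_onI)
      fix x y assume x: "x : car M" and y: "y : car M" and "?e x = ?e y"
      hence eq: "eps x = eps y" by simp
      have "eps (-[M] y) = -[E 0] eps y" using eps_smult[of "-[R] 1[R]" y] y eps_closed[OF y] by (simp add: M.smult_l_minus E.smult_l_minus)
      hence "eps (x +[M] -[M] y) = 0[E 0]" using x y eq eps_closed by (simp add: eps_add E.M.r_neg)
      hence "x +[M] -[M] y = 0[M]" using eps_inj x y by simp
      thus "x = y" using x y by (metis M.M.a_comm M.M.a_inv_closed M.M.minus_equality M.M.minus_minus)
    qed
    show "?e ` car M = a_kernel (E 0) (E 1) (?d 0)" unfolding a_kernel_eq using exact_0 eps_closed by auto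
    show "?d i ` car (E i) = a_kernel (E (Suc i)) (E (Suc (Suc i))) (?d (Suc i))" for i
      unfolding a_kernel_eq using exact[of _ i] d_closed[of _ i] by auto
  qed
  hence "enat n : {enat n | n. \<exists>eps (E :: nat => ('a, (nat + 'a + 'b) set) module) d.
      injective_resolution R M eps E d & (ALL i>n. car (E i) = {0[E i]})}" using E_vanish by blast
  hence "inj_dim R M <= enat n" unfolding inj_dim_def by (rule Inf_lower)
  thus ?thesis using enat_ord_simps(4) order_le_less_trans by blast
qed

text \<open>Any coresolution, on whatever type, has a subcoresolution on the type used by \<open>inj_dim\<close>
  (downward Loewenheim-Skolem): close the module under the module operations, the differentials, a choice of
  preimages under them, and a choice of solutions of finite systems of equations
  \<open>r e = y\<close>. By Baer's criterion for finitely generated ideals the closure consists of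
  injective modules. Its elements are named by terms; a term denotes a list of pairs, and an element \<open>e\<close> is
  represented by a singleton list.\<close>

datatype ('a, 'b) closure_term =
    Base 'b
  | Const nat
  | Unary nat nat 'a "('a, 'b) closure_term"
  | Binary nat 'a "('a, 'b) closure_term" "('a, 'b) closure_term"

text \<open>The summand \<open>nat\<close> makes \<open>nat + 'a + 'b\<close> infinite, so the type
  carries a pairing function. Terms are coded with it by recursion, the numbers 0 to 3 serving as
  tags of the constructors.\<close>

lemma closure_term_injection: "EX f :: ('a, 'b) closure_term => (nat + 'a + 'b) set. inj f"
proof -
  let ?U = "UNIV :: (nat + 'a + 'b) set"
  have "infinite ?U" by (simp add: finite_Plus_UNIV_iff)
  hence "(card_of (?U \<times> ?U), card_of ?U) : ordIso" by (rule card_of_Times_same_infinite)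
  hence "(card_of (?U \<times> ?U), card_of ?U) : ordLeq" by (rule ordIso_imp_ordLeq)
  then obtain p :: "(nat + 'a + 'b) \<times> (nat + 'a + 'b) => nat + 'a + 'b" where p: "inj p" unfolding card_of_ordLeq[symmetric] by auto
  have pe: "p (a, b) = p (c, e) <-> a = c & b = e" for a b c e using injD[OF p] by blast
  define code :: "('a, 'b) closure_term => nat + 'a + 'b" where
    "code = rec_closure_term (%b. p (Inl 0, Inr (Inr b))) (%n. p (Inl 1, Inl n))
      (%k i a _ t. p (Inl 2, p (Inl k, p (Inl i, p (Inr (Inl a), t)))))
      (%i a _ _ t u. p (Inl 3, p (Inl i, p (Inr (Inl a), p (t, u)))))"
  have code_simps: "code (Base b) = p (Inl 0, Inr (Inr b))" "code (Const m) = p (Inl 1, Inl m)"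
    "code (Unary k i a t) = p (Inl 2, p (Inl k, p (Inl i, p (Inr (Inl a), code t))))"
    "code (Binary i a t u) = p (Inl 3, p (Inl i, p (Inr (Inl a), p (code t, code u))))" for b m k i a t u by (simp_all add: code_def)
  have "t = u" if "code t = code u" for t u using that
  proof (induction t arbitrary: u)
    case (Base x) thus ?case by (cases u) (auto simp: code_simps pe)
  next
    case (Const x) thus ?case by (cases u) (auto simp: code_simps pe)
  next
    case (Unary x1 x2 x3 t) thus ?case by (cases u) (auto simp: code_simps pe)
  next
    case (Binary x1 x2 t1 t2) thus ?case by (cases u) (auto simp: code_simps pe)
  qed
  hence "inj (%t. {code t})" by (auto intro!: injI)
  thus ?thesis by blast
qed

definition image_module :: "('b => 'c) => ('a, 'b, 'm) module_scheme => ('a, 'c) module"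
  where "image_module c M =
    (let c' = inv_into (car M) c in
    (|carrier = c ` car M, monoid.mult = undefined, one = undefined, ring.zero = c 0[M],
     add = (%x y. c (c' x +[M] c' y)), smult = (%a x. c (a *>[M] c' x))|))"

context
  fixes c :: "'b => 'c" and M :: "('a, 'b, 'm) module_scheme"
  assumes c: "inj_on c (car M)"
begin

lemma image_module_simps:
  "car (image_module c M) = c ` car M" "0[image_module c M] = c 0[M]"
  "[|x : car M; y : car M|] ==> c x +[image_module c M] c y = c (x +[M] y)"
  "x : car M ==> a *>[image_module c M] c x = c (a *>[M] x)" using c by (auto simp: image_module_def Let_def)

lemma image_module_module:
  assumes "module R M" shows "module R (image_module c M)"
proof -
  interpret M: module R M by fact
  show ?thesis
  proof (rule moduleI[OF M.R.is_cring])
    show "abelian_group (image_module c M)"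
    proof (rule abelian_groupI)
      show "EX y:car (image_module c M). y +[image_module c M] x = 0[image_module c M]"
        if x: "x : car (image_module c M)" for x
      proof -
        obtain u where u: "u : car M" "x = c u" using x by (auto simp: image_module_simps)
        hence "c (-[M] u) +[image_module c M] x = 0[image_module c M]" by (simp add: image_module_simps M.M.l_neg)
        thus ?thesis using u by (intro bexI[of _ "c (-[M] u)"]) (auto simp: image_module_simps)
      qed
    qed (auto simp: image_module_simps M.M.a_ac)
  qed (auto simp: image_module_simps M.smult_l_distr M.smult_r_distr M.smult_assoc1)
qed

lemma image_module_baer:
  assumes "baer R M" shows "baer R (image_module c M)"
proof (rule baerI[OF image_module_module[OF baer_module[OF assms]]])
  interpret M: module R M using assms by (rule baer_module)
  fix J g assume J: "ideal J R" and g: "!!j. j : J ==> g j : car (image_module c M)"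
      "!!i j. [|i : J; j : J|] ==> g (i +[R] j) = g i +[image_module c M] g j"
      "!!a j. [|a : car R; j : J|] ==> g (a *[R] j) = a *>[image_module c M] g j"
  have "EX u. u : car M & g j = c u" if "j : J" for j using g(1)[OF that] by (auto simp: image_module_simps)
  then obtain h where h: "!!j. j : J ==> h j : car M" "!!j. j : J ==> g j = c (h j)" by metis
  have ceq: "x = y" if "c x = c y" "x : car M" "y : car M" for x y using inj_onD[OF c that] .
  have "EX e:car M. ALL j:J. h j = j *>[M] e"
  proof (rule baerD[OF assms J h(1)])
    show "h (i +[R] j) = h i +[M] h j" if ij: "i : J" "j : J" for i j
    proof -
      have s: "i +[R] j : J" using M.R.idealD(4)[OF J ij] .
      have "c (h (i +[R] j)) = c (h i +[M] h j)" using g(2)[OF ij] h(2)[OF s] h(2)[OF ij(1)] h(2)[OF ij(2)] h(1) ij by (simp add: image_module_simps)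
      thus ?thesis using ceq h(1) s ij by simp
    qed
    show "h (a *[R] j) = a *>[M] h j" if aj: "a : car R" "j : J" for a j
    proof -
      have s: "a *[R] j : J" using M.R.idealD(7)[OF J aj] .
      have "c (h (a *[R] j)) = c (a *>[M] h j)" using g(3)[OF aj] h(2)[OF s] h(2)[OF aj(2)] h(1) aj by (simp add: image_module_simps)
      thus ?thesis using ceq h(1) s aj by simp
    qed
  qed
  then obtain e where e: "e : car M" "!!j. j : J ==> h j = j *>[M] e" by blast
  thus "EX e:car (image_module c M). ALL j:J. g j = j *>[image_module c M] e" using h by (intro bexI[of _ "c e"]) (auto simp: image_module_simps)
qed

end

context coresolution
begin

definition sol :: "nat => ('a \<times> 'e) list => 'e"
  where "sol i l = (SOME e. e : car (E i) & (ALL p:set l. fst p *>[E i] e = snd p))"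

definition pre :: "nat => 'e => 'e"
  where "pre i y = (SOME x. x : car (E i) & d i x = y)"

text \<open>A list of pairs \<open>(r, y)\<close> is a system of equations \<open>r e = y\<close>,
  the argument of \<open>sol\<close>. An element is stored as a one-entry list with the fixed filler
  \<open>undefined\<close> in front, so that one kind of term serves both purposes.\<close>

fun val :: "('a, 'b) closure_term => ('a \<times> 'e) list" where
  "val (Base b) = [(undefined, eps b)]"
| "val (Const k) = (case k of 0 => [] | Suc i => [(undefined, 0[E i])])"
| "val (Unary k i a t) =
    [(undefined,
      if k = 0 then a *>[E i] snd (hd (val t))
      else if k = 1 then sol i (val t)
      else if k = 2 then d i (snd (hd (val t)))
      else pre i (snd (hd (val t))))]"
| "val (Binary k a t u) = (case k of 0 => (a, snd (hd (val t))) # val u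
    | Suc i => [(undefined, snd (hd (val t)) +[E i] snd (hd (val u)))])"

text \<open>All \<open>E i\<close> share the type \<open>'e\<close>, so the degree is not visible in
  the value of a term; membership in \<open>carrier (E i)\<close> supplies it.\<close>

definition Cl :: "nat => 'e set"
  where "Cl i = {e : car (E i). EX t. val t = [(undefined, e)]}"

lemma Cl_carrier: "e : Cl i ==> e : car (E i)"
  by (simp add: Cl_def)

lemma Cl_zero: "0[E i] : Cl i"
proof -
  have "val (Const (Suc i)) = [(undefined, 0[E i])]" by simp
  thus ?thesis unfolding Cl_def by blast
qed

lemma Cl_add: assumes "x : Cl i" "y : Cl i" shows "x +[E i] y : Cl i"
proof -
  obtain t u where tu: "val t = [(undefined, x)]" "val u = [(undefined, y)]" using assms unfolding Cl_def by blast
  have "val (Binary (Suc i) undefined t u) = [(undefined, x +[E i] y)]" using tu by simp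
  thus ?thesis using assms unfolding Cl_def by blast
qed

lemma Cl_smult: assumes "a : car R" "x : Cl i" shows "a *>[E i] x : Cl i"
proof -
  obtain t where t: "val t = [(undefined, x)]" using assms unfolding Cl_def by blast
  have "val (Unary 0 i a t) = [(undefined, a *>[E i] x)]" using t by simp
  thus ?thesis using assms unfolding Cl_def by blast
qed

lemma Cl_d: assumes "x : Cl i" shows "d i x : Cl (Suc i)"
proof -
  obtain t where t: "val t = [(undefined, x)]" using assms unfolding Cl_def by blast
  have "val (Unary 2 i undefined t) = [(undefined, d i x)]" using t by simp
  thus ?thesis using d_closed[OF Cl_carrier[OF assms]] unfolding Cl_def by blast
qed

lemma Cl_eps: assumes "c : car M" shows "eps c : Cl 0"
proof -
  have "val (Base c) = [(undefined, eps c)]" by simp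
  thus ?thesis using eps_closed[OF assms] unfolding Cl_def by blast
qed

lemma Cl_pre:
  assumes "y : Cl (Suc i)" "x : car (E i)" "d i x = y"
  shows "EX x:Cl i. d i x = y"
proof -
  have p: "pre i y : car (E i) & d i (pre i y) = y" unfolding pre_def by (rule someI[of _ x]) (use assms in auto)
  obtain t where t: "val t = [(undefined, y)]" using assms unfolding Cl_def by blast
  have "val (Unary 3 i undefined t) = [(undefined, pre i y)]" using t by simp
  thus ?thesis using p unfolding Cl_def by blast
qed

lemma Cl_sol:
  assumes "!!p. p : set l ==> snd p : Cl i" "e : car (E i)" "!!p. p : set l ==> fst p *>[E i] e = snd p"
  shows "EX e:Cl i. ALL p:set l. fst p *>[E i] e = snd p"
proof -
  have s: "sol i l : car (E i) & (ALL p:set l. fst p *>[E i] sol i l = snd p)" unfolding sol_def by (rule someI[of _ e]) (use assms in auto)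
  have "EX t. val t = l" using assms(1)
  proof (induction l)
    case Nil
    have "val (Const 0) = []" by simp
    thus ?case by blast
  next
    case (Cons p l)
    then obtain u where u: "val u = l" by auto
    obtain t where t: "val t = [(undefined, snd p)]" using Cons.prems[of p] by (auto simp: Cl_def)
    have "val (Binary 0 (fst p) t u) = p # l" using t u by simp
    thus ?case by blast
  qed
  then obtain t where t: "val t = l" by blast
  have "val (Unary 1 i undefined t) = [(undefined, sol i l)]" using t by simp
  thus ?thesis using s unfolding Cl_def by blast
qed

lemma Cl_submodule: "submodule (Cl i) R (E i)"
  by (rule E.submodule_criterion) (auto simp: Cl_carrier Cl_zero Cl_add Cl_smult)

text \<open>A linear map on an ideal is determined by finitely many equations
  \<open>x e = g x\<close>, one for each generator. They are solvable in \<open>E i\<close>, so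
  \<open>sol\<close> supplies a solution inside the closure.\<close>

lemma Cl_baer:
  assumes "noetherian_ring R" shows "baer R ((E i)(|carrier := Cl i|))"
proof (rule baerI)
  show "module R ((E i)(|carrier := Cl i|))" by (rule submodule.submodule_is_module[OF Cl_submodule E.module_axioms])
  fix J g assume J: "ideal J R" and g: "!!j. j : J ==> g j : car ((E i)(|carrier := Cl i|))"
      "!!k j. [|k : J; j : J|] ==> g (k +[R] j) = g k +[(E i)(|carrier := Cl i|)] g j"
      "!!a j. [|a : car R; j : J|] ==> g (a *[R] j) = a *>[(E i)(|carrier := Cl i|)] g j"
  have gc: "g j : Cl i" "g j : car (E i)" if "j : J" for j using g(1)[OF that] Cl_carrier by auto
  have "EX e:car (E i). ALL j:J. g j = j *>[E i] e" by (rule baerD[OF E_baer J]) (use g(2,3) gc in auto)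
  then obtain e0 where e0: "e0 : car (E i)" "!!j. j : J ==> g j = j *>[E i] e0" by blast
  obtain X where X: "X <= car R" "finite X" "J = Idl\<^bsub>R\<^esub> X" using noetherian_ring.finetely_gen[OF assms J] by auto
  have XJ: "X <= J" unfolding X(3) by (rule E.R.genideal_self[OF X(1)])
  obtain xs where xs: "set xs = X" using finite_list[OF X(2)] by auto
  have "EX e:Cl i. ALL p:set (map (%r. (r, g r)) xs). fst p *>[E i] e = snd p" by (rule Cl_sol[OF _ e0(1)]) (use xs XJ gc e0(2) in auto)
  then obtain e where e: "e : Cl i" "!!x. x : X ==> x *>[E i] e = g x" using xs by auto
  have ec: "e : car (E i)" using e Cl_carrier by auto
  have "ideal {j : car R. j *>[E i] e = j *>[E i] e0} R" by (rule E.R.ideal_criterion) (use ec e0(1) in "auto simp: E.smult_l_distr E.smult_assoc1")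
  moreover have "X <= {j : car R. j *>[E i] e = j *>[E i] e0}" using X(1) e(2) e0(2) XJ by auto
  ultimately have "J <= {j : car R. j *>[E i] e = j *>[E i] e0}" unfolding X(3) by (rule E.R.genideal_minimal)
  hence "ALL j:J. g j = j *>[E i] e" using e0(2) by auto
  thus "EX e:car ((E i)(|carrier := Cl i|)). ALL j:J. g j = j *>[(E i)(|carrier := Cl i|)] e" using e(1) by auto
qed

text \<open>The closure of \<open>M\<close> is a coresolution again, and naming each of its elements
  by one term that denotes it places it on the type that \<open>inj_dim\<close> prescribes.\<close>

theorem inj_dim_finite:
  assumes "noetherian_ring R" "module R M" shows "inj_dim R M < \<infinity>"
proof -
  obtain f :: "('a, 'b) closure_term => (nat + 'a + 'b) set" where f: "inj f" using closure_term_injection by blast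
  define c where "c e = f (SOME t. val t = [(undefined, e)])" for e
  have c: "inj_on c (Cl i)" for i
  proof (rule inj_onI)
    fix x y assume xy: "x : Cl i" "y : Cl i" "c x = c y"
    have "val (SOME t. val t = [(undefined, z)]) = [(undefined, z)]" if "z : Cl i" for z by (rule someI_ex) (use that Cl_def in auto)
    thus "x = y" using xy injD[OF f] unfolding c_def by (metis list.inject prod.inject)
  qed
  let ?C = "%i. (E i)(|carrier := Cl i|)"
  let ?E = "%i. image_module c (?C i)"
  have ci: "inj_on c (car (?C i))" for i using c by simp
  note sm = image_module_simps[OF ci, simplified]
  define c' where "c' i = inv_into (Cl i) c" for i
  have c': "c' i (c x) = x" if "x : Cl i" for i x using inv_into_f_f[OF c that] by (simp add: c'_def)
  have ceq: "c x = c y <-> x = y" if "x : Cl i" "y : Cl i" for x y i using inj_onD[OF c] that by blast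
  let ?d = "%i y. c (d i (c' i y))"
  have "coresolution R M n (%m. c (eps m)) ?E ?d"
  proof
    show "baer R (?E i)" for i by (rule image_module_baer[OF ci Cl_baer[OF assms(1)]])
    show "?d i x : car (?E (Suc i))" if x: "x : car (?E i)" for i x
    proof -
      obtain u where "u : Cl i" "x = c u" using x by (auto simp: sm)
      thus ?thesis by (simp add: sm c' Cl_d)
    qed
    show "?d i (x +[?E i] y) = ?d i x +[?E (Suc i)] ?d i y" if xy: "x : car (?E i)" "y : car (?E i)" for i x y
    proof -
      obtain u v where "u : Cl i" "x = c u" "v : Cl i" "y = c v" using xy by (auto simp: sm)
      thus ?thesis by (simp add: sm c' Cl_d Cl_add d_add Cl_carrier)
    qed
    show "?d i (a *>[?E i] x) = a *>[?E (Suc i)] ?d i x" if ax: "a : car R" "x : car (?E i)" for i a x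
    proof -
      obtain u where "u : Cl i" "x = c u" using ax by (auto simp: sm)
      thus ?thesis using ax(1) by (simp add: sm c' Cl_d Cl_smult d_smult Cl_carrier)
    qed
    show "c (eps m) : car (?E 0)" if "m : car M" for m using that by (simp add: sm Cl_eps)
    show "c (eps (m +[M] m')) = c (eps m) +[?E 0] c (eps m')" if "m : car M" "m' : car M" for m m' using that by (simp add: sm Cl_eps eps_add)
    show "c (eps (a *>[M] m)) = a *>[?E 0] c (eps m)" if "a : car R" "m : car M" for a m using that by (simp add: sm Cl_eps eps_smult)
    show "m = 0[M]" if "m : car M" "c (eps m) = 0[?E 0]" for m using that eps_inj ceq[OF Cl_eps[OF that(1)] Cl_zero] by (simp add: sm)
    show "?d 0 x = 0[?E 1] <-> (EX m:car M. x = c (eps m))" if x: "x : car (?E 0)" for x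
    proof -
      obtain u where u: "u : Cl 0" "x = c u" using x by (auto simp: sm)
      have "?d 0 x = 0[?E 1] <-> d 0 u = 0[E 1]" using u ceq[OF Cl_d[OF u(1)] Cl_zero] by (simp add: sm c')
      also have "... <-> (EX m:car M. u = eps m)" using exact_0 Cl_carrier[OF u(1)] by blast
      also have "... <-> (EX m:car M. x = c (eps m))" using u ceq Cl_eps by blast
      finally show ?thesis .
    qed
    show "?d (Suc i) x = 0[?E (Suc (Suc i))] <-> (EX y:car (?E i). x = ?d i y)" if x: "x : car (?E (Suc i))" for i x
    proof -
      obtain u where u: "u : Cl (Suc i)" "x = c u" using x by (auto simp: sm)
      have "?d (Suc i) x = 0[?E (Suc (Suc i))] <-> d (Suc i) u = 0[E (Suc (Suc i))]" using u ceq[OF Cl_d[OF u(1)] Cl_zero] by (simp add: sm c')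
      also have "... <-> (EX y:car (E i). u = d i y)" using exact Cl_carrier[OF u(1)] by blast
      also have "... <-> (EX y:Cl i. u = d i y)" using Cl_pre[OF u(1)] Cl_carrier by metis
      also have "... <-> (EX y:Cl i. x = c (d i y))" using u ceq[OF u(1) Cl_d] by auto
      also have "... <-> (EX y:car (?E i). x = ?d i y)" by (simp add: sm c')
      finally show ?thesis .
    qed
    show "car (?E i) = {0[?E i]}" if "n < i" for i
    proof -
      have "Cl i = {0[E i]}" using E_vanish[OF that] Cl_zero[of i] Cl_carrier by blast
      moreover have "car (?E i) = c ` Cl i" "0[?E i] = c 0[E i]" by (simp_all add: sm)
      ultimately show ?thesis by (metis image_empty image_insert)
    qed
  qed
  thus ?thesis using coresolution_imp_inj_dim_finite assms(2) by blast
qed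

end

context ring_localization
begin

text \<open>The coresolution of \<open>M'\<close> consists of the complements of the torsion in the
  given terms, with the action of \<open>B\<close> that exists because \<open>T\<close> acts
  bijectively on them. \<open>M'\<close> is a localization of \<open>M\<close> only by virtue of
  \<open>f\<close>, which covers extended ideals, \<open>B\<close> itself as the image of a
  principal ideal, and plain isomorphisms.\<close>

lemma localization_coresolution:
  fixes M :: "('a, 'x, 'm) module_scheme" and M' :: "('b, 'y, 'n) module_scheme"
    and E :: "nat => ('a, 'e) module"
  assumes res: "coresolution A M n eps E d" and noeth: "noetherian_ring A"
    and M: "module A M" and M': "module B M'"
    and f: "!!x. x : car M ==> f x : car M'"
    "!!x y. [|x : car M; y : car M|] ==> f (x +[M] y) = f x +[M'] f y"
    "!!a x. [|a : car A; x : car M|] ==> f (a *>[M] x) = phi a *>[M'] f x"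
    and f_surj: "!!y. y : car M' ==> EX x:car M. EX s:T. phi s *>[M'] y = f x"
    and f_ker: "!!x. [|x : car M; f x = 0[M']|] ==> EX s:T. s *>[M] x = 0[M]"
  shows "\<exists>eps' (E' :: nat => ('b, 'e) module) d'. coresolution B M' n eps' E' d'"
proof -
  interpret coresolution A M n eps E d by fact
  interpret M: module A M by fact
  interpret M': module B M' by fact
  define good where "good i F rho <-> submodule F A (E i) & (ALL x:car (E i). rho x : F) &
    (ALL x:car (E i). ALL y:car (E i). rho (x +[E i] y) = rho x +[E i] rho y) &
    (ALL a:car A. ALL x:car (E i). rho (a *>[E i] x) = a *>[E i] rho x) &
    (ALL x:F. rho x = x) & (ALL x:car (E i). rho x = 0[E i] <-> x : torsion (E i))" for i F rho
  have "EX F rho. good i F rho" for i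
  proof (rule torsion_complement[OF noeth E_baer[of i]])
    fix F rho assume "submodule F A (E i)" "!!x. x : car (E i) ==> rho x : F"
      "!!x y. [|x : car (E i); y : car (E i)|] ==> rho (x +[E i] y) = rho x +[E i] rho y"
      "!!a x. [|a : car A; x : car (E i)|] ==> rho (a *>[E i] x) = a *>[E i] rho x"
      "!!x. x : F ==> rho x = x" "!!x. x : car (E i) ==> (rho x = 0[E i]) = (x : torsion (E i))"
    hence "good i F rho" by (simp add: good_def)
    thus ?thesis by blast
  qed
  then obtain F rho where good: "!!i. good i (F i) (rho i)" by metis
  note good' = good[unfolded good_def]
  have F_sub: "submodule (F i) A (E i)" for i using good'[of i] by blast
  have rhoF: "rho i x : F i" if "x : car (E i)" for i x using good'[of i] that by blast
  have rho_add: "rho i (x +[E i] y) = rho i x +[E i] rho i y" if "x : car (E i)" "y : car (E i)" for i x y using good'[of i] that by blast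
  have rho_smult: "rho i (a *>[E i] x) = a *>[E i] rho i x" if "a : car A" "x : car (E i)" for i a x using good'[of i] that by blast
  have rho_id: "rho i x = x" if "x : F i" for i x using good'[of i] that by blast
  have rho_ker: "rho i x = 0[E i] <-> (EX s:T. s *>[E i] x = 0[E i])" if "x : car (E i)" for i x using good'[of i] that by (simp add: torsion_def)
  note Fs = E.submoduleE[OF F_sub]
  have Fc: "x : car (E i)" if "x : F i" for i x using Fs(1) that by blast
  have rhoc: "rho i x : car (E i)" if "x : car (E i)" for i x using rhoF[OF that] Fc by blast
  have eq_of_minus: "x = y" if "x +[E i] -[E i] y = 0[E i]" "x : car (E i)" "y : car (E i)" for i x y
    using that by (metis E.M.a_comm E.M.a_inv_closed E.M.minus_equality E.M.minus_minus)
  have rho_minus: "rho i (-[E i] x) = -[E i] rho i x" if "x : car (E i)" for i x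
    using rho_smult[of "-[A] 1[A]" x i] that rhoc[OF that] by (simp add: E.smult_l_minus)
  have d_minus: "d i (-[E i] x) = -[E (Suc i)] d i x" if "x : car (E i)" for i x
    using d_smult[of "-[A] 1[A]" x i] that d_closed[OF that] by (simp add: E.smult_l_minus)
  have rho0: "rho i 0[E i] = 0[E i]" for i using rho_smult[of "0[A]" "0[E i]" i] rhoc[of "0[E i]" i] by simp
  have F0: "0[E i] : F i" for i using rhoF[of "0[E i]" i] rho0 by simp
  let ?FA = "%i. (E i)(|carrier := F i|)"
  have FAm: "module A (?FA i)" for i by (rule submodule.submodule_is_module[OF F_sub E.module_axioms])
  have div: "divisible_by_T (?FA i)" for i unfolding divisible_by_T_def
  proof (intro conjI ballI impI)
    show "module A (?FA i)" by (rule FAm)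
    fix s x assume s: "s : T" and "x : car (?FA i)"
    hence x: "x : F i" by simp
    have sc: "s : car A" using s T_carrier by auto
    show "x = 0[?FA i]" if "s *>[?FA i] x = 0[?FA i]"
    proof -
      have "rho i x = 0[E i]" using that s rho_ker[OF Fc[OF x]] by auto
      thus ?thesis using rho_id[OF x] by simp
    qed
    obtain y where y: "y : car (E i)" "s *>[E i] y +[E i] -[E i] x : torsion (E i)" using torsion_divide[OF noeth E_baer s Fc[OF x]] .
    have "rho i (s *>[E i] y +[E i] -[E i] x) = 0[E i]" using y sc Fc[OF x] by (subst rho_ker) (auto simp: torsion_def)
    hence "s *>[E i] rho i y +[E i] -[E i] x = 0[E i]" using y sc Fc[OF x] rho_id[OF x] by (simp add: rho_add rho_smult rho_minus)
    hence "s *>[E i] rho i y = x" using eq_of_minus sc rhoc[OF y(1)] Fc[OF x] by simp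
    thus "EX y:car (?FA i). s *>[?FA i] y = x" using rhoF[OF y(1)] by auto
  qed
  have cancel: "x = y" if "s : T" "x : F i" "y : F i" "s *>[E i] x = s *>[E i] y" for s x y i using T_cancel[OF div[of i], of s x y] that by simp
  have divide: "EX y:F i. s *>[E i] y = x" if "s : T" "x : F i" for s x i using T_divide[OF div[of i] that(1), of x] that by simp
  have FAb: "baer A (?FA i)" for i
  proof (rule baerI[OF FAm])
    fix J g assume J: "ideal J A" and g: "!!j. j : J ==> g j : car (?FA i)"
      "!!k j. [|k : J; j : J|] ==> g (k +[A] j) = g k +[?FA i] g j"
      "!!a j. [|a : car A; j : J|] ==> g (a *[A] j) = a *>[?FA i] g j"
    have "EX e:car (E i). ALL j:J. g j = j *>[E i] e" by (rule baerD[OF E_baer J]) (use g Fc in auto)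
    then obtain e where e: "e : car (E i)" "!!j. j : J ==> g j = j *>[E i] e" by blast
    have "g j = j *>[E i] rho i e" if j: "j : J" for j using e(2)[OF j] rho_smult[OF A.idealD(3)[OF J j] e(1)] rho_id[of "g j" i] g(1)[OF j] by simp
    thus "EX e:car (?FA i). ALL j:J. g j = j *>[?FA i] e" using rhoF[OF e(1)] by auto
  qed
  let ?E' = "%i. extend_scalars (?FA i)"
  \<comment> \<open>The differential maps torsion to torsion, so \<open>rho d\<close> depends on
    \<open>x\<close> only through \<open>rho x\<close>; this makes \<open>rho d\<close> a
    differential on the complements.\<close>
  have rhod_ker: "rho (Suc i) (d i x) = 0[E (Suc i)]" if x: "x : car (E i)" "rho i x = 0[E i]" for i x
  proof -
    obtain s where s: "s : T" "s *>[E i] x = 0[E i]" using x rho_ker by blast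
    hence "s *>[E (Suc i)] d i x = 0[E (Suc i)]" using d_smult[OF T_carrier[OF s(1)] x(1)] d_zero by simp
    thus ?thesis using rho_ker[OF d_closed[OF x(1)]] s(1) by blast
  qed
  have rhod: "rho (Suc i) (d i (rho i x)) = rho (Suc i) (d i x)" if x: "x : car (E i)" for i x
  proof -
    let ?y = "x +[E i] -[E i] rho i x"
    have "rho i ?y = 0[E i]" using x rhoc[OF x] rho_id[OF rhoF[OF x]] by (simp add: rho_add rho_minus E.M.r_neg)
    hence "rho (Suc i) (d i ?y) = 0[E (Suc i)]" using rhod_ker[of ?y i] x rhoc[OF x] by simp
    hence "rho (Suc i) (d i x) +[E (Suc i)] -[E (Suc i)] rho (Suc i) (d i (rho i x)) = 0[E (Suc i)]"
      using x rhoc[OF x] d_closed by (simp add: d_add d_minus rho_add rho_minus)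
    from eq_of_minus[OF this] show ?thesis using x rhoc d_closed by simp
  qed
  let ?d = "%i x. rho (Suc i) (d i x)"
  have dF: "?d i x : F (Suc i)" if "x : F i" for i x using rhoF[OF d_closed[OF Fc[OF that]]] .
  have d_sm: "?d i (a *>[E i] x) = a *>[E (Suc i)] ?d i x" if "a : car A" "x : F i" for a x i using that Fc d_closed by (simp add: d_smult rho_smult)
  have f_eq: "EX t:T. t *>[M] x = t *>[M] y" if xy: "x : car M" "y : car M" "f x = f y" for x y
  proof -
    have "f (-[M] y) = phi (-[A] 1[A]) *>[M'] f y" using f(3)[of "-[A] 1[A]" y] xy by (simp add: M.smult_l_minus)
    hence "f (x +[M] -[M] y) = f y +[M'] phi (-[A] 1[A]) *>[M'] f y" using f(2)[of x "-[M] y"] xy by simp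
    also have "... = phi (1[A] +[A] -[A] 1[A]) *>[M'] f y" using f(1)[OF xy(2)] phi_in by (simp add: phi_add phi_one M'.smult_l_distr del: A.r_neg)
    also have "... = 0[M']" using f(1)[OF xy(2)] by (simp add: A.r_neg phi_zero)
    finally obtain t where t: "t : T" "t *>[M] (x +[M] -[M] y) = 0[M]" using f_ker[of "x +[M] -[M] y"] xy by auto
    hence "t *>[M] x +[M] -[M] (t *>[M] y) = 0[M]" using xy T_carrier[OF t(1)] by (simp add: M.smult_r_distr M.smult_r_minus)
    hence "t *>[M] x = t *>[M] y" using xy T_carrier[OF t(1)] by (metis M.M.a_comm M.M.a_inv_closed M.M.minus_equality M.M.minus_minus M.smult_closed)
    thus ?thesis using t by blast
  qed
  let ?r = "%x. rho 0 (eps x)"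
  have r: "?r x : F 0" "?r x : car (E 0)" if "x : car M" for x using rhoF[OF eps_closed[OF that]] Fc by auto
  have r_add: "?r (x +[M] y) = ?r x +[E 0] ?r y" if "x : car M" "y : car M" for x y using that eps_closed by (simp add: eps_add rho_add)
  have r_sm: "?r (a *>[M] x) = a *>[E 0] ?r x" if "a : car A" "x : car M" for a x using that eps_closed by (simp add: eps_smult rho_smult)
  \<comment> \<open>The future image of the fraction \<open>y = x / s\<close>: the element
    \<open>z\<close> of \<open>F 0\<close> with \<open>s z = rho (eps x)\<close>.\<close>
  have "EX z:F 0. EX x:car M. EX s:T. phi s *>[M'] y = f x & s *>[E 0] z = ?r x" if "y : car M'" for y using f_surj[OF that] divide r(1) by metis
  then obtain e where e: "!!y. y : car M' ==> e y : F 0 & (EX x:car M. EX s:T. phi s *>[M'] y = f x & s *>[E 0] e y = ?r x)" by metis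
  have eF: "e y : F 0" if "y : car M'" for y using e that by blast
  have lc: "a *>[E i] (b *>[E i] x) = b *>[E i] (a *>[E i] x)" if "a : car A" "b : car A" "x : car (E i)" for a b x i
    using that by (simp add: E.smult_assoc1[symmetric] A.m_comm)
  have e_spec: "s *>[E 0] e y = ?r x" if y: "y : car M'" and x: "x : car M" and s: "s : T" and eq: "phi s *>[M'] y = f x" for y x s
  proof -
    obtain x' s' where x': "x' : car M" "s' : T" "phi s' *>[M'] y = f x'" "s' *>[E 0] e y = ?r x'" using e[OF y] by blast
    have c: "s : car A" "s' : car A" using s x' T_carrier by auto
    have "f (s' *>[M] x) = phi s' *>[M'] (phi s *>[M'] y)" using f(3)[OF c(2) x] eq by simp
    also have "... = phi s *>[M'] (phi s' *>[M'] y)" using y phi_in c by (simp add: M'.smult_assoc1[symmetric] B.m_comm)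
    also have "... = f (s *>[M] x')" using f(3)[OF c(1) x'(1)] x'(3) by simp
    finally obtain t where t: "t : T" "t *>[M] (s' *>[M] x) = t *>[M] (s *>[M] x')" using f_eq[of "s' *>[M] x" "s *>[M] x'"] x x'(1) c by auto
    have tc: "t : car A" using t T_carrier by auto
    have "(t *[A] s') *>[E 0] ?r x = ?r (t *>[M] (s' *>[M] x))" using tc c x r by (simp add: r_sm E.smult_assoc1)
    also have "... = t *>[E 0] (s *>[E 0] (s' *>[E 0] e y))" unfolding t(2) x'(4) using tc c x'(1) by (simp add: r_sm)
    also have "... = (t *[A] s') *>[E 0] (s *>[E 0] e y)" using tc c Fc[OF eF[OF y]] lc by (simp add: E.smult_assoc1)
    finally show ?thesis using cancel[of "t *[A] s'" "s *>[E 0] e y" 0 "?r x"] T_mult t(1) x'(2) r(1)[OF x] Fs(4)[OF c(1) eF[OF y]] by simp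
  qed
  have "coresolution B M' n e ?E' ?d"
  proof
    show "baer B (?E' i)" for i by (rule extend_scalars_baer[OF div FAb])
    show "?d i x : car (?E' (Suc i))" if "x : car (?E' i)" for i x using dF that by simp
    show "?d i (x +[?E' i] y) = ?d i x +[?E' (Suc i)] ?d i y" if "x : car (?E' i)" "y : car (?E' i)" for i x y
      using that Fc d_closed by (simp add: d_add rho_add)
    show "?d i (b *>[?E' i] x) = b *>[?E' (Suc i)] ?d i x" if "b : car B" "x : car (?E' i)" for i b x
      using act_linear[OF div[of i] div[of "Suc i"], of "?d i" b x] dF[of _ i] d_sm[of _ _ i] that by simp
    show "e y : car (?E' 0)" if "y : car M'" for y using eF that by simp
    show "e (y +[M'] z) = e y +[?E' 0] e z" if yz: "y : car M'" "z : car M'" for y z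
    proof -
      obtain x s x' s' where *: "x : car M" "s : T" "phi s *>[M'] y = f x" "x' : car M" "s' : T" "phi s' *>[M'] z = f x'" using f_surj yz by metis
      have c: "s : car A" "s' : car A" using * T_carrier by auto
      note pc = phi_in[OF c(1)] phi_in[OF c(2)]
      let ?x = "s' *>[M] x +[M] s *>[M] x'"
      have "phi (s *[A] s') *>[M'] (y +[M'] z) = phi s' *>[M'] (phi s *>[M'] y) +[M'] phi s *>[M'] (phi s' *>[M'] z)"
        using yz pc c by (simp add: phi_mult M'.smult_r_distr M'.smult_assoc1[symmetric] B.m_comm)
      also have "... = f ?x" using *(1,3,4,6) c by (simp add: f)
      finally have "(s *[A] s') *>[E 0] e (y +[M'] z) = ?r ?x" using e_spec[of "y +[M'] z" ?x "s *[A] s'"] yz *(1,2,4,5) c T_mult by simp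
      also have "... = s' *>[E 0] (s *>[E 0] e y) +[E 0] s *>[E 0] (s' *>[E 0] e z)"
        using e_spec[OF yz(1) *(1-3)] e_spec[OF yz(2) *(4-6)] *(1,4) c by (simp add: r_add r_sm)
      also have "... = (s *[A] s') *>[E 0] (e y +[E 0] e z)"
        using c Fc[OF eF[OF yz(1)]] Fc[OF eF[OF yz(2)]] lc by (simp add: E.smult_r_distr E.smult_assoc1)
      finally show ?thesis using cancel[of "s *[A] s'" "e (y +[M'] z)" 0 "e y +[E 0] e z"] T_mult *(2,5) eF yz Fs(5) by simp
    qed
    show "e (b *>[M'] y) = b *>[?E' 0] e y" if bm: "b : car B" "y : car M'" for b y
    proof -
      obtain x s where *: "x : car M" "s : T" "phi s *>[M'] y = f x" using f_surj bm(2) by metis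
      obtain a t where at: "a : car A" "t : T" "phi t *[B] b = phi a" using phi_surj bm(1) by metis
      have c: "s : car A" "t : car A" using * at T_carrier by auto
      note pc = phi_in[OF c(1)] phi_in[OF c(2)]
      have "phi (t *[A] s) *>[M'] (b *>[M'] y) = ((phi t *[B] b) *[B] phi s) *>[M'] y"
        using pc c bm by (simp add: phi_mult M'.smult_assoc1[symmetric] B.m_ac)
      also have "... = f (a *>[M] x)" using at(1,3) *(1,3) pc bm(2) phi_in[OF at(1)] by (simp add: f M'.smult_assoc1)
      finally have "(t *[A] s) *>[E 0] e (b *>[M'] y) = ?r (a *>[M] x)"
        using e_spec[of "b *>[M'] y" "a *>[M] x" "t *[A] s"] bm at(1) *(1) T_mult at(2) *(2) by simp
      also have "... = s *>[E 0] (a *>[E 0] e y)" using e_spec[OF bm(2) *(1-3)] at(1) *(1) lc[OF c(1) at(1) Fc[OF eF[OF bm(2)]]] by (simp add: r_sm)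
      also have "a *>[E 0] e y = t *>[E 0] act (?FA 0) b (e y)" using act_spec[OF div[of 0], of "e y" b a t] eF[OF bm(2)] bm(1) at by simp
      also have "s *>[E 0] (t *>[E 0] act (?FA 0) b (e y)) = (t *[A] s) *>[E 0] act (?FA 0) b (e y)"
        using c Fc[of "act (?FA 0) b (e y)" 0] act_closed[OF div[of 0], of "e y" b] eF[OF bm(2)] bm(1) lc by (simp add: E.smult_assoc1)
      finally show ?thesis using cancel[of "t *[A] s" "e (b *>[M'] y)" 0 "act (?FA 0) b (e y)"] T_mult at(2) *(2) eF bm
          act_closed[OF div[of 0], of "e y" b] by simp
    qed
    show "y = 0[M']" if y: "y : car M'" "e y = 0[?E' 0]" for y
    proof -
      obtain x s where *: "x : car M" "s : T" "phi s *>[M'] y = f x" using f_surj y(1) by metis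
      have "?r x = 0[E 0]" using e_spec[OF y(1) *] y(2) T_carrier[OF *(2)] by simp
      then obtain t where t: "t : T" "t *>[E 0] eps x = 0[E 0]" using rho_ker[OF eps_closed[OF *(1)]] by blast
      have tc: "t : car A" using t T_carrier by auto
      hence "eps (t *>[M] x) = 0[E 0]" using t(2) *(1) by (simp add: eps_smult)
      hence "t *>[M] x = 0[M]" using eps_inj tc *(1) by simp
      moreover have "f 0[M] = 0[M']" using f(3)[of "0[A]" "0[M]"] f(1)[of "0[M]"] phi_zero by simp
      ultimately have "phi t *>[M'] (phi s *>[M'] y) = 0[M']" using f(3)[OF tc *(1)] *(3) by simp
      moreover have u: "phi t *[B] phi s : Units B" using phi_unit t(1) *(2) by simp
      moreover have "phi t : car B" "phi s : car B" using phi_in tc T_carrier[OF *(2)] by auto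
      ultimately have "(inv\<^bsub>B\<^esub> (phi t *[B] phi s)) *>[M'] ((phi t *[B] phi s) *>[M'] y) = 0[M']" using y(1) by (simp add: M'.smult_assoc1)
      thus ?thesis using u y(1) by (simp add: M'.smult_assoc1[symmetric] B.Units_l_inv B.Units_closed)
    qed
    show "?d 0 z = 0[?E' 1] <-> (EX y:car M'. z = e y)" if "z : car (?E' 0)" for z
    proof
      have z: "z : F 0" using that by simp
      assume "?d 0 z = 0[?E' 1]"
      then obtain s where s: "s : T" "s *>[E 1] d 0 z = 0[E 1]" using rho_ker[OF d_closed[OF Fc[OF z]]] by auto
      have sc: "s : car A" using s T_carrier by auto
      have "d 0 (s *>[E 0] z) = 0[E 1]" using s sc Fc[OF z] by (simp add: d_smult)
      then obtain x where x: "x : car M" "s *>[E 0] z = eps x" using exact_0[of "s *>[E 0] z"] sc Fc[OF z] by auto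
      let ?y = "inv\<^bsub>B\<^esub> (phi s) *>[M'] f x"
      have u: "phi s : Units B" using phi_unit s by auto
      have y: "?y : car M'" using u f(1)[OF x(1)] by auto
      have "phi s *>[M'] ?y = f x" using u f(1)[OF x(1)] by (simp add: M'.smult_assoc1[symmetric] B.Units_closed B.Units_r_inv)
      hence "s *>[E 0] e ?y = ?r x" using e_spec[OF y x(1) s(1)] by simp
      also have "... = s *>[E 0] z" using x(2)[symmetric] rho_smult[OF sc Fc[OF z]] rho_id[OF z] by simp
      finally have "z = e ?y" using cancel[OF s(1) eF[OF y] z] by simp
      thus "EX y:car M'. z = e y" using y by blast
    next
      assume "EX y:car M'. z = e y"
      then obtain y where y: "y : car M'" "z = e y" by blast
      obtain x s where *: "x : car M" "s : T" "phi s *>[M'] y = f x" using f_surj y(1) by metis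
      have sc: "s : car A" using * T_carrier by auto
      have "s *>[E 1] ?d 0 z = ?d 0 (s *>[E 0] e y)" using d_sm[OF sc eF[OF y(1)]] y(2) by simp
      also have "... = rho 1 (d 0 (rho 0 (eps x)))" using e_spec[OF y(1) *] by simp
      also have "... = rho 1 0[E 1]" using rhod[OF eps_closed[OF *(1)]] d_eps[OF *(1)] by simp
      also have "... = 0[E 1]" by (rule rho0)
      finally have "s *>[E 1] ?d 0 z = s *>[E 1] 0[E 1]" using sc by simp
      thus "?d 0 z = 0[?E' 1]" using cancel[OF *(2), of "?d 0 z" 1 "0[E 1]"] dF[OF eF[OF y(1)]] y(2) F0[of 1] by simp
    qed
    show "?d (Suc i) x = 0[?E' (Suc (Suc i))] <-> (EX y:car (?E' i). x = ?d i y)" if "x : car (?E' (Suc i))" for i x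
    proof
      have x: "x : F (Suc i)" using that by simp
      assume "?d (Suc i) x = 0[?E' (Suc (Suc i))]"
      \<comment> \<open>Vanishing of \<open>rho d x\<close> means that \<open>d x\<close> is
        torsion. After multiplication by \<open>s\<close>, exactness of the given coresolution
        yields a preimage \<open>y\<close>, and \<open>rho y\<close> is divided by \<open>s\<close>
        again.\<close>
      then obtain s where s: "s : T" "s *>[E (Suc (Suc i))] d (Suc i) x = 0[E (Suc (Suc i))]" using rho_ker[OF d_closed[OF Fc[OF x]]] by auto
      have sc: "s : car A" using s T_carrier by auto
      have "d (Suc i) (s *>[E (Suc i)] x) = 0[E (Suc (Suc i))]" using s sc Fc[OF x] by (simp add: d_smult)
      then obtain y where y: "y : car (E i)" "s *>[E (Suc i)] x = d i y" using exact[of "s *>[E (Suc i)] x" i] sc Fc[OF x] by auto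
      obtain z where z: "z : F i" "s *>[E i] z = rho i y" using divide[OF s(1) rhoF[OF y(1)]] by blast
      have "s *>[E (Suc i)] x = rho (Suc i) (s *>[E (Suc i)] x)" using rho_smult[OF sc Fc[OF x]] rho_id[OF x] by simp
      also have "... = ?d i (rho i y)" using y rhod by simp
      also have "... = s *>[E (Suc i)] ?d i z" using d_sm[OF sc z(1)] z(2) by simp
      finally have "x = ?d i z" using cancel[OF s(1) x dF[OF z(1)]] by simp
      thus "EX y:car (?E' i). x = ?d i y" using z(1) by auto
    next
      assume "EX y:car (?E' i). x = ?d i y"
      then obtain y where y: "y : F i" "x = ?d i y" by auto
      have "?d (Suc i) x = rho (Suc (Suc i)) (d (Suc i) (d i y))" using y rhod[OF d_closed[OF Fc[OF y(1)]]] by simp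
      also have "... = rho (Suc (Suc i)) 0[E (Suc (Suc i))]" using d_d[OF Fc[OF y(1)]] by simp
      also have "... = 0[E (Suc (Suc i))]" by (rule rho0)
      finally show "?d (Suc i) x = 0[?E' (Suc (Suc i))]" by simp
    qed
    show "car (?E' i) = {0[?E' i]}" if "n < i" for i
    proof -
      have "F i <= {0[E i]}" using Fc E_vanish[OF that] by blast
      thus ?thesis using F0[of i] by auto
    qed
  qed
  thus ?thesis by blast
qed

theorem inj_dim_localization:
  fixes M :: "('a, 'x, 'm) module_scheme" and M' :: "('b, 'y, 'n) module_scheme"
  assumes "inj_dim A M < \<infinity>" and "noetherian_ring A" "noetherian_ring B"
    and M: "module A M" and M': "module B M'"
    and f: "!!x. x : car M ==> f x : car M'"
    "!!x y. [|x : car M; y : car M|] ==> f (x +[M] y) = f x +[M'] f y"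
    "!!a x. [|a : car A; x : car M|] ==> f (a *>[M] x) = phi a *>[M'] f x"
    and f_surj: "!!y. y : car M' ==> EX x:car M. EX s:T. phi s *>[M'] y = f x"
    and f_ker: "!!x. [|x : car M; f x = 0[M']|] ==> EX s:T. s *>[M] x = 0[M]"
  shows "inj_dim B M' < \<infinity>"
proof -
  obtain n eps d and E :: "nat => ('a, (nat + 'a + 'x) set) module" where "coresolution A M n eps E d"
    using inj_dim_finite_imp_coresolution[OF assms(1) M] by blast
  then obtain eps' d' and E' :: "nat => ('b, (nat + 'a + 'x) set) module" where "coresolution B M' n eps' E' d'"
    using localization_coresolution[OF _ assms(2) M M' f f_surj f_ker] by blast
  thus ?thesis using coresolution.inj_dim_finite assms(3) M' by blast
qed

end

section \<open>The fraction construction satisfies the axioms of a localization\<close>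

locale fractions = module R M for R (structure) and M (structure) +
  fixes T :: "'a set"
  assumes T_sub: "T <= car R" and T_one: "\<one> : T" and T_mult: "!!s t. [|s : T; t : T|] ==> s ** t : T"
begin

lemma Tc: "s : T ==> s : car R"
  using T_sub by auto

lemma lcomm: "[|a : car R; b : car R; x : car M|] ==> a *>[M] (b *>[M] x) = b *>[M] (a *>[M] x)"
  by (simp add: smult_assoc1[symmetric] R.m_comm)

lemma fraction_mem: "(n, t) : fraction T M m s <->
    n : car M & t : T & (EX u:T. u *>[M] (t *>[M] m) = u *>[M] (s *>[M] n))" by (simp add: fraction_def)

lemma fraction_self: "[|m : car M; s : T|] ==> (m, s) : fraction T M m s"
  using T_one by (auto simp: fraction_mem)

lemma fraction_subset:
  assumes "m : car M" "n : car M" "s : T" "t : T" "v : T" "v *>[M] (t *>[M] m) = v *>[M] (s *>[M] n)"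
  shows "fraction T M m s <= fraction T M n t"
proof
  fix p assume "p : fraction T M m s"
  then obtain k r u where *: "p = (k, r)" "k : car M" "r : T" "u : T" "u *>[M] (r *>[M] m) = u *>[M] (s *>[M] k)" by (auto simp: fraction_def)
  have c: "s : car R" "t : car R" "v : car R" "r : car R" "u : car R" using assms * Tc by auto
  have "(u ** (v ** s)) *>[M] (r *>[M] n) = u *>[M] (r *>[M] (v *>[M] (s *>[M] n)))" using c assms(2) by (simp add: smult_assoc1 lcomm)
  also have "... = v *>[M] (t *>[M] (u *>[M] (r *>[M] m)))" unfolding assms(6)[symmetric] using c assms(1) by (simp add: lcomm)
  also have "... = (u ** (v ** s)) *>[M] (t *>[M] k)" unfolding *(5) using c *(2) by (simp add: smult_assoc1 lcomm)
  finally show "p : fraction T M n t" using * assms T_mult by (auto simp: fraction_mem)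
qed

lemma fraction_eq:
  assumes "m : car M" "n : car M" "s : T" "t : T"
  shows "fraction T M m s = fraction T M n t <-> (EX u:T. u *>[M] (t *>[M] m) = u *>[M] (s *>[M] n))"
proof
  assume "fraction T M m s = fraction T M n t"
  hence "(n, t) : fraction T M m s" using fraction_self[OF assms(2,4)] by simp
  thus "EX u:T. u *>[M] (t *>[M] m) = u *>[M] (s *>[M] n)" by (simp add: fraction_mem)
next
  assume "EX u:T. u *>[M] (t *>[M] m) = u *>[M] (s *>[M] n)"
  then obtain u where u: "u : T" "u *>[M] (t *>[M] m) = u *>[M] (s *>[M] n)" by blast
  show "fraction T M m s = fraction T M n t" using fraction_subset[OF assms u] fraction_subset[OF assms(2,1,4,3) u(1) u(2)[symmetric]] by blast
qed

lemma fraction_eqI: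
  assumes "m : car M" "n : car M" "s : T" "t : T" "t *>[M] m = s *>[M] n"
  shows "fraction T M m s = fraction T M n t"
  using fraction_eq[OF assms(1-4)] assms T_one by auto

lemma fraction_memD:
  assumes "(n, t) : fraction T M m s" "m : car M" "s : T"
  shows "n : car M" "t : T" "fraction T M n t = fraction T M m s"
proof -
  obtain u where u: "n : car M" "t : T" "u : T" "u *>[M] (t *>[M] m) = u *>[M] (s *>[M] n)" using assms(1) by (auto simp: fraction_mem)
  thus "n : car M" "t : T" by auto
  show "fraction T M n t = fraction T M m s" using fraction_eq[OF assms(2) u(1) assms(3) u(2)] u(3,4) by blast
qed

end

text \<open>Operations on fractions are unions over representatives; when all members of such a
  union are equal, it collapses to any one of them.\<close>

lemma UN_const: "[|x : X; !!y. y : X ==> f y = c|] ==> (\<Union>y\<in>X. f y) = c"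
  by blast

context fractions
begin

abbreviation "LM == loc_module R T M"

lemma loc_module_carrier: "car LM = {fraction T M m s | m s. m : car M & s : T}"
  by (simp add: loc_module_def)

lemma loc_module_add:
  assumes m: "m : car M" "s : T" and n: "n : car M" "t : T"
  shows "fraction T M m s +[LM] fraction T M n t = fraction T M (t *>[M] m +[M] s *>[M] n) (s ** t)"
proof -
  have eq: "fraction T M (t' *>[M] m' +[M] s' *>[M] n') (s' ** t') = fraction T M (t *>[M] m +[M] s *>[M] n) (s ** t)"
    if m': "(m', s') : fraction T M m s" and n': "(n', t') : fraction T M n t" for m' s' n' t'
  proof -
    obtain u where u: "m' : car M" "s' : T" "u : T" "u *>[M] (s' *>[M] m) = u *>[M] (s *>[M] m')" using m' by (auto simp: fraction_mem)
    obtain v where v: "n' : car M" "t' : T" "v : T" "v *>[M] (t' *>[M] n) = v *>[M] (t *>[M] n')" using n' by (auto simp: fraction_mem)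
    have c: "s : car R" "t : car R" "s' : car R" "t' : car R" "u : car R" "v : car R" using m n u v Tc by auto
    have "(u ** v) *>[M] ((s ** t) *>[M] (t' *>[M] m' +[M] s' *>[M] n')) =
        v *>[M] (t *>[M] (t' *>[M] (u *>[M] (s *>[M] m')))) +[M] u *>[M] (s *>[M] (s' *>[M] (v *>[M] (t *>[M] n'))))"
      using c u(1) v(1) by (simp add: smult_assoc1 smult_r_distr lcomm)
    also have "... = (u ** v) *>[M] ((s' ** t') *>[M] (t *>[M] m +[M] s *>[M] n))"
      unfolding u(4)[symmetric] v(4)[symmetric] using c m(1) n(1) by (simp add: smult_assoc1 smult_r_distr lcomm)
    finally show ?thesis using c u v m n T_mult by (subst fraction_eq) (auto intro!: bexI[of _ "u ** v"])
  qed
  have "fraction T M m s +[LM] fraction T M n t =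
    (\<Union>p\<in>fraction T M m s. \<Union>q\<in>fraction T M n t. fraction T M (snd q *>[M] fst p +[M] snd p *>[M] fst q) (snd p ** snd q))"
    by (simp add: loc_module_def split_def)
  also have "... = fraction T M (t *>[M] m +[M] s *>[M] n) (s ** t)"
    by (intro UN_const[OF fraction_self[OF m]] UN_const[OF fraction_self[OF n]] eq) auto
  finally show ?thesis .
qed

lemma loc_module_smult:
  assumes a: "a : car R" "s : T" and n: "n : car M" "t : T"
  shows "fraction T (self_module R) a s *>[LM] fraction T M n t = fraction T M (a *>[M] n) (s ** t)"
proof -
  interpret S: fractions R "self_module R" T by (intro fractions.intro fractions_axioms.intro R.self_module_module) (use T_sub T_one T_mult in auto)
  have sel: "car (self_module R) = car R" "smult (self_module R) = (\<otimes>)" by (simp_all add: self_module_def)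
  have eq: "fraction T M (a' *>[M] n') (s' ** t') = fraction T M (a *>[M] n) (s ** t)"
    if a': "(a', s') : fraction T (self_module R) a s" and n': "(n', t') : fraction T M n t" for a' s' n' t'
  proof -
    obtain u where u: "a' : car R" "s' : T" "u : T" "u ** (s' ** a) = u ** (s ** a')" using a' by (auto simp: S.fraction_mem sel)
    obtain v where v: "n' : car M" "t' : T" "v : T" "v *>[M] (t' *>[M] n) = v *>[M] (t *>[M] n')" using n' by (auto simp: fraction_mem)
    have c: "s : car R" "t : car R" "s' : car R" "t' : car R" "u : car R" "v : car R" using a n u v Tc by auto
    have "(u ** v) *>[M] ((s ** t) *>[M] (a' *>[M] n')) = (u ** (s ** a')) *>[M] (v *>[M] (t *>[M] n'))"
      using c u(1) v(1) by (simp add: smult_assoc1 lcomm)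
    also have "... = (u ** v) *>[M] ((s' ** t') *>[M] (a *>[M] n))"
      unfolding u(4)[symmetric] v(4)[symmetric] using c a(1) n(1) by (simp add: smult_assoc1 lcomm)
    finally show ?thesis using c u v a n T_mult by (subst fraction_eq) (auto intro!: bexI[of _ "u ** v"])
  qed
  have "fraction T (self_module R) a s *>[LM] fraction T M n t =
    (\<Union>p\<in>fraction T (self_module R) a s. \<Union>q\<in>fraction T M n t. fraction T M (fst p *>[M] fst q) (snd p ** snd q))"
    by (simp add: loc_module_def split_def)
  also have "... = fraction T M (a *>[M] n) (s ** t)" by (intro UN_const[OF S.fraction_self] UN_const[OF fraction_self[OF n]] eq) (use a sel in auto)
  finally show ?thesis .
qed

end

locale multiplicative_set = cring R for R (structure) +
  fixes T :: "'a set"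
  assumes T_sub: "T <= car R" and T_one: "\<one> : T" and T_mult: "!!s t. [|s : T; t : T|] ==> s ** t : T"
begin

sublocale S: fractions R "self_module R" T by (intro fractions.intro fractions_axioms.intro self_module_module T_sub T_one T_mult)

abbreviation frac :: "'a => 'a => ('a \<times> 'a) set" where "frac == fraction T (self_module R)"

abbreviation "LR == loc_ring R T"

lemma self_module_simps [simp]: "car (self_module R) = car R" "x *>[self_module R] y = x ** y"
    "x +[self_module R] y = x +. y" "0[self_module R] = \<zero>" by (simp_all add: self_module_def)

lemma loc_ring_carrier: "car LR = {frac a s | a s. a : car R & s : T}"
  by (simp add: loc_ring_def)

lemma loc_ringE: assumes "X : car LR" obtains a s where "a : car R" "s : T" "X = frac a s"
  using assms by (auto simp: loc_ring_carrier)

lemma frac_closed: "[|a : car R; s : T|] ==> frac a s : car LR"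
  by (auto simp: loc_ring_carrier)

lemma loc_ring_zero: "0[LR] = frac \<zero> \<one>" and loc_ring_one: "1[LR] = frac \<one> \<one>"
  by (simp_all add: loc_ring_def)

lemma loc_ring_add:
  "[|a : car R; s : T; b : car R; t : T|] ==> frac a s +[LR] frac b t = frac (t ** a +. s ** b) (s ** t)"
  using S.loc_module_add[of a s b t] by (simp add: loc_module_def loc_ring_def)

lemma loc_ring_mult:
  "[|a : car R; s : T; b : car R; t : T|] ==> frac a s *[LR] frac b t = frac (a ** b) (s ** t)"
  using S.loc_module_smult[of a s b t] by (simp add: loc_module_def loc_ring_def)

lemma frac_eq: "[|a : car R; b : car R; s : T; t : T|] ==>
    frac a s = frac b t <-> (EX u:T. u ** (t ** a) = u ** (s ** b))" using S.fraction_eq[of a b s t] by simp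

lemma frac_eqI: "[|a : car R; b : car R; s : T; t : T; t ** a = s ** b|] ==> frac a s = frac b t"
  using S.fraction_eqI[of a b s t] by simp

lemma Tc: "s : T ==> s : car R"
  using T_sub by auto

lemma loc_ring_cring: "cring LR"
proof (rule cringI)
  show "abelian_group LR"
  proof (rule abelian_groupI)
    show "x +[LR] y : car LR" if xy: "x : car LR" "y : car LR" for x y
    proof -
      obtain a s b t where *: "a : car R" "s : T" "x = frac a s" "b : car R" "t : T" "y = frac b t" using xy loc_ringE by metis
      thus ?thesis using Tc T_mult by (simp add: loc_ring_add frac_closed)
    qed
    show "0[LR] : car LR" by (simp add: loc_ring_zero frac_closed T_one)
    show "x +[LR] y +[LR] z = x +[LR] (y +[LR] z)" if xyz: "x : car LR" "y : car LR" "z : car LR" for x y z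
    proof -
      obtain a s b t c r where *: "a : car R" "s : T" "x = frac a s" "b : car R" "t : T" "y = frac b t"
        "c : car R" "r : T" "z = frac c r" using xyz loc_ringE by metis
      have c: "s : car R" "t : car R" "r : car R" using * Tc by auto
      have "r ** (t ** a +. s ** b) +. s ** t ** c = t ** r ** a +. s ** (r ** b +. t ** c)" using *(1,4,7) c by algebra
      moreover have "s ** t ** r = s ** (t ** r)" using c by algebra
      ultimately show ?thesis using * c T_mult by (simp add: loc_ring_add)
    qed
    show "x +[LR] y = y +[LR] x" if xy: "x : car LR" "y : car LR" for x y
    proof -
      obtain a s b t where *: "a : car R" "s : T" "x = frac a s" "b : car R" "t : T" "y = frac b t" using xy loc_ringE by metis
      thus ?thesis using Tc T_mult by (simp add: loc_ring_add a_comm m_comm)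
    qed
    show "0[LR] +[LR] x = x" if x: "x : car LR" for x
    proof -
      obtain a s where *: "a : car R" "s : T" "x = frac a s" using x by (rule loc_ringE)
      thus ?thesis using Tc T_one by (simp add: loc_ring_add loc_ring_zero)
    qed
    show "EX y:car LR. y +[LR] x = 0[LR]" if x: "x : car LR" for x
    proof -
      obtain a s where *: "a : car R" "s : T" "x = frac a s" using x by (rule loc_ringE)
      have c: "s : car R" using * Tc by auto
      have "frac (\<ominus> a) s +[LR] x = frac (s ** \<ominus> a +. s ** a) (s ** s)" using * c by (simp add: loc_ring_add)
      also have "... = frac \<zero> \<one>" using * c T_mult T_one by (intro frac_eqI) (auto simp: r_minus l_neg)
      finally show ?thesis using * by (intro bexI[of _ "frac (\<ominus> a) s"]) (auto simp: loc_ring_zero frac_closed)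
    qed
  qed
  show "comm_monoid LR"
  proof (rule comm_monoidI)
    show "x *[LR] y : car LR" if xy: "x : car LR" "y : car LR" for x y
    proof -
      obtain a s b t where *: "a : car R" "s : T" "x = frac a s" "b : car R" "t : T" "y = frac b t" using xy loc_ringE by metis
      thus ?thesis using Tc T_mult by (simp add: loc_ring_mult frac_closed)
    qed
    show "1[LR] : car LR" by (simp add: loc_ring_one frac_closed T_one)
    show "x *[LR] y *[LR] z = x *[LR] (y *[LR] z)" if xyz: "x : car LR" "y : car LR" "z : car LR" for x y z
    proof -
      obtain a s b t c r where *: "a : car R" "s : T" "x = frac a s" "b : car R" "t : T" "y = frac b t"
        "c : car R" "r : T" "z = frac c r" using xyz loc_ringE by metis
      thus ?thesis using T_mult Tc by (simp add: loc_ring_mult m_assoc)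
    qed
    show "x *[LR] y = y *[LR] x" if xy: "x : car LR" "y : car LR" for x y
    proof -
      obtain a s b t where *: "a : car R" "s : T" "x = frac a s" "b : car R" "t : T" "y = frac b t" using xy loc_ringE by metis
      thus ?thesis using Tc T_mult by (simp add: loc_ring_mult m_comm)
    qed
    show "1[LR] *[LR] x = x" if x: "x : car LR" for x
    proof -
      obtain a s where *: "a : car R" "s : T" "x = frac a s" using x by (rule loc_ringE)
      thus ?thesis using Tc T_one by (simp add: loc_ring_mult loc_ring_one)
    qed
  qed
  show "(x +[LR] y) *[LR] z = x *[LR] z +[LR] y *[LR] z" if xyz: "x : car LR" "y : car LR" "z : car LR" for x y z
  proof -
    obtain a s b t c r where *: "a : car R" "s : T" "x = frac a s" "b : car R" "t : T" "y = frac b t"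
      "c : car R" "r : T" "z = frac c r" using xyz loc_ringE by metis
    have c: "s : car R" "t : car R" "r : car R" using * Tc by auto
    have "frac ((t ** a +. s ** b) ** c) (s ** t ** r) = frac (t ** r ** (a ** c) +. s ** r ** (b ** c)) (s ** r ** (t ** r))"
    proof (rule frac_eqI)
      show "s ** r ** (t ** r) ** ((t ** a +. s ** b) ** c) = s ** t ** r ** (t ** r ** (a ** c) +. s ** r ** (b ** c))" using *(1,4,7) c by algebra
    qed (use * c T_mult in auto)
    thus ?thesis using * c T_mult by (simp add: loc_ring_mult loc_ring_add)
  qed
qed

lemma loc_ring_localization: "ring_localization R T LR (%a. frac a \<one>)"
proof (rule ring_localization.intro)
  interpret L: cring LR by (rule loc_ring_cring)
  show "cring R" "cring LR" by (rule is_cring, rule loc_ring_cring)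
  show "(%a. frac a \<one>) : ring_hom R LR" by (rule ring_hom_memI) (auto simp: frac_closed T_one loc_ring_add loc_ring_mult loc_ring_one)
  show "T <= car R" "\<one> : T" "!!s t. [|s : T; t : T|] ==> s ** t : T" using T_sub T_one T_mult by auto
  show "frac s \<one> : Units LR" if s: "s : T" for s
  proof -
    have "frac s \<one> *[LR] frac \<one> s = frac \<one> \<one>" using s Tc T_one T_mult by (simp add: loc_ring_mult) (intro frac_eqI, auto)
    thus ?thesis unfolding Units_def using s Tc T_one frac_closed L.m_comm by (auto simp: loc_ring_one intro!: bexI[of _ "frac \<one> s"])
  qed
  show "EX a:car R. EX s:T. frac s \<one> *[LR] b = frac a \<one>" if b: "b : car LR" for b
  proof -
    obtain a s where *: "a : car R" "s : T" "b = frac a s" using b by (rule loc_ringE)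
    have "frac s \<one> *[LR] b = frac (s ** a) (\<one> ** s)" using * Tc T_one by (simp add: loc_ring_mult)
    also have "... = frac a \<one>" using * Tc T_one by (intro frac_eqI) auto
    finally show ?thesis using * by blast
  qed
  show "EX s:T. s ** a = \<zero>" if a: "a : car R" "frac a \<one> = 0[LR]" for a using a T_one Tc by (auto simp: loc_ring_zero frac_eq)
qed

end

lemma (in cring) prime_complement_multiplicative:
  assumes "primeideal P R" shows "multiplicative_set R (car R - P)"
  using primeD[OF assms] by unfold_locales auto

lemma loc_at_localization:
  assumes "primeideal P R"
  shows "ring_localization R (car R - P) (loc_at R P) (%a. fraction (car R - P) (self_module R) a 1[R])"
proof -
  interpret P: primeideal P R by fact
  interpret multiplicative_set R "car R - P" by (rule P.prime_complement_multiplicative[OF assms])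
  show ?thesis unfolding loc_at_def by (rule loc_ring_localization)
qed

section \<open>Ideals, primes and heights under localization\<close>

context ring_localization
begin

definition contract :: "'b set => 'a set"
  where "contract Q = {a : car A. phi a : Q}"

definition extend :: "'a set => 'b set"
  where "extend J = {b : car B. EX a:J. EX s:T. phi s *[B] b = phi a}"

lemma extend_mono: "J <= K ==> extend J <= extend K"
  unfolding extend_def by blast

lemma contract_ideal: assumes "ideal Q B" shows "ideal (contract Q) A"
  by (rule A.ideal_criterion)
    (use B.idealD[OF assms] phi_in in "auto simp: contract_def phi_zero phi_add phi_mult")

lemma ideal_mem_contract:
  assumes Q: "ideal Q B" and b: "b : car B" and as: "a : car A" "s : T" "phi s *[B] b = phi a"
  shows "b : Q <-> a : contract Q"
proof
  assume "b : Q"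
  hence "phi a : Q" using as B.idealD(7)[OF Q phi_in[OF T_carrier[OF as(2)]]] by metis
  thus "a : contract Q" using as by (simp add: contract_def)
next
  assume "a : contract Q"
  hence "inv\<^bsub>B\<^esub> (phi s) *[B] phi a : Q" using B.idealD(7)[OF Q] phi_unit[OF as(2)] by (simp add: contract_def)
  moreover have "inv\<^bsub>B\<^esub> (phi s) *[B] phi a = b" using phi_unit[OF as(2)] b as(3)[symmetric] by (simp add: B.m_assoc[symmetric] B.Units_closed)
  ultimately show "b : Q" by simp
qed

lemma contract_subset_iff:
  assumes Q: "ideal Q B" "ideal Q' B"
  shows "contract Q <= contract Q' <-> Q <= Q'"
proof
  assume sub: "contract Q <= contract Q'"
  show "Q <= Q'"
  proof
    fix b assume b: "b : Q"
    hence bc: "b : car B" using B.idealD(3)[OF Q(1)] by auto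
    obtain a s where as: "a : car A" "s : T" "phi s *[B] b = phi a" using phi_surj[OF bc] by blast
    show "b : Q'" using ideal_mem_contract[OF Q(1) bc as] ideal_mem_contract[OF Q(2) bc as] b sub by auto
  qed
qed (auto simp: contract_def)

lemma contract_prime:
  assumes "primeideal Q B" shows "primeideal (contract Q) A" "contract Q Int T = {}"
proof -
  note q = B.primeD[OF assms]
  show "primeideal (contract Q) A"
  proof (rule A.primeideal_criterion[OF contract_ideal[OF q(1)]])
    show "1[A] ~: contract Q" using q(2) by (simp add: contract_def phi_one)
    show "a : contract Q \<or> b : contract Q" if "a : car A" "b : car A" "a *[A] b : contract Q" for a b
      using that q(3)[of "phi a" "phi b"] phi_in by (auto simp: contract_def phi_mult)
  qed
  have "phi s ~: Q" if "s : T" for s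
  proof
    assume "phi s : Q"
    hence "inv\<^bsub>B\<^esub> (phi s) *[B] phi s : Q"  by (rule B.idealD(7)[OF q(1) B.Units_inv_closed[OF phi_unit[OF that]]])
    thus False using phi_unit[OF that] q(2) by simp
  qed
  thus "contract Q Int T = {}" by (auto simp: contract_def)
qed

text \<open>Inclusions between ideals of \<open>B\<close> are detected by their contractions, so the
  images of generators of \<open>contract Q\<close> generate \<open>Q\<close>.\<close>

lemma noetherian_B: assumes "noetherian_ring A" shows "noetherian_ring B"
proof (rule B.noetherian_ringI)
  fix Q assume Q: "ideal Q B"
  obtain X where X: "X <= car A" "finite X" "contract Q = Idl\<^bsub>A\<^esub> X" using noetherian_ring.finetely_gen[OF assms contract_ideal[OF Q]] by auto
  have XQ: "X <= contract Q" unfolding X(3) by (rule A.genideal_self[OF X(1)])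
  have c: "phi ` X <= car B" using X(1) phi_in by auto
  let ?I = "Idl\<^bsub>B\<^esub> (phi ` X)"
  have I: "ideal ?I B" by (rule B.genideal_ideal[OF c])
  have "?I <= Q" by (rule B.genideal_minimal[OF Q]) (use XQ in "auto simp: contract_def")
  moreover have "contract Q <= contract ?I" unfolding X(3)
    by (rule A.genideal_minimal[OF contract_ideal[OF I]]) (use B.genideal_self[OF c] X(1) in "auto simp: contract_def")
  hence "Q <= ?I" using contract_subset_iff[OF Q I] by simp
  ultimately show "EX F<=car B. finite F & Q = Idl\<^bsub>B\<^esub> F" using c X(2) by blast
qed

lemma extend_ideal:
  assumes J: "ideal J A" shows "ideal (extend J) B"
proof (rule B.ideal_criterion)
  note cJ = A.idealD[OF J]
  show "extend J <= car B" by (auto simp: extend_def)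
  have "phi 1[A] *[B] 0[B] = phi 0[A]" using phi_zero phi_in[OF A.one_closed] by simp
  thus "0[B] : extend J" using cJ(2) T_one unfolding extend_def by blast
  show "x +[B] y : extend J" if xy: "x : extend J" "y : extend J" for x y
  proof -
    obtain a s b t where *: "x : car B" "a : J" "s : T" "phi s *[B] x = phi a" "y : car B" "b : J" "t : T" "phi t *[B] y = phi b"
      using xy by (auto simp: extend_def)
    have c: "s : car A" "t : car A" "a : car A" "b : car A" using * T_carrier cJ(3) by auto
    note pc = phi_in[OF c(1)] phi_in[OF c(2)]
    have "phi s *[B] phi t *[B] (x +[B] y) = phi t *[B] (phi s *[B] x) +[B] phi s *[B] (phi t *[B] y)" using pc *(1,5) by algebra
    hence "phi (s *[A] t) *[B] (x +[B] y) = phi (t *[A] a +[A] s *[A] b)" using c *(4,8) by (simp add: phi_mult phi_add)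
    moreover have "t *[A] a +[A] s *[A] b : J" using cJ(4,7) * c by simp
    ultimately show ?thesis using * T_mult unfolding extend_def by blast
  qed
  show "b *[B] x : extend J" if bx: "b : car B" "x : extend J" for b x
  proof -
    obtain a s where *: "x : car B" "a : J" "s : T" "phi s *[B] x = phi a" using bx by (auto simp: extend_def)
    obtain a' t where at: "a' : car A" "t : T" "phi t *[B] b = phi a'" using phi_surj bx(1) by blast
    have c: "s : car A" "t : car A" "a : car A" using * at T_carrier cJ(3) by auto
    note pc = phi_in[OF c(1)] phi_in[OF c(2)]
    have "phi s *[B] phi t *[B] (b *[B] x) = (phi t *[B] b) *[B] (phi s *[B] x)" using pc *(1) bx(1) by algebra
    hence "phi (s *[A] t) *[B] (b *[B] x) = phi (a' *[A] a)" using c at *(4) by (simp add: phi_mult)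
    moreover have "a' *[A] a : J" using cJ(7) * at by simp
    ultimately show ?thesis using * at bx T_mult unfolding extend_def by blast
  qed
qed

lemma phi_mem_extend:
  assumes J: "ideal J A" and a: "a : car A"
  shows "phi a : extend J <-> (EX s:T. s *[A] a : J)"
proof
  assume "phi a : extend J"
  then obtain b s where *: "b : J" "s : T" "phi s *[B] phi a = phi b" by (auto simp: extend_def)
  have c: "s : car A" "b : car A" using * T_carrier A.idealD(3)[OF J] by auto
  have "phi (s *[A] a) = phi b" using c a *(3) by (simp add: phi_mult)
  then obtain t where t: "t : T" "t *[A] (s *[A] a) = t *[A] b" using phi_eq[of "s *[A] a" b] c a by auto
  have "(t *[A] s) *[A] a = t *[A] b" using t c a T_carrier by (simp add: A.m_assoc)
  thus "EX s:T. s *[A] a : J" using T_mult[OF t(1) *(2)] A.idealD(7)[OF J T_carrier[OF t(1)] *(1)] by metis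
next
  assume "EX s:T. s *[A] a : J"
  then obtain s where s: "s : T" "s *[A] a : J" by blast
  have "phi s *[B] phi a = phi (s *[A] a)" using a T_carrier[OF s(1)] by (simp add: phi_mult)
  thus "phi a : extend J" using s phi_in[OF a] unfolding extend_def by blast
qed

lemma contract_extend_prime:
  assumes P: "primeideal P A" "P Int T = {}" shows "contract (extend P) = P"
proof -
  note p = A.primeD[OF P(1)]
  have "(EX s:T. s *[A] a : P) <-> a : P" if "a : car A" for a using p(3)[of _ a] T_carrier that P(2) T_one A.idealD(7)[OF p(1)] by blast
  thus ?thesis using phi_mem_extend[OF p(1)] A.idealD(3)[OF p(1)] by (auto simp: contract_def)
qed

lemma extend_prime:
  assumes P: "primeideal P A" "P Int T = {}" shows "primeideal (extend P) B"
proof -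
  note p = A.primeD[OF P(1)]
  have e: "ideal (extend P) B" by (rule extend_ideal[OF p(1)])
  note ce = contract_extend_prime[OF P]
  show ?thesis
  proof (rule B.primeideal_criterion[OF e])
    show "1[B] ~: extend P" using p(2) ce by (auto simp: contract_def phi_one[symmetric])
    fix b c assume bc: "b : car B" "c : car B" "b *[B] c : extend P"
    obtain x s y t where *: "x : car A" "s : T" "phi s *[B] b = phi x" "y : car A" "t : T" "phi t *[B] c = phi y" using phi_surj bc by metis
    have sc: "s : car A" "t : car A" using * T_carrier by auto
    note pc = phi_in[OF sc(1)] phi_in[OF sc(2)]
    have "phi s *[B] phi t *[B] (b *[B] c) = (phi s *[B] b) *[B] (phi t *[B] c)" using pc bc(1,2) by algebra
    hence "phi (s *[A] t) *[B] (b *[B] c) = phi (x *[A] y)" using *(1,3,4,6) sc by (simp add: phi_mult)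
    hence "x *[A] y : P" using ideal_mem_contract[OF e, of "b *[B] c" "x *[A] y" "s *[A] t"] bc * T_mult ce by simp
    hence "x : P \<or> y : P" using p(3) * by blast
    thus "b : extend P \<or> c : extend P" using ideal_mem_contract[OF e bc(1) *(1-3)] ideal_mem_contract[OF e bc(2) *(4-6)] ce by simp
  qed
qed

lemma extend_contract_prime:
  assumes Q: "primeideal Q B" shows "extend (contract Q) = Q"
proof -
  note q = B.primeD(1)[OF Q]
  have e: "ideal (extend (contract Q)) B" by (rule extend_ideal[OF contract_ideal[OF q]])
  show ?thesis using contract_subset_iff[OF e q] contract_subset_iff[OF q e]
      contract_extend_prime[OF contract_prime[OF Q]] by auto
qed

text \<open>Contraction and extension carry strict chains of primes to strict chains. In
  \<open>A\<close> all members of a chain that ends at \<open>contract Q\<close> miss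
  \<open>T\<close>, because the last one does.\<close>

lemma height_contract:
  assumes Q: "primeideal Q B" shows "height A (contract Q) = height B Q"
proof (rule antisym)
  show "height B Q <= height A (contract Q)"
  proof (rule height_leI)
    fix n c assume c: "prime_chain B n c" "c n = Q"
    have "prime_chain A n (%i. contract (c i))" using c(1) contract_prime(1) contract_subset_iff B.primeD(1)
      unfolding prime_chain_def psubset_eq by (metis less_imp_le Suc_leI subset_antisym order_refl)
    thus "enat n <= height A (contract Q)" using prime_chain_le_height c(2) by fastforce
  qed
  show "height A (contract Q) <= height B Q"
  proof (rule height_leI)
    fix n c assume c: "prime_chain A n c" "c n = contract Q"
    have sub: "c i <= contract Q" if "i <= n" for i using that
    proof (induction rule: inc_induct)
      case base thus ?case using c by simp
    next
      case (step m) thus ?case using c(1) unfolding prime_chain_def by blast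
    qed
    have p: "primeideal (c i) A" "c i Int T = {}" if "i <= n" for i
      using c(1) that sub[OF that] contract_prime(2)[OF Q] by (auto simp: prime_chain_def)
    have "extend (c i) < extend (c (Suc i))" if "i < n" for i
    proof -
      have sc: "c i < c (Suc i)" using c(1) that by (simp add: prime_chain_def)
      have "contract (extend (c i)) = c i" "contract (extend (c (Suc i))) = c (Suc i)" using contract_extend_prime p that by auto
      moreover have "extend (c i) <= extend (c (Suc i))" using sc by (intro extend_mono) auto
      ultimately show ?thesis using sc by (metis psubset_eq)
    qed
    hence "prime_chain B n (%i. extend (c i))" using extend_prime p by (auto simp: prime_chain_def)
    thus "enat n <= height B Q" using prime_chain_le_height[of B n "%i. extend (c i)"] c(2) extend_contract_prime[OF Q] by simp
  qed
qed

lemma local_noetherian_B: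
  assumes P: "primeideal P A" "T = car A - P" and "noetherian_ring A"
  shows "local_noetherian B (extend P)"
proof -
  have PT: "P Int T = {}" using P by auto
  note pe = B.primeD[OF extend_prime[OF P(1) PT]]
  show ?thesis
  proof (intro local_noetherian.intro noetherian_cring.intro local_noetherian_axioms.intro)
    show "cring B" by (rule B_cring)
    show "noetherian_ring B" using noetherian_B assms(3) .
    show "ideal (extend P) B" "1[B] ~: extend P" using pe by auto
    fix b assume b: "b : car B" "b ~: extend P"
    obtain a s where as: "a : car A" "s : T" "phi s *[B] b = phi a" using phi_surj[OF b(1)] by blast
    have "a ~: P" using ideal_mem_contract[OF pe(1) b(1) as] b(2) contract_extend_prime[OF P(1) PT] by simp
    hence "phi a : Units B" using phi_unit as(1) P(2) by simp
    hence "phi s *[B] b : Units B" using as(3) by simp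
    thus "b : Units B" using b(1) phi_in[OF T_carrier[OF as(2)]] B.unit_factor B.m_comm by metis
  qed
qed

end

lemma (in local_noetherian) n_maximal: "maximalideal J R <-> J = nn"
proof
  assume J: "maximalideal J R"
  interpret J: maximalideal J R by fact
  have "\<one> ~: J" using J.I_notcarr J.one_imp_carrier by auto
  hence "J <= nn" by (rule proper_ideal_subset_n[OF J.is_ideal])
  thus "J = nn" using J.I_maximal[OF n_ideal] n_closed(1) n_proper by auto
next
  assume "J = nn"
  moreover have "maximalideal nn R"
  proof (rule maximalidealI[OF n_ideal])
    show "car R ~= nn" using n_proper by auto
    fix K assume K: "ideal K R" "nn <= K" "K <= car R"
    show "K = nn \<or> K = car R" using proper_ideal_subset_n[OF K(1)] ideal.one_imp_carrier[OF K(1)] K(2) by blast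
  qed
  ultimately show "maximalideal J R" by simp
qed

lemma (in local_noetherian) max_ideal_eq: "max_ideal R = nn"
  by (simp add: max_ideal_def n_maximal)

lemma (in local_noetherian) noetherian_local: "noetherian_local_ring R"
  by (simp add: noetherian_local_ring_def n_maximal is_cring noetherian_ring_axioms)

lemma noetherian_local_ring_imp:
  assumes "noetherian_local_ring R" shows "local_noetherian R (max_ideal R)"
proof -
  have c: "cring R" and n: "noetherian_ring R" and ex: "EX! \<mm>. maximalideal \<mm> R" using assms by (auto simp: noetherian_local_ring_def)
  interpret noetherian_cring R by (intro noetherian_cring.intro c n)
  have m: "maximalideal (max_ideal R) R" unfolding max_ideal_def by (rule theI'[OF ex])
  interpret m: maximalideal "max_ideal R" R by fact
  show ?thesis
  proof (intro local_noetherian.intro local_noetherian_axioms.intro noetherian_cring_axioms)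
    show "ideal (max_ideal R) R" by (rule m.is_ideal)
    show "1[R] ~: max_ideal R" using m.I_notcarr m.one_imp_carrier by auto
    fix x assume x: "x : car R" "x ~: max_ideal R"
    show "x : Units R"
    proof (rule ccontr)
      assume nu: "x ~: Units R"
      have "PIdl\<^bsub>R\<^esub> x ~= car R"
      proof
        assume "PIdl\<^bsub>R\<^esub> x = car R"
        then obtain y where "y : car R" "1[R] = y *[R] x" unfolding cgenideal_def using one_closed by blast
        thus False using nu x(1) m_comm unfolding Units_def by auto
      qed
      then obtain K where K: "maximalideal K R" "PIdl\<^bsub>R\<^esub> x <= K" using maximal_ideal_above[OF cgenideal_ideal[OF x(1)]] by blast
      hence "K = max_ideal R" using ex m by blast
      thus False using K(2) cgenideal_self[OF x(1)] x(2) by blast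
    qed
  qed
qed

lemma loc_ideal_at_eq:
  assumes P: "primeideal P R" and J: "J <= car R"
  shows "loc_ideal_at R P J = ring_localization.extend (car R - P) (loc_at R P)
    (%a. fraction (car R - P) (self_module R) a 1[R]) J"
proof -
  interpret P: primeideal P R by fact
  interpret multiplicative_set R "car R - P" by (rule P.prime_complement_multiplicative[OF P])
  interpret L: ring_localization R "car R - P" LR "%a. frac a 1[R]" by (rule loc_ring_localization)
  have "X : L.extend J <-> (EX a s. a : J & s : car R - P & X = frac a s)" for X
  proof
    assume "X : L.extend J"
    then obtain a s where *: "X : car LR" "a : J" "s : car R - P" "frac s 1[R] *[LR] X = frac a 1[R]" by (auto simp: L.extend_def)
    have ac: "a : car R" "s : car R" using * J by auto
    have "frac s 1[R] *[LR] frac a s = frac (s *[R] a) (1[R] *[R] s)" using ac * T_one by (simp add: loc_ring_mult)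
    also have "... = frac a 1[R]" using ac * T_one by (intro frac_eqI) auto
    finally have "X = frac a s" using L.phi_cancel[OF *(3,1) frac_closed[OF ac(1) *(3)]] *(4) by simp
    thus "EX a s. a : J & s : car R - P & X = frac a s" using * by blast
  next
    assume "EX a s. a : J & s : car R - P & X = frac a s"
    then obtain a s where *: "a : J" "s : car R - P" "X = frac a s" by blast
    have ac: "a : car R" "s : car R" using * J by auto
    have "frac s 1[R] *[LR] frac a s = frac (s *[R] a) (1[R] *[R] s)" using ac * T_one by (simp add: loc_ring_mult)
    also have "... = frac a 1[R]" using ac * T_one by (intro frac_eqI) auto
    finally show "X : L.extend J" using * frac_closed[OF ac(1) *(2)] unfolding L.extend_def by blast
  qed
  thus ?thesis unfolding loc_ideal_at_def loc_at_def by blast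
qed

section \<open>Ideals of finite injective dimension in a local ring\<close>

lemma (in local_noetherian) finite_inj_dim_coresolution:
  assumes C: "ideal C R" and "inj_dim R (ideal_module R C) < \<infinity>"
  shows "\<exists>eps (E :: nat => ('a, (nat + 'a + 'a) set) module) d n. local_coresolution R nn C eps E d n"
proof -
  have sel: "car (ideal_module R C) = C" "x +[ideal_module R C] y = x +. y" "a *>[ideal_module R C] x = a ** x"
    "0[ideal_module R C] = \<zero>" for x y a by (simp_all add: ideal_module_def self_module_def)
  obtain n eps d and E :: "nat => ('a, (nat + 'a + 'a) set) module" where "coresolution R (ideal_module R C) n eps E d"
    using inj_dim_finite_imp_coresolution[OF assms(2) ideal_module_module[OF C]] by blast
  then interpret coresolution R "ideal_module R C" n eps E d .
  have "local_coresolution R nn C eps E d n"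
  proof (intro local_coresolution.intro local_coresolution_axioms.intro local_noetherian_axioms C)
    show "module R (E i)" for i by (rule E.module_axioms)
    show "EX w:car (E i). (ALL j:J. j *>[E i] w = 0[E i]) & a *>[E i] w = v"
      if "ideal J R" "a : car R" "v : car (E i)" "!!r. [|r : car R; r ** a : J|] ==> r *>[E i] v = 0[E i]"
      for i J a v using baer_divisible[OF E_baer that] .
    show "!!c. [|c : C; eps c = 0[E 0]|] ==> c = \<zero>" using eps_inj sel by simp
    show "!!x. x : car (E 0) ==> (d 0 x = 0[E 1]) = (EX c:C. x = eps c)" using exact_0 sel by simp
    show "!!i x. x : car (E (Suc i)) ==> (d (Suc i) x = 0[E (Suc (Suc i))]) = (EX y:car (E i). x = d i y)" using exact by simp
    show "!!i. n < i ==> car (E i) = {0[E i]}" using E_vanish by simp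
    show "!!c. c : C ==> eps c : car (E 0)" using eps_closed sel by simp
    show "!!c c'. [|c : C; c' : C|] ==> eps (c +. c') = eps c +[E 0] eps c'" using eps_add sel by simp
    show "!!a c. [|a : car R; c : C|] ==> eps (a ** c) = a *>[E 0] eps c" using eps_smult sel by simp
  qed (auto simp: d_closed d_add d_smult)
  thus ?thesis by blast
qed

context local_noetherian
begin

lemma finite_inj_dim_socle_extension:
  assumes C: "ideal C R" "inj_dim R (ideal_module R C) < \<infinity>"
    and x: "!!j. j < delta ==> x j : nn"
      "!!j. j < delta ==> nonzerodiv R (adjoin_seq R {\<zero>} x (car R) j) (car R) (x j)"
      "!!j. j < delta ==> nonzerodiv R (adjoin_seq R {\<zero>} x C j) C (x j)"
    and maximal: "!!q. [|primeideal q R; adjoin_seq R {\<zero>} x (car R) delta <= q|] ==> q = nn"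
    and m: "m : C" "!!k. k : nn ==> k ** m : adjoin_seq R {\<zero>} x C delta"
    and sig: "sig : car R" "colon R (adjoin_seq R {\<zero>} x (car R) delta) sig = nn"
  shows "EX u:C. sig ** u \<ominus> m : adjoin_seq R {\<zero>} x C delta"
proof -
  obtain eps d n and E :: "nat => ('a, (nat + 'a + 'a) set) module" where "local_coresolution R nn C eps E d n"
    using finite_inj_dim_coresolution[OF C] by blast
  then interpret local_coresolution R nn C eps E d n .
  show ?thesis by (rule socle_divisible[OF x(1,2) maximal x(3) m sig]) auto
qed

lemma socle_multiple:
  assumes maximal: "!!q. [|primeideal q R; J <= q|] ==> q = nn"
    and J: "ideal J R" and b: "b : car R" "b ~: J"
  shows "EX r:car R. r ** b ~: J & colon R J (r ** b) = nn"
proof -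
  have M: "ideal (PIdl b) R" and bM: "b : PIdl b" using cgenideal_ideal[OF b(1)] cgenideal_self[OF b(1)] .
  obtain m where m: "m : PIdl b" "m ~: J" "primeideal (colon R J m) R" using colon_prime[OF J M bM b(2)] by blast
  have mc: "m : car R" using m(1) idealD(3)[OF M] by auto
  have "colon R J m = nn" using maximal[OF m(3)] subset_colon[OF J mc] by auto
  thus ?thesis using m(1,2) by (auto simp: cgenideal_def)
qed

lemma adjoin_seq_mult:
  assumes "ideal C R" "!!i. i < j ==> x i : car R" "a : adjoin_seq R {\<zero>} x (car R) j" "c : C"
  shows "a ** c : adjoin_seq R {\<zero>} x C j"
  using assms(2,3)
proof (induction j arbitrary: a)
  case 0
  thus ?case using idealD(3)[OF assms(1,4)] by simp
next
  case (Suc j)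
  obtain n m where nm: "n : adjoin_seq R {\<zero>} x (car R) j" "m : car R" "a = n +. x j ** m" using Suc.prems(2) by (auto elim: adjoinE)
  have xj: "x j : car R" using Suc.prems by auto
  have nc: "n : car R" using nm(1) idealD(3)[OF adjoin_seq_ideal[OF zeroideal oneideal, of j x]] Suc.prems(1) by auto
  have cc: "c : car R" using idealD(3)[OF assms(1,4)] .
  have "a ** c = n ** c +. x j ** (m ** c)" unfolding nm(3) using nc nm(2) xj cc by algebra
  moreover have "n ** c : adjoin_seq R {\<zero>} x C j" by (rule Suc.IH[OF _ nm(1)]) (use Suc.prems in auto)
  moreover have "m ** c : C" using idealD(7)[OF assms(1) nm(2) assms(4)] .
  ultimately show ?case using adjoinI by simp
qed

lemma adjoin_seq_subset:
  assumes "ideal C R" "!!i. i < j ==> x i : car R"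
  shows "adjoin_seq R {\<zero>} x C j <= C"
  using assms(2)
proof (induction j)
  case (Suc j)
  thus ?case using adjoin_minimal[OF assms(1), of "adjoin_seq R {\<zero>} x C j" C "x j"] idealD(7)[OF assms(1)] by auto
qed (use idealD[OF assms(1)] in auto)

lemma adjoin_seq_proper:
  assumes C: "ideal C R" "~ C <= {\<zero>}" and x: "!!i. i < j ==> x i : nn"
  shows "~ C <= adjoin_seq R {\<zero>} x C j"
  using x
proof (induction j)
  case 0
  thus ?case using C by simp
next
  case (Suc j)
  have xc: "x i : car R" if "i < Suc j" for i using Suc.prems[OF that] n_closed(3) by auto
  let ?N = "adjoin_seq R {\<zero>} x C j"
  have N: "ideal ?N R" by (rule adjoin_seq_ideal[OF zeroideal C(1)]) (use xc in auto)
  have NC: "?N <= C" by (rule adjoin_seq_subset[OF C(1)]) (use xc in auto)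
  have xn: "x j : nn" using Suc.prems by auto
  show ?case using nakayama_local[OF N C(1) xn xn _ _ NC] Suc.IH Suc.prems by auto
qed

text \<open>The quotient is nonzero by Nakayama, and an associated prime of it contains the regular
  sequence, hence equals \<open>nn\<close>.\<close>

lemma socle_of_quotient:
  assumes maximal: "!!q. [|primeideal q R; adjoin_seq R {\<zero>} x (car R) delta <= q|] ==> q = nn"
    and x: "!!j. j < delta ==> x j : nn" and C: "ideal C R" "~ C <= {\<zero>}"
  shows "EX m:C. m ~: adjoin_seq R {\<zero>} x C delta & (ALL k:nn. k ** m : adjoin_seq R {\<zero>} x C delta)"
proof -
  have xc: "x i : car R" if "i < delta" for i using x[OF that] n_closed(3) by auto
  let ?N = "adjoin_seq R {\<zero>} x C delta"
  have N: "ideal ?N R" by (rule adjoin_seq_ideal[OF zeroideal C(1)]) (use xc in auto)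
  obtain c where c: "c : C" "c ~: ?N" using adjoin_seq_proper[where x=x and j=delta, OF C x] by blast
  obtain m where m: "m : C" "m ~: ?N" "primeideal (colon R ?N m) R" using colon_prime[OF N C(1) c] by blast
  have "adjoin_seq R {\<zero>} x (car R) delta <= colon R ?N m"
  proof
    fix a assume a: "a : adjoin_seq R {\<zero>} x (car R) delta"
    have "a : car R" using a adjoin_seq_subset[OF oneideal, of delta x] xc by auto
    thus "a : colon R ?N m" using adjoin_seq_mult[OF C(1) xc a m(1)] by (simp add: colon_def)
  qed
  hence "colon R ?N m = nn" by (rule maximal[OF m(3)])
  thus ?thesis using m(1,2) by (auto simp: colon_def)
qed

text \<open>Modulo a maximal regular sequence \<open>C\<close> becomes a nonzero injective module over an
  Artinian ring, which is faithful; Nakayama's lemma lifts this back.\<close>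

lemma finite_inj_dim_faithful:
  assumes dim: "krull_dim R = enat d" "depth_ge nn (car R) d {\<zero>}"
    and C: "ideal C R" "inj_dim R (ideal_module R C) < \<infinity>" "depth_ge nn C d {\<zero>}"
    and b: "b : car R" "!!c. c : C ==> b ** c = \<zero>"
  shows "b = \<zero>"
proof -
  note cC = idealD[OF C(1)]
  have C0: "~ C <= {\<zero>}" using depth_ge_not_subset[OF is_cring zeroideal C(1) n_closed(1) C(3)] .
  obtain x where x: "ALL j<d. x j : nn & nonzerodiv R (adjoin_seq R {\<zero>} x (car R) j) (car R) (x j)
    & nonzerodiv R (adjoin_seq R {\<zero>} x C j) C (x j)" using common_regular_sequence[OF oneideal C(1) zeroideal zeroideal _ _ dim(2) C(3)] cC by auto
  have xn: "x j : nn" and xc: "x j : car R" if "j < d" for j using x that n_closed(3) by auto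
  have xr: "nonzerodiv R (adjoin_seq R {\<zero>} x (car R) j) (car R) (x j)"
    "nonzerodiv R (adjoin_seq R {\<zero>} x C j) C (x j)" if "j < d" for j using x that by auto
  let ?a = "adjoin_seq R {\<zero>} x (car R)" and ?N = "adjoin_seq R {\<zero>} x C"
  have aI: "ideal (?a j) R" if "j <= d" for j by (rule adjoin_seq_ideal[OF zeroideal oneideal]) (use xc that in auto)
  have NI: "ideal (?N j) R" if "j <= d" for j by (rule adjoin_seq_ideal[OF zeroideal C(1)]) (use xc that in auto)
  have maximal: "q = nn" if "primeideal q R" "?a d <= q" for q using prime_over_maximal_regular_sequence[OF dim(1) xc xr(1)] that by blast
  \<comment> \<open>The annihilator of \<open>C / (x 0, ..., x (j - 1)) C\<close>, to be shown equal
    to \<open>?a j\<close> from \<open>j = d\<close> down to \<open>j = 0\<close>.\<close>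
  define bb where "bb j = {b : car R. ALL c:C. b ** c : ?N j}" for j
  have bbI: "ideal (bb j) R" if "j <= d" for j unfolding bb_def
    by (rule ideal_criterion) (use idealD[OF NI[OF that]] cC in "auto simp: l_distr m_assoc")
  have abb: "?a j <= bb j" if "j <= d" for j using adjoin_seq_mult[OF C(1), of j x] xc that idealD(3)[OF aI[OF that]] by (auto simp: bb_def)
  have "bb j <= ?a j" if "j <= d" for j using that
  proof (induction rule: inc_induct)
    case base
    obtain m where m: "m : C" "m ~: ?N d" "!!k. k : nn ==> k ** m : ?N d"
      using socle_of_quotient[where x=x and delta=d, OF maximal xn C(1) C0] by blast
    show ?case
    proof (rule subsetI, rule ccontr)
      fix b assume b: "b : bb d" "b ~: ?a d"
      have bc: "b : car R" using b by (simp add: bb_def)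
      \<comment> \<open>\<open>r b\<close> is a nonzero socle element of \<open>R / ?a d\<close>, so
        by injectivity the socle element \<open>m\<close> of \<open>C / ?N d\<close> equals
        \<open>r b u\<close> there. But \<open>b\<close> kills that quotient.\<close>
      obtain r where r: "r : car R" "colon R (?a d) (r ** b) = nn" using socle_multiple[OF maximal aI[OF order_refl] bc b(2)] by blast
      obtain u where u: "u : C" "r ** b ** u \<ominus> m : ?N d"
        using finite_inj_dim_socle_extension[where x=x and delta=d and sig="r ** b", OF C(1,2) xn xr maximal m(1,3)] r bc by auto
      note cN = idealD[OF NI[OF order_refl]]
      have uc: "u : car R" "m : car R" using u m cC by auto
      have "r ** (b ** u) : ?N d" using b(1) u(1) r(1) cN(7) by (simp add: bb_def)
      hence "r ** (b ** u) \<ominus> (r ** b ** u \<ominus> m) : ?N d" using u(2) cN(6) by blast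
      moreover have "r ** (b ** u) \<ominus> (r ** b ** u \<ominus> m) = m" using r(1) bc uc by algebra
      ultimately show False using m(2) by simp
    qed
  next
    case (step j)
    have j: "j < d" "j <= d" "Suc j <= d" using step by auto
    note cN = idealD[OF NI[OF j(2)]] and ca = idealD[OF aI[OF j(2)]]
    \<comment> \<open>The case \<open>Suc j\<close> gives \<open>b = a + x j b'\<close>. Regularity
      of \<open>x j\<close> on \<open>C / ?N j\<close> shows that \<open>b'\<close> is in
      \<open>bb j\<close> again, and Nakayama applies.\<close>
    have "bb j <= adjoin R (?a j) (x j) (bb j)"
    proof
      fix b assume b: "b : bb j"
      have "?N j <= ?N (Suc j)" using adjoin_superset[OF NI[OF j(2)] C(1) xc[OF j(1)]] by simp
      hence "b : bb (Suc j)" using b by (auto simp: bb_def)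
      hence "b : adjoin R (?a j) (x j) (car R)" using step.IH by auto
      then obtain a b' where *: "a : ?a j" "b' : car R" "b = a +. x j ** b'" by (rule adjoinE)
      have "b' ** c : ?N j" if c: "c : C" for c
      proof -
        have cc: "c : car R" "a : car R" using c cC * ca(3) by auto
        have "x j ** (b' ** c) = (a +. x j ** b') ** c \<ominus> a ** c" using cc *(2) xc[OF j(1)] by algebra
        also have "... : ?N j" using b c abb[OF j(2)] *(1) cN(6) unfolding *(3)[symmetric] by (auto simp: bb_def)
        finally show ?thesis using xr(2)[OF j(1)] cC(7)[OF *(2) c] by (auto simp: nonzerodiv_def)
      qed
      hence "b' : bb j" using * by (simp add: bb_def)
      thus "b : adjoin R (?a j) (x j) (bb j)" unfolding *(3) by (rule adjoinI[OF *(1)])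
    qed
    thus ?case using nakayama_local[OF aI[OF j(2)] bbI[OF j(2)] xn[OF j(1)] xn[OF j(1)] _ _ abb[OF j(2)]] by auto
  qed
  hence "bb 0 <= {\<zero>}" by (metis adjoin_seq.simps(1) le0)
  moreover have "b : bb 0" using b by (simp add: bb_def)
  ultimately show ?thesis by blast
qed

text \<open>A nonzero ideal \<open>C\<close> of finite injective dimension in a one-dimensional Gorenstein ring is generated
  by a nonzerodivisor: some \<open>c : C\<close> generates a free submodule of \<open>C / y C\<close>, whence
  \<open>C / R c\<close> has no \<open>y\<close>-torsion; but it is annihilated by \<open>c\<close>.\<close>

lemma finite_inj_dim_principal:
  assumes dim: "krull_dim R = 1" and y: "y : nn" "nonzerodiv R {\<zero>} (car R) y"
    and R: "inj_dim R (ideal_module R (car R)) < \<infinity>"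
    and C: "ideal C R" "inj_dim R (ideal_module R C) < \<infinity>" "~ C <= {\<zero>}"
  shows "EX c:C. C = PIdl c & nonzerodiv R {\<zero>} (car R) c"
proof -
  note cC = idealD[OF C(1)]
  have yc: "y : car R" using y n_closed(3) by auto
  have dim1: "krull_dim R = enat 1" using dim by (simp add: one_enat_def)
  let ?x = "%_::nat. y" and ?a = "adjoin R {\<zero>} y (car R)" and ?N = "adjoin R {\<zero>} y C"
  have a1: "adjoin_seq R {\<zero>} ?x (car R) 1 = ?a" and N1: "adjoin_seq R {\<zero>} ?x C 1 = ?N" by simp_all
  have aI: "ideal ?a R" by (rule adjoin_ideal[OF zeroideal oneideal yc])
  have NI: "ideal ?N R" by (rule adjoin_ideal[OF zeroideal C(1) yc])
  have a_iff: "b : ?a <-> (EX r:car R. b = y ** r)" for b using yc by (force simp: adjoin_def)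
  have N_iff: "b : ?N <-> (EX r:C. b = y ** r)" for b using yc cC(3) by (force simp: adjoin_def)
  have yC: "nonzerodiv R {\<zero>} C y" using y(2) cC(3) by (auto simp: nonzerodiv_def)
  have y0: "r = \<zero>" if "r : car R" "y ** r = \<zero>" for r using y(2) that by (auto simp: nonzerodiv_def)
  have maximal: "q = nn" if "primeideal q R" "adjoin_seq R {\<zero>} ?x (car R) 1 <= q" for q
    by (rule prime_over_maximal_regular_sequence[OF dim1, of ?x]) (use yc y that in auto)
  have one_a: "\<one> ~: ?a" using adjoin_minimal[OF n_ideal, of "{\<zero>}" "car R" y] n_closed(2,8) y(1) n_proper by auto
  obtain sig where sig: "sig : car R" "sig ~: ?a" "colon R ?a sig = nn"
    using socle_multiple[OF maximal[unfolded a1] aI one_closed one_a] by (metis m_closed one_closed)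
  obtain m where m: "m : C" "m ~: ?N" "!!k. k : nn ==> k ** m : ?N"
    using socle_of_quotient[where x="?x" and delta=1, OF maximal _ C(1,3)] y(1) N1 by auto
  \<comment> \<open>The socle element \<open>m\<close> of \<open>C / y C\<close> is divided by the
    socle element \<open>sig\<close> of \<open>R / y R\<close>; so \<open>sig c\<close> does not
    vanish modulo \<open>y C\<close>.\<close>
  obtain c where c: "c : C" "sig ** c \<ominus> m : ?N"
    using finite_inj_dim_socle_extension[where x="?x" and delta=1 and m=m and sig=sig, OF C(1,2)] y yC maximal m(1,3) sig(1,3) by auto
  have cc: "c : car R" "m : car R" using c m cC by auto
  \<comment> \<open>A nonzero class \<open>b\<close> in \<open>R / y R\<close> has a multiple
    \<open>r b\<close> in the socle, and self-injectivity of \<open>R / y R\<close> makes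
    \<open>sig\<close> a multiple of it. So if \<open>b\<close> killed the class of
    \<open>c\<close>, then \<open>sig\<close> would kill it too.\<close>
  have free: "b : ?a" if b: "b : car R" "b ** c : ?N" for b
  proof (rule ccontr)
    assume "b ~: ?a"
    then obtain r where r: "r : car R" "colon R ?a (r ** b) = nn" using socle_multiple[OF maximal[unfolded a1] aI b(1)] by blast
    have "k ** sig : ?a" if "k : nn" for k using that sig(3) by (auto simp: colon_def)
    then obtain u where u: "u : car R" "r ** b ** u \<ominus> sig : ?a"
      using finite_inj_dim_socle_extension[where x="?x" and delta=1 and m=sig and sig="r ** b", OF oneideal R] y maximal sig(1) r b(1) by auto
    obtain v where v: "v : car R" "r ** b ** u \<ominus> sig = y ** v" using u(2) a_iff by blast
    have "sig = r ** b ** u \<ominus> (r ** b ** u \<ominus> sig)" using r(1) b(1) u(1) sig(1) by algebra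
    hence s: "sig = r ** b ** u \<ominus> y ** v" using v by simp
    have "sig ** c = (r ** u) ** (b ** c) \<ominus> y ** (v ** c)" unfolding s using r(1) b(1) u(1) v(1) yc cc by algebra
    moreover have "y ** (v ** c) : ?N" using N_iff cC(7)[OF v(1) c(1)] by blast
    ultimately have "sig ** c : ?N" using idealD(6,7)[OF NI] b(2) r(1) u(1) by simp
    hence "sig ** c \<ominus> (sig ** c \<ominus> m) : ?N" using c(2) idealD(6)[OF NI] by blast
    moreover have "sig ** c \<ominus> (sig ** c \<ominus> m) = m" using sig(1) cc by algebra
    ultimately show False using m(2) by simp
  qed
  \<comment> \<open>The annihilator of \<open>c\<close> lies in \<open>y R\<close> by
    \<open>free\<close>, and in \<open>y Z\<close> because \<open>y\<close> is regular; by Nakayama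
    it is zero.\<close>
  define Z where "Z = {b : car R. b ** c = \<zero>}"
  have ZI: "ideal Z R" unfolding Z_def by (rule ideal_criterion) (use cc in "auto simp: l_distr m_assoc")
  have "Z <= adjoin R {\<zero>} y Z"
  proof
    fix b assume b: "b : Z"
    hence bc: "b : car R" "b ** c = \<zero>" by (auto simp: Z_def)
    hence "b : ?a" using free idealD(2)[OF NI] by simp
    then obtain r where r: "r : car R" "b = y ** r" using a_iff by blast
    have "y ** (r ** c) = \<zero>" using bc(2) r yc cc by (simp add: m_assoc)
    hence "r : Z" using y0 r cc by (simp add: Z_def)
    thus "b : adjoin R {\<zero>} y Z" using adjoin_mult[OF zeroideal ZI yc] r by simp
  qed
  hence Z0: "Z = {\<zero>}" using nakayama_local[OF zeroideal ZI y(1) y(1)] idealD(2)[OF ZI] by auto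
  hence cnz: "nonzerodiv R {\<zero>} (car R) c" using cc by (auto simp: nonzerodiv_def Z_def m_comm)
  have prime_c: "q = nn" if q: "primeideal q R" "c : q" for q
  proof -
    have "{\<zero>} <= q" using idealD(2)[OF primeD(1)[OF q(1)]] by auto
    moreover have "adjoin R {\<zero>} c (car R) <= q" by (rule adjoin_minimal[OF primeD(1)[OF q(1)]])
        (use idealD(2,8)[OF primeD(1)[OF q(1)]] q(2) in auto)
    ultimately show ?thesis using prime_over_maximal_regular_sequence[OF dim1, of "%_. c" q] cc cnz q(1) by simp
  qed
  have PI: "ideal (PIdl c) R" by (rule cgenideal_ideal[OF cc(1)])
  have P_iff: "b : PIdl c <-> (EX r:car R. b = r ** c)" for b by (auto simp: cgenideal_def)
  have "C <= PIdl c"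
  proof (rule ccontr)
    assume "~ C <= PIdl c"
    then obtain w where w: "w : C" "w ~: PIdl c" by blast
    \<comment> \<open>An associated prime of \<open>C / R c\<close> contains the nonzerodivisor
      \<open>c\<close>, hence is \<open>nn\<close> and contains \<open>y\<close>. From
      \<open>y v = r c\<close> the property \<open>free\<close> gives \<open>r = y s\<close>, and
      cancelling \<open>y\<close> puts \<open>v\<close> into \<open>R c\<close>.\<close>
    obtain v where v: "v : C" "v ~: PIdl c" "primeideal (colon R (PIdl c) v) R" using colon_prime[OF PI C(1) w] by blast
    have vc: "v : car R" using v cC by auto
    have "c : colon R (PIdl c) v" using cc vc P_iff m_comm by (auto simp: colon_def)
    hence "y : colon R (PIdl c) v" using prime_c[OF v(3)] y(1) by simp
    then obtain r where r: "r : car R" "y ** v = r ** c" using P_iff by (auto simp: colon_def)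
    have "r ** c : ?N" using r(2)[symmetric] v(1) N_iff by auto
    then obtain s where s: "s : car R" "r = y ** s" using free[OF r(1)] a_iff by blast
    have "y ** (v \<ominus> s ** c) = y ** v \<ominus> (y ** s) ** c" using yc vc s(1) cc(1) by algebra
    also have "... = \<zero>" using r s yc vc cc(1) by (simp add: r_right_minus_eq)
    finally have "v \<ominus> s ** c = \<zero>" using y0 vc s(1) cc(1) by simp
    hence "v = s ** c" using vc s(1) cc(1) by (simp add: r_right_minus_eq)
    thus False using v(2) P_iff s(1) by blast
  qed
  moreover have "PIdl c <= C" using cgenideal_minimal[OF C(1) c(1)] .
  ultimately show ?thesis using c(1) cnz by blast
qed

end

section \<open>Depth and canonical ideals in elementwise terms\<close>

lemma ideal_module_simps:
  "car (ideal_module R C) = C" "x +[ideal_module R C] y = x +[R] y" "a *>[ideal_module R C] x = a *[R] x"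
  "0[ideal_module R C] = 0[R]" by (simp_all add: ideal_module_def self_module_def)

lemma ideal_module_carrier: "ideal_module R (car R) = self_module R"
  by (simp add: ideal_module_def self_module_def)

lemma (in module) submodule_iff:
  "submodule N R M <-> N <= car M & 0[M] : N & (ALL x:N. ALL y:N. x +[M] y : N) & (ALL a:car R. ALL x:N. a *>[M] x : N)"
proof
  assume N: "submodule N R M"
  have "0[M] : N" using subgroup.one_closed[OF submodule.axioms(1)[OF N]] by simp
  thus "N <= car M & 0[M] : N & (ALL x:N. ALL y:N. x +[M] y : N) & (ALL a:car R. ALL x:N. a *>[M] x : N)" using submoduleE[OF N] by blast
next
  assume N: "N <= car M & 0[M] : N & (ALL x:N. ALL y:N. x +[M] y : N) & (ALL a:car R. ALL x:N. a *>[M] x : N)"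
  show "submodule N R M" by (rule submodule_criterion) (use N in blast)+
qed

lemma (in cring) ideal_iff:
  "ideal N R <-> N <= car R & \<zero> : N & (ALL x:N. ALL y:N. x +. y : N) & (ALL a:car R. ALL x:N. a ** x : N)"
proof
  assume N: "ideal N R"
  show "N <= car R & \<zero> : N & (ALL x:N. ALL y:N. x +. y : N) & (ALL a:car R. ALL x:N. a ** x : N)" using idealD(1,2,4,7)[OF N] by simp
next
  assume N: "N <= car R & \<zero> : N & (ALL x:N. ALL y:N. x +. y : N) & (ALL a:car R. ALL x:N. a ** x : N)"
  show "ideal N R" by (rule ideal_criterion) (use N in blast)+
qed

lemma (in cring) submodule_ideal_module:
  assumes C: "ideal C R"
  shows "submodule N R (ideal_module R C) <-> ideal N R & N <= C"
  unfolding module.submodule_iff[OF ideal_module_module[OF C]] ideal_iff ideal_module_simps using idealD(1)[OF C] by blast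

text \<open>Translates the spanned submodule of \<open>regular_sequence\<close> into
  \<open>adjoin_seq\<close>: both are the least ideal that contains all products of
  \<open>xs ! j\<close>, for \<open>j < i\<close>, with elements of \<open>C\<close>.\<close>

lemma (in cring) ideal_smult_take:
  assumes C: "ideal C R" and xs: "set xs <= car R" and "i <= length xs"
  shows "ideal_smult R (Idl (set (take i xs))) (ideal_module R C) = adjoin_seq R {\<zero>} ((!) xs) C i"
proof -
  note cC = idealD[OF C]
  have xc: "xs ! j : car R" if "j < i" for j using xs that assms(3) by auto
  have tc: "set (take i xs) <= car R" using xs set_take_subset by fast
  have taken: "xs ! j : set (take i xs)" if "j < i" for j using that assms(3) by (auto simp: in_set_conv_nth)
  let ?P = "{a *>[ideal_module R C] x | a x. a : Idl (set (take i xs)) & x : car (ideal_module R C)}"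
  let ?N = "adjoin_seq R {\<zero>} ((!) xs) C"
  have NI: "ideal (?N j) R" if "j <= i" for j by (rule adjoin_seq_ideal[OF zeroideal C]) (use xc that in auto)
  have Nmono: "?N j <= ?N i" if "j <= i" for j using that
  proof (induction rule: inc_induct)
    case (step j)
    thus ?case using adjoin_superset[OF NI[of j] C xc[of j]] by auto
  qed simp
  have NC: "?N j <= C" if "j <= i" for j using that
  proof (induction j)
    case (Suc j)
    thus ?case using adjoin_minimal[OF C, of "?N j" C "xs ! j"] cC(7) xc[of j] by auto
  qed (use cC in auto)
  have sub: "?P <= ?N i"
  proof -
    have "ideal {a : car R. ALL c:C. a ** c : ?N i} R" by (rule ideal_criterion) (use idealD[OF NI[OF order_refl]] cC in "auto simp: l_distr m_assoc")
    moreover have "set (take i xs) <= {a : car R. ALL c:C. a ** c : ?N i}"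
    proof
      fix a assume a: "a : set (take i xs)"
      then obtain j where j: "j < i" "a = xs ! j" using assms(3) by (auto simp: in_set_conv_nth)
      have "a ** c : ?N i" if "c : C" for c using adjoin_mult[OF NI[of j] C xc[OF j(1)] that] Nmono[of "Suc j"] j by auto
      thus "a : {a : car R. ALL c:C. a ** c : ?N i}" using a tc by auto
    qed
    ultimately have "Idl (set (take i xs)) <= {a : car R. ALL c:C. a ** c : ?N i}" by (rule genideal_minimal)
    thus ?thesis by (auto simp: ideal_module_simps)
  qed
  have sup: "?N j <= L" if "j <= i" "ideal L R" "?P <= L" for j L using that(1)
  proof (induction j)
    case 0
    thus ?case using idealD(2)[OF that(2)] by auto
  next
    case (Suc j)
    have "xs ! j ** c : L" if c: "c : C" for c
    proof -
      have "xs ! j : Idl (set (take i xs))" using genideal_self[OF tc] taken[of j] Suc.prems by auto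
      hence "xs ! j ** c : ?P" using c by (auto simp: ideal_module_simps)
      thus ?thesis using \<open>?P <= L\<close> by blast
    qed
    thus ?case using adjoin_minimal[OF that(2)] Suc by auto
  qed
  have "span_module R (ideal_module R C) ?P = ?N i" unfolding span_module_def submodule_ideal_module[OF C]
  proof (rule antisym)
    show "\<Inter>{N. (ideal N R & N <= C) & ?P <= N} <= ?N i" by (rule Inter_lower) (use NI[OF order_refl] NC[OF order_refl] sub in auto)
    show "?N i <= \<Inter>{N. (ideal N R & N <= C) & ?P <= N}" by (rule Inter_greatest) (use sup[OF order_refl] in blast)
  qed
  thus ?thesis by (simp add: ideal_smult_def)
qed

context local_noetherian
begin

lemma regular_sequence_depth_ge:
  assumes C: "ideal C R" and xs: "regular_sequence R (ideal_module R C) xs" "set xs <= nn"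
  shows "depth_ge nn C (length xs) {\<zero>}"
proof -
  let ?n = "length xs" and ?N = "adjoin_seq R {\<zero>} ((!) xs) C"
  have xc: "set xs <= car R" using xs(2) n_closed(1) by auto
  note sm = ideal_smult_take[OF C xc]
  have reg: "nonzerodiv R (?N i) C (xs ! i)" if i: "i < ?n" for i
    using xs(1) sm[of i] i unfolding regular_sequence_def nonzerodiv_def by (auto simp: ideal_module_simps)
  have NI: "ideal (?N i) R" if "i <= ?n" for i by (rule adjoin_seq_ideal[OF zeroideal C]) (use xc that in auto)
  have "?N ?n ~= C" using xs(1) sm[of ?n] unfolding regular_sequence_def by (auto simp: ideal_module_simps)
  moreover have "?N ?n <= C" by (rule adjoin_seq_subset[OF C]) (use xc in auto)
  ultimately have top: "~ C <= ?N ?n" by auto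
  have "depth_ge nn C (?n - i) (?N i)" if "i <= ?n" for i using that
  proof (induction rule: inc_induct)
    case base
    thus ?case using top by simp
  next
    case (step i)
    have "?n - i = Suc (?n - Suc i)" using step by auto
    moreover have "xs ! i : nn" using step xs(2) by auto
    ultimately show ?case using step reg[of i] by auto
  qed
  from this[of 0] show ?thesis by simp
qed

text \<open>Depth is a supremum: a sequence longer than \<open>d - 1\<close> is taken and then cut
  down by \<open>depth_ge_mono\<close>. The case \<open>d = 0\<close> rests on \<open>C\<close>
  being nonzero.\<close>

lemma depth_enat_depth_ge:
  assumes C: "ideal C R" "C ~= {\<zero>}" and d: "depth R (ideal_module R C) = enat d"
  shows "depth_ge nn C d {\<zero>}"
proof (cases d)
  case 0
  thus ?thesis using C idealD(2)[OF C(1)] by auto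
next
  case (Suc d')
  let ?S = "{enat (length xs) | xs. regular_sequence R (ideal_module R C) xs & set xs <= max_ideal R}"
  have "enat d' < Sup ?S" using d Suc unfolding depth_def by simp
  then obtain xs where xs: "regular_sequence R (ideal_module R C) xs" "set xs <= max_ideal R" "enat d' < enat (length xs)"
    unfolding less_Sup_iff by blast
  hence "depth_ge nn C (length xs) {\<zero>}" using regular_sequence_depth_ge[OF C(1)] max_ideal_eq by simp
  thus ?thesis using depth_ge_mono[OF C(1) zeroideal, of d "length xs"] xs(3) Suc by simp
qed

lemma depth_finite: "depth R (self_module R) ~= \<infinity>"
proof
  assume inf: "depth R (self_module R) = \<infinity>"
  obtain s where s: "!!k. depth_ge nn (car R) k {\<zero>} ==> k <= s" using depth_ge_bounded by blast
  let ?S = "{enat (length xs) | xs. regular_sequence R (self_module R) xs & set xs <= max_ideal R}"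
  have "enat s < Sup ?S" using inf unfolding depth_def by simp
  then obtain xs where xs: "regular_sequence R (self_module R) xs" "set xs <= max_ideal R" "enat s < enat (length xs)" unfolding less_Sup_iff by blast
  hence "depth_ge nn (car R) (length xs) {\<zero>}" using regular_sequence_depth_ge[OF oneideal] max_ideal_eq by (simp add: ideal_module_carrier)
  thus False using s xs(3) by fastforce
qed

text \<open>The number of generators of the maximal ideal bounds the depth, so the Cohen-Macaulay
  equation makes the dimension finite as well.\<close>

lemma cohen_macaulay_dim:
  assumes "cohen_macaulay_local_ring R"
  obtains d where "krull_dim R = enat d" "depth_ge nn (car R) d {\<zero>}"
proof -
  have eq: "depth R (self_module R) = krull_dim R" using assms by (simp add: cohen_macaulay_local_ring_def)
  then obtain d where d: "krull_dim R = enat d" using depth_finite by (cases "krull_dim R") auto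
  have "car R ~= {\<zero>}"
  proof
    assume eq: "car R = {\<zero>}"
    have "nn = car R" using idealD(2)[OF n_ideal] n_closed(1) unfolding eq by blast
    thus False using n_proper one_closed by blast
  qed
  moreover have "depth R (ideal_module R (car R)) = enat d" using eq d by (simp add: ideal_module_carrier)
  ultimately have "depth_ge nn (car R) d {\<zero>}" by (rule depth_enat_depth_ge[OF oneideal])
  with d show ?thesis by (rule that)
qed

lemma canonical_ideal_depth_ge:
  assumes "canonical_ideal R C" "krull_dim R = enat d"
  shows "ideal C R" "inj_dim R (ideal_module R C) < \<infinity>" "depth_ge nn C d {\<zero>}"
proof -
  have m: "maximal_cohen_macaulay_module R (ideal_module R C)" and C: "ideal C R"
    and i: "inj_dim R (ideal_module R C) < \<infinity>"
    using assms(1) unfolding canonical_ideal_def canonical_module_local_def by blast+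
  show "ideal C R" by (rule C)
  show "inj_dim R (ideal_module R C) < \<infinity>" by (rule i)
  have "depth R (ideal_module R C) = enat d" using m assms(2) unfolding maximal_cohen_macaulay_module_def by simp
  moreover have "C ~= {\<zero>}" using m unfolding maximal_cohen_macaulay_module_def ideal_module_simps by blast
  ultimately show "depth_ge nn C d {\<zero>}" using depth_enat_depth_ge[OF C] by blast
qed

end

text \<open>\<open>J\<close> is generated at \<open>P\<close> by the nonzerodivisor
  \<open>g\<close>, expressed through elements of \<open>R\<close> and with one denominator
  \<open>s\<close> for all of \<open>J\<close>; in this form the property can be moved between a
  ring and its localizations.\<close>

definition locally_principal :: "('a, 'r) ring_scheme => 'a set => 'a set => bool"
  where "locally_principal R P J <-> (EX g:J. EX s:car R - P.
    (ALL x:J. EX y:car R. s *[R] x = g *[R] y) &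
    (ALL f:car R. f *[R] g = 0[R] --> (EX u:car R - P. u *[R] f = 0[R])))"

context ring_localization
begin

lemma phi_extend:
  assumes J: "ideal J A" and x: "x : J" shows "phi x : extend J"
proof -
  have xc: "x : car A" using A.idealD(3)[OF J x] .
  hence "1[A] *[A] x : J" using x by simp
  thus ?thesis unfolding phi_mem_extend[OF J xc] by (rule bexI[OF _ T_one])
qed

lemma phi_nonzerodivisor:
  assumes g: "g : car A" and nz: "!!f. [|f : car A; f *[A] g = 0[A]|] ==> EX u:T. u *[A] f = 0[A]"
  shows "nonzerodiv B {0[B]} (car B) (phi g)"
  unfolding nonzerodiv_def
proof (intro ballI impI)
  fix b assume b: "b : car B" "phi g *[B] b : {0[B]}"
  obtain a s where as: "a : car A" "s : T" "phi s *[B] b = phi a" using phi_surj[OF b(1)] by blast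
  have sc: "s : car A" using as T_carrier by auto
  note pc = phi_in[OF sc] phi_in[OF g]
  have "phi (a *[A] g) = phi s *[B] (phi g *[B] b)" using as g b(1) pc by (simp add: phi_mult as(3)[symmetric] B.m_ac)
  also have "... = 0[B]" using b(2) pc by simp
  finally obtain t where t: "t : T" "t *[A] (a *[A] g) = 0[A]" using phi_ker[of "a *[A] g"] as g by auto
  have tc: "t : car A" using t T_carrier by auto
  have "(t *[A] a) *[A] g = 0[A]" using t(2) tc as(1) g by (simp add: A.m_assoc)
  then obtain u where u: "u : T" "u *[A] (t *[A] a) = 0[A]" using nz[of "t *[A] a"] tc as(1) by auto
  have uc: "u : car A" using u T_carrier by auto
  have "phi (u *[A] t *[A] s) *[B] b = phi u *[B] phi t *[B] (phi s *[B] b)" using uc tc sc b(1) phi_in by (simp add: phi_mult B.m_assoc)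
  also have "... = phi (u *[A] (t *[A] a))" using as uc tc phi_in by (simp add: phi_mult B.m_assoc)
  also have "... = 0[B]" using u(2) phi_zero by simp
  finally have "phi (u *[A] t *[A] s) *[B] b = phi (u *[A] t *[A] s) *[B] 0[B]" using uc tc sc phi_in by simp
  hence "b = 0[B]" using phi_cancel[of "u *[A] t *[A] s" b "0[B]"] u(1) t(1) as(2) T_mult b(1) by simp
  thus "b : {0[B]}" by simp
qed

lemma extend_locally_principal:
  assumes J: "ideal J A" and g: "g : J" and s: "s : T" "ALL x:J. EX y:car A. s *[A] x = g *[A] y"
  shows "extend J = PIdl\<^bsub>B\<^esub> (phi g)"
proof
  note cJ = A.idealD[OF J]
  have gc: "g : car A" using g cJ by auto
  show "extend J <= PIdl\<^bsub>B\<^esub> (phi g)"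
  proof
    fix b assume "b : extend J"
    then obtain a t where b: "b : car B" "a : J" "t : T" "phi t *[B] b = phi a" by (auto simp: extend_def)
    obtain y where y: "y : car A" "s *[A] a = g *[A] y" using s b by blast
    have c: "s : car A" "t : car A" "a : car A" using s b T_carrier cJ by auto
    note pc = phi_in[OF c(1)] phi_in[OF c(2)]
    have u: "phi s *[B] phi t : Units B" using phi_unit s(1) b(3) by simp
    have "phi s *[B] phi t *[B] b = phi (s *[A] a)" using b(1,4) c pc phi_mult[OF c(1,3)] by (simp add: B.m_assoc)
    also have "... = phi y *[B] phi g" using y gc A.m_comm[OF gc y(1)] phi_mult[OF y(1) gc] by simp
    finally have "phi s *[B] phi t *[B] b = phi y *[B] phi g" .
    hence "inv\<^bsub>B\<^esub> (phi s *[B] phi t) *[B] (phi s *[B] phi t *[B] b) = inv\<^bsub>B\<^esub> (phi s *[B] phi t) *[B] (phi y *[B] phi g)" by simp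
    hence "b = (inv\<^bsub>B\<^esub> (phi s *[B] phi t) *[B] phi y) *[B] phi g" using u b(1) pc phi_in[OF y(1)] phi_in[OF gc]
      by (simp add: B.m_assoc[symmetric, of "inv\<^bsub>B\<^esub> (phi s *[B] phi t)"])
    thus "b : PIdl\<^bsub>B\<^esub> (phi g)" using u phi_in[OF y(1)] unfolding cgenideal_def by blast
  qed
  have "phi g : extend J" using phi_extend[OF J g] .
  thus "PIdl\<^bsub>B\<^esub> (phi g) <= extend J" by (rule B.cgenideal_minimal[OF extend_ideal[OF J]])
qed

lemma inj_dim_extend:
  assumes J: "ideal J A" and noeth: "noetherian_ring A" and "inj_dim A (ideal_module A J) < \<infinity>"
  shows "inj_dim B (ideal_module B (extend J)) < \<infinity>"
proof (rule inj_dim_localization[OF assms(3) noeth noetherian_B[OF noeth] A.ideal_module_module[OF J]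
      B.ideal_module_module[OF extend_ideal[OF J]], of phi])
  note cJ = A.idealD[OF J]
  show "phi x : car (ideal_module B (extend J))" if "x : car (ideal_module A J)" for x using that phi_extend[OF J] by (simp add: ideal_module_simps)
  show "EX x:car (ideal_module A J). EX s:T. phi s *>[ideal_module B (extend J)] y = phi x"
    if "y : car (ideal_module B (extend J))" for y using that by (auto simp: ideal_module_simps extend_def)
qed (use A.idealD(3)[OF J] phi_ker in "auto simp: ideal_module_simps phi_add phi_mult")

text \<open>Division by \<open>phi g\<close> identifies the localized ideal with \<open>B\<close>,
  so \<open>B\<close> itself is a localization of the module \<open>J\<close> and inherits its
  finite injective dimension.\<close>

lemma inj_dim_locally_principal:
  assumes J: "ideal J A" and noeth: "noetherian_ring A" and id: "inj_dim A (ideal_module A J) < \<infinity>"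
    and T: "T = car A - P" and lp: "locally_principal A P J"
  shows "inj_dim B (self_module B) < \<infinity>"
proof -
  note cJ = A.idealD[OF J]
  obtain g s where g: "g : J" "s : T" "ALL x:J. EX y:car A. s *[A] x = g *[A] y"
    "!!f. [|f : car A; f *[A] g = 0[A]|] ==> EX u:T. u *[A] f = 0[A]" using lp T unfolding locally_principal_def by blast
  have gc: "g : car A" "phi g : car B" using g cJ phi_in by auto
  have nz: "b = 0[B]" if "b : car B" "phi g *[B] b = 0[B]" for b using phi_nonzerodivisor[OF gc(1) g(4)] that by (auto simp: nonzerodiv_def)
  have can: "b = b'" if bb: "b : car B" "b' : car B" "phi g *[B] b = phi g *[B] b'" for b b'
  proof -
    have "phi g *[B] (b -[B] b') = phi g *[B] b -[B] phi g *[B] b'" using bb(1,2) gc by algebra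
    hence "phi g *[B] (b -[B] b') = 0[B]" using bb gc by (simp add: B.r_right_minus_eq)
    hence "b -[B] b' = 0[B]" using nz bb by simp
    thus ?thesis using bb by (simp add: B.r_right_minus_eq)
  qed
  have "EX b. b : car B & phi g *[B] b = phi x" if x: "x : J" for x
  proof -
    have "phi x : PIdl\<^bsub>B\<^esub> (phi g)" using extend_locally_principal[OF J g(1-3)] phi_extend[OF J x] by simp
    thus ?thesis using gc B.m_comm unfolding cgenideal_def by auto
  qed
  then obtain f where f: "!!x. x : J ==> f x : car B" "!!x. x : J ==> phi g *[B] f x = phi x" by metis
  show ?thesis
  proof (rule inj_dim_localization[OF id noeth noetherian_B[OF noeth] A.ideal_module_module[OF J] B.self_module_module, of f])
    show "f x : car (self_module B)" if "x : car (ideal_module A J)" for x using that f by (simp add: ideal_module_simps self_module_def)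
    show "f (x +[ideal_module A J] y) = f x +[self_module B] f y"
      if "x : car (ideal_module A J)" "y : car (ideal_module A J)" for x y
    proof -
      have xy: "x : J" "y : J" "x +[A] y : J" using that cJ by (auto simp: ideal_module_simps)
      have "phi g *[B] (f x +[B] f y) = phi (x +[A] y)" using f xy gc cJ(3) by (simp add: B.r_distr phi_add)
      hence "f (x +[A] y) = f x +[B] f y" using can[of "f (x +[A] y)" "f x +[B] f y"] f xy by simp
      thus ?thesis by (simp add: ideal_module_simps self_module_def)
    qed
    show "f (a *>[ideal_module A J] x) = phi a *>[self_module B] f x"
      if "a : car A" "x : car (ideal_module A J)" for a x
    proof -
      have ax: "a : car A" "x : J" "a *[A] x : J" using that cJ by (auto simp: ideal_module_simps)
      have "phi g *[B] (phi a *[B] f x) = phi (a *[A] x)" using f ax gc cJ(3) phi_in B.m_lcomm[of "phi g" "phi a" "f x"] by (simp add: phi_mult)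
      hence "f (a *[A] x) = phi a *[B] f x" using can[of "f (a *[A] x)" "phi a *[B] f x"] f ax phi_in by simp
      thus ?thesis by (simp add: ideal_module_simps self_module_def)
    qed
    show "EX x:car (ideal_module A J). EX s:T. phi s *>[self_module B] y = f x" if "y : car (self_module B)" for y
    proof -
      have y: "y : car B" using that by (simp add: self_module_def)
      obtain a t where at: "a : car A" "t : T" "phi t *[B] y = phi a" using phi_surj[OF y] by blast
      have ag: "a *[A] g : J" using at g cJ by auto
      have "phi g *[B] phi a = phi (a *[A] g)" using at(1) gc phi_in[OF at(1)] by (simp add: phi_mult B.m_comm)
      hence "phi a = f (a *[A] g)" using can[of "phi a" "f (a *[A] g)"] f[OF ag] phi_in[OF at(1)] by simp
      hence "phi t *[B] y = f (a *[A] g)" using at(3) by simp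
      thus ?thesis using at(2) ag by (auto simp: ideal_module_simps self_module_def)
    qed
    show "EX s:T. s *>[ideal_module A J] x = 0[ideal_module A J]"
      if "x : car (ideal_module A J)" "f x = 0[self_module B]" for x
    proof -
      have x: "x : J" "f x = 0[B]" using that by (auto simp: ideal_module_simps self_module_def)
      hence "phi x = 0[B]" using f(2)[OF x(1)] gc by simp
      thus ?thesis using phi_ker[of x] cJ(3) x(1) by (simp add: ideal_module_simps)
    qed
  qed
qed

text \<open>The denominators of finitely many generators of \<open>J\<close> multiply to one that
  serves all of \<open>J\<close>.\<close>

lemma uniform_denominator:
  assumes noeth: "noetherian_ring A" and J: "ideal J A" and K: "ideal K A"
    and ex: "!!x. x : J ==> EX s:T. s *[A] x : K"
  shows "EX s:T. ALL x:J. s *[A] x : K"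
proof -
  obtain X where X: "X <= car A" "finite X" "J = Idl\<^bsub>A\<^esub> X" using noetherian_ring.finetely_gen[OF noeth J] by auto
  have "EX s:T. ALL x:Y. s *[A] x : K" if "finite Y" "Y <= J" for Y using that
  proof (induction Y rule: finite_induct)
    case empty thus ?case using T_one by auto
  next
    case (insert y Y)
    then obtain s t where st: "s : T" "ALL x:Y. s *[A] x : K" "t : T" "t *[A] y : K" using ex by (metis insert_subset)
    have c: "s : car A" "t : car A" using st T_carrier by auto
    have "(s *[A] t) *[A] x : K" if x: "x : insert y Y" for x
    proof -
      have xc: "x : car A" using x insert.prems A.idealD(3)[OF J] by auto
      have "(s *[A] t) *[A] x = s *[A] (t *[A] x)" "(s *[A] t) *[A] x = t *[A] (s *[A] x)" using c xc by (auto simp: A.m_ac)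
      thus ?thesis using x st A.idealD(7)[OF K] c by (metis insertE)
    qed
    thus ?case using T_mult st by blast
  qed
  then obtain s where s: "s : T" "ALL x:X. s *[A] x : K" using X A.genideal_self[OF X(1)] by blast
  have sc: "s : car A" using s T_carrier by auto
  have "ideal {x : car A. s *[A] x : K} A" by (rule A.ideal_criterion) (use A.idealD[OF K] sc in "auto simp: A.r_distr A.m_lcomm")
  hence "J <= {x : car A. s *[A] x : K}" unfolding X(3) by (rule A.genideal_minimal) (use X(1) s(2) in auto)
  thus ?thesis using s by auto
qed

end

lemma height_mono:
  assumes "primeideal P R" "primeideal Q R" "P <= Q" shows "height R P <= height R Q"
proof (cases "P = Q")
  case False
  show ?thesis
  proof (rule height_leI)
    fix n c assume "prime_chain R n c" "c n = P"
    hence "enat (Suc n) <= height R Q" using height_strict_mono[OF assms(1,2), of n] prime_chain_le_height[of R n c] assms(3) False by auto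
    thus "enat n <= height R Q" by (meson enat_ord_simps(1) le_SucI order_refl order_trans)
  qed
qed simp

context local_noetherian
begin

lemma krull_dim_eq_height: "krull_dim R = height R nn"
proof (rule antisym)
  show "krull_dim R <= height R nn" unfolding krull_dim_def
  proof (rule SUP_least)
    fix P assume "P : {P. primeideal P R}"
    hence P: "primeideal P R" by simp
    show "height R P <= height R nn" by (rule height_mono[OF P n_prime proper_ideal_subset_n]) (use primeD[OF P] in auto)
  qed
qed (rule height_le_krull_dim[OF n_prime])

text \<open>If \<open>K\<close> consisted of zero-divisors, it would be contained in an associated
  prime, and that prime is minimal because depth and dimension agree; \<open>low\<close> excludes
  this.\<close>

lemma nonzerodivisor_in_prime:
  assumes dim: "krull_dim R = enat d" "depth_ge nn (car R) d {\<zero>}"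
    and K: "ideal K R" and low: "!!P. [|primeideal P R; K <= P|] ==> EX q. primeideal q R & q < P"
  obtains y where "y : K" "nonzerodiv R {\<zero>} (car R) y"
proof -
  have no: "m = \<zero>" if m: "m : car R" "!!k. k : K ==> k ** m = \<zero>" for m
  proof (rule ccontr)
    assume "m ~= \<zero>"
    then obtain u where u: "u : car R" "primeideal (colon R {\<zero>} u) R" "colon R {\<zero>} m <= colon R {\<zero>} u"
      using colon_prime[OF zeroideal oneideal m(1)] by auto
    have "K <= colon R {\<zero>} m" using m idealD(3)[OF K] by (auto simp: colon_def)
    then obtain q where "primeideal q R" "q < colon R {\<zero>} u" using low[OF u(2)] u(3) by auto
    thus False using associated_prime_minimal[OF dim(2,1) u(1,2)] by blast
  qed
  obtain k where k: "k : K" "!!N M. (N, M) : {({\<zero>}, car R)} ==> nonzerodiv R N M (\<zero> +. k)"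
    by (rule coset_nonzerodivisor[OF K zero_closed, of "{({\<zero>}, car R)}"]) (use no zeroideal oneideal in auto)
  thus ?thesis using that[of k] idealD(3)[OF K] by simp
qed

end

text \<open>A canonical ideal is locally principal at a prime of height one at which some ideal of finite
  injective dimension is locally principal, since the localization is then Gorenstein.\<close>

lemma (in local_noetherian) canonical_ideal_locally_principal:
  assumes cm: "cohen_macaulay_local_ring R" and C: "canonical_ideal R C"
    and P: "primeideal P R" "height R P = 1"
    and J: "ideal J R" "inj_dim R (ideal_module R J) < \<infinity>" "locally_principal R P J"
  shows "locally_principal R P C"
proof -
  obtain d where d: "krull_dim R = enat d" "depth_ge nn (car R) d {\<zero>}" using cohen_macaulay_dim[OF cm] .
  note cC = canonical_ideal_depth_ge[OF C d(1)]
  let ?T = "car R - P" and ?B = "loc_at R P"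
  define phi where "phi = (%a. fraction ?T (self_module R) a \<one>)"
  interpret L: ring_localization R ?T ?B phi unfolding phi_def by (rule loc_at_localization[OF P(1)])
  note noeth = noetherian_ring_axioms
  interpret B: local_noetherian ?B "L.extend P" by (rule L.local_noetherian_B[OF P(1) refl noeth])
  have PT: "P Int ?T = {}" by auto
  have hB: "krull_dim ?B = 1"
    using B.krull_dim_eq_height L.height_contract[OF L.extend_prime[OF P(1) PT]] L.contract_extend_prime[OF P(1) PT] P(2) by simp
  have low: "EX q. primeideal q R & q < Q" if Q: "primeideal Q R" "P <= Q" for Q
  proof -
    have "enat 1 <= height R P" using P(2) by (simp add: one_enat_def)
    then obtain m c where c: "1 <= m" "prime_chain R m c" "c m = P" using enat_le_height[OF P(1)] by blast
    then obtain k where "m = Suc k" by (cases m) auto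
    hence "c k < P" "primeideal (c k) R" using c unfolding prime_chain_def by auto
    thus ?thesis using Q by blast
  qed
  obtain y where y: "y : P" "nonzerodiv R {\<zero>} (car R) y" using nonzerodivisor_in_prime[OF d primeD(1)[OF P(1)] low] by blast
  have yc: "y : car R" using y idealD(3)[OF primeD(1)[OF P(1)]] by auto
  have "nonzerodiv ?B {0[?B]} (car ?B) (phi y)"
  proof (rule L.phi_nonzerodivisor[OF yc])
    fix f assume f: "f : car R" "f ** y = \<zero>"
    hence "f = \<zero>" using y(2) yc by (auto simp: nonzerodiv_def m_comm)
    thus "EX u:?T. u ** f = \<zero>" using L.T_one by auto
  qed
  moreover have "phi y : L.extend P" using L.phi_extend[OF primeD(1)[OF P(1)] y(1)] .
  moreover have "inj_dim ?B (ideal_module ?B (car ?B)) < \<infinity>"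
    using L.inj_dim_locally_principal[OF J(1) noeth J(2) refl J(3)] by (simp add: ideal_module_carrier)
  \<comment> \<open>If \<open>C\<close> vanished at \<open>P\<close>, a single element outside
    \<open>P\<close> would annihilate \<open>C\<close>, contrary to faithfulness.\<close>
  moreover have "~ L.extend C <= {0[?B]}"
  proof
    assume z: "L.extend C <= {0[?B]}"
    have "EX s:?T. s ** x : {\<zero>}" if x: "x : C" for x
    proof -
      have xc: "x : car R" using x idealD(3)[OF cC(1)] by auto
      have "phi x : L.extend C" using L.phi_extend[OF cC(1) x] .
      hence "phi x = 0[?B]" using z by blast
      thus ?thesis using L.phi_ker[OF xc] by auto
    qed
    then obtain s where s: "s : ?T" "ALL x:C. s ** x : {\<zero>}" using L.uniform_denominator[OF noeth cC(1) zeroideal] by blast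
    hence "s = \<zero>" using finite_inj_dim_faithful[OF d cC, of s] by auto
    thus False using s(1) idealD(2)[OF primeD(1)[OF P(1)]] by auto
  qed
  ultimately obtain c where c: "c : L.extend C" "L.extend C = PIdl\<^bsub>?B\<^esub> c" "nonzerodiv ?B {0[?B]} (car ?B) c"
    using B.finite_inj_dim_principal[OF hB _ _ _ L.extend_ideal[OF cC(1)] L.inj_dim_extend[OF cC(1) noeth cC(2)]] by blast
  \<comment> \<open>The generator \<open>c\<close> of the localized ideal is a fraction with
    numerator \<open>a\<close> in \<open>C\<close>. The two differ by a unit, and what follows
    clears denominators in the two properties of \<open>c\<close>.\<close>
  obtain a s where a: "c : car ?B" "a : C" "s : ?T" "phi s *[?B] c = phi a" using c(1) by (auto simp: L.extend_def)
  have ac: "a : car R" "s : car R" using a idealD(3)[OF cC(1)] by auto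
  have nz: "EX u:?T. u ** f = \<zero>" if f: "f : car R" "f ** a = \<zero>" for f
  proof -
    have "c *[?B] (phi f *[?B] phi s) = phi (f ** a)" using f(1) ac a(1) L.phi_in by (simp add: L.phi_mult a(4)[symmetric] L.B.m_ac)
    hence "c *[?B] (phi f *[?B] phi s) = 0[?B]" using f(2) L.phi_zero by simp
    hence "phi f *[?B] phi s = 0[?B]" using c(3) L.phi_in f(1) ac by (auto simp: nonzerodiv_def)
    hence "phi s *[?B] phi f = phi s *[?B] 0[?B]" using L.phi_in f(1) ac by (simp add: L.B.m_comm)
    hence "phi f = 0[?B]" using L.phi_cancel[OF a(3)] L.phi_in f(1) by simp
    thus ?thesis using L.phi_ker[OF f(1)] by simp
  qed
  have ex: "EX t:?T. t ** x : PIdl a" if x: "x : C" for x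
  proof -
    have xc: "x : car R" using x idealD(3)[OF cC(1)] by auto
    have "phi x : PIdl\<^bsub>?B\<^esub> c" using c(2) L.phi_extend[OF cC(1) x] by simp
    then obtain r where r: "r : car ?B" "phi x = r *[?B] c" unfolding cgenideal_def by blast
    obtain z t where z: "z : car R" "t : ?T" "phi t *[?B] r = phi z" using L.phi_surj[OF r(1)] by blast
    have tc: "t : car R" using z by auto
    have "phi (t ** s ** x) = (phi t *[?B] r) *[?B] (phi s *[?B] c)" using tc ac xc r a(1) L.phi_in by (simp add: L.phi_mult L.B.m_ac)
    also have "... = phi (z ** a)" using z a(4) ac by (simp add: L.phi_mult)
    finally obtain u where u: "u : ?T" "u ** (t ** s ** x) = u ** (z ** a)" using L.phi_eq[of "t ** s ** x" "z ** a"] tc ac xc z(1) by auto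
    have uc: "u : car R" using u by auto
    have "(u ** (t ** s)) ** x = (u ** z) ** a" using u(2) uc tc ac xc z(1) by (simp add: m_assoc)
    moreover have "u ** (t ** s) : ?T" using L.T_mult u(1) z(2) a(3) by simp
    ultimately show ?thesis using uc z(1) unfolding cgenideal_def by blast
  qed
  obtain t where t: "t : ?T" "ALL x:C. t ** x : PIdl a" using L.uniform_denominator[OF noeth cC(1) cgenideal_ideal[OF ac(1)] ex] by blast
  have "EX z:car R. t ** x = a ** z" if "x : C" for x
  proof -
    obtain z where "z : car R" "t ** x = z ** a" using t(2) \<open>x : C\<close> unfolding cgenideal_def by blast
    thus ?thesis using m_comm[OF ac(1)] by auto
  qed
  with nz show ?thesis unfolding locally_principal_def by (intro bexI[OF _ a(2)] bexI[OF _ t(1)] conjI) simp_all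
qed

section \<open>Lengths and multiplicities\<close>

definition set_chain :: "'a set set => nat => (nat => 'a set) => bool"
  where "set_chain F n c <-> (ALL i<=n. c i : F) & (ALL i<n. c i < c (Suc i))"

text \<open>Length of an arbitrary family ordered by inclusion: submodules of a quotient, ideals
  over \<open>J\<close> and ideals between two others can then be compared by strictly monotone
  maps.\<close>

definition chain_length :: "'a set set => enat"
  where "chain_length F = Sup {enat n | n. EX c. set_chain F n c}"

lemma module_length_eq: "module_length R M = chain_length {N. submodule N R M}"
  by (simp add: module_length_def chain_length_def set_chain_def)

lemma chain_length_ge: "set_chain F n c ==> enat n <= chain_length F"
  unfolding chain_length_def by (rule Sup_upper) blast

lemma chain_length_leI: "(!!n c. set_chain F n c ==> enat n <= b) ==> chain_length F <= b"
  unfolding chain_length_def by (rule Sup_least) blast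

lemma chain_length_attained:
  assumes "chain_length F = enat n" "F ~= {}"
  obtains c where "set_chain F n c"
proof (cases n)
  case 0
  obtain X where "X : F" using assms(2) by blast
  hence "set_chain F n (%_. X)" using 0 by (simp add: set_chain_def)
  thus ?thesis by (rule that)
next
  case (Suc k)
  have "enat k < Sup {enat n | n. EX c. set_chain F n c}" using assms(1) Suc unfolding chain_length_def by simp
  then obtain m c where m: "k < m" "set_chain F m c" unfolding less_Sup_iff by auto
  hence "m = n" using chain_length_ge[OF m(2)] assms(1) Suc by simp
  thus ?thesis using that m(2) by simp
qed

lemma chain_length_mono:
  assumes "!!X. X : F ==> f X : G" "!!X Y. [|X : F; Y : F; X < Y|] ==> f X < f Y"
  shows "chain_length F <= chain_length G"
proof (rule chain_length_leI)
  fix n c assume "set_chain F n c"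
  hence "set_chain G n (%i. f (c i))" using assms unfolding set_chain_def by simp
  thus "enat n <= chain_length G" by (rule chain_length_ge)
qed

text \<open>Each strict inclusion \<open>X < Y\<close> stays strict after \<open>f\<close> or after
  \<open>g\<close>, so a chain in \<open>F\<close> splits into two chains whose lengths add up to at
  least its own. For intersection and sum with a fixed ideal, \<open>fg\<close> is the modular
  law.\<close>

lemma chain_length_sum:
  assumes f: "!!X. X : F ==> f X : F1" "!!X Y. [|X : F; Y : F; X < Y|] ==> f X <= f Y"
    and g: "!!X. X : F ==> g X : F2" "!!X Y. [|X : F; Y : F; X < Y|] ==> g X <= g Y"
    and fg: "!!X Y. [|X : F; Y : F; X < Y; f X = f Y|] ==> g X ~= g Y"
  shows "chain_length F <= chain_length F1 + chain_length F2"
proof (rule chain_length_leI)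
  fix n c assume c: "set_chain F n c"
  have ext: "set_chain G (Suc a) (d(Suc a := Y))" if "set_chain G a d" "d a < Y" "Y : G" for G a d and Y :: "'x set"
    using that unfolding set_chain_def by (auto simp: le_Suc_eq less_Suc_eq)
  have "EX a b d e. set_chain F1 a d & d a = f (c k) & set_chain F2 b e & e b = g (c k) & k <= a + b" if "k <= n" for k using that
  proof (induction k)
    case 0
    have "set_chain F1 0 (%_. f (c 0))" "set_chain F2 0 (%_. g (c 0))" using c f g by (auto simp: set_chain_def)
    thus ?case by blast
  next
    case (Suc k)
    then obtain a b d e where d: "set_chain F1 a d" "d a = f (c k)" "set_chain F2 b e" "e b = g (c k)" "k <= a + b" by auto
    have ck: "c k : F" "c (Suc k) : F" "c k < c (Suc k)" using c Suc.prems by (auto simp: set_chain_def)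
    have step: "EX a' d'. set_chain G a' d' & d' a' = Y & a <= a' & (X ~= Y --> Suc a <= a')"
      if "set_chain G a d" "d a = X" "X <= Y" "Y : G" for G a d and X Y :: "'x set"
    proof (cases "X = Y")
      case True thus ?thesis using that by blast
    next
      case False
      hence "set_chain G (Suc a) (d(Suc a := Y))" using ext[OF that(1)] that by blast
      moreover have "(d(Suc a := Y)) (Suc a) = Y" by simp
      ultimately show ?thesis by (meson le_SucI order_refl)
    qed
    obtain a' d' where d': "set_chain F1 a' d'" "d' a' = f (c (Suc k))" "a <= a'" "f (c k) ~= f (c (Suc k)) --> Suc a <= a'"
      using step[OF d(1,2) f(2)[OF ck] f(1)[OF ck(2)]] by blast
    obtain b' e' where e': "set_chain F2 b' e'" "e' b' = g (c (Suc k))" "b <= b'" "g (c k) ~= g (c (Suc k)) --> Suc b <= b'"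
      using step[OF d(3,4) g(2)[OF ck] g(1)[OF ck(2)]] by blast
    have "Suc k <= a' + b'" using fg[OF ck] d'(3,4) e'(3,4) d(5) by (cases "f (c k) = f (c (Suc k))") auto
    thus ?case using d' e' by blast
  qed
  from this[OF order_refl] obtain a b d e where d: "set_chain F1 a d" "set_chain F2 b e" "n <= a + b" by blast
  have "enat n <= enat a + enat b" using d(3) by simp
  also have "... <= chain_length F1 + chain_length F2" by (intro add_mono chain_length_ge[OF d(1)] chain_length_ge[OF d(2)])
  finally show "enat n <= chain_length F1 + chain_length F2" .
qed

lemma chain_length_concat:
  assumes F: "F1 <= F" "F2 <= F" "!!X Y. [|X : F1; Y : F2|] ==> X <= Y"
    and c: "set_chain F1 a c" "set_chain F2 b d"
  shows "enat (a + b) <= chain_length F"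
proof (rule chain_length_ge[of _ _ "%i. if i < a then c i else d (i - a)"])
  have "c i < d 0" if "i < a" "~ Suc i < a" for i
  proof -
    have "a = Suc i" using that by simp
    hence "c i < c a" "c a : F1" "d 0 : F2" using c by (auto simp: set_chain_def)
    thus ?thesis using F(3) by blast
  qed
  moreover have "d (i - a) < d (Suc i - a)" if "~ i < a" "i < a + b" for i using c(2) that by (simp add: set_chain_def Suc_diff_le)
  moreover have "a = Suc i" if "i < a" "~ Suc i < a" for i using that by simp
  ultimately show "set_chain F (a + b) (%i. if i < a then c i else d (i - a))" using c F(1,2) unfolding set_chain_def by (auto simp: subset_iff)
qed

lemma module_image:
  assumes M: "module R M" and q: "q ` car M = car Q"
    and add: "!!x y. [|x : car M; y : car M|] ==> q x +[Q] q y = q (x +[M] y)"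
    and smult: "!!a x. [|a : car R; x : car M|] ==> a *>[Q] q x = q (a *>[M] x)"
    and zero: "0[Q] = q 0[M]"
  shows "module R Q"
proof -
  interpret M: module R M by fact
  have ex: "EX x:car M. X = q x" if "X : car Q" for X using that q by blast
  have qc: "q x : car Q" if "x : car M" for x using that q by blast
  show ?thesis
  proof (rule moduleI)
    show "abelian_group Q"
    proof (rule abelian_groupI)
      fix X assume "X : car Q"
      then obtain x where x: "x : car M" "X = q x" using ex by blast
      have "q (-[M] x) +[Q] X = 0[Q]" using x by (simp add: add zero M.l_neg)
      thus "EX Y:car Q. Y +[Q] X = 0[Q]" using qc[of "-[M] x"] x by blast
    qed (auto dest!: ex simp: zero add qc M.a_ac)
  qed (auto dest!: ex simp: add smult qc M.smult_l_distr M.smult_r_distr M.smult_assoc1 M.is_cring)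
qed

context module
begin

lemma quot_module_simps:
  assumes N: "submodule N R M"
  shows "car (quot_module M N) = (%x. N +>\<^bsub>M\<^esub> x) ` car M"
    "0[quot_module M N] = N +>\<^bsub>M\<^esub> 0[M]"
    "[|x : car M; y : car M|] ==> (N +>\<^bsub>M\<^esub> x) +[quot_module M N] (N +>\<^bsub>M\<^esub> y) = N +>\<^bsub>M\<^esub> (x +[M] y)"
    "[|a : car R; x : car M|] ==> a *>[quot_module M N] (N +>\<^bsub>M\<^esub> x) = N +>\<^bsub>M\<^esub> (a *>[M] x)"
    "[|x : car M; y : car M|] ==> N +>\<^bsub>M\<^esub> x = N +>\<^bsub>M\<^esub> y <-> x -[M] y : N"
proof -
  have "subgroup N (add_monoid M)" using submodule.axioms(1)[OF N] .
  then interpret N: abelian_subgroup N M by (intro abelian_subgroupI3 additive_subgroup.intro) (auto intro: abelian_group_axioms)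
  note c = submodule_iff[of N, THEN iffD1, OF N]
  show "car (quot_module M N) = (%x. N +>\<^bsub>M\<^esub> x) ` car M" by (auto simp: quot_module_def A_RCOSETS_def')
  show "0[quot_module M N] = N +>\<^bsub>M\<^esub> 0[M]" using N.a_subset by (simp add: quot_module_def)
  show "(N +>\<^bsub>M\<^esub> x) +[quot_module M N] (N +>\<^bsub>M\<^esub> y) = N +>\<^bsub>M\<^esub> (x +[M] y)" if "x : car M" "y : car M"
    using that N.a_rcos_sum by (simp add: quot_module_def)
  have eq: "N +>\<^bsub>M\<^esub> x = N +>\<^bsub>M\<^esub> y <-> x -[M] y : N" if xy: "x : car M" "y : car M" for x y
  proof
    assume "N +>\<^bsub>M\<^esub> x = N +>\<^bsub>M\<^esub> y"
    hence "x : N +>\<^bsub>M\<^esub> y" using N.a_rcos_self[OF xy(1)] by simp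
    thus "x -[M] y : N" using N.a_rcos_module_imp[OF xy(2)] by (simp add: minus_eq)
  next
    assume "x -[M] y : N"
    hence "x : N +>\<^bsub>M\<^esub> y" using N.a_rcos_module_rev[OF xy(2,1)] by (simp add: minus_eq)
    thus "N +>\<^bsub>M\<^esub> x = N +>\<^bsub>M\<^esub> y" using N.a_repr_independence'[of x y] xy by simp
  qed
  show "[|x : car M; y : car M|] ==> N +>\<^bsub>M\<^esub> x = N +>\<^bsub>M\<^esub> y <-> x -[M] y : N" by (rule eq)
  show "a *>[quot_module M N] (N +>\<^bsub>M\<^esub> x) = N +>\<^bsub>M\<^esub> (a *>[M] x)" if ax: "a : car R" "x : car M"
  proof -
    have "N +>\<^bsub>M\<^esub> (a *>[M] y) = N +>\<^bsub>M\<^esub> (a *>[M] x)" if y: "y : N +>\<^bsub>M\<^esub> x" for y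
    proof -
      have yc: "y : car M" using y N.a_elemrcos_carrier[OF ax(2)] by blast
      have "y -[M] x : N" using N.a_rcos_module_imp[OF ax(2) y] by (simp add: minus_eq)
      moreover have "a *>[M] y -[M] a *>[M] x = a *>[M] (y -[M] x)" using ax yc by (simp add: minus_eq smult_r_distr smult_r_minus)
      ultimately have "a *>[M] y -[M] a *>[M] x : N" using c ax(1) by simp
      thus ?thesis using eq[of "a *>[M] y" "a *>[M] x"] ax yc by simp
    qed
    hence "(\<Union>y\<in>N +>\<^bsub>M\<^esub> x. N +>\<^bsub>M\<^esub> (a *>[M] y)) = N +>\<^bsub>M\<^esub> (a *>[M] x)" using N.a_rcos_self[OF ax(2)] by blast
    thus ?thesis by (simp add: quot_module_def)
  qed
qed

lemma quot_module_module:
  assumes N: "submodule N R M"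
  shows "module R (quot_module M N)"
  by (rule module_image[OF module_axioms, of "%x. N +>\<^bsub>M\<^esub> x"]) (auto simp: quot_module_simps[OF N])

lemma module_length_quot:
  assumes N: "submodule N R M"
  shows "module_length R (quot_module M N) = chain_length {L. submodule L R M & N <= L}"
  unfolding module_length_eq
proof (rule antisym)
  note q = quot_module_simps[OF N] and c = submodule_iff[of N, THEN iffD1, OF N]
  interpret Q: module R "quot_module M N" by (rule quot_module_module[OF N])
  have coset0: "N +>\<^bsub>M\<^esub> x = 0[quot_module M N]" if "x : N" for x
  proof -
    have z: "-[M] 0[M] = 0[M]" by (rule minus_equality) auto
    have xc: "x : car M" using that c by blast
    hence "x -[M] 0[M] = x" unfolding minus_eq z by simp
    thus ?thesis unfolding q(2) using q(5)[OF xc zero_closed] that by simp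
  qed
  show "chain_length {L. submodule L R (quot_module M N)} <= chain_length {L. submodule L R M & N <= L}"
  proof (rule chain_length_mono[of _ "%L. {x : car M. N +>\<^bsub>M\<^esub> x : L}"])
    fix L assume "L : {L. submodule L R (quot_module M N)}"
    hence L: "L <= car (quot_module M N)" "0[quot_module M N] : L"
      "!!x y. [|x : L; y : L|] ==> x +[quot_module M N] y : L" "!!a x. [|a : car R; x : L|] ==> a *>[quot_module M N] x : L"
      using Q.submodule_iff by auto
    have "submodule {x : car M. N +>\<^bsub>M\<^esub> x : L} R M" by (rule submodule_criterion) (use L(2-4) q(2) in "auto simp: q(3,4)[symmetric]")
    thus "{x : car M. N +>\<^bsub>M\<^esub> x : L} : {L. submodule L R M & N <= L}" using coset0 L(2) c by auto
  next
    fix X Y assume XY: "X : {L. submodule L R (quot_module M N)}" "Y : {L. submodule L R (quot_module M N)}" "X < Y"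
    then obtain y where y: "y : Y" "y ~: X" by blast
    have "Y <= car (quot_module M N)" using XY(2) Q.submodule_iff by auto
    then obtain x where "x : car M" "y = N +>\<^bsub>M\<^esub> x" using y q(1) by auto
    thus "{x : car M. N +>\<^bsub>M\<^esub> x : X} < {x : car M. N +>\<^bsub>M\<^esub> x : Y}" using XY(3) y by blast
  qed
  show "chain_length {L. submodule L R M & N <= L} <= chain_length {L. submodule L R (quot_module M N)}"
  proof (rule chain_length_mono[of _ "%L. (%x. N +>\<^bsub>M\<^esub> x) ` L"])
    fix L assume "L : {L. submodule L R M & N <= L}"
    hence L: "L <= car M" "0[M] : L" "!!x y. [|x : L; y : L|] ==> x +[M] y : L" "!!a x. [|a : car R; x : L|] ==> a *>[M] x : L"
      using submodule_iff by auto
    have "submodule ((%x. N +>\<^bsub>M\<^esub> x) ` L) R (quot_module M N)"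
    proof (rule Q.submodule_criterion)
      show "(%x. N +>\<^bsub>M\<^esub> x) ` L <= car (quot_module M N)" using L(1) q(1) by blast
      show "0[quot_module M N] : (%x. N +>\<^bsub>M\<^esub> x) ` L" using L(2) q(2) by blast
      show "X +[quot_module M N] Y : (%x. N +>\<^bsub>M\<^esub> x) ` L" if XY: "X : (%x. N +>\<^bsub>M\<^esub> x) ` L" "Y : (%x. N +>\<^bsub>M\<^esub> x) ` L" for X Y
      proof -
        obtain x y where "x : L" "y : L" "X = N +>\<^bsub>M\<^esub> x" "Y = N +>\<^bsub>M\<^esub> y" using XY by blast
        thus ?thesis using L(1) L(3)[of x y] q(3)[of x y] by auto
      qed
      show "a *>[quot_module M N] X : (%x. N +>\<^bsub>M\<^esub> x) ` L" if aX: "a : car R" "X : (%x. N +>\<^bsub>M\<^esub> x) ` L" for a X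
      proof -
        obtain x where "x : L" "X = N +>\<^bsub>M\<^esub> x" using aX by blast
        thus ?thesis using aX L(1) L(4)[of a x] q(4)[of a x] by auto
      qed
    qed
    thus "(%x. N +>\<^bsub>M\<^esub> x) ` L : {L. submodule L R (quot_module M N)}" by simp
  next
    fix X Y assume XY: "X : {L. submodule L R M & N <= L}" "Y : {L. submodule L R M & N <= L}" "X < Y"
    then obtain y where y: "y : Y" "y ~: X" by blast
    have X: "N <= X" "X <= car M" "!!x y. [|x : X; y : X|] ==> x +[M] y : X" and Y: "Y <= car M" using XY submodule_iff by auto
    have "N +>\<^bsub>M\<^esub> y ~: (%x. N +>\<^bsub>M\<^esub> x) ` X"
    proof
      assume "N +>\<^bsub>M\<^esub> y : (%x. N +>\<^bsub>M\<^esub> x) ` X"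
      then obtain x where x: "x : X" "N +>\<^bsub>M\<^esub> y = N +>\<^bsub>M\<^esub> x" by blast
      have xy: "x : car M" "y : car M" using x y X Y by auto
      have "y -[M] x : N" using x(2) q(5)[OF xy(2,1)] by simp
      hence "(y -[M] x) +[M] x : X" using X x by blast
      moreover have "(y -[M] x) +[M] x = y" using xy by (simp add: minus_eq a_assoc l_neg)
      ultimately show False using y by simp
    qed
    thus "(%x. N +>\<^bsub>M\<^esub> x) ` X < (%x. N +>\<^bsub>M\<^esub> x) ` Y" using XY(3) y by blast
  qed
qed

end

lemma hom_module_module:
  assumes "module R M" "module R N"
  shows "module R (hom_module R M N)"
proof -
  interpret M: module R M by fact
  interpret N: module R N by fact
  let ?H = "module_hom R M N"
  have H: "f : ?H <-> f : extensional (car M) & (ALL x:car M. f x : car N) &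
      (ALL x:car M. ALL y:car M. f (x +[M] y) = f x +[N] f y) &
      (ALL a:car R. ALL x:car M. f (a *>[M] x) = a *>[N] f x)" for f by (auto simp: module_hom_def PiE_def Pi_def)
  have add: "(\<lambda>x\<in>car M. f x +[N] g x) : ?H" if "f : ?H" "g : ?H" for f g using that unfolding H by (auto simp: N.smult_r_distr N.a_ac)
  have smult: "(\<lambda>x\<in>car M. a *>[N] f x) : ?H" if "f : ?H" "a : car R" for f a
    using that unfolding H by (auto simp: N.smult_r_distr N.smult_assoc1[symmetric] M.R.m_comm)
  have zero: "(\<lambda>x\<in>car M. 0[N]) : ?H" unfolding H by auto
  have neg: "(\<lambda>x\<in>car M. (-[R] 1[R]) *>[N] f x +[N] f x) = (\<lambda>x\<in>car M. 0[N])" if "f : ?H" for f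
    using that unfolding H by (auto simp: N.smult_l_minus N.l_neg)
  have ext: "(\<lambda>x\<in>car M. f x) = f" if "f : ?H" for f using that unfolding H by (auto simp: extensional_restrict)
  have val: "f x : car N" if "f : ?H" "x : car M" for f x using that unfolding H by auto
  show ?thesis
  proof (rule moduleI)
    show "abelian_group (hom_module R M N)"
    proof (rule abelian_groupI)
      fix f assume f: "f : car (hom_module R M N)"
      hence "(\<lambda>x\<in>car M. (-[R] 1[R]) *>[N] f x) +[hom_module R M N] f = 0[hom_module R M N]"
        using neg[of f] by (simp add: hom_module_def cong: restrict_cong)
      moreover have "(\<lambda>x\<in>car M. (-[R] 1[R]) *>[N] f x) : car (hom_module R M N)" using smult[of f "-[R] 1[R]"] f by (simp add: hom_module_def)
      ultimately show "EX g:car (hom_module R M N). g +[hom_module R M N] f = 0[hom_module R M N]" by blast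
      show "0[hom_module R M N] +[hom_module R M N] f = f" using f val ext[of f] by (simp add: hom_module_def cong: restrict_cong)
    qed (use add zero val in "auto simp: hom_module_def N.a_ac intro!: restrict_ext")
  next
    fix f assume f: "f : car (hom_module R M N)"
    thus "1[R] *>[hom_module R M N] f = f" using val ext[of f] by (simp add: hom_module_def cong: restrict_cong)
  qed (use smult val M.is_cring in "auto simp: hom_module_def N.smult_l_distr N.smult_r_distr N.smult_assoc1 intro!: restrict_ext")
qed

lemma (in cring) quot_length_eq:
  assumes J: "ideal J R"
  shows "quot_length R J = chain_length {L. ideal L R & J <= L}"
proof -
  have sub: "submodule L R (self_module R) <-> ideal L R" for L
    using submodule_ideal_module[OF oneideal, of L] idealD(1)[of L] by (auto simp: ideal_module_carrier)
  show ?thesis unfolding quot_length_def module.module_length_quot[OF self_module_module sub[THEN iffD2, OF J]] sub ..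
qed

text \<open>The upper bound is the modular law for \<open>X Int L\<close> and \<open>X + L\<close>.
  For the lower bound longest chains below and above \<open>L\<close> are concatenated, and these
  exist when both lengths are finite.\<close>

lemma (in cring) quot_length_additive:
  assumes K: "ideal K R" and L: "ideal L R" "K <= L"
  defines "F == {X. ideal X R & K <= X & X <= L}"
  shows "quot_length R K <= chain_length F + quot_length R L"
    "[|chain_length F = enat a; quot_length R L = enat b|] ==> enat (a + b) <= quot_length R K"
proof -
  note cL = idealD[OF L(1)]
  have sum: "x : set_add R X L <-> (EX y:X. EX l:L. x = y +. l)" for x X by (auto simp: set_add_def')
  have le: "X <= set_add R X L" if X: "ideal X R" for X
  proof
    fix x assume "x : X"
    moreover from this have "x = x +. \<zero>" using idealD(3)[OF X] by simp
    ultimately show "x : set_add R X L" unfolding sum using cL(2) by blast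
  qed
  have le2: "L <= set_add R X L" if X: "ideal X R" for X
  proof
    fix x assume "x : L"
    moreover from this have "x = \<zero> +. x" using cL(3) by simp
    ultimately show "x : set_add R X L" unfolding sum using idealD(2)[OF X] by blast
  qed
  show "quot_length R K <= chain_length F + quot_length R L" unfolding quot_length_eq[OF K] quot_length_eq[OF L(1)]
  proof (rule chain_length_sum[of _ "%X. X Int L" _ "%X. set_add R X L"])
    fix X assume "X : {X. ideal X R & K <= X}"
    hence X: "ideal X R" "K <= X" by auto
    show "X Int L : F" unfolding F_def using X L i_intersect[OF X(1) L(1)] by blast
    show "set_add R X L : {X. ideal X R & L <= X}" using add_ideals[OF X(1) L(1)] le2[OF X(1)] by blast
  next
    fix X Y assume "X : {X. ideal X R & K <= X}" "Y : {X. ideal X R & K <= X}" and XY: "X < Y"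
    hence X: "ideal X R" and Y: "ideal Y R" by auto
    show "X Int L <= Y Int L" using XY by blast
    show "set_add R X L <= set_add R Y L" using XY sum by blast
    assume eq: "X Int L = Y Int L"
    show "set_add R X L ~= set_add R Y L"
    proof
      assume eq2: "set_add R X L = set_add R Y L"
      obtain y where y: "y : Y" "y ~: X" using XY by blast
      hence "y : set_add R X L" using le[OF Y] eq2 by blast
      then obtain x l where x: "x : X" "l : L" "y = x +. l" unfolding sum by blast
      have c: "x : car R" "l : car R" using x idealD(3)[OF X] cL(3) by auto
      have "l = y \<ominus> x" using x(3) c by algebra
      hence "l : Y" using idealD(6)[OF Y] y x XY by blast
      hence "l : X" using eq x(2) by blast
      thus False using idealD(4)[OF X x(1)] x(3) y(2) by simp
    qed
  qed
  assume a: "chain_length F = enat a" and b: "quot_length R L = enat b"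
  have "L : F" "car R : {X. ideal X R & L <= X}" using L oneideal cL(1) by (auto simp: F_def)
  hence ne: "F ~= {}" "{X. ideal X R & L <= X} ~= {}" by blast+
  obtain c where c: "set_chain F a c" using chain_length_attained[OF a ne(1)] .
  obtain d where d: "set_chain {X. ideal X R & L <= X} b d" using chain_length_attained[OF b[unfolded quot_length_eq[OF L(1)]] ne(2)] .
  show "enat (a + b) <= quot_length R K" unfolding quot_length_eq[OF K] by (rule chain_length_concat[OF _ _ _ c d]) (use L(2) in "auto simp: F_def")
qed

context local_noetherian
begin

text \<open>Let \<open>K\<close> be maximal among the ideals over \<open>g\<close> of infinite
  colength. It is prime: for \<open>a b\<close> in \<open>K\<close> with \<open>a\<close> and
  \<open>b\<close> outside, \<open>K + a R\<close> and \<open>(K : a)\<close> are larger, and their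
  finite colengths add up to a bound for \<open>K\<close>. Being a prime that contains a
  nonzerodivisor, it has a smaller prime below it, so in dimension one it is \<open>nn\<close>, of
  colength at most one.\<close>

lemma quot_length_finite:
  assumes dim: "krull_dim R = 1" and g: "g : car R" "nonzerodiv R {\<zero>} (car R) g"
  shows "quot_length R (PIdl g) < \<infinity>"
proof (rule ccontr)
  let ?S = "{K. ideal K R & PIdl g <= K & quot_length R K = \<infinity>}"
  assume "~ quot_length R (PIdl g) < \<infinity>"
  hence "PIdl g : ?S" using cgenideal_ideal[OF g(1)] by simp
  hence "?S ~= {}" by blast
  hence "EX M:?S. ALL J:?S. M <= J --> J = M" by (rule ideal_family_maximal) auto
  then obtain K where KS: "K : ?S" and mx: "ALL J:?S. K <= J --> J = K" ..
  have K: "ideal K R" "PIdl g <= K" "quot_length R K = \<infinity>" using KS by simp_all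
  have max: "J = K" if "ideal J R" "quot_length R J = \<infinity>" "K <= J" for J using mx that K(2) by simp
  note cK = idealD[OF K(1)]
  have gK: "g : K" using K(2) cgenideal_self[OF g(1)] by blast
  have top: "quot_length R J <= enat 1" if J: "ideal J R" "!!X. [|ideal X R; J <= X|] ==> X = J \<or> X = car R" for J unfolding quot_length_eq[OF J(1)]
  proof (rule chain_length_leI)
    fix n c assume c: "set_chain {L. ideal L R & J <= L} n c"
    have "~ 2 <= n"
    proof
      assume n: "2 <= n"
      have "c 0 < c 1" "c 1 < c 2" "!!i. i <= 2 ==> c i = J \<or> c i = car R" using c n J(2) unfolding set_chain_def by (auto simp: numeral_2_eq_2)
      thus False by (metis less_imp_le one_le_numeral order_less_irrefl order_less_trans zero_le_numeral order_refl)
    qed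
    thus "enat n <= enat 1" by simp
  qed
  have K1: "\<one> ~: K"
  proof
    assume "\<one> : K"
    hence "K = car R" using ideal.one_imp_carrier[OF K(1)] by simp
    hence "quot_length R K <= enat 1" using top[OF K(1)] idealD(1) by blast
    thus False using K(3) by simp
  qed
  have "primeideal K R"
  proof (rule primeideal_criterion[OF K(1) K1], rule ccontr)
    fix a b assume ab: "a : car R" "b : car R" "a ** b : K" and no: "~ (a : K \<or> b : K)"
    let ?L = "adjoin R K a (car R)" and ?C = "colon R K a"
    have L: "ideal ?L R" "K <= ?L" using adjoin_ideal[OF K(1) oneideal ab(1)] adjoin_superset[OF K(1) oneideal ab(1)] by auto
    have aL: "a : ?L" using adjoin_mult[OF K(1) oneideal ab(1) one_closed] ab(1) by simp
    have C: "ideal ?C R" "K <= ?C" "b : ?C" using colon_ideal[OF K(1) ab(1)] cK(1,8) ab by (auto simp: colon_def m_comm[OF ab(2,1)])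
    have fin: "quot_length R ?L ~= \<infinity>" "quot_length R ?C ~= \<infinity>" using max[OF L(1) _ L(2)] max[OF C(1) _ C(2)] C(3) no aL by auto
    \<comment> \<open>Multiplication by \<open>a\<close> identifies \<open>R / (K : a)\<close> with
      \<open>(K + a R) / K\<close>.\<close>
    have "chain_length {X. ideal X R & K <= X & X <= ?L} <= quot_length R ?C" unfolding quot_length_eq[OF C(1)]
    proof (rule chain_length_mono[of _ "%X. colon R X a"])
      fix X assume "X : {X. ideal X R & K <= X & X <= ?L}"
      thus "colon R X a : {L. ideal L R & ?C <= L}" using colon_ideal[of X a] ab(1) by (auto simp: colon_def)
    next
      fix X Y assume X: "X : {X. ideal X R & K <= X & X <= ?L}" and Y: "Y : {X. ideal X R & K <= X & X <= ?L}" and XY: "X < Y"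
      have iX: "ideal X R" "K <= X" and iY: "ideal Y R" "K <= Y" using X Y by auto
      obtain y where y: "y : Y" "y ~: X" using XY by blast
      hence "y : ?L" using Y by blast
      then obtain k x where k: "k : K" "x : car R" "y = k +. a ** x" by (rule adjoinE)
      have kc: "k : car R" using k cK by auto
      have "x ** a = y \<ominus> k" using k(2,3) kc ab(1) by algebra
      hence "x ** a : Y" using idealD(6)[OF iY(1) y(1), of k] k(1) iY(2) by auto
      moreover have "x ** a ~: X"
      proof
        assume "x ** a : X"
        hence "k +. x ** a : X" using idealD(4)[OF iX(1)] k(1) iX(2) by blast
        thus False using y(2) k(2,3) ab(1) by (simp add: m_comm)
      qed
      ultimately show "colon R X a < colon R Y a" using XY k(2) by (auto simp: colon_def)
    qed
    hence "chain_length {X. ideal X R & K <= X & X <= ?L} ~= \<infinity>" using fin(2) by (metis enat_ord_simps(5))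
    hence "chain_length {X. ideal X R & K <= X & X <= ?L} + quot_length R ?L ~= \<infinity>"
      using fin(1) by (simp add: plus_eq_infty_iff_enat del: not_infinity_eq)
    thus False using quot_length_additive(1)[OF K(1) L] K(3) by auto
  qed
  hence Kp: "primeideal K R" .
  obtain q where q: "primeideal q R" "q <= K" "g ~: q" using nonzerodivisor_prime_below[OF zeroideal g Kp] cK(2) by blast
  have "K = nn"
  proof (rule ccontr)
    assume "K ~= nn"
    hence "K < nn" using proper_ideal_subset_n[OF K(1)] K1 by blast
    moreover have "q < K" using q gK by blast
    ultimately have "prime_chain R 2 (%i. if i = 0 then q else if i = 1 then K else nn)"
      unfolding prime_chain_def using q(1) Kp n_prime by (auto simp: less_2_cases_iff)
    hence "enat 2 <= krull_dim R" by (rule prime_chain_le_krull_dim)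
    thus False using dim by (simp add: one_enat_def)
  qed
  have "X = K \<or> X = car R" if "ideal X R" "K <= X" for X
    using that proper_ideal_subset_n[OF that(1)] \<open>K = nn\<close> ideal.one_imp_carrier[OF that(1)] by blast
  hence "quot_length R K <= enat 1" using top[OF K(1)] by blast
  thus False using K(3) by simp
qed

text \<open>Multiplication by \<open>g\<close> identifies \<open>R / (g^n)\<close> with
  \<open>(g) / (g^(n+1))\<close>, so each further power adds \<open>l\<close> to the length.\<close>

lemma quot_length_power:
  assumes dim: "krull_dim R = 1" and g: "g : car R" "nonzerodiv R {\<zero>} (car R) g"
    and l: "quot_length R (PIdl g) = enat l"
  shows "quot_length R (PIdl (g [^] n)) = enat (n * l)"
proof (induction n)
  case 0
  have "quot_length R (car R) <= 0" unfolding quot_length_eq[OF oneideal]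
  proof (rule chain_length_leI)
    fix n c assume c: "set_chain {L. ideal L R & car R <= L} n c"
    show "enat n <= 0"
    proof (cases n)
      case (Suc k)
      hence "c 0 < c 1" "ideal (c 1) R" "car R <= c 0" using c by (auto simp: set_chain_def)
      thus ?thesis using idealD(1)[of "c 1"] by blast
    qed (simp add: zero_enat_def)
  qed
  moreover have "PIdl \<one> = car R" using ideal.one_imp_carrier[OF cgenideal_ideal] cgenideal_self by simp
  ultimately show ?case by (simp add: enat_0)
next
  case (Suc n)
  let ?K = "PIdl (g [^] n)" and ?K' = "PIdl (g [^] Suc n)" and ?L = "PIdl g"
  have gn: "g [^] n : car R" "g [^] Suc n = g ** g [^] n" using g(1) by (auto simp: m_comm)
  have id: "ideal ?K R" "ideal ?K' R" "ideal ?L R" using cgenideal_ideal g(1) by auto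
  have mem: "y : PIdl a <-> (EX x:car R. y = x ** a)" for y a by (auto simp: cgenideal_def)
  have sub: "?K' <= ?L" by (rule cgenideal_minimal[OF id(3)]) (use gn g(1) in \<open>auto simp: mem m_comm intro!: bexI[of _ "g [^] n"]\<close>)
  have can: "x = y" if "x : car R" "y : car R" "g ** x = g ** y" for x y
  proof -
    have "g ** (x \<ominus> y) = g ** x \<ominus> g ** y" using that(1,2) g(1) by algebra
    hence "g ** (x \<ominus> y) = \<zero>" using that g(1) by (simp add: r_right_minus_eq)
    hence "x \<ominus> y = \<zero>" using g(2) that by (auto simp: nonzerodiv_def)
    thus ?thesis using that by (simp add: r_right_minus_eq)
  qed
  let ?F = "{X. ideal X R & ?K' <= X & X <= ?L}"
  have "chain_length ?F <= quot_length R ?K" unfolding quot_length_eq[OF id(1)]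
  proof (rule chain_length_mono[of _ "%X. colon R X g"])
    fix X assume X: "X : ?F"
    have "g [^] n : colon R X g" using X gn cgenideal_self[of "g [^] Suc n"] g(1) by (auto simp: colon_def m_comm)
    moreover have "ideal (colon R X g) R" by (rule colon_ideal) (use X g(1) in auto)
    ultimately show "colon R X g : {X. ideal X R & ?K <= X}" using cgenideal_minimal[of "colon R X g"] by blast
  next
    fix X Y assume X: "X : ?F" and Y: "Y : ?F" and XY: "X < Y"
    obtain y where y: "y : Y" "y ~: X" using XY by blast
    hence "y : ?L" using Y by blast
    then obtain x where "x : car R" "y = x ** g" unfolding mem by blast
    thus "colon R X g < colon R Y g" using y XY by (auto simp: colon_def)
  qed
  moreover have "quot_length R ?K <= chain_length ?F" unfolding quot_length_eq[OF id(1)]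
  proof (rule chain_length_mono[of _ "%X. (%x. g ** x) ` X"])
    fix X assume "X : {X. ideal X R & ?K <= X}"
    hence X: "ideal X R" "?K <= X" by auto
    note cX = idealD[OF X(1)]
    have "ideal ((%x. g ** x) ` X) R"
    proof (rule ideal_criterion)
      show "(%x. g ** x) ` X <= car R" using cX(3) g(1) by auto
      show "\<zero> : (%x. g ** x) ` X" using cX(2) g(1) by (auto intro!: image_eqI[of _ _ \<zero>])
      show "a +. b : (%x. g ** x) ` X" if ab: "a : (%x. g ** x) ` X" "b : (%x. g ** x) ` X" for a b
      proof -
        obtain x y where "x : X" "y : X" "a = g ** x" "b = g ** y" using ab by blast
        thus ?thesis using cX(3,4) g(1) by (intro image_eqI[of _ _ "x +. y"]) (auto simp: r_distr)
      qed
      show "a ** b : (%x. g ** x) ` X" if ab: "a : car R" "b : (%x. g ** x) ` X" for a b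
      proof -
        obtain x where "x : X" "b = g ** x" using ab by blast
        thus ?thesis using ab(1) cX(3,7) g(1) by (intro image_eqI[of _ _ "a ** x"]) (auto simp: m_lcomm)
      qed
    qed
    moreover have "?K' <= (%x. g ** x) ` X" by (rule cgenideal_minimal) (use calculation gn X(2) cgenideal_self[OF gn(1)] in auto)
    moreover have "(%x. g ** x) ` X <= ?L" unfolding mem subset_iff using cX(3) m_comm[OF g(1)] by blast
    ultimately show "(%x. g ** x) ` X : ?F" by blast
  next
    fix X Y assume "X : {X. ideal X R & ?K <= X}" "Y : {X. ideal X R & ?K <= X}" and XY: "X < Y"
    hence X: "!!x. x : X ==> x : car R" and Y: "!!x. x : Y ==> x : car R" using idealD(3) by blast+
    obtain y where y: "y : Y" "y ~: X" using XY by blast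
    hence "g ** y ~: (%x. g ** x) ` X" using can[OF Y X] by blast
    thus "(%x. g ** x) ` X < (%x. g ** x) ` Y" using y XY by blast
  qed
  ultimately have F: "chain_length ?F = enat (n * l)" using Suc.IH by simp
  have "quot_length R ?K' <= enat (n * l + l)" using quot_length_additive(1)[OF id(2,3) sub] F l by simp
  moreover have "enat (n * l + l) <= quot_length R ?K'" using quot_length_additive(2)[OF id(2,3) sub F l] .
  ultimately show ?case by (simp add: add.commute)
qed

lemma principal_ideal_power:
  assumes g: "g : car R"
  shows "PIdl g [^]\<^bsub>ideals_set R\<^esub> (n::nat) = PIdl (g [^] n)"
proof (induction n)
  case 0
  have "PIdl \<one> = car R" using ideal.one_imp_carrier[OF cgenideal_ideal] cgenideal_self by simp
  thus ?case by (simp add: nat_pow_def ideals_set_def)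
next
  case (Suc n)
  have c: "g [^] n : car R" using g by simp
  have "PIdl g [^]\<^bsub>ideals_set R\<^esub> Suc n = ideal_prod R (PIdl (g [^] n)) (PIdl g)" using Suc by (simp add: nat_pow_def ideals_set_def)
  also have "... = Idl (PIdl (g [^] n ** g))"
    using ideal_prod_eq_genideal[OF cgenideal_ideal[OF c] cgenideal_ideal[OF g]] cgenideal_prod[OF c g] by simp
  also have "... = PIdl (g [^] n ** g)"
    using genideal_minimal[OF cgenideal_ideal[of "g [^] n ** g"] order_refl] genideal_self[OF idealD(1)[OF cgenideal_ideal[of "g [^] n ** g"]]] c g by blast
  finally show ?case by simp
qed

lemma multiplicity_principal:
  assumes dim: "krull_dim R = 1" and g: "g : car R" "nonzerodiv R {\<zero>} (car R) g"
  shows "multiplicity_wrt R (PIdl g) = real (the_enat (quot_length R (PIdl g)))"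
proof -
  obtain l where l: "quot_length R (PIdl g) = enat l" using quot_length_finite[OF dim g] by (cases "quot_length R (PIdl g)") auto
  \<comment> \<open>In dimension one the sequence that defines the multiplicity is
    \<open>n l / n\<close>: constant from \<open>n = 1\<close> on, with the value 0 at
    \<open>n = 0\<close> by the convention for division by zero.\<close>
  have "(%n. real (n * l) / real n) \<longlonglongrightarrow> real l" by (rule Lim_transform_eventually[OF tendsto_const]) (rule eventually_sequentiallyI[of 1], simp)
  hence "lim (%n. real (n * l) / real n) = real l" by (rule limI)
  thus ?thesis unfolding multiplicity_wrt_def principal_ideal_power[OF g(1)] quot_length_power[OF dim g l] l dim Let_def by (simp add: one_enat_def)
qed

end

text \<open>The bidual is compared with \<open>C\<close> before localizing. If
  \<open>s x = g y(x)\<close> on \<open>C\<close> and \<open>t\<close> kills the annihilator of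
  \<open>g\<close>, then \<open>f = t y\<close> is a homomorphism from \<open>C\<close> to
  \<open>R\<close>, and \<open>g f\<close> is \<open>t s\<close> times the inclusion. For
  \<open>b\<close> in the bidual, the value of some \<open>h\<close> at the inclusion, this gives
  \<open>t s b = g h(f)\<close>, an element of \<open>C\<close>; and \<open>t s\<close> is outside
  \<open>P\<close>.\<close>

lemma (in noetherian_cring) loc_bidual_ideal:
  assumes P: "primeideal P R" and C: "ideal C R" "locally_principal R P C"
  shows "loc_ideal_at R P (bidual_ideal R C) = loc_ideal_at R P C"
proof -
  interpret multiplicative_set R "car R - P" by (rule prime_complement_multiplicative[OF P])
  interpret L: ring_localization R "car R - P" "loc_ring R (car R - P)" "%a. frac a \<one>" by (rule loc_ring_localization)
  let ?M = "ideal_module R C" and ?S = "self_module R" let ?D = "hom_module R ?M ?S" let ?i = "\<lambda>x\<in>C. x"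
  note cC = idealD[OF C(1)]
  have D: "car ?D = module_hom R ?M ?S" by (simp add: hom_module_def)
  have homD: "f : module_hom R ?M ?S <-> f : C \<rightarrow>\<^sub>E car R & (ALL x:C. ALL y:C. f (x +. y) = f x +. f y) & (ALL a:car R. ALL x:C. f (a ** x) = a ** f x)" for f
    by (simp add: module_hom_def ideal_module_simps self_module_def)
  have ops: "f +[?D] h = (\<lambda>x\<in>C. f x +. h x)" "a *>[?D] f = (\<lambda>x\<in>C. a ** f x)" for a f h
    by (simp_all add: hom_module_def ideal_module_simps self_module_def)
  have S: "car ?S = car R" "x +[?S] y = x +. y" "a *>[?S] x = a ** x" for a x y by (simp_all add: self_module_def)
  have i: "?i : module_hom R ?M ?S" unfolding homD using cC by auto
  have CB: "C <= bidual_ideal R C"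
  proof
    fix c assume c: "c : C"
    \<comment> \<open>Evaluation at \<open>c\<close> is an element of the bidual whose value at the
      inclusion is \<open>c\<close>.\<close>
    let ?e = "\<lambda>f\<in>module_hom R ?M ?S. f c"
    interpret D: module R ?D by (rule hom_module_module[OF ideal_module_module[OF C(1)] self_module_module])
    note scal = D.smult_closed[unfolded D ops] and add = D.a_closed[unfolded D ops]
    have "?e : module_hom R ?D ?S" unfolding module_hom_def[of R ?D] D
    proof (intro CollectI conjI ballI)
      show "?e : module_hom R ?M ?S \<rightarrow>\<^sub>E car ?S" unfolding S using c by (auto simp: homD)
    qed (use c scal add in "auto simp: ops S")
    moreover have "?e ?i = c" using i c by simp
    ultimately show "c : bidual_ideal R C" unfolding bidual_ideal_def by (metis image_eqI)
  qed
  obtain g s where g: "g : C" "s : car R - P" "!!x. x : C ==> EX y:car R. s ** x = g ** y"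
    "!!f. [|f : car R; f ** g = \<zero>|] ==> EX u:car R - P. u ** f = \<zero>" using C(2) unfolding locally_principal_def by blast
  have gc: "g : car R" "s : car R" using g cC by auto
  have ex0: "EX u:car R - P. u ** x : {\<zero>}" if "x : colon R {\<zero>} g" for x using g(4)[of x] that by (auto simp: colon_def)
  obtain t where t: "t : car R - P" "!!x. [|x : car R; x ** g = \<zero>|] ==> t ** x = \<zero>"
    using L.uniform_denominator[OF noetherian_ring_axioms colon_ideal[OF zeroideal gc(1)] zeroideal ex0] by (auto simp: colon_def)
  have tc: "t : car R" using t by auto
  obtain y where y: "!!x. x : C ==> y x : car R" "!!x. x : C ==> s ** x = g ** y x" using g(3) by metis
  \<comment> \<open>The quotient of \<open>s x\<close> by \<open>g\<close> is determined up to the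
    annihilator of \<open>g\<close>, which \<open>t\<close> kills; this is what makes
    \<open>t y\<close> linear although \<open>y\<close> is merely chosen.\<close>
  have uniq: "t ** z = t ** z'" if z: "z : car R" "z' : car R" "g ** z = g ** z'" for z z'
  proof -
    have "(z \<ominus> z') ** g = g ** z \<ominus> g ** z'" using z(1,2) gc by algebra
    hence "(z \<ominus> z') ** g = \<zero>" using z gc by (simp add: r_right_minus_eq)
    hence "t ** (z \<ominus> z') = \<zero>" using t(2) z by simp
    moreover have "t ** (z \<ominus> z') = t ** z \<ominus> t ** z'" using z(1,2) tc by algebra
    ultimately show ?thesis using z tc by (simp add: r_right_minus_eq)
  qed
  define f where "f = (\<lambda>x\<in>C. t ** y x)"
  have f: "f : module_hom R ?M ?S" unfolding homD
  proof (intro conjI ballI)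
    show "f : C \<rightarrow>\<^sub>E car R" using y tc by (auto simp: f_def)
    fix x assume x: "x : C"
    { fix x' assume x': "x' : C"
      have "g ** y (x +. x') = g ** (y x +. y x')"
        using y(2)[OF cC(4)[OF x x'], symmetric] y(2)[OF x, symmetric] y(2)[OF x', symmetric] y(1)[OF x] y(1)[OF x'] gc cC(3)[OF x] cC(3)[OF x']
        by (simp add: r_distr)
      thus "f (x +. x') = f x +. f x'" using uniq[of "y (x +. x')" "y x +. y x'"] y(1) x x' cC(4)[OF x x'] tc by (simp add: f_def r_distr) }
    fix a assume a: "a : car R"
    have "g ** y (a ** x) = s ** (a ** x)" using y(2)[OF cC(7)[OF a x]] by simp
    also have "... = a ** (s ** x)" using a gc cC(3)[OF x] by (simp add: m_lcomm)
    also have "... = g ** (a ** y x)" using y(2)[OF x] a gc y(1)[OF x] by (simp add: m_lcomm)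
    finally show "f (a ** x) = a ** f x"
      using uniq[of "y (a ** x)" "a ** y x"] y(1)[OF x] y(1)[OF cC(7)[OF a x]] a x cC(7)[OF a x] tc by (simp add: f_def m_lcomm)
  qed
  have gf: "g *>[?D] f = (t ** s) *>[?D] ?i" unfolding ops
  proof (rule restrict_ext)
    fix x assume x: "x : C"
    have "g ** (t ** y x) = t ** (s ** x)" using y(2)[OF x] y(1)[OF x] gc tc by (simp add: m_lcomm)
    thus "g ** f x = t ** s ** ?i x" using x gc tc cC(3)[OF x] by (simp add: f_def m_assoc)
  qed
  have ts: "t ** s : car R - P" using T_mult t(1) g(2) by blast
  have BC: "b : car R & (t ** s) ** b : C" if b: "b : bidual_ideal R C" for b
  proof -
    obtain h where h: "h : module_hom R ?D ?S" "b = h ?i" using b unfolding bidual_ideal_def by blast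
    have hD: "h x : car R" "h (a *>[?D] x) = a ** h x" if "x : module_hom R ?M ?S" "a : car R" for x a
      using h(1) that unfolding module_hom_def[of R ?D] D by (auto simp: self_module_def)
    have "(t ** s) ** b = g ** h f" using hD(2)[OF i, of "t ** s"] hD(2)[OF f gc(1)] gf h(2) tc gc by simp
    thus ?thesis using hD(1)[OF i gc(1)] hD(1)[OF f gc(1)] h(2) cC(8) g(1) by simp
  qed
  show ?thesis
  proof
    show "loc_ideal_at R P (bidual_ideal R C) <= loc_ideal_at R P C"
    proof
      fix X assume "X : loc_ideal_at R P (bidual_ideal R C)"
      then obtain b r where b: "b : bidual_ideal R C" "r : car R - P" "X = frac b r" unfolding loc_ideal_at_def by blast
      have rc: "r : car R" "b : car R" "(t ** s) ** b : C" using b BC by auto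
      have "X = frac ((t ** s) ** b) ((t ** s) ** r)" unfolding b(3) by (rule frac_eqI) (use rc tc gc ts b(2) T_mult in "auto simp: m_ac")
      thus "X : loc_ideal_at R P C" unfolding loc_ideal_at_def using rc(3) T_mult[OF ts b(2)] by blast
    qed
    show "loc_ideal_at R P C <= loc_ideal_at R P (bidual_ideal R C)" unfolding loc_ideal_at_def using CB by blast
  qed
qed

lemma (in noetherian_cring) degree_terms_zero:
  assumes P: "primeideal P R" "height R P = 1" and C: "ideal C R" "locally_principal R P C"
  shows "bideg_term R C P = 0" "cdeg_term R C P = 0"
proof -
  show "bideg_term R C P = 0" by (simp add: bideg_term_def loc_bidual_ideal[OF P(1) C])
  let ?T = "car R - P" and ?B = "loc_at R P"
  define phi where "phi = (%a. fraction ?T (self_module R) a \<one>)"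
  interpret L: ring_localization R ?T ?B phi unfolding phi_def by (rule loc_at_localization[OF P(1)])
  interpret B: local_noetherian ?B "L.extend P" by (rule L.local_noetherian_B[OF P(1) refl noetherian_ring_axioms])
  have PT: "P Int ?T = {}" by auto
  have hB: "krull_dim ?B = 1"
    using B.krull_dim_eq_height L.height_contract[OF L.extend_prime[OF P(1) PT]] L.contract_extend_prime[OF P(1) PT] P(2) by simp
  obtain g s where g: "g : C" "s : ?T" "ALL x:C. EX y:car R. s ** x = g ** y"
    "!!f. [|f : car R; f ** g = \<zero>|] ==> EX u:?T. u ** f = \<zero>" using C(2) unfolding locally_principal_def by blast
  have gc: "g : car R" using g(1) idealD(3)[OF C(1)] by blast
  have eq: "loc_ideal_at R P C = PIdl\<^bsub>?B\<^esub> (phi g)"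
    using loc_ideal_at_eq[OF P(1) idealD(1)[OF C(1)]] L.extend_locally_principal[OF C(1) g(1-3)] by (simp add: phi_def)
  show "cdeg_term R C P = 0" unfolding cdeg_term_def eq using B.multiplicity_principal[OF hB L.phi_in[OF gc] L.phi_nonzerodivisor[OF gc g(4)]] by simp
qed

section \<open>Rees algebras\<close>

lemma (in ring) ideal_finsum:
  assumes "ideal p R" "finite A" "!!i. i : A ==> f i : p" shows "finsum R f A : p"
  using assms(2,3)
proof (induction A rule: finite_induct)
  case empty thus ?case using idealD(2)[OF assms(1)] by simp
next
  case (insert x A)
  have "finsum R f (insert x A) = f x +. finsum R f A" using insert.hyps insert.prems idealD(3)[OF assms(1)] by (intro finsum_insert) auto
  thus ?case using insert idealD(4)[OF assms(1)] by simp
qed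

locale rees = local_noetherian +
  fixes I and S :: "('a, nat => 'a) up_ring"
  assumes I_ideal: "ideal I R" and S_eq: "S = rees_algebra R I" and S_cring: "cring S" and S_noeth: "noetherian_ring S"
begin

sublocale S: noetherian_cring S using S_cring S_noeth by (intro noetherian_cring.intro)

definition pw :: "nat => 'a set" where "pw n = I [^]\<^bsub>ideals_set R\<^esub> n"

definition mon :: "'a => nat => nat => 'a" where "mon a n = (%i. if i = n then a else \<zero>)"

lemma pw_0: "pw 0 = car R" and pw_Suc: "pw (Suc n) = ideal_prod R (pw n) I"
  by (simp_all add: pw_def nat_pow_def ideals_set_def)

lemma pw_ideal: "ideal (pw n) R"
  by (induction n) (simp_all add: pw_0 pw_Suc oneideal ideal_prod_is_ideal I_ideal)

lemmas pw_closed = idealD[OF pw_ideal]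

lemma pw_antimono: "m <= n ==> pw n <= pw m"
proof (induction rule: dec_induct)
  case (step n)
  thus ?case using ideal_prod_inter[OF pw_ideal[of n] I_ideal] pw_Suc by blast
qed simp

lemma pw_mult: "[|a : pw m; b : pw n|] ==> a ** b : pw (m + n)"
proof (induction n arbitrary: b)
  case 0
  thus ?case using pw_closed(8) pw_0 by simp
next
  case (Suc n)
  from Suc.prems(2) have "b : ideal_prod R (pw n) I" by (simp add: pw_Suc)
  hence "b : car R & a ** b : ideal_prod R (pw (m + n)) I"
  proof (induction rule: ideal_prod.induct)
    case (prod i j)
    have "a ** i ** j : ideal_prod R (pw (m + n)) I" using prod Suc by (intro ideal_prod.prod) auto
    thus ?case using pw_closed(3) prod Suc.prems(1) idealD(3)[OF I_ideal] by (simp add: m_assoc)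
  next
    case (sum x y)
    thus ?case using pw_closed(3)[OF Suc.prems(1)] by (simp add: r_distr ideal_prod.sum)
  qed
  thus ?case by (simp add: pw_Suc)
qed

lemma pw_pow: "a : I ==> a [^] n : pw n"
proof (induction n)
  case (Suc n)
  thus ?case by (simp add: pw_Suc ideal_prod.prod)
qed (simp add: pw_0)

lemma pw_1: "a : I ==> a : pw 1"
  using pw_pow[of a 1] idealD(3)[OF I_ideal] by simp

lemma S_carrier: "f : car S <-> f : up R & (ALL j. f j : pw j)"
  by (auto simp: S_eq rees_algebra_def UP_def pw_def)

lemma S_up: "f : car S ==> f : up R"
  by (simp add: S_carrier)

text \<open>Stated for all coefficient sequences in \<open>up R\<close>, because the expected module
  is an \<open>S\<close>-submodule of the polynomial ring and need not lie in
  \<open>S\<close>.\<close>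

lemma S_ops:
  "[|f : up R; g : up R|] ==> f +[S] g = (%i. f i +. g i)"
  "[|f : up R; g : up R|] ==> f *[S] g = (%n. \<Oplus>i\<in>{..n}. f i ** g (n - i))"
  "0[S] = (%i. \<zero>)" "1[S] = mon \<one> 0" by (simp_all add: S_eq rees_algebra_def UP_def mon_def)

lemma monom_eq: "a : car R ==> monom (UP R) a n = mon a n"
  by (simp add: UP_def mon_def)

lemma mon_up: "a : car R ==> mon a n : up R"
  by (auto simp: mon_def intro!: mem_upI exI[of _ n])

lemma mon_closed: "a : pw n ==> mon a n : car S"
  using mon_up[of a n] pw_closed(2,3) by (auto simp: S_carrier mon_def)

lemma mon_0_closed: "a : car R ==> mon a 0 : car S"
  by (simp add: mon_closed pw_0)

lemma mon_times:
  assumes a: "a : car R" and f: "f : up R"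
  shows "mon a n *[S] f = (%k. if k < n then \<zero> else a ** f (k - n))"
proof
  fix k
  have fc: "f j : car R" for j using f by auto
  have "(mon a n *[S] f) k = (\<Oplus>i\<in>{..k}. if n = i then a ** f (k - i) else \<zero>)"
    unfolding S_ops(2)[OF mon_up[OF a] f] by (rule finsum_cong') (use a fc in "auto simp: mon_def")
  also have "... = (if k < n then \<zero> else a ** f (k - n))"
  proof (cases "k < n")
    case True
    hence "(\<Oplus>i\<in>{..k}. if n = i then a ** f (k - i) else \<zero>) = (\<Oplus>i\<in>{..k}. \<zero>)" by (intro finsum_cong') auto
    thus ?thesis using True by (simp add: finsum_zero)
  next
    case False
    thus ?thesis using finsum_singleton[of n "{..k}" "%i. a ** f (k - i)"] a fc by simp
  qed
  finally show "(mon a n *[S] f) k = (if k < n then \<zero> else a ** f (k - n))" .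
qed

lemma mon_0_times: "[|a : car R; f : up R|] ==> mon a 0 *[S] f = (%k. a ** f k)"
  by (simp add: mon_times)

lemma mon_mult: "[|a : car R; b : car R|] ==> mon a m *[S] mon b n = mon (a ** b) (m + n)"
  by (rule ext) (auto simp: mon_times mon_up, auto simp: mon_def)

lemma mon_add: "[|a : car R; b : car R|] ==> mon a n +[S] mon b n = mon (a +. b) n"
  by (simp add: S_ops mon_up) (auto simp: mon_def)

lemma mon_pow: "a : car R ==> mon a n [^]\<^bsub>S\<^esub> k = mon (a [^] k) (n * k)"
  by (induction k) (simp_all add: S_ops(4) mon_mult add.commute)

lemma ideal_mem:
  assumes K: "ideal K S" and f: "f : car S" "!!n. mon (f n) n : K"
  shows "f : K"
proof -
  have fu: "f : up R" and fc: "f i : car R" for i using f(1) S_up by auto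
  have "(%i. if i < k then f i else \<zero>) : K" for k
  proof (induction k)
    case 0
    thus ?case using S.idealD(2)[OF K] by (simp add: S_ops)
  next
    case (Suc k)
    have "(%i. if i < k then f i else \<zero>) : up R" using Suc S.idealD(3)[OF K] S_up by blast
    hence "(%i. if i < k then f i else \<zero>) +[S] mon (f k) k = (%i. if i < Suc k then f i else \<zero>)"
      using fc by (auto simp: S_ops mon_up) (auto simp: mon_def less_Suc_eq)
    thus ?case using S.idealD(4)[OF K Suc f(2)[of k]] by simp
  qed
  moreover obtain n where "bound \<zero> n f" using fu by auto
  hence "(%i. if i < Suc n then f i else \<zero>) = f" by (auto simp: fun_eq_iff bound_def)
  ultimately show ?thesis by metis
qed

text \<open>\<open>I^(n+1) t^(n+1)\<close> is spanned by products of \<open>I^n t^n\<close> and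
  \<open>I t\<close>; so an ideal of \<open>S\<close> that contains \<open>I t\<close> contains
  everything of positive degree.\<close>

lemma ideal_mon:
  assumes K: "ideal K S" "!!a. a : I ==> mon a 1 : K" and a: "a : pw (Suc n)"
  shows "mon a (Suc n) : K"
proof -
  from a have "a : ideal_prod R (pw n) I" by (simp add: pw_Suc)
  hence "a : car R & mon a (Suc n) : K"
  proof (induction rule: ideal_prod.induct)
    case (prod i j)
    have c: "i : car R" "j : car R" using prod pw_closed(3) idealD(3)[OF I_ideal] by auto
    have "mon (i ** j) (Suc n) = mon i n *[S] mon j 1" using c by (simp add: mon_mult)
    thus ?case using c S.idealD(7)[OF K(1) mon_closed[OF prod(1)] K(2)[OF prod(2)]] by simp
  next
    case (sum x y)
    thus ?case using S.idealD(4)[OF K(1), of "mon x (Suc n)" "mon y (Suc n)"] mon_add[of x y "Suc n"] by auto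
  qed
  thus ?thesis by blast
qed

text \<open>The contraction to \<open>S\<close> of the extension of \<open>p\<close> to the
  polynomial ring.\<close>

definition star :: "'a set => (nat => 'a) set"
  where "star p = {f : car S. ALL i. f i : p}"

lemma mon_star: "[|ideal p R; a : car R|] ==> mon a 0 : star p <-> a : p"
  using mon_0_closed[of a] idealD(2)[of p] by (auto simp: star_def mon_def)

lemma star_ideal: assumes p: "ideal p R" shows "ideal (star p) S"
proof (rule S.ideal_criterion)
  note cp = idealD[OF p]
  show "star p <= car S" by (auto simp: star_def)
  show "0[S] : star p" using S.zero_closed cp(2) by (auto simp: star_def S_ops)
  show "x +[S] y : star p" if "x : star p" "y : star p" for x y using that S.a_closed[of x y] cp(4) S_up by (auto simp: star_def S_ops)
  show "x *[S] y : star p" if xy: "x : car S" "y : star p" for x y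
  proof -
    have "x i : car R" for i using xy(1) S_up by auto
    hence "(\<Oplus>i\<in>{..n}. x i ** y (n - i)) : p" for n using xy cp(7) by (intro ideal_finsum[OF p]) (auto simp: star_def)
    thus ?thesis using xy S.m_closed[of x y] S_up by (auto simp: star_def S_ops)
  qed
qed

text \<open>Gauss's lemma: if \<open>i\<close> and \<open>j\<close> are the lowest degrees with
  coefficients outside \<open>p\<close>, the coefficient of degree \<open>i + j\<close> of the
  product is congruent to \<open>f i ** g j\<close> modulo \<open>p\<close>.\<close>

lemma star_prime: assumes p: "primeideal p R" shows "primeideal (star p) S"
proof (rule S.primeideal_criterion)
  note cp = primeD[OF p] note ip = idealD[OF cp(1)]
  show "ideal (star p) S" by (rule star_ideal[OF cp(1)])
  show "1[S] ~: star p" using mon_star[OF cp(1), of \<one>] cp(2) by (simp add: S_ops)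
  fix f g assume fg: "f : car S" "g : car S" "f *[S] g : star p"
  show "f : star p \<or> g : star p"
  proof (rule ccontr)
    assume "~ (f : star p \<or> g : star p)"
    hence ex: "EX i. f i ~: p" "EX j. g j ~: p" using fg by (auto simp: star_def)
    define i j where "i = (LEAST i. f i ~: p)" and "j = (LEAST j. g j ~: p)"
    have i: "f i ~: p" "!!k. k < i ==> f k : p" unfolding i_def using LeastI_ex[OF ex(1)] not_less_Least[where P="%i. f i ~: p"] by blast+
    have j: "g j ~: p" "!!k. k < j ==> g k : p" unfolding j_def using LeastI_ex[OF ex(2)] not_less_Least[where P="%i. g i ~: p"] by blast+
    have fc: "f k : car R" "g k : car R" for k using fg S_up by auto
    let ?h = "%k. f k ** g (i + j - k)"
    have rest: "finsum R ?h ({..i + j} - {i}) : p"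
    proof (rule ideal_finsum[OF cp(1)])
      fix k assume k: "k : {..i + j} - {i}"
      show "?h k : p"
      proof (cases "k < i")
        case True thus ?thesis using i(2) ip(8) fc by simp
      next
        case False
        hence "i + j - k < j" using k by auto
        thus ?thesis using j(2) ip(7) fc by simp
      qed
    qed simp
    have "finsum R ?h {..i + j} = ?h i +. finsum R ?h ({..i + j} - {i})"
    proof -
      have "finsum R ?h (insert i ({..i + j} - {i})) = ?h i +. finsum R ?h ({..i + j} - {i})" using fc by (intro finsum_insert) auto
      moreover have "insert i ({..i + j} - {i}) = {..i + j}" by auto
      ultimately show ?thesis by simp
    qed
    hence eq: "?h i = finsum R ?h {..i + j} \<ominus> finsum R ?h ({..i + j} - {i})" using ip(3)[OF rest] fc by (simp add: minus_eq a_assoc r_neg)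
    have "finsum R ?h {..i + j} : p" using fg S_up by (auto simp: star_def S_ops)
    hence "?h i : p" unfolding eq using rest by (rule ip(6))
    thus False using cp(3)[of "f i" "g j"] fc i(1) j(1) by simp
  qed
qed

lemma star_strict_mono: assumes "ideal p R" "ideal q R" "p < q" shows "star p < star q"
proof -
  obtain a where a: "a : q" "a ~: p" using assms(3) by blast
  hence "mon a 0 : star q" "mon a 0 ~: star p" using mon_star[OF assms(1)] mon_star[OF assms(2)] idealD(3)[OF assms(2)] by auto
  moreover have "star p <= star q" using assms(3) by (auto simp: star_def)
  ultimately show ?thesis by blast
qed

lemma height_star: assumes p: "primeideal p R" shows "height R p <= height S (star p)"
proof (rule height_leI)
  fix n c assume c: "prime_chain R n c" "c n = p"
  have "prime_chain S n (%i. star (c i))" using c(1) star_prime star_strict_mono primeD(1) unfolding prime_chain_def by (simp add: less_imp_le)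
  thus "enat n <= height S (star p)" using prime_chain_le_height[of S n] c(2) by blast
qed

lemma height_ge_ideal_height:
  assumes P: "primeideal P S" "!!a. a : I ==> mon a 0 : P" "!!a. a : I ==> mon a 1 : P"
  shows "ideal_height R I <= height S P"
proof -
  note cP = S.primeD[OF P(1)] note iP = S.idealD[OF cP(1)]
  let ?p = "{a : car R. mon a 0 : P}"
  have p: "primeideal ?p R"
  proof (rule primeideal_criterion[OF ideal_criterion])
    show "\<zero> : ?p" using iP(2) by (simp add: S_ops mon_def)
    show "x +. y : ?p" if "x : ?p" "y : ?p" for x y using that iP(4)[of "mon x 0" "mon y 0"] by (simp add: mon_add)
    show "a ** x : ?p" if "a : car R" "x : ?p" for a x using that iP(7)[OF mon_0_closed[of a], of "mon x 0"] by (simp add: mon_mult)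
    show "\<one> ~: ?p" using cP(2) by (simp add: S_ops)
    show "a : ?p \<or> b : ?p" if "a : car R" "b : car R" "a ** b : ?p" for a b
      using that cP(3)[OF mon_0_closed[of a] mon_0_closed[of b]] by (simp add: mon_mult)
  qed auto
  have "f : P" if f: "f : star ?p" for f
  proof (rule ideal_mem[OF cP(1)])
    show "f : car S" using f by (simp add: star_def)
    \<comment> \<open>Degree 0 holds by the choice of \<open>?p\<close>; in positive degree
      \<open>P\<close> contains all monomials of \<open>S\<close>, since it contains
      \<open>I t\<close>.\<close>
    thus "mon (f n) n : P" for n using f ideal_mon[OF cP(1) P(3)] by (cases n) (auto simp: star_def S_carrier)
  qed
  hence "height S (star ?p) <= height S P" by (intro height_mono[OF star_prime[OF p] P(1)]) blast
  moreover have "ideal_height R I <= height R ?p" unfolding ideal_height_def by (rule INF_lower) (use p P(2) idealD(3)[OF I_ideal] in auto)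
  ultimately show ?thesis using height_star[OF p] by (meson order_trans)
qed

lemma rees_max_ideal_eq: "rees_max_ideal R I = {f : car S. f 0 : nn}"
  and rees_max_ideal_maximal: "maximalideal (rees_max_ideal R I) S"
proof -
  let ?N = "{f : car S. f 0 : nn}"
  have N: "ideal ?N S"
  proof (rule S.ideal_criterion)
    show "0[S] : ?N" using S.zero_closed n_closed(2) by (simp add: S_ops)
    show "x +[S] y : ?N" if "x : ?N" "y : ?N" for x y using that S.a_closed[of x y] n_closed(4) S_up by (simp add: S_ops)
    show "x *[S] y : ?N" if xy: "x : car S" "y : ?N" for x y
    proof -
      have c: "x 0 : car R" "y 0 : car R" using xy S_up by auto
      hence "(x *[S] y) 0 = x 0 ** y 0" using xy S_up by (simp add: S_ops)
      thus ?thesis using xy S.m_closed[of x y] n_closed(7)[OF c(1)] by simp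
    qed
  qed auto
  let ?G = "{monom (UP R) a 0 | a. a : max_ideal R} Un {monom (UP R) a 1 | a. a : I}"
  have G: "?G = {mon a 0 | a. a : nn} Un {mon a 1 | a. a : I}"
  proof -
    have 0: "monom (UP R) a 0 = mon a 0" if "a : nn" for a using monom_eq n_closed(3)[OF that] .
    have 1: "monom (UP R) a 1 = mon a 1" if "a : I" for a using monom_eq idealD(3)[OF I_ideal that] .
    have "{monom (UP R) a 0 | a. a : nn} = {mon a 0 | a. a : nn}" by (rule Collect_cong) (metis 0)
    moreover have "{monom (UP R) a 1 | a. a : I} = {mon a 1 | a. a : I}" by (rule Collect_cong) (metis 1)
    ultimately show ?thesis unfolding max_ideal_eq by simp
  qed
  have "mon a 0 : ?N" if "a : nn" for a using mon_0_closed[OF n_closed(3)[OF that]] that by (simp add: mon_def)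
  moreover have "mon a 1 : ?N" if "a : I" for a using mon_closed[OF pw_1[OF that]] n_closed(2) by (simp add: mon_def)
  ultimately have GN: "?G <= ?N" unfolding G by blast
  have M: "rees_max_ideal R I = Idl\<^bsub>S\<^esub> ?G" by (simp add: rees_max_ideal_def S_eq)
  have Gc: "?G <= car S" using GN by blast
  have "f : Idl\<^bsub>S\<^esub> ?G" if f: "f : ?N" for f
  proof (rule ideal_mem[OF S.genideal_ideal[OF Gc]])
    show fS: "f : car S" using f by simp
    have "mon a 1 : Idl\<^bsub>S\<^esub> ?G" if "a : I" for a using S.genideal_self[OF Gc] that unfolding G by blast
    moreover have "mon (f 0) 0 : Idl\<^bsub>S\<^esub> ?G" using S.genideal_self[OF Gc] f unfolding G by blast
    ultimately show "mon (f n) n : Idl\<^bsub>S\<^esub> ?G" for n using ideal_mon[OF S.genideal_ideal[OF Gc]] fS by (cases n) (auto simp: S_carrier)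
  qed
  thus eq: "rees_max_ideal R I = ?N" unfolding M using S.genideal_minimal[OF N GN] by blast
  show "maximalideal (rees_max_ideal R I) S" unfolding eq
  proof (rule maximalidealI[OF N])
    have "1[S] ~: ?N" using n_proper by (simp add: S_ops mon_def)
    thus "car S ~= ?N" using S.one_closed by metis
    fix K assume K: "ideal K S" "?N <= K" "K <= car S"
    show "K = ?N \<or> K = car S"
    proof (rule ccontr)
      assume no: "~ (K = ?N \<or> K = car S)"
      then obtain f where f: "f : K" "f ~: ?N" using K(2) by blast
      have fS: "f : car S" and fc: "f i : car R" for i using f K(3) S_up by auto
      have u: "f 0 : Units R" using n_units[OF fc[of 0]] f fS by blast
      \<comment> \<open>\<open>g\<close> has constant term 0 and cancels all terms of
        \<open>f\<close> of positive degree, so \<open>K\<close> contains the constant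
        \<open>f 0\<close>, a unit.\<close>
      define g where "g = (%i. if i = 0 then \<zero> else \<ominus> f i)"
      have "g : up R"
      proof (rule mem_upI)
        show "g n : car R" for n using fc by (simp add: g_def)
        obtain n where "bound \<zero> n f" using S_up[OF fS] by auto
        hence "bound \<zero> n g" using minus_zero by (auto simp: g_def bound_def)
        thus "EX n. bound \<zero> n g" ..
      qed
      moreover have "g j : pw j" for j using fS pw_closed(2,5) by (auto simp: S_carrier g_def)
      ultimately have gS: "g : car S" by (simp add: S_carrier)
      moreover have "g 0 : nn" using n_closed(2) by (simp add: g_def)
      ultimately have "f +[S] g : K" using S.idealD(4)[OF K(1) f(1)] K(2) by blast
      moreover have "f +[S] g = mon (f 0) 0" unfolding S_ops(1)[OF S_up[OF fS] S_up[OF gS]] using fc by (auto simp: g_def mon_def r_neg)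
      ultimately have "mon (inv (f 0)) 0 *[S] mon (f 0) 0 : K" using S.idealD(7)[OF K(1) mon_0_closed] u by simp
      hence "1[S] : K" using u fc by (simp add: mon_mult S_ops)
      thus False using ideal.one_imp_carrier[OF K(1)] no by blast
    qed
  qed
qed

end

lemma prime_below:
  assumes "primeideal P R" "1 <= height R P"
  shows "EX q. primeideal q R & q < P"
proof -
  have "enat 1 <= height R P" using assms(2) by (simp add: one_enat_def)
  then obtain m c where c: "1 <= m" "prime_chain R m c" "c m = P" using enat_le_height[OF assms(1)] by blast
  then obtain k where "m = Suc k" by (cases m) auto
  hence "c k < P" "primeideal (c k) R" using c unfolding prime_chain_def by auto
  thus ?thesis by blast
qed

lemma (in cring) primeideal_pow:
  assumes "primeideal P R" "x : car R" "x ~: P" shows "x [^] (n::nat) ~: P"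
proof (induction n)
  case 0
  thus ?case using primeD(2)[OF assms(1)] by simp
next
  case (Suc n)
  thus ?case using primeD(3)[OF assms(1), of "x [^] n" x] assms(2,3) by auto
qed

lemma (in cring) nonzerodivisor_pow:
  assumes "nonzerodiv R {\<zero>} (car R) a" "a : car R" "x : car R" "a [^] (n::nat) ** x = \<zero>"
  shows "x = \<zero>"
  using assms(3,4)
proof (induction n arbitrary: x)
  case (Suc n)
  have "a [^] n ** (a ** x) = \<zero>" using Suc.prems assms(2) by (simp add: m_assoc)
  hence "a ** x = \<zero>" using Suc.IH[of "a ** x"] Suc.prems assms(2) by simp
  thus ?case using assms(1) Suc.prems(1) by (auto simp: nonzerodiv_def)
qed simp

lemma (in local_noetherian) cohen_macaulay_associated_prime:
  assumes "cohen_macaulay_local_ring R" "u : car R" "primeideal (colon R {\<zero>} u) R" "primeideal q R"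
  shows "~ q < colon R {\<zero>} u"
proof -
  obtain d where "krull_dim R = enat d" "depth_ge nn (car R) d {\<zero>}" using cohen_macaulay_dim[OF assms(1)] .
  thus ?thesis using associated_prime_minimal[OF _ _ assms(2-4)] by simp
qed

context rees
begin

text \<open>Cohen-Macaulayness is given for \<open>S\<close> at its graded maximal ideal, so an
  associated prime of \<open>R\<close> has to be exhibited there. If \<open>I\<close> consisted of
  zero-divisors, it would lie in the annihilator \<open>p\<close> of some \<open>u\<close>, a prime
  of height at least one. The annihilator of \<open>u\<close> in \<open>S\<close> is
  \<open>star p\<close>; after localization it is an associated prime with the smaller prime
  \<open>star q\<close> below it, against unmixedness.\<close>

lemma nonzerodivisor_exists:
  assumes cm: "cohen_macaulay_local_ring (loc_at S (rees_max_ideal R I))" and ht: "2 <= ideal_height R I"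
  obtains a where "a : I" "nonzerodiv R {\<zero>} (car R) a"
proof -
  let ?M = "rees_max_ideal R I" let ?T = "car S - ?M" and ?A = "loc_at S ?M"
  define phi where "phi = (%a. fraction ?T (self_module S) a 1[S])"
  have M: "primeideal ?M S" by (rule S.maximalideal_prime[OF rees_max_ideal_maximal])
  interpret L: ring_localization S ?T ?A phi unfolding phi_def by (rule loc_at_localization[OF M])
  interpret A: local_noetherian ?A "L.extend ?M" by (rule L.local_noetherian_B[OF M refl S_noeth])
  have no: "m = \<zero>" if m: "m : car R" "!!k. k : I ==> k ** m = \<zero>" for m
  proof (rule ccontr)
    assume "m ~= \<zero>"
    then obtain u where u: "u : car R" "primeideal (colon R {\<zero>} u) R" "colon R {\<zero>} m <= colon R {\<zero>} u"
      using colon_prime[OF zeroideal oneideal m(1)] by auto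
    let ?p = "colon R {\<zero>} u"
    note p = u(2) and cp = primeD[OF u(2)]
    have Ip: "I <= ?p" using u(3) m idealD(3)[OF I_ideal] by (auto simp: colon_def)
    have "ideal_height R I <= height R ?p" unfolding ideal_height_def by (rule INF_lower) (use p Ip in auto)
    hence "1 <= height R ?p" using ht by (meson one_le_numeral order_trans)
    then obtain q where q: "primeideal q R" "q < ?p" using prime_below[OF p] by blast
    have pM: "star ?p Int ?T = {}" using proper_ideal_subset_n[OF cp(1,2)] by (auto simp: star_def rees_max_ideal_eq)
    hence qM: "star q Int ?T = {}" using star_strict_mono[OF primeD(1)[OF q(1)] cp(1) q(2)] by blast
    have star: "f : star ?p <-> f *[S] mon u 0 = 0[S]" if f: "f : car S" for f
    proof -
      have fc: "f k : car R" for k using f S_up by auto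
      have "f *[S] mon u 0 = (%k. u ** f k)" using S.m_comm[OF f mon_0_closed[OF u(1)]] mon_0_times[OF u(1) S_up[OF f]] by simp
      thus ?thesis using f fc u(1) by (simp add: star_def colon_def S_ops fun_eq_iff m_comm)
    qed
    have uS: "mon u 0 : car S" using mon_0_closed[OF u(1)] .
    \<comment> \<open>Taking the annihilator of \<open>u\<close> commutes with localization, so
      \<open>star ?p\<close> extends to an associated prime of the local ring.\<close>
    have eq: "colon ?A {0[?A]} (phi (mon u 0)) = L.extend (star ?p)"
    proof (intro Set.set_eqI iffI)
      fix b assume "b : colon ?A {0[?A]} (phi (mon u 0))"
      hence b: "b : car ?A" "b *[?A] phi (mon u 0) = 0[?A]" by (auto simp: colon_def)
      obtain f s where f: "f : car S" "s : ?T" "phi s *[?A] b = phi f" using L.phi_surj[OF b(1)] by blast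
      have sc: "s : car S" using f(2) by simp
      have "phi (f *[S] mon u 0) = phi s *[?A] (b *[?A] phi (mon u 0))"
        using f(1) uS b(1) L.phi_in[OF sc] L.phi_in[OF uS] by (simp add: L.phi_mult f(3)[symmetric] L.B.m_assoc)
      hence "phi (f *[S] mon u 0) = 0[?A]" using b(2) L.phi_in[OF sc] by simp
      then obtain t where t: "t : ?T" "t *[S] (f *[S] mon u 0) = 0[S]" using L.phi_ker[of "f *[S] mon u 0"] f uS by auto
      have tc: "t : car S" using t(1) by simp
      have tf: "t *[S] f : star ?p" using star[of "t *[S] f"] t(2) tc f(1) uS by (simp add: S.m_assoc)
      have "phi (t *[S] s) *[?A] b = phi (t *[S] f)" using tc sc f(1,3) b(1) L.phi_in[OF tc] L.phi_in[OF sc] by (simp add: L.phi_mult L.B.m_assoc)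
      thus "b : L.extend (star ?p)" unfolding L.extend_def using b(1) tf L.T_mult[OF t(1) f(2)] by blast
    next
      fix b assume "b : L.extend (star ?p)"
      then obtain f s where f: "b : car ?A" "f : star ?p" "s : ?T" "phi s *[?A] b = phi f" unfolding L.extend_def by blast
      have c: "f : car S" "s : car S" using f by (auto simp: star_def)
      have "phi s *[?A] (b *[?A] phi (mon u 0)) = phi (f *[S] mon u 0)"
        using c uS f(1) L.phi_in[OF c(2)] L.phi_in[OF uS] by (simp add: L.phi_mult f(4)[symmetric] L.B.m_assoc)
      also have "... = phi s *[?A] 0[?A]" using star[OF c(1)] f(2) L.phi_zero L.phi_in[OF c(2)] by simp
      finally have "b *[?A] phi (mon u 0) = 0[?A]" using L.phi_cancel[OF f(3), of "b *[?A] phi (mon u 0)" "0[?A]"] f(1) L.phi_in[OF uS] by simp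
      thus "b : colon ?A {0[?A]} (phi (mon u 0))" using f(1) by (simp add: colon_def)
    qed
    have "L.extend (star q) < L.extend (star ?p)"
    proof
      have lt: "star q < star ?p" by (rule star_strict_mono[OF primeD(1)[OF q(1)] cp(1) q(2)])
      thus "L.extend (star q) <= L.extend (star ?p)" by (rule L.extend_mono[OF psubset_imp_subset])
      show "L.extend (star q) ~= L.extend (star ?p)"
      proof
        assume "L.extend (star q) = L.extend (star ?p)"
        hence "L.contract (L.extend (star q)) = L.contract (L.extend (star ?p))" by simp
        thus False using lt unfolding L.contract_extend_prime[OF star_prime[OF q(1)] qM] L.contract_extend_prime[OF star_prime[OF p] pM] by blast
      qed
    qed
    thus False using A.cohen_macaulay_associated_prime[OF cm L.phi_in[OF uS], unfolded eq,
          OF L.extend_prime[OF star_prime[OF p] pM] L.extend_prime[OF star_prime[OF q(1)] qM]] by simp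
  qed
  obtain k where k: "k : I" "!!N M. (N, M) : {({\<zero>}, car R)} ==> nonzerodiv R N M (\<zero> +. k)"
    by (rule coset_nonzerodivisor[OF I_ideal zero_closed, of "{({\<zero>}, car R)}"]) (use no zeroideal oneideal in auto)
  thus ?thesis using that[of k] idealD(3)[OF I_ideal] by simp
qed

definition em :: "int => (nat => 'a) set"
  where "em m = {f : up R. ALL j. f j : pw (nat (int j - m))}"

text \<open>A copy of the expected module inside \<open>S\<close>: for a nonzerodivisor
  \<open>a\<close> in \<open>I\<close>, multiplication by \<open>a^m\<close> is injective and brings
  the coefficients into the right powers of \<open>I\<close>. For \<open>m = -1\<close> the exponent
  \<open>nat m\<close> is 0, and \<open>em m\<close> lies in \<open>S\<close> already.\<close>

definition canon :: "'a => int => (nat => 'a) set"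
  where "canon a m = (%k i. a [^] nat m ** k i) ` em m"

lemma expected_module_simps:
  "car (expected_module R I m) = em m" "x +[expected_module R I m] y = x +[S] y" "f *>[expected_module R I m] x = f *[S] x"
  by (auto simp: expected_module_def em_def S_eq rees_algebra_def UP_def pw_def)

lemma up_times: "[|f : up R; g : up R|] ==> f *[S] g : up R"
  by (simp add: S_ops up_mult_closed)

lemma em_add: "[|x : em m; y : em m|] ==> x +[S] y : em m"
  by (auto simp: em_def S_ops up_add_closed pw_closed(4))

lemma em_mult:
  assumes f: "f : car S" and k: "k : em m"
  shows "f *[S] k : em m"
proof -
  have "(f *[S] k) n : pw (nat (int n - m))" for n
  proof -
    have "f i ** k (n - i) : pw (nat (int n - m))" if "i <= n" for i
    proof -
      have "f i ** k (n - i) : pw (i + nat (int (n - i) - m))" using f k by (intro pw_mult) (auto simp: S_carrier em_def)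
      moreover have "nat (int n - m) <= i + nat (int (n - i) - m)" using that by arith
      ultimately show ?thesis using pw_antimono by blast
    qed
    thus ?thesis using f k by (simp add: S_ops S_carrier em_def) (auto intro!: ideal_finsum pw_ideal)
  qed
  thus ?thesis using f k up_times by (simp add: em_def S_carrier)
qed

text \<open>For \<open>j <= m\<close> the factor \<open>a^m\<close> alone lies in
  \<open>I^j\<close>; above, it supplies the \<open>m\<close> powers of \<open>I\<close> that the
  coefficient lacks.\<close>

lemma em_scale:
  assumes "a : I" "k : em m" shows "(%i. a [^] nat m ** k i) : car S"
proof -
  have "a [^] nat m ** k j : pw j" for j
  proof -
    have "a [^] nat m ** k j : pw (nat m + nat (int j - m))" using assms by (intro pw_mult pw_pow) (auto simp: em_def)
    moreover have "j <= nat m + nat (int j - m)" by arith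
    ultimately show ?thesis using pw_antimono by blast
  qed
  thus ?thesis using assms idealD(3)[OF I_ideal] by (simp add: S_carrier em_def up_smult_closed)
qed

lemma scale_add:
  assumes "c : car R" "x : up R" "y : up R"
  shows "(%i. c ** (x +[S] y) i) = (%i. c ** x i) +[S] (%i. c ** y i)"
proof -
  have "x i : car R" "y i : car R" for i using assms by auto
  thus ?thesis using assms by (simp add: S_ops up_smult_closed r_distr)
qed

lemma scale_mult:
  assumes c: "c : car R" and f: "f : up R" "x : up R"
  shows "(%i. c ** (f *[S] x) i) = f *[S] (%i. c ** x i)"
proof
  fix n
  have fc: "f i : car R" "x i : car R" for i using f by auto
  have "c ** (\<Oplus>i\<in>{..n}. f i ** x (n - i)) = (\<Oplus>i\<in>{..n}. c ** (f i ** x (n - i)))" using c fc by (intro finsum_rdistr) auto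
  also have "... = (\<Oplus>i\<in>{..n}. f i ** (c ** x (n - i)))" using c fc by (intro finsum_cong') (auto simp: m_lcomm)
  finally show "c ** (f *[S] x) n = (f *[S] (%i. c ** x i)) n" using c f by (simp add: S_ops up_smult_closed)
qed

lemma canon_ideal: assumes a: "a : I" shows "ideal (canon a m) S"
proof (rule S.ideal_criterion)
  let ?c = "a [^] nat m"
  have c: "?c : car R" using idealD(3)[OF I_ideal a] by simp
  have up: "k : up R" if "k : em m" for k using that by (simp add: em_def)
  show "canon a m <= car S" using em_scale[OF a] by (auto simp: canon_def)
  have "(%i. \<zero>) : em m" using S_up[OF S.zero_closed] pw_closed(2) by (simp add: em_def S_ops)
  thus "0[S] : canon a m" using c by (auto simp: canon_def S_ops intro!: image_eqI[of _ _ "%i. \<zero>"])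
  show "x +[S] y : canon a m" if xy: "x : canon a m" "y : canon a m" for x y
  proof -
    obtain k l where "k : em m" "l : em m" "x = (%i. ?c ** k i)" "y = (%i. ?c ** l i)" using xy by (auto simp: canon_def)
    thus ?thesis unfolding canon_def using scale_add[OF c up up] em_add by (intro image_eqI[of _ _ "k +[S] l"]) auto
  qed
  show "f *[S] x : canon a m" if fx: "f : car S" "x : canon a m" for f x
  proof -
    obtain k where "k : em m" "x = (%i. ?c ** k i)" using fx by (auto simp: canon_def)
    thus ?thesis unfolding canon_def using scale_mult[OF c S_up[OF fx(1)] up] em_mult[OF fx(1)] by (intro image_eqI[of _ _ "f *[S] k"]) auto
  qed
qed

lemma canon_iso:
  assumes a: "a : I" "nonzerodiv R {\<zero>} (car R) a" and iso: "module_iso S \<omega> (expected_module R I m)"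
  obtains H where "bij_betw H (carrier \<omega>) (canon a m)"
    "!!x y. [|x : carrier \<omega>; y : carrier \<omega>|] ==> H (x +[\<omega>] y) = H x +[S] H y"
    "!!f x. [|f : car S; x : carrier \<omega>|] ==> H (f *>[\<omega>] x) = f *[S] H x"
proof -
  obtain h where h: "h : module_hom S \<omega> (expected_module R I m)" "bij_betw h (carrier \<omega>) (em m)"
    using iso by (auto simp: module_iso_def expected_module_simps)
  note hD = module_homD[OF h(1), unfolded expected_module_simps]
  let ?c = "a [^] nat m"
  have ac: "a : car R" and c: "?c : car R" using idealD(3)[OF I_ideal a(1)] by auto
  have up: "h x : up R" if "x : carrier \<omega>" for x using hD(1)[OF that] by (simp add: em_def)
  have "inj_on (%k i. ?c ** k i) (em m)"
  proof (rule inj_onI, rule ext)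
    fix k l i assume kl: "k : em m" "l : em m" "(%i. ?c ** k i) = (%i. ?c ** l i)"
    have kc: "k i : car R" "l i : car R" using kl by (auto simp: em_def)
    have "?c ** k i = ?c ** l i" using kl(3) by meson
    moreover have "?c ** (k i \<ominus> l i) = ?c ** k i \<ominus> ?c ** l i" using kc c by algebra
    ultimately have "?c ** (k i \<ominus> l i) = \<zero>" using kc c by (simp add: r_right_minus_eq)
    hence "k i \<ominus> l i = \<zero>" using nonzerodivisor_pow[OF a(2) ac] kc by blast
    thus "k i = l i" using kc by (simp add: r_right_minus_eq)
  qed
  hence "bij_betw (%k i. ?c ** k i) (em m) (canon a m)" unfolding canon_def by (rule inj_on_imp_bij_betw)
  from bij_betw_trans[OF h(2) this] have "bij_betw (%x i. ?c ** h x i) (carrier \<omega>) (canon a m)" by (simp add: comp_def)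
  thus ?thesis
  proof (rule that)
    show "(%i. ?c ** h (x +[\<omega>] y) i) = (%i. ?c ** h x i) +[S] (%i. ?c ** h y i)" if "x : carrier \<omega>" "y : carrier \<omega>" for x y
      using hD(2)[OF that] scale_add[OF c up[OF that(1)] up[OF that(2)]] by simp
    show "(%i. ?c ** h (f *>[\<omega>] x) i) = f *[S] (%i. ?c ** h x i)" if "f : car S" "x : carrier \<omega>" for f x
      using hD(3)[OF that] scale_mult[OF c S_up[OF that(1)] up[OF that(2)]] by simp
  qed
qed

text \<open>For \<open>m >= 0\<close> the expected module is generated by \<open>1\<close> once
  \<open>b\<close> is inverted, and by \<open>t^m\<close> once \<open>b t\<close> is; for
  \<open>m = -1\<close> it is generated by \<open>b\<close> in both cases. The exponent
  \<open>e\<close>, which is 0 or 1, treats the two alternatives together.\<close>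

lemma canon_locally_principal:
  assumes a: "a : I" "nonzerodiv R {\<zero>} (car R) a" and m: "-1 <= m"
    and P: "primeideal P S" and b: "b : I" "e <= 1" "mon b e ~: P"
  shows "locally_principal S P (canon a m)"
proof -
  have ac: "a : car R" and bc: "b : car R" using idealD(3)[OF I_ideal] a b by auto
  have bS: "mon b e : car S" using b(1,2) pw_1[OF b(1)] bc mon_closed[of b e] by (cases e) (auto simp: pw_0)
  show ?thesis
  proof (cases "0 <= m")
    case True
    \<comment> \<open>The generator comes from \<open>t^(e m)\<close>, an element of
      \<open>em m\<close> since \<open>e m <= m\<close>, and the denominator is
      \<open>(b t^e)^m\<close>. Multiplying \<open>a^m k\<close> by it gives
      \<open>a^m t^(e m)\<close> times \<open>b^m k\<close>, and \<open>b^m k\<close> is in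
      \<open>S\<close> by \<open>em_scale\<close>.\<close>
    let ?n = "nat m" let ?k = "e * ?n" let ?c = "a [^] ?n" and ?d = "b [^] ?n"
    have cd: "?c : car R" "?d : car R" using ac bc by auto
    have "nat (int ?k - m) = 0" using b(2) True by (cases e) auto
    hence "mon \<one> ?k : em m" using mon_up[of \<one> ?k] pw_0 pw_closed(2) by (auto simp: em_def mon_def)
    hence g: "mon ?c ?k : canon a m" unfolding canon_def using cd by (intro image_eqI[of _ _ "mon \<one> ?k"]) (auto simp: mon_def)
    have "mon b e [^]\<^bsub>S\<^esub> ?n = mon ?d ?k" by (rule mon_pow[OF bc])
    hence s: "mon ?d ?k : car S - P" using S.primeideal_pow[OF P bS b(3), of ?n] S.nat_pow_closed[OF bS, of ?n] by simp
    have "EX y:car S. mon ?d ?k *[S] x = mon ?c ?k *[S] y" if x: "x : canon a m" for x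
    proof -
      obtain k where k: "k : em m" "x = (%i. ?c ** k i)" using x by (auto simp: canon_def)
      have ku: "k : up R" and kc: "k i : car R" for i using k by (auto simp: em_def)
      have "mon ?d ?k *[S] x = mon ?c ?k *[S] (%i. ?d ** k i)" unfolding k(2) using cd ku kc by (auto simp: mon_times up_smult_closed m_lcomm)
      thus ?thesis using em_scale[OF b(1) k(1)] by blast
    qed
    moreover have "EX u:car S - P. u *[S] f = 0[S]" if f: "f : car S" "f *[S] mon ?c ?k = 0[S]" for f
    proof -
      have "mon ?c ?k *[S] f = 0[S]" using f g S.idealD(3)[OF canon_ideal[OF a(1)]] by (simp add: S.m_comm)
      hence "(if i + ?k < ?k then \<zero> else ?c ** f (i + ?k - ?k)) = \<zero>" for i unfolding mon_times[OF cd(1) S_up[OF f(1)]] S_ops by (rule fun_cong)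
      hence "?c ** f i = \<zero>" for i by simp
      moreover have "f i : car R" for i using S_up[OF f(1)] by auto
      ultimately have "f i = \<zero>" for i using nonzerodivisor_pow[OF a(2) ac] by blast
      hence "f = 0[S]" by (simp add: S_ops fun_eq_iff)
      thus ?thesis using S.primeD(2)[OF P] by (intro bexI[of _ "1[S]"]) auto
    qed
    ultimately show ?thesis unfolding locally_principal_def using g s by blast
  next
    case False
    hence m1: "m = -1" using m by simp
    have canon: "canon a m = em m"
    proof -
      have "(%i. \<one> ** k i) = k" if "k : em m" for k
      proof -
        have "k i : car R" for i using that by (auto simp: em_def)
        thus ?thesis by simp
      qed
      thus ?thesis unfolding canon_def m1 by (force simp: image_iff)
    qed
    \<comment> \<open>Here the coefficient of \<open>t^j\<close> ranges over \<open>I^(j+1)\<close>.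
      For such \<open>x\<close> the product \<open>t^e x\<close> is in \<open>S\<close> as
      \<open>e <= 1\<close>, and \<open>(b t^e) x = b (t^e x)\<close> exhibits \<open>b\<close> as
      generator. What \<open>b\<close> annihilates is annihilated by \<open>b t^e\<close>, which is
      outside \<open>P\<close>.\<close>
    have pow: "nat (int j - m) = Suc j" for j by (simp add: m1)
    have g: "mon b 0 : canon a m" unfolding canon em_def pow using mon_up[OF bc] pw_1[OF b(1)] pw_closed(2) by (auto simp: mon_def)
    have "EX y:car S. mon b e *[S] x = mon b 0 *[S] y" if x: "x : canon a m" for x
    proof -
      have xu: "x : up R" and xc: "!!i. x i : car R" and xp: "!!j. x j : pw (Suc j)" using x unfolding canon em_def pow by auto
      let ?y = "mon \<one> e *[S] x"
      have y: "?y = (%k. if k < e then \<zero> else x (k - e))" using xu xc by (auto simp: mon_times)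
      have yu: "?y : up R" by (rule up_times[OF mon_up[OF one_closed] xu])
      have "?y j : pw j" for j
      proof -
        have "j <= Suc (j - e)" using b(2) by arith
        thus ?thesis unfolding y using xp[of "j - e"] pw_antimono[of j "Suc (j - e)"] pw_closed(2) by auto
      qed
      hence "?y : car S" using yu by (simp add: S_carrier)
      moreover have "mon b e *[S] x = mon b 0 *[S] ?y" unfolding mon_0_times[OF bc yu] unfolding y using xu bc by (auto simp: mon_times)
      ultimately show ?thesis by blast
    qed
    moreover have "EX u:car S - P. u *[S] f = 0[S]" if f: "f : car S" "f *[S] mon b 0 = 0[S]" for f
    proof -
      have "mon b 0 *[S] f = 0[S]" using f mon_0_closed[OF bc] by (simp add: S.m_comm)
      hence z: "b ** f i = \<zero>" for i unfolding mon_0_times[OF bc S_up[OF f(1)]] S_ops by (rule fun_cong)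
      have "mon b e *[S] f = 0[S]" unfolding mon_times[OF bc S_up[OF f(1)]] S_ops by (rule ext) (simp add: z)
      thus ?thesis using b(3) bS by blast
    qed
    ultimately show ?thesis unfolding locally_principal_def using g bS b(3) by blast
  qed
qed

lemma canon_locally_principal_height:
  assumes a: "a : I" "nonzerodiv R {\<zero>} (car R) a" and m: "-1 <= m"
    and P: "primeideal P S" "height S P < ideal_height R I"
  shows "locally_principal S P (canon a m)"
proof -
  have "~ (ALL e<=1. ALL b:I. mon b e : P)" using height_ge_ideal_height[OF P(1)] P(2) by (meson leD le_numeral_extra(4) zero_le_one)
  thus ?thesis using canon_locally_principal[OF a m P(1)] by blast
qed

end

section \<open>Canonical modules under isomorphism\<close>

text \<open>Serves to carry the property of being canonical from the localization of an abstract
  module, whose elements are classes of pairs, to an ideal of the local ring.\<close>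

locale module_isomorphism = M: module R M + N: module R N for R (structure) and M and N +
  fixes F
  assumes bij: "bij_betw F (car M) (car N)"
    and F_add: "!!x y. [|x : car M; y : car M|] ==> F (x +[M] y) = F x +[N] F y"
    and F_smult: "!!a x. [|a : car R; x : car M|] ==> F (a *>[M] x) = a *>[N] F x"
begin

lemma F_closed: "x : car M ==> F x : car N"
  using bij by (auto simp: bij_betw_def)

lemma F_inj: "[|x : car M; y : car M; F x = F y|] ==> x = y"
  using bij by (auto simp: bij_betw_def inj_on_def)

lemma F_surj: "y : car N ==> EX x:car M. y = F x"
  using bij by (auto simp: bij_betw_def)

lemma F_zero: "F 0[M] = 0[N]"
  using F_smult[of \<zero> "0[M]"] F_closed[of "0[M]"] by simp

lemma F_zero_iff: "x : car M ==> F x = 0[N] <-> x = 0[M]"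
  using F_inj[of x "0[M]"] F_zero by auto

lemma inverse: "module_isomorphism R N M (inv_into (car M) F)"
proof -
  let ?G = "inv_into (car M) F"
  have G: "?G y : car M" "F (?G y) = y" if "y : car N" for y using that bij by (auto simp: bij_betw_def inv_into_into f_inv_into_f)
  show ?thesis
  proof (unfold_locales)
    show "bij_betw ?G (car N) (car M)" using bij by (rule bij_betw_inv_into)
    show "?G (x +[N] y) = ?G x +[M] ?G y" if "x : car N" "y : car N" for x y by (rule F_inj) (use G that in "auto simp: F_add")
    show "?G (a *>[N] x) = a *>[M] ?G x" if "a : car R" "x : car N" for a x by (rule F_inj) (use G that in "auto simp: F_smult")
  qed
qed

lemma submodule_vimage: assumes "submodule L R N" shows "submodule {x : car M. F x : L} R M"
  using N.submodule_iff[THEN iffD1, OF assms] by (intro M.submodule_criterion) (auto simp: F_zero F_add F_smult)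

lemma submodule_image: assumes "submodule L R M" shows "submodule (F ` L) R N"
proof -
  note L = M.submodule_iff[THEN iffD1, OF assms]
  have "x : car M" if "x : L" for x using L that by blast
  thus ?thesis using L by (intro N.submodule_criterion)
      (auto simp: F_closed F_zero[symmetric] F_add[symmetric] F_smult[symmetric])
qed

lemma F_image_mem: "[|L <= car M; x : car M|] ==> F x : F ` L <-> x : L"
  using F_inj by blast

lemma span_iff:
  assumes A: "A <= car M" and x: "x : car M"
  shows "F x : span_module R N (F ` A) <-> x : span_module R M A"
proof
  assume Fx: "F x : span_module R N (F ` A)"
  show "x : span_module R M A" unfolding span_module_def
  proof (rule InterI)
    fix L assume "L : {L. submodule L R M & A <= L}"
    hence L: "submodule L R M" "A <= L" by auto
    hence "F x : F ` L" using Fx submodule_image[OF L(1)] unfolding span_module_def by blast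
    thus "x : L" using F_image_mem[OF _ x] M.submodule_iff[THEN iffD1, OF L(1)] by blast
  qed
next
  assume xs: "x : span_module R M A"
  show "F x : span_module R N (F ` A)" unfolding span_module_def
  proof (rule InterI)
    fix L assume "L : {L. submodule L R N & F ` A <= L}"
    hence L: "submodule L R N" "F ` A <= L" by auto
    hence "A <= {x : car M. F x : L}" using A by blast
    hence "x : {x : car M. F x : L}" using xs submodule_vimage[OF L(1)] unfolding span_module_def by blast
    thus "F x : L" by simp
  qed
qed

lemma (in module) span_subset: "A <= car M ==> span_module R M A <= car M"
proof -
  have "submodule (car M) R M" by (rule submodule_criterion) auto
  thus "A <= car M ==> span_module R M A <= car M" unfolding span_module_def by blast
qed

lemma ideal_smult_iff:
  assumes J: "J <= car R" and x: "x : car M"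
  shows "F x : ideal_smult R J N <-> x : ideal_smult R J M"
proof -
  let ?A = "{a *>[M] x | a x. a : J & x : car M}"
  have "{a *>[N] y | a y. a : J & y : car N} = F ` ?A"
  proof
    show "{a *>[N] y | a y. a : J & y : car N} <= F ` ?A"
    proof
      fix z assume "z : {a *>[N] y | a y. a : J & y : car N}"
      then obtain a x where "a : J" "x : car M" "z = a *>[N] F x" using F_surj by blast
      thus "z : F ` ?A" using J F_smult[of a x] by (intro image_eqI[of _ _ "a *>[M] x"]) auto
    qed
    have "F (a *>[M] x) = a *>[N] F x" if "a : J" "x : car M" for a x using that J F_smult by blast
    thus "F ` ?A <= {a *>[N] y | a y. a : J & y : car N}" using F_closed by blast
  qed
  moreover have "?A <= car M" using J by auto
  ultimately show ?thesis unfolding ideal_smult_def using span_iff[OF _ x] by simp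
qed

lemma ideal_smult_carrier_iff:
  assumes J: "J <= car R"
  shows "ideal_smult R J N = car N <-> ideal_smult R J M = car M"
proof -
  have "ideal_smult R J M <= car M" "ideal_smult R J N <= car N" unfolding ideal_smult_def using J by (auto intro!: M.span_subset N.span_subset)
  hence "ideal_smult R J M = car M <-> (ALL x:car M. x : ideal_smult R J M)"
    "ideal_smult R J N = car N <-> (ALL x:car M. F x : ideal_smult R J N)" using F_surj F_closed by blast+
  thus ?thesis using ideal_smult_iff[OF J] by simp
qed

lemma regular_sequence_iff: "regular_sequence R N xs <-> regular_sequence R M xs"
proof (cases "set xs <= car R")
  case True
  have J: "Idl (set (take i xs)) <= car R" for i using True set_take_subset[of i xs] by (intro M.R.idealD(1)[OF M.R.genideal_ideal]) blast
  have all: "(ALL y:car N. Q y) <-> (ALL x:car M. Q (F x))" for Q using F_surj F_closed by blast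
  have "(ALL y:car N. xs ! i *>[N] y : ideal_smult R (Idl (set (take i xs))) N --> y : ideal_smult R (Idl (set (take i xs))) N)
    <-> (ALL y:car M. xs ! i *>[M] y : ideal_smult R (Idl (set (take i xs))) M --> y : ideal_smult R (Idl (set (take i xs))) M)"
    if "i < length xs" for i
  proof -
    have x: "xs ! i : car R" using True that by auto
    show ?thesis unfolding all using x by (simp add: F_smult[symmetric] ideal_smult_iff[OF J])
  qed
  moreover have "ideal_smult R (Idl (set xs)) N = car N <-> ideal_smult R (Idl (set xs)) M = car M"
    using ideal_smult_carrier_iff[OF J[of "length xs"]] by simp
  ultimately show ?thesis unfolding regular_sequence_def by auto
qed (simp add: regular_sequence_def)

lemma depth_eq: "depth R N = depth R M"
  by (simp add: depth_def regular_sequence_iff)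

lemma module_dim_eq: "module_dim R N = module_dim R M"
proof -
  have "annihilator R N = annihilator R M"
  proof -
    have all: "(ALL y:car N. Q y) <-> (ALL x:car M. Q (F x))" for Q using F_surj F_closed by blast
    show ?thesis unfolding annihilator_def all by (auto simp: F_smult[symmetric] F_zero_iff)
  qed
  thus ?thesis by (simp add: module_dim_def)
qed

lemma fin_gen_image: assumes "fin_gen R M" shows "fin_gen R N"
proof -
  obtain A where A: "finite A" "A <= car M" "span_module R M A = car M" using assms by (auto simp: fin_gen_def)
  have "F ` A <= car N" using A(2) F_closed by blast
  moreover have "car N <= span_module R N (F ` A)"
  proof
    fix y assume "y : car N"
    then obtain x where x: "x : car M" "y = F x" using F_surj by blast
    thus "y : span_module R N (F ` A)" using span_iff[OF A(2) x(1)] A(3) by simp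
  qed
  ultimately show ?thesis unfolding fin_gen_def using A(1) N.span_subset by (intro exI[of _ "F ` A"]) blast
qed

lemma hom_compose:
  assumes X: "module R X" and f: "f : module_hom R X M"
  shows "(\<lambda>x\<in>car X. F (f x)) : module_hom R X N"
proof -
  interpret X: module R X by fact
  note fD = module_homD[OF f]
  show ?thesis unfolding module_hom_def using fD F_closed by (auto simp: F_add F_smult)
qed

lemma hom_isomorphism:
  assumes X: "module R X"
  shows "module_isomorphism R (hom_module R X M) (hom_module R X N) (%f. \<lambda>x\<in>car X. F (f x))"
proof -
  interpret X: module R X by fact
  interpret G: module_isomorphism R N M "inv_into (car M) F" by (rule inverse)
  let ?G = "inv_into (car M) F"
  interpret HM: module R "hom_module R X M" by (rule hom_module_module[OF X M.module_axioms])
  interpret HN: module R "hom_module R X N" by (rule hom_module_module[OF X N.module_axioms])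
  have GF: "?G (F x) = x" if "x : car M" for x using bij that by (auto simp: bij_betw_def inv_into_f_f)
  have FG: "F (?G y) = y" if "y : car N" for y using bij that by (auto simp: bij_betw_def f_inv_into_f)
  have c: "car (hom_module R X M) = module_hom R X M" "car (hom_module R X N) = module_hom R X N" by (simp_all add: hom_module_def)
  have ext: "(\<lambda>x\<in>car X. f x) = f" if "f : module_hom R X Q" for f and Q :: "('a, 'z, 'zz) module_scheme"
    using that by (auto simp: module_hom_def PiE_def extensional_restrict)
  show ?thesis
  proof (unfold_locales)
    show "bij_betw (%f. \<lambda>x\<in>car X. F (f x)) (car (hom_module R X M)) (car (hom_module R X N))" unfolding c
    proof (rule bij_betw_byWitness[of _ "%f. \<lambda>x\<in>car X. ?G (f x)"])
      show "ALL f:module_hom R X M. (\<lambda>x\<in>car X. ?G ((\<lambda>x\<in>car X. F (f x)) x)) = f"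
      proof
        fix f assume f: "f : module_hom R X M"
        have "(\<lambda>x\<in>car X. ?G ((\<lambda>x\<in>car X. F (f x)) x)) = (\<lambda>x\<in>car X. f x)" by (rule restrict_ext) (simp add: GF module_homD(1)[OF f])
        thus "(\<lambda>x\<in>car X. ?G ((\<lambda>x\<in>car X. F (f x)) x)) = f" using ext[OF f] by simp
      qed
      show "ALL f:module_hom R X N. (\<lambda>x\<in>car X. F ((\<lambda>x\<in>car X. ?G (f x)) x)) = f"
      proof
        fix f assume f: "f : module_hom R X N"
        have "(\<lambda>x\<in>car X. F ((\<lambda>x\<in>car X. ?G (f x)) x)) = (\<lambda>x\<in>car X. f x)" by (rule restrict_ext) (simp add: FG module_homD(1)[OF f])
        thus "(\<lambda>x\<in>car X. F ((\<lambda>x\<in>car X. ?G (f x)) x)) = f" using ext[OF f] by simp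
      qed
    qed (use hom_compose[OF X] G.hom_compose[OF X] in blast)+
  qed (auto simp: hom_module_def module_homD F_add F_smult intro!: restrict_ext)
qed

end

section \<open>Resolutions by finitely generated free modules\<close>

lemma free_module_simps:
  "v : car (free_module R n) <-> v : extensional {..<n} & (ALL i<n. v i : car R)"
  "v +[free_module R n] w = (\<lambda>i\<in>{..<n}. v i +[R] w i)" "a *>[free_module R n] v = (\<lambda>i\<in>{..<n}. a *[R] v i)"
  "0[free_module R n] = (\<lambda>i\<in>{..<n}. 0[R])" by (auto simp: free_module_def PiE_def Pi_def)

lemma free_module_eqI:
  assumes "v : extensional {..<n}" "w : extensional {..<n}" "!!i. i < n ==> v i = w i"
  shows "v = w"
  by (rule extensionalityI[OF assms(1,2)]) (simp add: assms(3))

lemma free_module_module: assumes "cring R" shows "module R (free_module R n)"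
proof -
  interpret cring R by fact
  note eqI = free_module_eqI[of _ n]
  show ?thesis
  proof (rule moduleI)
    show "abelian_group (free_module R n)"
    proof (rule abelian_groupI)
      fix v assume v: "v : car (free_module R n)"
      have "(\<lambda>i\<in>{..<n}. -[R] v i) +[free_module R n] v = 0[free_module R n]" by (rule eqI) (use v in "auto simp: free_module_simps l_neg")
      moreover have "(\<lambda>i\<in>{..<n}. -[R] v i) : car (free_module R n)" using v by (simp add: free_module_simps)
      ultimately show "EX w:car (free_module R n). w +[free_module R n] v = 0[free_module R n]" by blast
    qed (auto simp: free_module_simps a_ac intro!: eqI)
  qed (use is_cring in "auto simp: free_module_simps l_distr r_distr m_assoc intro!: eqI")
qed

context noetherian_cring
begin

text \<open>Finite generation of \<open>K\<close>, in the form that directly yields the next map of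
  a resolution.\<close>

definition free_image :: "('a, 'x, 'y) module_scheme => 'x set => bool"
  where "free_image N K <-> (EX r. EX d:module_hom R (free_module R r) N. d ` car (free_module R r) = K)"

lemma free_image_zero: assumes "module R N" shows "free_image N {0[N]}"
proof -
  interpret N: module R N by fact
  interpret F: module R "free_module R 0" by (rule free_module_module) (rule is_cring)
  let ?d = "\<lambda>x\<in>car (free_module R 0). 0[N]"
  have "?d : module_hom R (free_module R 0) N" by (auto simp: module_hom_def)
  moreover have "?d ` car (free_module R 0) = {0[N]}" using F.zero_closed by auto
  ultimately show ?thesis unfolding free_image_def by blast
qed

lemma free_image_adjoin:
  assumes N: "module R N" and K: "free_image N K" and v: "v : car N"
  shows "free_image N {x +[N] a *>[N] v | x a. x : K & a : car R}"
proof -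
  interpret N: module R N by fact
  obtain r d where d: "d : module_hom R (free_module R r) N" "d ` car (free_module R r) = K" using K by (auto simp: free_image_def)
  interpret F: module R "free_module R r" by (rule free_module_module) (rule is_cring)
  interpret F': module R "free_module R (Suc r)" by (rule free_module_module) (rule is_cring)
  note dD = module_homD[OF d(1)]
  let ?d = "\<lambda>x\<in>car (free_module R (Suc r)). d (restrict x {..<r}) +[N] x r *>[N] v"
  have res: "restrict x {..<r} : car (free_module R r)" "x r : car R" if "x : car (free_module R (Suc r))" for x
    using that by (auto simp: free_module_simps)
  have "?d : module_hom R (free_module R (Suc r)) N" unfolding module_hom_def
  proof (intro CollectI conjI ballI)
    show "?d : car (free_module R (Suc r)) \<rightarrow>\<^sub>E car N" using res dD(1) v by auto
    fix x assume x: "x : car (free_module R (Suc r))"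
    { fix y assume y: "y : car (free_module R (Suc r))"
      have 1: "restrict (x +[free_module R (Suc r)] y) {..<r} = restrict x {..<r} +[free_module R r] restrict y {..<r}"
        by (rule free_module_eqI) (auto simp: free_module_simps)
      have 2: "(x +[free_module R (Suc r)] y) r = x r +. y r" by (simp add: free_module_simps)
      have "?d (x +[free_module R (Suc r)] y) = (d (restrict x {..<r}) +[N] d (restrict y {..<r})) +[N] (x r +. y r) *>[N] v"
        using F'.a_closed[OF x y] by (simp add: 1 2 dD(2) res[OF x] res[OF y])
      also have "... = ?d x +[N] ?d y"
        using x y dD(1)[OF res(1)[OF x]] dD(1)[OF res(1)[OF y]] res[OF x] res[OF y] v by (simp add: N.smult_l_distr N.a_ac)
      finally show "?d (x +[free_module R (Suc r)] y) = ?d x +[N] ?d y" . }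
    fix a assume a: "a : car R"
    have 1: "restrict (a *>[free_module R (Suc r)] x) {..<r} = a *>[free_module R r] restrict x {..<r}"
      by (rule free_module_eqI) (auto simp: free_module_simps)
    have 2: "(a *>[free_module R (Suc r)] x) r = a ** x r" by (simp add: free_module_simps)
    have "?d (a *>[free_module R (Suc r)] x) = a *>[N] d (restrict x {..<r}) +[N] (a ** x r) *>[N] v"
      using F'.smult_closed[OF a x] a by (simp add: 1 2 dD(3) res[OF x])
    also have "... = a *>[N] ?d x" using x a dD(1)[OF res(1)[OF x]] res[OF x] v by (simp add: N.smult_r_distr N.smult_assoc1)
    finally show "?d (a *>[free_module R (Suc r)] x) = a *>[N] ?d x" .
  qed
  moreover have "?d ` car (free_module R (Suc r)) = {x +[N] a *>[N] v | x a. x : K & a : car R}" (is "?L = ?R")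
  proof
    show "?L <= ?R" using res d(2) by auto
    show "?R <= ?L"
    proof
      fix y assume "y : ?R"
      then obtain z a where z: "z : car (free_module R r)" "a : car R" "y = d z +[N] a *>[N] v" using d(2) by blast
      define w where "w = (\<lambda>i\<in>{..<Suc r}. if i = r then a else z i)"
      have w: "w : car (free_module R (Suc r))" using z(1,2) by (auto simp: free_module_simps w_def)
      have 1: "restrict w {..<r} = z" by (rule free_module_eqI[of _ r]) (use z(1) in "auto simp: free_module_simps w_def")
      have 2: "w r = a" by (simp add: w_def)
      have "?d w = y" unfolding z(3) using w by (simp add: 1 2)
      thus "y : ?L" using w by (intro image_eqI[of _ _ w]) simp_all
    qed
  qed
  ultimately show ?thesis unfolding free_image_def by blast
qed

text \<open>Induction on the number of leading coordinates that may be nonzero on \<open>K\<close>.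
  The values of the last of these form an ideal. Among the ideals \<open>L\<close> of values for
  which the corresponding part of \<open>K\<close> is an image of a free module a maximal one must
  be everything, since a vector realizing one more value can be adjoined.\<close>

lemma submodule_free_image:
  assumes "submodule K R (free_module R n)"
  shows "free_image (free_module R n) K"
proof -
  interpret F: module R "free_module R n" by (rule free_module_module) (rule is_cring)
  have "free_image (free_module R n) K" if "k <= n" "submodule K R (free_module R n)" "ALL v:K. ALL i. k <= i & i < n --> v i = \<zero>" for k K using that
  proof (induction k arbitrary: K)
    case 0
    note K = F.submodule_iff[THEN iffD1, OF 0(2)]
    have "v = 0[free_module R n]" if "v : K" for v by (rule free_module_eqI[of _ n]) (use that K 0(3) in "auto simp: free_module_simps")
    hence "K = {0[free_module R n]}" using K by blast
    thus ?case using free_image_zero[OF F.module_axioms] by simp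
  next
    case (Suc k)
    note K = F.submodule_iff[THEN iffD1, OF Suc.prems(2)]
    have Kc: "v : extensional {..<n}" "i < n ==> v i : car R" if "v : K" for v i using K that by (auto simp: free_module_simps)
    have kn: "k < n" using Suc.prems(1) by simp
    have Ka: "(\<lambda>i\<in>{..<n}. v i +. w i) : K" "a : car R ==> (\<lambda>i\<in>{..<n}. a ** v i) : K" if "v : K" "w : K" for v w a
      using K that by (auto simp: free_module_simps)
    let ?C = "(%v. v k) ` K" let ?K = "%L. {v : K. v k : L}"
    have C: "ideal ?C R"
    proof (rule ideal_criterion)
      show "?C <= car R" using Kc(2)[OF _ kn] by blast
      have "0[free_module R n] : K" using K by blast
      thus "\<zero> : ?C" using kn by (intro image_eqI[of _ _ "0[free_module R n]"]) (simp_all add: free_module_simps)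
      show "x +. y : ?C" if "x : ?C" "y : ?C" for x y
      proof -
        obtain v w where "v : K" "w : K" "x = v k" "y = w k" using \<open>x : ?C\<close> \<open>y : ?C\<close> by blast
        thus ?thesis using Ka(1) kn by (intro image_eqI[of _ _ "\<lambda>i\<in>{..<n}. v i +. w i"]) auto
      qed
      show "a ** x : ?C" if "a : car R" "x : ?C" for a x
      proof -
        obtain v where "v : K" "x = v k" using \<open>x : ?C\<close> by blast
        thus ?thesis using Ka(2)[of v v a] \<open>a : car R\<close> kn by (intro image_eqI[of _ _ "\<lambda>i\<in>{..<n}. a ** v i"]) auto
      qed
    qed
    let ?S = "{L. ideal L R & L <= ?C & free_image (free_module R n) (?K L)}"
    have "submodule (?K {\<zero>}) R (free_module R n)"
    proof (rule F.submodule_criterion)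
      show "?K {\<zero>} <= car (free_module R n)" using K by blast
      have "0[free_module R n] : K" using K by blast
      thus "0[free_module R n] : ?K {\<zero>}" using kn by (simp add: free_module_simps(4))
      show "x +[free_module R n] y : ?K {\<zero>}" if xy: "x : ?K {\<zero>}" "y : ?K {\<zero>}" for x y
      proof -
        have "x +[free_module R n] y : K" using K xy by blast
        thus ?thesis using xy kn by (simp add: free_module_simps(2))
      qed
      show "a *>[free_module R n] x : ?K {\<zero>}" if ax: "a : car R" "x : ?K {\<zero>}" for a x
      proof -
        have "a *>[free_module R n] x : K" using K ax by blast
        thus ?thesis using ax kn by (simp add: free_module_simps(3))
      qed
    qed
    moreover have "ALL v:?K {\<zero>}. ALL i. k <= i & i < n --> v i = \<zero>"
    proof (intro ballI allI impI)
      fix v i assume v: "v : ?K {\<zero>}" and i: "k <= i & i < n"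
      show "v i = \<zero>"
      proof (cases "i = k")
        case False
        hence "Suc k <= i & i < n" using i by simp
        thus ?thesis using Suc.prems(3) v by blast
      qed (use v in simp)
    qed
    ultimately have "free_image (free_module R n) (?K {\<zero>})" by (rule Suc.IH[OF less_imp_le[OF kn]])
    hence "{\<zero>} : ?S" using zeroideal idealD(2)[OF C] by simp
    hence "?S ~= {}" by blast
    hence "EX L:?S. ALL J:?S. L <= J --> J = L" by (rule ideal_family_maximal) simp
    then obtain L where LS: "L : ?S" and mx: "ALL J:?S. L <= J --> J = L" ..
    have L: "ideal L R" "L <= ?C" "free_image (free_module R n) (?K L)" using LS by simp_all
    have "?C <= L"
    proof
      fix c assume c: "c : ?C"
      then obtain v where v: "v : K" "v k = c" by blast
      have vc: "v : car (free_module R n)" and cc: "c : car R" using v K idealD(3)[OF C c] by auto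
      let ?J = "adjoin R L c (car R)"
      have J: "ideal ?J R" "L <= ?J" using adjoin_ideal[OF L(1) oneideal cc] adjoin_superset[OF L(1) oneideal cc] by auto
      have JC: "?J <= ?C" by (rule adjoin_minimal[OF C L(2)]) (use idealD(8)[OF C _ c] in blast)
      have "{x +[free_module R n] a *>[free_module R n] v | x a. x : ?K L & a : car R} = ?K ?J" (is "?X = _")
      proof
        show "?X <= ?K ?J"
        proof
          fix y assume "y : ?X"
          then obtain x a where x: "x : K" "x k : L" "a : car R" "y = x +[free_module R n] a *>[free_module R n] v" by blast
          have "y : K" using K x(1,3) v(1) unfolding x(4) by blast
          moreover have "y k = x k +. c ** a" unfolding x(4) using kn v(2) x(3) cc by (simp add: free_module_simps m_comm)
          ultimately show "y : ?K ?J" using adjoinI[OF x(2,3)] by simp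
        qed
        show "?K ?J <= ?X"
        proof
          fix y assume "y : ?K ?J"
          hence y: "y : K" "y k : ?J" by auto
          obtain l a where l: "l : L" "a : car R" "y k = l +. c ** a" using y(2) by (rule adjoinE)
          have yc: "y : car (free_module R n)" using y K by blast
          let ?x = "y +[free_module R n] (\<ominus> a) *>[free_module R n] v"
          have lc: "l : car R" using idealD(3)[OF L(1) l(1)] .
          have "?x : K" using K y(1) v(1) l(2) by blast
          moreover have "?x k = l"
          proof -
            have "?x k = (l +. c ** a) +. (\<ominus> a) ** c" using kn v(2) l(3) by (simp add: free_module_simps)
            also have "... = l" using lc l(2) cc by algebra
            finally show ?thesis .
          qed
          moreover have "y = ?x +[free_module R n] a *>[free_module R n] v" using yc vc l(2) by (simp add: F.smult_l_minus F.a_assoc F.l_neg)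
          ultimately show "y : ?X" using l(1,2) by blast
        qed
      qed
      hence "free_image (free_module R n) (?K ?J)" using free_image_adjoin[OF F.module_axioms L(3) vc] by simp
      hence "?J = L" using mx J JC by simp
      moreover have "\<zero> +. c ** \<one> : ?J" by (rule adjoinI[OF idealD(2)[OF L(1)] one_closed])
      ultimately show "c : L" using cc by simp
    qed
    hence "?K L = K" by blast
    thus ?case using L(3) by simp
  qed
  from this[OF order_refl assms] show ?thesis by (rule meta_mp) auto
qed

lemma hom_kernel_submodule:
  assumes "module R M" "module R N" "h : module_hom R M N" shows "submodule (a_kernel M N h) R M"
proof -
  interpret M: module R M by fact
  interpret N: module R N by fact
  note hD = module_homD[OF assms(3)]
  have "h 0[M] = 0[N]" using hD(3)[of \<zero> "0[M]"] hD(1)[of "0[M]"] by simp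
  thus ?thesis by (intro M.submodule_criterion) (auto simp: a_kernel_def' hD)
qed

lemma free_resolution_exists:
  assumes N: "module R N" and eps: "eps : module_hom R (free_module R k) N" "eps ` car (free_module R k) = car N"
  shows "EX r d. free_resolution R N r eps d"
proof -
  note F = free_module_module[OF is_cring]
  have ex: "EX b d. d : module_hom R (free_module R b) (free_module R a) & d ` car (free_module R b) = K"
    if "submodule K R (free_module R a)" for a K using submodule_free_image[OF that] unfolding free_image_def by blast
  \<comment> \<open>Dependent choice over triples of two ranks and a map between the free modules of
    these ranks: \<open>?Q\<close> makes the next map cover the kernel of the present one, and
    \<open>?P\<close> ties the first map to \<open>eps\<close>.\<close>
  let ?P = "%(n::nat) (a, b, d). d : module_hom R (free_module R b) (free_module R a) &
      (n = 0 --> a = k & d ` car (free_module R b) = a_kernel (free_module R k) N eps)"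
  let ?Q = "%(n::nat) (a, b, d) (a', b', d'). a' = b &
      d' ` car (free_module R b') = a_kernel (free_module R b) (free_module R a) d"
  have "EX f. ALL n. ?P n (f n) & ?Q n (f n) (f (Suc n))"
  proof (rule dependent_nat_choice)
    show "EX x. ?P 0 x" using ex[OF hom_kernel_submodule[OF F N eps(1)]] by fastforce
    fix x n assume x: "?P n x"
    obtain a b d where abd: "x = (a, b, d)" by (cases x)
    hence "d : module_hom R (free_module R b) (free_module R a)" using x by simp
    from ex[OF hom_kernel_submodule[OF F F this]] obtain b' d' where "d' : module_hom R (free_module R b') (free_module R b)"
      "d' ` car (free_module R b') = a_kernel (free_module R b) (free_module R a) d" by blast
    thus "EX y. ?P (Suc n) y & ?Q n x y" unfolding abd by (intro exI[of _ "(b, b', d')"]) simp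
  qed
  then obtain f where PQ: "ALL n. ?P n (f n) & ?Q n (f n) (f (Suc n))" ..
  have f: "?P n (f n)" "?Q n (f n) (f (Suc n))" for n using PQ[THEN spec, of n] by (rule conjunct1, rule conjunct2)
  define r d where "r = (%i. fst (f i))" and "d = (%i. snd (snd (f i)))"
  have r: "fst (snd (f i)) = r (Suc i)" for i using f(2)[of i] by (simp add: r_def case_prod_beta)
  have P: "d i : module_hom R (free_module R (r (Suc i))) (free_module R (r i))" for i
    using f(1)[of i] r[of i] by (simp add: r_def d_def case_prod_beta)
  have r0: "r 0 = k" and d0: "d 0 ` car (free_module R (r 1)) = a_kernel (free_module R k) N eps"
    using f(1)[of 0] r[of 0] by (simp_all add: r_def d_def case_prod_beta)
  have Q: "d (Suc i) ` car (free_module R (r (Suc (Suc i)))) = a_kernel (free_module R (r (Suc i))) (free_module R (r i)) (d i)" for i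
    using f(2)[of i] r[of i] r[of "Suc i"] by (simp add: r_def d_def case_prod_beta)
  have "free_resolution R N r eps d" unfolding free_resolution_def Let_def r0 using eps P d0 Q r0 by simp
  thus ?thesis by blast
qed

end

text \<open>\<open>ext_module\<close> picks its resolution with \<open>SOME\<close>; existence
  guarantees that what it picks is a resolution.\<close>

lemma (in local_noetherian) residue_free_resolution: "EX r eps d. free_resolution R (residue_module R) r eps d"
proof -
  have k: "residue_module R = quot_module (self_module R) nn" by (simp add: residue_module_def max_ideal_eq)
  interpret S: module R "self_module R" by (rule self_module_module)
  have sub: "submodule nn R (self_module R)" using submodule_ideal_module[OF oneideal, of nn] n_ideal n_closed(1) by (simp add: ideal_module_carrier)
  note q = S.quot_module_simps[OF sub]
  have c: "car (self_module R) = car R" "x +[self_module R] y = x +. y" "a *>[self_module R] x = a ** x" for a x y by (simp_all add: self_module_def)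
  interpret Q: module R "quot_module (self_module R) nn" by (rule S.quot_module_module[OF sub])
  interpret F: module R "free_module R 1" by (rule free_module_module[OF is_cring])
  let ?e = "\<lambda>x\<in>car (free_module R 1). nn +>\<^bsub>self_module R\<^esub> x 0"
  have x0: "x 0 : car R" if "x : car (free_module R 1)" for x using that by (simp add: free_module_simps)
  have e1: "?e : module_hom R (free_module R 1) (quot_module (self_module R) nn)" unfolding module_hom_def
  proof (intro CollectI conjI ballI)
    show "?e : car (free_module R 1) \<rightarrow>\<^sub>E car (quot_module (self_module R) nn)" using x0 by (auto simp: q(1) c)
    fix x assume x: "x : car (free_module R 1)"
    show "?e (a *>[free_module R 1] x) = a *>[quot_module (self_module R) nn] ?e x" if "a : car R" for a
      using F.smult_closed[OF that x] x x0[OF x] that q(4)[of a "x 0"] by (simp add: c free_module_simps(3))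
    show "?e (x +[free_module R 1] y) = ?e x +[quot_module (self_module R) nn] ?e y" if y: "y : car (free_module R 1)" for y
      using F.a_closed[OF x y] x y x0[OF x] x0[OF y] q(3)[of "x 0" "y 0"] by (simp add: c free_module_simps(2))
  qed
  have e2: "?e ` car (free_module R 1) = car (quot_module (self_module R) nn)"
  proof
    show "?e ` car (free_module R 1) <= car (quot_module (self_module R) nn)" using x0 by (auto simp: q(1) c)
    show "car (quot_module (self_module R) nn) <= ?e ` car (free_module R 1)"
    proof
      fix X assume "X : car (quot_module (self_module R) nn)"
      then obtain a where a: "a : car R" "X = nn +>\<^bsub>self_module R\<^esub> a" by (auto simp: q(1) c)
      hence "(\<lambda>i\<in>{..<1}. a) : car (free_module R 1)" by (auto simp: free_module_simps)
      thus "X : ?e ` car (free_module R 1)" using a(2) by (intro image_eqI[of _ _ "\<lambda>i\<in>{..<1}. a"]) simp_all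
    qed
  qed
  show ?thesis unfolding k using free_resolution_exists[OF Q.module_axioms e1 e2] by blast
qed

lemma (in module) submodule_carrier_update:
  assumes Z: "submodule Z R M"
  shows "submodule L R (M(|carrier := Z|)) <-> submodule L R M & L <= Z"
  unfolding module.submodule_iff[OF submodule.submodule_is_module[OF Z module_axioms]] submodule_iff using submodule_iff[THEN iffD1, OF Z] by auto

context module_isomorphism
begin

text \<open>The length of Ext is the chain length of the submodules between coboundaries and
  cocycles, and composition with \<open>F\<close> maps these for \<open>M\<close> to those for
  \<open>N\<close>, strictly monotonically. \<open>dd\<close> ensures that coboundaries are
  cocycles.\<close>

lemma ext_length_le:
  assumes d: "!!i. d i : module_hom R (free_module R (r (Suc i))) (free_module R (r i))"
    and dd: "!!i x. x : car (free_module R (r (Suc (Suc i)))) ==> d i (d (Suc i) x) = 0[free_module R (r i)]"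
  shows "module_length R (quot_module ((hom_module R (free_module R (r i)) M)(|carrier := cocycles R r d M i|)) (coboundaries R r d M i))
    <= module_length R (quot_module ((hom_module R (free_module R (r i)) N)(|carrier := cocycles R r d N i|)) (coboundaries R r d N i))"
proof -
  note F = free_module_module[OF M.R.is_cring]
  let ?X = "free_module R (r i)" and ?Y = "free_module R (r (Suc i))"
  interpret X: module R ?X by (rule F)
  interpret Y: module R ?Y by (rule F)
  note dD = module_homD[OF d]
  have len: "module_length R (quot_module ((hom_module R ?X Q)(|carrier := cocycles R r d Q i|)) (coboundaries R r d Q i))
      = chain_length {L. submodule L R (hom_module R ?X Q) & L <= cocycles R r d Q i & coboundaries R r d Q i <= L}"
    and sub: "submodule (cocycles R r d Q i) R (hom_module R ?X Q)"
    if Q: "module R Q" for Q :: "('a, 'y, 'z) module_scheme"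
  proof -
    interpret Q: module R Q by (rule Q)
    interpret H: module R "hom_module R ?X Q" by (rule hom_module_module[OF F Q])
    have H: "car (hom_module R (free_module R k) Q) = module_hom R (free_module R k) Q"
      "f +[hom_module R (free_module R k) Q] g = (\<lambda>x\<in>car (free_module R k). f x +[Q] g x)" "a *>[hom_module R (free_module R k) Q] f = (\<lambda>x\<in>car (free_module R k). a *>[Q] f x)"
      "0[hom_module R (free_module R k) Q] = (\<lambda>x\<in>car (free_module R k). 0[Q])" for k f g a by (simp_all add: hom_module_def)
    show Z: "submodule (cocycles R r d Q i) R (hom_module R ?X Q)"
    proof (rule H.submodule_criterion)
      show "cocycles R r d Q i <= car (hom_module R ?X Q)" by (auto simp: cocycles_def H)
      show "0[hom_module R ?X Q] : cocycles R r d Q i" using H.zero_closed dD(1) by (simp add: cocycles_def H)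
      show "f +[hom_module R ?X Q] g : cocycles R r d Q i" if "f : cocycles R r d Q i" "g : cocycles R r d Q i" for f g
        using that H.a_closed[of f g] dD(1) by (simp add: cocycles_def H)
      show "a *>[hom_module R ?X Q] f : cocycles R r d Q i" if "a : car R" "f : cocycles R r d Q i" for a f
        using that H.smult_closed[of a f] dD(1) by (simp add: cocycles_def H)
    qed
    have B: "submodule (coboundaries R r d Q i) R (hom_module R ?X Q) & coboundaries R r d Q i <= cocycles R r d Q i"
    proof (cases i)
      case 0
      have "submodule {0[hom_module R ?X Q]} R (hom_module R ?X Q)" by (rule H.submodule_criterion) auto
      moreover have "0[hom_module R ?X Q] : cocycles R r d Q i" using H.submodule_iff[THEN iffD1, OF Z] by blast
      ultimately show ?thesis using 0 by simp
    next
      case (Suc j)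
      let ?W = "free_module R (r j)"
      interpret W: module R ?W by (rule F)
      interpret G: module R "hom_module R ?W Q" by (rule hom_module_module[OF F Q])
      let ?b = "%g. \<lambda>x\<in>car ?X. g (d j x)"
      have eq: "coboundaries R r d Q i = ?b ` module_hom R ?W Q" using Suc by simp
      note dj = module_homD[OF d[of j], folded Suc]
      have b: "?b g : module_hom R ?X Q" if g: "g : module_hom R ?W Q" for g by (rule restrict_module_hom) (simp_all add: dj module_homD[OF g])
      have "submodule (coboundaries R r d Q i) R (hom_module R ?X Q)" unfolding eq
      proof (rule H.submodule_criterion)
        show "?b ` module_hom R ?W Q <= car (hom_module R ?X Q)" unfolding H(1) by (rule image_subsetI) (rule b)
        have "?b 0[hom_module R ?W Q] = 0[hom_module R ?X Q]" unfolding H by (rule restrict_ext) (simp add: dj(1))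
        thus "0[hom_module R ?X Q] : ?b ` module_hom R ?W Q" by (rule image_eqI[OF sym G.zero_closed[unfolded H(1)]])
        show "f +[hom_module R ?X Q] g : ?b ` module_hom R ?W Q" if fg: "f : ?b ` module_hom R ?W Q" "g : ?b ` module_hom R ?W Q" for f g
        proof -
          obtain f' g' where f': "f' : module_hom R ?W Q" "g' : module_hom R ?W Q" "f = ?b f'" "g = ?b g'" using fg by blast
          have "f +[hom_module R ?X Q] g = ?b (f' +[hom_module R ?W Q] g')" unfolding H f'(3,4) by (rule restrict_ext) (simp add: dj(1))
          thus ?thesis by (rule image_eqI[OF _ G.a_closed[unfolded H(1), OF f'(1,2)]])
        qed
        show "a *>[hom_module R ?X Q] f : ?b ` module_hom R ?W Q" if af: "a : car R" "f : ?b ` module_hom R ?W Q" for a f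
        proof -
          obtain f' where f': "f' : module_hom R ?W Q" "f = ?b f'" using af by blast
          have "a *>[hom_module R ?X Q] f = ?b (a *>[hom_module R ?W Q] f')" unfolding H f'(2) by (rule restrict_ext) (simp add: dj(1))
          thus ?thesis by (rule image_eqI[OF _ G.smult_closed[unfolded H(1), OF af(1) f'(1)]])
        qed
      qed
      moreover have bZ: "?b g : cocycles R r d Q i" if g: "g : module_hom R ?W Q" for g
      proof -
        have "g 0[?W] = 0[Q]" using module_homD(3)[OF g M.R.zero_closed W.zero_closed] module_homD(1)[OF g W.zero_closed] by simp
        hence "?b g (d i x) = 0[Q]" if "x : car ?Y" for x using dD(1)[OF that] dd[of x j] that Suc by simp
        thus ?thesis unfolding cocycles_def using b[OF g] by blast
      qed
      moreover have "coboundaries R r d Q i <= cocycles R r d Q i" unfolding eq by (rule image_subsetI) (rule bZ)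
      ultimately show ?thesis by blast
    qed
    have Zm: "module R ((hom_module R ?X Q)(|carrier := cocycles R r d Q i|))" by (rule submodule.submodule_is_module[OF Z H.module_axioms])
    show "module_length R (quot_module ((hom_module R ?X Q)(|carrier := cocycles R r d Q i|)) (coboundaries R r d Q i))
      = chain_length {L. submodule L R (hom_module R ?X Q) & L <= cocycles R r d Q i & coboundaries R r d Q i <= L}"
      using module.module_length_quot[OF Zm] B unfolding H.submodule_carrier_update[OF Z] by (simp add: conj_assoc)
  qed
  interpret H: module_isomorphism R "hom_module R ?X M" "hom_module R ?X N" "%f. \<lambda>x\<in>car ?X. F (f x)" by (rule hom_isomorphism[OF F])
  let ?h = "%f. \<lambda>x\<in>car ?X. F (f x)"
  have Hc: "car (hom_module R X Q) = module_hom R X Q" for X :: "('a, 'u, 'v) module_scheme" and Q :: "('a, 'y, 'z) module_scheme" by (simp add: hom_module_def)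
  have hZ: "?h f : cocycles R r d N i" if f: "f : cocycles R r d M i" for f using f hom_compose[OF F] dD(1) F_zero by (simp add: cocycles_def)
  have hB: "g : ?h ` coboundaries R r d M i" if g: "g : coboundaries R r d N i" for g
  proof (cases i)
    case 0
    have "?h 0[hom_module R ?X M] = 0[hom_module R ?X N]" by (rule H.F_zero)
    thus ?thesis using g 0 by simp
  next
    case (Suc j)
    let ?W = "free_module R (r j)"
    interpret J: module_isomorphism R "hom_module R ?W M" "hom_module R ?W N" "%f. \<lambda>x\<in>car ?W. F (f x)" by (rule hom_isomorphism[OF F])
    obtain g' where g': "g' : module_hom R ?W N" "g = (\<lambda>x\<in>car ?X. g' (d j x))" using g Suc by auto
    obtain f' where f': "f' : module_hom R ?W M" "g' = (\<lambda>x\<in>car ?W. F (f' x))" using J.F_surj[of g'] g'(1) by (auto simp: Hc)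
    have "g = ?h (\<lambda>x\<in>car ?X. f' (d j x))" unfolding g'(2) f'(2) by (rule restrict_ext) (use dD(1)[of _ j] Suc in simp)
    moreover have "coboundaries R r d M i = (%g. \<lambda>x\<in>car ?X. g (d j x)) ` module_hom R ?W M" using Suc by simp
    hence "(\<lambda>x\<in>car ?X. f' (d j x)) : coboundaries R r d M i" using f'(1) by blast
    ultimately show ?thesis by (rule image_eqI)
  qed
  show ?thesis unfolding len[OF M.module_axioms] len[OF N.module_axioms]
  proof (rule chain_length_mono[of _ "%L. ?h ` L"])
    fix L assume "L : {L. submodule L R (hom_module R ?X M) & L <= cocycles R r d M i & coboundaries R r d M i <= L}"
    hence L: "submodule L R (hom_module R ?X M)" "L <= cocycles R r d M i" "coboundaries R r d M i <= L" by auto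
    thus "?h ` L : {L. submodule L R (hom_module R ?X N) & L <= cocycles R r d N i & coboundaries R r d N i <= L}"
      using H.submodule_image[OF L(1)] hZ hB by blast
  next
    fix L L' assume L: "L : {L. submodule L R (hom_module R ?X M) & L <= cocycles R r d M i & coboundaries R r d M i <= L}"
      "L' : {L. submodule L R (hom_module R ?X M) & L <= cocycles R r d M i & coboundaries R r d M i <= L}" "L < L'"
    have c: "L <= car (hom_module R ?X M)" "L' <= car (hom_module R ?X M)" using L(1,2) H.M.submodule_iff by auto
    obtain f where f: "f : L'" "f ~: L" using L(3) by blast
    hence "?h f ~: ?h ` L" using H.F_image_mem[OF c(1), of f] c(2) by blast
    thus "?h ` L < ?h ` L'" using f L(3) by blast
  qed
qed

text \<open>The resolution picked by \<open>SOME\<close> depends on the residue module alone, so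
  both types are computed from the same maps, and \<open>ext_length_le\<close> applies to
  \<open>F\<close> and to its inverse.\<close>

lemma cm_type_eq:
  assumes "local_noetherian R nn" shows "cm_type R N = cm_type R M"
proof -
  interpret R: local_noetherian R nn by fact
  obtain r d where rd: "(SOME (r, d). \<exists>eps. free_resolution R (residue_module R) r eps d) = (r, d)" by force
  have "EX x. case x of (r, d) => \<exists>eps. free_resolution R (residue_module R) r eps d" using R.residue_free_resolution by auto
  from someI_ex[OF this] obtain eps where res: "free_resolution R (residue_module R) r eps d" unfolding rd by auto
  have d: "d i : module_hom R (free_module R (r (Suc i))) (free_module R (r i))"
    and ex: "d (Suc i) ` car (free_module R (r (Suc (Suc i)))) = a_kernel (free_module R (r (Suc i))) (free_module R (r i)) (d i)" for i
    using res unfolding free_resolution_def Let_def by auto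
  have dd: "d i (d (Suc i) x) = 0[free_module R (r i)]" if "x : car (free_module R (r (Suc (Suc i))))" for i x
    using ex[of i] that by (auto simp: a_kernel_def')
  interpret G: module_isomorphism R N M "inv_into (car M) F" by (rule inverse)
  show ?thesis
    unfolding cm_type_def ext_module_def rd prod.case Let_def depth_eq using ext_length_le[where r=r and d=d, OF d dd] G.ext_length_le[where r=r and d=d, OF d dd] by (intro antisym) simp_all
qed

lemma inj_dim_image:
  assumes "noetherian_ring R" "inj_dim R M < \<infinity>" shows "inj_dim R N < \<infinity>"
proof -
  \<comment> \<open>An isomorphism of \<open>R\<close>-modules is a localization at the
    multiplicative set of the unit element.\<close>
  interpret ring_localization R "{\<one>}" R "%x. x" by unfold_locales (auto intro!: ring_hom_memI)
  show ?thesis by (rule inj_dim_localization[OF assms(2,1,1) M.module_axioms N.module_axioms, of F])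
      (use F_surj in "auto simp: F_closed F_add F_smult F_zero_iff")
qed

lemma canonical_module_local_image:
  assumes "canonical_module_local R M" shows "canonical_module_local R N"
proof -
  have cm: "cohen_macaulay_local_ring R" and M: "maximal_cohen_macaulay_module R M" "cm_type R M = 1" "inj_dim R M < \<infinity>"
    using assms unfolding canonical_module_local_def by blast+
  have nl: "noetherian_local_ring R" using cm unfolding cohen_macaulay_local_ring_def by blast
  have m: "fin_gen R M" "car M ~= {0[M]}" "depth R M = module_dim R M" "module_dim R M = krull_dim R"
    using M(1) unfolding maximal_cohen_macaulay_module_def by blast+
  have "car N ~= {0[N]}"
  proof
    assume "car N = {0[N]}"
    hence "x = 0[M]" if "x : car M" for x using F_closed[OF that] F_zero_iff[OF that] by simp
    thus False using m(2) M.zero_closed by blast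
  qed
  hence "maximal_cohen_macaulay_module R N"
    unfolding maximal_cohen_macaulay_module_def depth_eq module_dim_eq using m fin_gen_image[OF m(1)] N.module_axioms by simp
  moreover have "cm_type R N = 1" using cm_type_eq[OF noetherian_local_ring_imp[OF nl]] M(2) by simp
  moreover have "inj_dim R N < \<infinity>" using inj_dim_image M(3) nl unfolding noetherian_local_ring_def by blast
  ultimately show ?thesis using cm unfolding canonical_module_local_def by blast
qed

end

section \<open>The canonical module at a prime, and localization in two steps\<close>

lemma (in cring) loc_module_isomorphism:
  assumes P: "primeideal P R" and J: "ideal J R" and om: "module R \<omega>" "module (loc_at R P) (loc_module_at R P \<omega>)"
    and H: "bij_betw H (carrier \<omega>) J" "!!x y. [|x : carrier \<omega>; y : carrier \<omega>|] ==> H (x +[\<omega>] y) = H x +. H y"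
    "!!f x. [|f : car R; x : carrier \<omega>|] ==> H (f *>[\<omega>] x) = f ** H x"
  obtains F where "module_isomorphism (loc_at R P) (loc_module_at R P \<omega>) (ideal_module (loc_at R P) (loc_ideal_at R P J)) F"
proof -
  let ?T = "car R - P"
  interpret multiplicative_set R ?T by (rule prime_complement_multiplicative[OF P])
  interpret W: fractions R \<omega> ?T by (intro fractions.intro fractions_axioms.intro om(1) T_sub T_one T_mult)
  interpret L: ring_localization R ?T "loc_at R P" "%a. frac a \<one>" by (rule loc_at_localization[OF P])
  have C: "ideal (loc_ideal_at R P J) (loc_at R P)" unfolding loc_ideal_at_eq[OF P idealD(1)[OF J]] by (rule L.extend_ideal[OF J])
  interpret LM: module "loc_at R P" "loc_module_at R P \<omega>" by (rule om(2))
  interpret LJ: module "loc_at R P" "ideal_module (loc_at R P) (loc_ideal_at R P J)" by (rule L.B.ideal_module_module[OF C])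
  have Hc: "H x : J" "H x : car R" if "x : carrier \<omega>" for x using H(1) that idealD(3)[OF J] by (auto simp: bij_betw_def)
  have Hi: "x = y" if "x : carrier \<omega>" "y : carrier \<omega>" "H x = H y" for x y using H(1) that by (auto simp: bij_betw_def inj_on_def)
  have Heq: "H (u *>[\<omega>] (t *>[\<omega>] x)) = u ** (t ** H x)" if "u : ?T" "t : ?T" "x : carrier \<omega>" for u t x
    using that H(3)[of u "t *>[\<omega>] x"] H(3)[of t x] by simp
  let ?fr = "fraction ?T \<omega>"
  define F where "F = (%X. \<Union>(x, s)\<in>X. frac (H x) s)"
  \<comment> \<open>Well-definedness and injectivity of \<open>F\<close> at once: \<open>H\<close>
    is injective and respects scalars, so two fractions agree on one side exactly when they agree on
    the other.\<close>
  have iff: "frac (H x) s = frac (H y) t <-> ?fr x s = ?fr y t" if x: "x : carrier \<omega>" "s : ?T" and y: "y : carrier \<omega>" "t : ?T" for x s y t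
  proof -
    have "u *>[\<omega>] (t *>[\<omega>] x) = u *>[\<omega>] (s *>[\<omega>] y) <-> u ** (t ** H x) = u ** (s ** H y)" if u: "u : ?T" for u
    proof -
      have "u *>[\<omega>] (t *>[\<omega>] x) : carrier \<omega>" "u *>[\<omega>] (s *>[\<omega>] y) : carrier \<omega>" using u x y by auto
      thus ?thesis using Hi Heq[OF u y(2) x(1)] Heq[OF u x(2) y(1)] by metis
    qed
    thus ?thesis unfolding frac_eq[OF Hc(2)[OF x(1)] Hc(2)[OF y(1)] x(2) y(2)] W.fraction_eq[OF x(1) y(1) x(2) y(2)] by blast
  qed
  have F: "F (?fr x s) = frac (H x) s" if x: "x : carrier \<omega>" "s : ?T" for x s unfolding F_def
  proof (rule UN_const[OF W.fraction_self[OF x]])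
    fix z assume z: "z : ?fr x s"
    obtain y t where yt: "z = (y, t)" by (cases z)
    note m = W.fraction_memD[OF z[unfolded yt] x]
    thus "(case z of (y, t) => frac (H y) t) = frac (H x) s" using iff[OF m(1,2) x] yt by simp
  qed
  have car: "car (loc_module_at R P \<omega>) = {?fr x s | x s. x : carrier \<omega> & s : ?T}" unfolding loc_module_at_def by (rule W.loc_module_carrier)
  have "module_isomorphism (loc_at R P) (loc_module_at R P \<omega>) (ideal_module (loc_at R P) (loc_ideal_at R P J)) F"
  proof unfold_locales
    show "bij_betw F (car (loc_module_at R P \<omega>)) (car (ideal_module (loc_at R P) (loc_ideal_at R P J)))" unfolding bij_betw_def
    proof
      show "inj_on F (car (loc_module_at R P \<omega>))"
      proof (rule inj_onI)
        fix X Y assume XY: "X : car (loc_module_at R P \<omega>)" "Y : car (loc_module_at R P \<omega>)" "F X = F Y"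
        obtain x s y t where "x : carrier \<omega>" "s : ?T" "X = ?fr x s" "y : carrier \<omega>" "t : ?T" "Y = ?fr y t" using XY(1,2) unfolding car by blast
        thus "X = Y" using XY(3) F iff by simp
      qed
      show "F ` car (loc_module_at R P \<omega>) = car (ideal_module (loc_at R P) (loc_ideal_at R P J))" unfolding ideal_module_simps
      proof
        show "F ` car (loc_module_at R P \<omega>) <= loc_ideal_at R P J" unfolding car loc_ideal_at_def using F Hc(1) by blast
        show "loc_ideal_at R P J <= F ` car (loc_module_at R P \<omega>)"
        proof
          fix X assume "X : loc_ideal_at R P J"
          then obtain a s where a: "a : J" "s : ?T" "X = frac a s" unfolding loc_ideal_at_def by blast
          obtain x where x: "x : carrier \<omega>" "a = H x" using a(1) H(1) by (auto simp: bij_betw_def)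
          have "X = F (?fr x s)" using F[OF x(1) a(2)] a(3) x(2) by simp
          thus "X : F ` car (loc_module_at R P \<omega>)" unfolding car using x(1) a(2) by blast
        qed
      qed
    qed
    fix X assume "X : car (loc_module_at R P \<omega>)"
    then obtain x s where x: "x : carrier \<omega>" "s : ?T" "X = ?fr x s" unfolding car by blast
    have sc: "s : car R" using x by simp
    { fix Y assume "Y : car (loc_module_at R P \<omega>)"
      then obtain y t where y: "y : carrier \<omega>" "t : ?T" "Y = ?fr y t" unfolding car by blast
      have tc: "t : car R" using y by simp
      have "F (X +[loc_module_at R P \<omega>] Y) = F (?fr (t *>[\<omega>] x +[\<omega>] s *>[\<omega>] y) (s ** t))"
        unfolding x(3) y(3) loc_module_at_def using W.loc_module_add[OF x(1,2) y(1,2)] by simp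
      also have "... = frac (t ** H x +. s ** H y) (s ** t)"
        using F[of "t *>[\<omega>] x +[\<omega>] s *>[\<omega>] y" "s ** t"] T_mult[OF x(2) y(2)] x(1) y(1) sc tc by (simp add: H)
      also have "... = F X +[loc_at R P] F Y"
        unfolding x(3) y(3) F[OF x(1,2)] F[OF y(1,2)] loc_at_def using loc_ring_add[OF Hc(2)[OF x(1)] x(2) Hc(2)[OF y(1)] y(2)] by simp
      finally show "F (X +[loc_module_at R P \<omega>] Y) = F X +[ideal_module (loc_at R P) (loc_ideal_at R P J)] F Y" by (simp add: ideal_module_simps) }
    fix A assume "A : car (loc_at R P)"
    then obtain a t where a: "a : car R" "t : ?T" "A = frac a t" unfolding loc_at_def loc_ring_carrier by blast
    have "F (A *>[loc_module_at R P \<omega>] X) = F (?fr (a *>[\<omega>] x) (t ** s))"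
      unfolding x(3) a(3) loc_module_at_def using W.loc_module_smult[OF a(1,2) x(1,2)] by simp
    also have "... = frac (a ** H x) (t ** s)" using F[of "a *>[\<omega>] x" "t ** s"] T_mult[OF a(2) x(2)] x(1) a(1) by (simp add: H)
    also have "... = A *[loc_at R P] F X" unfolding x(3) a(3) F[OF x(1,2)] loc_at_def using loc_ring_mult[OF a(1,2) Hc(2)[OF x(1)] x(2)] by simp
    finally show "F (A *>[loc_module_at R P \<omega>] X) = A *>[ideal_module (loc_at R P) (loc_ideal_at R P J)] F X" by (simp add: ideal_module_simps)
  qed
  thus ?thesis by (rule that)
qed

context ring_localization
begin

lemma locally_principal_extend:
  assumes P: "primeideal P A" "P Int T = {}" and J: "ideal J A" and lp: "locally_principal A P J"
  shows "locally_principal B (extend P) (extend J)"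
proof -
  note cJ = A.idealD[OF J] and con = contract_extend_prime[OF P]
  have notin: "phi u : car B - extend P" if "u : car A - P" for u using that con phi_in[of u] unfolding contract_def by blast
  obtain g s where g: "g : J" "s : car A - P" "!!x. x : J ==> EX y:car A. s *[A] x = g *[A] y"
    "!!f. [|f : car A; f *[A] g = 0[A]|] ==> EX u:car A - P. u *[A] f = 0[A]" using lp unfolding locally_principal_def by blast
  have gc: "g : car A" "s : car A" using g cJ by auto
  note pg = phi_in[OF gc(1)] phi_in[OF gc(2)]
  have "EX y:car B. phi s *[B] x = phi g *[B] y" if x: "x : extend J" for x
  proof -
    obtain a t where a: "x : car B" "a : J" "t : T" "phi t *[B] x = phi a" using x unfolding extend_def by blast
    obtain y where y: "y : car A" "s *[A] a = g *[A] y" using g(3)[OF a(2)] by blast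
    have c: "t : car A" "a : car A" using a T_carrier cJ(3) by auto
    note pc = phi_in[OF c(1)] phi_in[OF y(1)]
    have u: "phi t : Units B" using phi_unit a(3) .
    hence ui: "inv\<^bsub>B\<^esub> phi t : car B" by simp
    have "phi t *[B] (phi s *[B] x) = phi s *[B] phi a" using a(1,4) pg pc B.m_lcomm[of "phi t" "phi s" x] by simp
    also have "... = phi g *[B] phi y" using phi_mult[OF gc(2) c(2)] phi_mult[OF gc(1) y(1)] y(2) by simp
    also have "... = phi t *[B] (phi g *[B] (inv\<^bsub>B\<^esub> phi t *[B] phi y))"
    proof -
      have "phi t *[B] (phi g *[B] (inv\<^bsub>B\<^esub> phi t *[B] phi y)) = (phi t *[B] inv\<^bsub>B\<^esub> phi t) *[B] (phi g *[B] phi y)"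
        using pg pc ui by (simp add: B.m_ac)
      thus ?thesis using u pg pc by simp
    qed
    finally have "phi s *[B] x = phi g *[B] (inv\<^bsub>B\<^esub> phi t *[B] phi y)" using phi_cancel[OF a(3)] a(1) pg pc ui by simp
    thus ?thesis using ui pc by blast
  qed
  moreover have "EX u:car B - extend P. u *[B] b = 0[B]" if b: "b : car B" "b *[B] phi g = 0[B]" for b
  proof -
    obtain a t where a: "a : car A" "t : T" "phi t *[B] b = phi a" using phi_surj[OF b(1)] by blast
    have tc: "t : car A" using a T_carrier by blast
    note pc = phi_in[OF tc] phi_in[OF a(1)]
    have "phi (a *[A] g) = phi t *[B] (b *[B] phi g)" using b(1) a(1) gc pg pc by (simp add: phi_mult a(3)[symmetric] B.m_assoc)
    hence "phi (a *[A] g) = 0[B]" using b(2) pc by simp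
    then obtain v where v: "v : T" "v *[A] (a *[A] g) = 0[A]" using phi_ker[of "a *[A] g"] a(1) gc by auto
    have vc: "v : car A" using v T_carrier by blast
    have "(v *[A] a) *[A] g = 0[A]" using v(2) vc a(1) gc by (simp add: A.m_assoc)
    then obtain u where u: "u : car A - P" "u *[A] (v *[A] a) = 0[A]" using g(4)[of "v *[A] a"] vc a(1) by auto
    have uc: "u : car A" using u by blast
    note pu = phi_in[OF uc] phi_in[OF vc]
    have "phi (v *[A] t) *[B] (phi u *[B] b) = phi u *[B] (phi v *[B] (phi t *[B] b))" using b(1) vc tc pc pu by (simp add: phi_mult B.m_ac)
    also have "... = phi (u *[A] (v *[A] a))" using a uc vc by (simp add: phi_mult)
    also have "... = phi (v *[A] t) *[B] 0[B]" using u(2) phi_zero phi_in[of "v *[A] t"] vc tc by simp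
    finally have "phi u *[B] b = 0[B]" using phi_cancel[OF T_mult[OF v(1) a(2)], of "phi u *[B] b" "0[B]"] b(1) pu by simp
    thus ?thesis using notin[OF u(1)] by blast
  qed
  ultimately show ?thesis unfolding locally_principal_def using phi_extend[OF J g(1)] notin[OF g(2)] by blast
qed

text \<open>Any model \<open>C\<close> of the localization of \<open>A\<close> at \<open>P\<close>
  is also one of \<open>B\<close> at the extension of \<open>P\<close>; \<open>psi\<close> sends the
  fraction of \<open>a\<close> by \<open>s\<close> to \<open>chi a\<close> divided by
  \<open>chi s\<close>. This is how the local ring of \<open>S\<close> at \<open>P\<close> is
  reached from the one at a maximal ideal above \<open>P\<close>.\<close>

lemma localization_tower:
  assumes P: "primeideal P A" "P Int T = {}" and C: "ring_localization A (car A - P) C chi"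
  obtains psi where "ring_localization B (car B - extend P) C psi"
proof -
  interpret C: ring_localization A "car A - P" C chi by fact
  have TP: "s : car A - P" if "s : T" for s using that P(2) T_carrier by blast
  have "EX c:car C. EX a:car A. EX s:T. phi s *[B] b = phi a & chi s *[C] c = chi a" if b: "b : car B" for b
  proof -
    obtain a s where a: "a : car A" "s : T" "phi s *[B] b = phi a" using phi_surj[OF b] by blast
    have u: "chi s : Units C" using C.phi_unit[OF TP[OF a(2)]] .
    have "chi s *[C] (inv\<^bsub>C\<^esub> chi s *[C] chi a) = chi a"
      using u C.B.Units_closed[OF u] C.phi_in[OF a(1)] C.B.m_assoc[of "chi s" "inv\<^bsub>C\<^esub> chi s" "chi a", symmetric] by simp
    moreover have "inv\<^bsub>C\<^esub> chi s *[C] chi a : car C" using u C.phi_in[OF a(1)] by simp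
    ultimately show ?thesis using a by blast
  qed
  then obtain psi where psi: "!!b. b : car B ==> psi b : car C"
    "!!b. b : car B ==> EX a:car A. EX s:T. phi s *[B] b = phi a & chi s *[C] psi b = chi a" by metis
  \<comment> \<open>\<open>psi b\<close> was chosen by means of one way of writing \<open>b\<close>
    as a fraction; it satisfies the defining equation for every other one, and the homomorphism laws
    follow from this.\<close>
  have key: "chi s *[C] psi b = chi a" if b: "b : car B" and a: "a : car A" "s : T" "phi s *[B] b = phi a" for b a s
  proof -
    obtain a0 s0 where 0: "a0 : car A" "s0 : T" "phi s0 *[B] b = phi a0" "chi s0 *[C] psi b = chi a0" using psi(2)[OF b] by blast
    have c: "s : car A" "s0 : car A" using a 0 T_carrier by auto
    note p = phi_in[OF c(1)] phi_in[OF c(2)] and q = C.phi_in[OF c(1)] C.phi_in[OF c(2)]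
    have "phi (s *[A] a0) = phi (s0 *[A] a)"
      using c a(1) 0(1) b p B.m_lcomm[of "phi s" "phi s0" b] by (simp add: phi_mult a(3)[symmetric] 0(3)[symmetric])
    then obtain t where t: "t : T" "t *[A] (s *[A] a0) = t *[A] (s0 *[A] a)" using phi_eq[of "s *[A] a0" "s0 *[A] a"] c a(1) 0(1) by auto
    have tc: "t : car A" using t T_carrier by blast
    have "chi t *[C] chi (s *[A] a0) = chi t *[C] chi (s0 *[A] a)" using C.phi_mult[OF tc, of "s *[A] a0"] C.phi_mult[OF tc, of "s0 *[A] a"] t(2) c a(1) 0(1) by simp
    hence "chi (s *[A] a0) = chi (s0 *[A] a)" using C.phi_cancel[OF TP[OF t(1)]] C.phi_in c a(1) 0(1) by simp
    hence "chi s0 *[C] (chi s *[C] psi b) = chi s0 *[C] chi a"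
      using c a(1) 0(1) q psi(1)[OF b] C.B.m_lcomm[of "chi s0" "chi s" "psi b"] by (simp add: C.phi_mult 0(4))
    thus ?thesis using C.phi_cancel[OF TP[OF 0(2)]] q psi(1)[OF b] C.phi_in[OF a(1)] by simp
  qed
  have psi_phi: "psi (phi x) = chi x" if x: "x : car A" for x
  proof -
    have "phi 1[A] *[B] phi x = phi x" using x phi_in[OF x] by (simp add: phi_one)
    hence "chi 1[A] *[C] psi (phi x) = chi x" using key[OF phi_in[OF x] x T_one] by simp
    thus ?thesis using psi(1)[OF phi_in[OF x]] by (simp add: C.phi_one)
  qed
  have con: "contract (extend P) = P" by (rule contract_extend_prime[OF P])
  have notin: "phi u : car B - extend P" if "u : car A - P" for u using that con phi_in[of u] unfolding contract_def by blast
  note eP = B.primeD[OF extend_prime[OF P]]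
  have "ring_localization B (car B - extend P) C psi"
  proof (intro ring_localization.intro)
    show "cring B" "cring C" by (rule B_cring, rule C.B_cring)
    show "psi : ring_hom B C"
    proof (rule ring_hom_memI)
      show "psi 1[B] = 1[C]" using psi_phi[of "1[A]"] by (simp add: phi_one C.phi_one)
      show "psi b : car C" if "b : car B" for b using psi(1)[OF that] .
      fix b b' assume b: "b : car B" "b' : car B"
      obtain a s where a: "a : car A" "s : T" "phi s *[B] b = phi a" using phi_surj[OF b(1)] by blast
      obtain a' s' where a': "a' : car A" "s' : T" "phi s' *[B] b' = phi a'" using phi_surj[OF b(2)] by blast
      have c: "s : car A" "s' : car A" using a a' T_carrier by auto
      note p = phi_in[OF c(1)] phi_in[OF c(2)] and q = C.phi_in[OF c(1)] C.phi_in[OF c(2)]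
        and k = key[OF b(1) a] key[OF b(2) a'] and pb = psi(1)[OF b(1)] psi(1)[OF b(2)]
      have ss: "s *[A] s' : T" using T_mult a(2) a'(2) by blast
      have "phi (s *[A] s') *[B] (b *[B] b') = (phi s *[B] b) *[B] (phi s' *[B] b')" using b c p by (simp add: phi_mult B.m_ac)
      hence "chi (s *[A] s') *[C] psi (b *[B] b') = chi (a *[A] a')"
        using key[of "b *[B] b'" "a *[A] a'" "s *[A] s'"] b a a' ss by (simp add: phi_mult)
      also have "... = (chi s *[C] psi b) *[C] (chi s' *[C] psi b')" using a(1) a'(1) by (simp add: C.phi_mult k)
      also have "... = chi (s *[A] s') *[C] (psi b *[C] psi b')" using c q pb by (simp add: C.phi_mult C.B.m_ac)
      finally show "psi (b *[B] b') = psi b *[C] psi b'" using C.phi_cancel[OF TP[OF ss]] psi(1) b by simp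
      have "phi (s *[A] s') *[B] (b +[B] b') = phi s' *[B] (phi s *[B] b) +[B] phi s *[B] (phi s' *[B] b')" using b c p by (simp add: phi_mult B.r_distr B.m_ac)
      also have "... = phi (s' *[A] a +[A] s *[A] a')" using a a' c by (simp add: phi_add phi_mult)
      finally have "chi (s *[A] s') *[C] psi (b +[B] b') = chi (s' *[A] a +[A] s *[A] a')"
        using key[of "b +[B] b'" "s' *[A] a +[A] s *[A] a'" "s *[A] s'"] b a a' c ss by simp
      also have "... = chi s' *[C] (chi s *[C] psi b) +[C] chi s *[C] (chi s' *[C] psi b')" using a(1) a'(1) c by (simp add: C.phi_add C.phi_mult k)
      also have "... = chi (s *[A] s') *[C] (psi b +[C] psi b')" using c q pb by (simp add: C.phi_mult C.B.r_distr C.B.m_ac)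
      finally show "psi (b +[B] b') = psi b +[C] psi b'" using C.phi_cancel[OF TP[OF ss]] psi(1) b by simp
    qed
    show "car B - extend P <= car B" by blast
    show "1[B] : car B - extend P" using eP(2) by simp
    show "s *[B] t : car B - extend P" if "s : car B - extend P" "t : car B - extend P" for s t using that eP(3)[of s t] by auto
    show "psi b : Units C" if b: "b : car B - extend P" for b
    proof -
      have bc: "b : car B" using b by blast
      obtain a s where a: "a : car A" "s : T" "phi s *[B] b = phi a" using phi_surj[OF bc] by blast
      have sc: "s : car A" using a T_carrier by blast
      have "a ~: P" using b a unfolding extend_def by blast
      hence "chi s *[C] psi b : Units C" using key[OF bc a] C.phi_unit[of a] a(1) by simp
      thus ?thesis using C.B.unit_factor[of "psi b" "chi s"] psi(1)[OF bc] C.phi_in[OF sc] by (simp add: C.B.m_comm)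
    qed
    show "EX a:car B. EX s:car B - extend P. psi s *[C] c = psi a" if c: "c : car C" for c
    proof -
      obtain a s where a: "a : car A" "s : car A - P" "chi s *[C] c = chi a" using C.phi_surj[OF c] by blast
      hence "psi (phi s) *[C] c = psi (phi a)" using psi_phi by simp
      thus ?thesis using phi_in[OF a(1)] notin[OF a(2)] by blast
    qed
    show "EX s:car B - extend P. s *[B] b = 0[B]" if b: "b : car B" "psi b = 0[C]" for b
    proof -
      obtain a s where a: "a : car A" "s : T" "phi s *[B] b = phi a" using phi_surj[OF b(1)] by blast
      have sc: "s : car A" using a T_carrier by blast
      have "chi a = 0[C]" using key[OF b(1) a] b(2) C.phi_in[OF sc] by simp
      then obtain u where u: "u : car A - P" "u *[A] a = 0[A]" using C.phi_ker[OF a(1)] by blast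
      have uc: "u : car A" using u by blast
      have "phi s *[B] (phi u *[B] b) = phi u *[B] phi a" using b(1) a(3) phi_in[OF sc] phi_in[OF uc] B.m_lcomm[of "phi s" "phi u" b] by simp
      also have "... = phi s *[B] 0[B]" unfolding phi_mult[OF uc a(1), symmetric] u(2) phi_zero using phi_in[OF sc] by simp
      finally have "phi u *[B] b = 0[B]" using phi_cancel[OF a(2), of "phi u *[B] b" "0[B]"] b(1) phi_in[OF uc] by simp
      thus ?thesis using notin[OF u(1)] by blast
    qed
  qed
  thus ?thesis by (rule that)
qed

end

theorem proposition7p1:
  fixes R :: "('a, 'r) ring_scheme" and I :: "'a set"
    and \<omega> :: "(nat \<Rightarrow> 'a, 'w, 'm) module_scheme"
  assumes "gorenstein_local_ring R"
    and "ideal I R"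
    and "2 \<le> ideal_height R I"
    and "cohen_macaulay_ring (rees_algebra R I)"
    and "canonical_module (rees_algebra R I) \<omega>"
    and "expected_form R I \<omega>"
  shows "(\<forall>P. primeideal P (rees_algebra R I) \<and> height (rees_algebra R I) P < ideal_height R I
            \<longrightarrow> gorenstein_local_ring (loc_at (rees_algebra R I) P)) \<and>
         (let A = loc_at (rees_algebra R I) (rees_max_ideal R I)
          in (\<exists>C. canonical_ideal A C) \<and>
             (\<forall>C. canonical_ideal A C \<longrightarrow> bideg A C = 0 \<and> cdeg A C = 0))"
proof -
  let ?S = "rees_algebra R I" and ?M = "rees_max_ideal R I"
  have "noetherian_local_ring R" using assms(1) unfolding gorenstein_local_ring_def by blast
  then interpret R: local_noetherian R "max_ideal R" by (rule noetherian_local_ring_imp)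
  have S: "cring ?S" "noetherian_ring ?S" and cmS: "!!\<mm>. maximalideal \<mm> ?S ==> cohen_macaulay_local_ring (loc_at ?S \<mm>)"
    using assms(4) unfolding cohen_macaulay_ring_def by blast+
  interpret rees R "max_ideal R" I ?S by (intro rees.intro rees_axioms.intro R.local_noetherian_axioms assms(2) refl S)
  have om: "module ?S \<omega>" and omc: "!!\<mm>. maximalideal \<mm> ?S ==> canonical_module_local (loc_at ?S \<mm>) (loc_module_at ?S \<mm> \<omega>)"
    using assms(5) unfolding canonical_module_def by blast+
  obtain m where m: "-1 <= m" "module_iso ?S \<omega> (expected_module R I m)" using assms(6) unfolding expected_form_def by blast
  note M = rees_max_ideal_maximal note Mp = S.maximalideal_prime[OF M]
  obtain a where a: "a : I" "nonzerodiv R {0[R]} (car R) a" using nonzerodivisor_exists[OF cmS[OF M] assms(3)] .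
  let ?J = "canon a m"
  note J = canon_ideal[OF a(1), of m]
  obtain H where H: "bij_betw H (carrier \<omega>) ?J"
    "!!x y. [|x : carrier \<omega>; y : carrier \<omega>|] ==> H (x +[\<omega>] y) = H x +[?S] H y"
    "!!f x. [|f : car ?S; x : carrier \<omega>|] ==> H (f *>[\<omega>] x) = f *[?S] H x" by (rule canon_iso[OF a m(2)]) (rule that)
  \<comment> \<open>At each maximal ideal the localized \<open>?J\<close> is isomorphic to the
    localized \<open>\<omega>\<close> and hence canonical. This yields both the existence of a
    canonical ideal and the finite injective dimension used below.\<close>
  have can: "canonical_module_local (loc_at ?S \<mm>) (ideal_module (loc_at ?S \<mm>) (loc_ideal_at ?S \<mm> ?J))" if mm: "maximalideal \<mm> ?S" for \<mm>
  proof -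
    have "module (loc_at ?S \<mm>) (loc_module_at ?S \<mm> \<omega>)"
      using omc[OF mm] unfolding canonical_module_local_def maximal_cohen_macaulay_module_def by blast
    then obtain F where "module_isomorphism (loc_at ?S \<mm>) (loc_module_at ?S \<mm> \<omega>) (ideal_module (loc_at ?S \<mm>) (loc_ideal_at ?S \<mm> ?J)) F"
      using S.loc_module_isomorphism[OF S.maximalideal_prime[OF mm] J om _ H] by blast
    thus ?thesis using omc[OF mm] by (rule module_isomorphism.canonical_module_local_image)
  qed
  have 1: "gorenstein_local_ring (loc_at ?S P)" if P: "primeideal P ?S" "height ?S P < ideal_height R I" for P
  proof -
    note cP = S.primeD[OF P(1)]
    \<comment> \<open>Canonical modules are described at maximal ideals, so \<open>P\<close> is
      approached through one above it.\<close>
    obtain \<mm> where mm: "maximalideal \<mm> ?S" "P <= \<mm>" using S.maximal_ideal_above[OF cP(1,4)] .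
    note mp = S.maximalideal_prime[OF mm(1)]
    let ?T = "car ?S - \<mm>" and ?B = "loc_at ?S \<mm>"
    define phi where "phi = (%a. fraction ?T (self_module ?S) a 1[?S])"
    interpret L: ring_localization ?S ?T ?B phi unfolding phi_def by (rule loc_at_localization[OF mp])
    have PT: "P Int ?T = {}" using mm(2) by blast
    have CJ: "loc_ideal_at ?S \<mm> ?J = L.extend ?J" unfolding phi_def by (rule loc_ideal_at_eq[OF mp S.idealD(1)[OF J]])
    have id: "inj_dim ?B (ideal_module ?B (L.extend ?J)) < \<infinity>" using can[OF mm(1)] unfolding CJ canonical_module_local_def by blast
    have lp: "locally_principal ?B (L.extend P) (L.extend ?J)"
      by (rule L.locally_principal_extend[OF P(1) PT J canon_locally_principal_height[OF a m(1) P]])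
    obtain psi where "ring_localization ?B (car ?B - L.extend P) (loc_at ?S P) psi"
      using L.localization_tower[OF P(1) PT loc_at_localization[OF P(1)]] .
    hence "inj_dim (loc_at ?S P) (self_module (loc_at ?S P)) < \<infinity>"
      by (rule ring_localization.inj_dim_locally_principal[OF _ L.extend_ideal[OF J] L.noetherian_B[OF S(2)] id refl lp])
    moreover have "noetherian_local_ring (loc_at ?S P)"
      by (rule local_noetherian.noetherian_local[OF ring_localization.local_noetherian_B[OF loc_at_localization[OF P(1)] P(1) refl S(2)]])
    ultimately show ?thesis unfolding gorenstein_local_ring_def by blast
  qed
  let ?T = "car ?S - ?M" and ?A = "loc_at ?S ?M"
  define phi where "phi = (%a. fraction ?T (self_module ?S) a 1[?S])"
  interpret L: ring_localization ?S ?T ?A phi unfolding phi_def by (rule loc_at_localization[OF Mp])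
  interpret A: local_noetherian ?A "L.extend ?M" by (rule L.local_noetherian_B[OF Mp refl S(2)])
  have CJ: "loc_ideal_at ?S ?M ?J = L.extend ?J" unfolding phi_def by (rule loc_ideal_at_eq[OF Mp S.idealD(1)[OF J]])
  have canA: "canonical_ideal ?A (L.extend ?J)" using can[OF M] L.extend_ideal[OF J] unfolding CJ canonical_ideal_def by blast
  have id: "inj_dim ?A (ideal_module ?A (L.extend ?J)) < \<infinity>" using can[OF M] unfolding CJ canonical_module_local_def by blast
  have terms: "bideg_term ?A C Q = 0" "cdeg_term ?A C Q = 0" if C: "canonical_ideal ?A C" and Q: "primeideal Q ?A" "height ?A Q = 1" for C Q
  proof -
    note cQ = L.contract_prime[OF Q(1)]
    have "height ?S (L.contract Q) = 1" using L.height_contract[OF Q(1)] Q(2) by simp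
    \<comment> \<open>Since the codimension is at least two, every prime of height one is in the
      range where \<open>?J\<close> is locally principal.\<close>
    hence "height ?S (L.contract Q) < ideal_height R I" using assms(3) by (simp add: one_enat_def numeral_eq_enat less_le_trans[of _ "enat 2"])
    hence "locally_principal ?S (L.contract Q) ?J" by (rule canon_locally_principal_height[OF a m(1) cQ(1)])
    hence "locally_principal ?A Q (L.extend ?J)" using L.locally_principal_extend[OF cQ J] unfolding L.extend_contract_prime[OF Q(1)] by blast
    hence lp: "locally_principal ?A Q C" by (rule A.canonical_ideal_locally_principal[OF cmS[OF M] C Q L.extend_ideal[OF J] id])
    have "ideal C ?A" using C unfolding canonical_ideal_def by blast
    thus "bideg_term ?A C Q = 0" "cdeg_term ?A C Q = 0" using A.degree_terms_zero[OF Q _ lp] by blast+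
  qed
  \<comment> \<open>The index sets retain nonzero terms only, so both sums are empty.\<close>
  have "bideg ?A C = 0 & cdeg ?A C = 0" if "canonical_ideal ?A C" for C
    unfolding bideg_def cdeg_def using terms[OF that] by (intro conjI sum.neutral) auto
  thus ?thesis unfolding Let_def using 1 canA by blast
qed

end
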